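(* Let $\widehat\phi\in C_b([0,\infty))$ be real-valued with $2\pi\int_0^\infty r^3|\widehat\phi(r)|^2dr=1$ and $\sup_{r\ge0}r|\widehat\phi(r)|<\infty$, and for $\varepsilon>0$ let $\mathcal{J}_{+1}^\varepsilon$, $\mathcal{K}_{+1}^\varepsilon$ be as defined in the context. Let $\varepsilon_0>0$ and let $F_0^\varepsilon\in\mathcal{B}_1^+(\mathbb{R}_{\ge0})$, $0<\varepsilon\le\varepsilon_0$, satisfy $\sup_{0<\varepsilon\le\varepsilon_0}\int_{\mathbb{R}_{\ge0}}(1+x)\,dF_0^\varepsilon(x)<\infty$. Let $F_t^\varepsilon\in\mathcal{B}_1^+(\mathbb{R}_{\ge0})$ be measure-valued isotropic weak solutions of Eq.(BE) with initial data $F_0^\varepsilon$. Then for any sequence $\mathcal{E}=\{\varepsilon_n\}_{n\ge1}\subset(0,\varepsilon_0]$ with $\varepsilon_n\to0$ there exist a subsequence, still denoted $\mathcal{E}$, and a measure-valued isotropic weak solution $F_t$ of Eq.(FPL), such that $F_t^\varepsilon\rightharpoonup F_t$ weakly as measures as $\mathcal{E}\ni\varepsilon\to0$ for all $t\ge0$ (in particular, the initial datum $F_0$ of $F_t$ is the weak limit of $F_0^\varepsilon$ along $\mathcal{E}$). More precisely, for every $t\in[0,\infty)$, $$\lim_{\mathcal{E}\ni\varepsilon\to0}\int_{\mathbb{R}_{\ge0}}\varphi(x)\,dF_t^\varepsilon(x)=\int_{\mathbb{R}_{\ge0}}\varphi(x)\,dF_t(x)\qquad\forall\,\varphi\in C_c(\mathbb{R}_{\ge0}),$$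 and for all $\varphi\in C_c^2(\mathbb{R}_{\ge0})$, $$\lim_{\mathcal{E}\ni\varepsilon\to0}\int_{\mathbb{R}_{\ge0}^2}\mathcal{J}_{+1}^\varepsilon[\varphi](y,z)\,dF_t^\varepsilon(y)\,dF_t^\varepsilon(z)=\int_{\mathbb{R}_{\ge0}^2}L[\varphi](y,z)\,dF_t(y)\,dF_t(z),$$ $$\lim_{\varepsilon\to0^+}\varepsilon^3\int_{\mathbb{R}_{\ge0}^3}\mathcal{K}_{+1}^\varepsilon[\varphi](x,y,z)\,dF_t^\varepsilon(x)\,dF_t^\varepsilon(y)\,dF_t^\varepsilon(z)=0 .$$
   Context: Notation: $\mathbb{R}_{\ge0}=[0,\infty)$, $a\wedge b=\min$, $a\vee b=\max$, $(u)_+=\max\{u,0\}$, $\mathrm{i}=\sqrt{-1}$. $\mathcal{B}_1^+(\mathbb{R}_{\ge0})$ is the set of nonnegative finite Borel measures $F$ on $\mathbb{R}_{\ge0}$ with $\int(1+x)\,dF(x)<\infty$. **Kernels.** For $\lambda\in\{-1,+1\}$, $\Phi_\lambda^\varepsilon(r,\rho)=\varepsilon^{-4}\big(\widehat\phi(r/\varepsilon)+\lambda\widehat\phi(\rho/\varepsilon)\big)^2$. For $\Phi\in C_b(\mathbb{R}_{\ge0}^2)$, $x,y,z\ge0$ and $x_*=(y+z-x)_+$ define $$W_\Phi(x,y,z)=\frac{4\pi}{\sqrt{xyz}}\int_{|\sqrt x-\sqrt y|\vee|\sqrt{x_*}-\sqrt z|}^{(\sqrt x+\sqrt y)\wedge(\sqrt{x_*}+\sqrt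 z)}ds\int_0^{2\pi}\Phi(\sqrt2\,s,\sqrt2\,Y_* )\,d\theta\quad\text{if }x_*,x,y,z>0,$$ $W_\Phi=\frac{(4\pi)^2}{\sqrt{yz}}\Phi(\sqrt{2y},\sqrt{2z})$ if $x=0$, $y,z>0$; $W_\Phi=\frac{(4\pi)^2}{\sqrt{xz}}\Phi(\sqrt{2x},\sqrt{2(z-x)})$ if $y=0$, $z>x>0$; $W_\Phi=\frac{(4\pi)^2}{\sqrt{xy}}\Phi(\sqrt{2(y-x)},\sqrt{2x})$ if $z=0$, $y>x>0$; $W_\Phi=0$ otherwise. Here $$Y_*=Y_*(x,y,z,s,\theta)=\left|\sqrt{\Big(z-\tfrac{(x-y+s^2)^2}{4s^2}\Big)_+}+e^{\mathrm{i}\theta}\sqrt{\Big(x-\tfrac{(x-y+s^2)^2}{4s^2}\Big)_+}\right|\ (s>0),\qquad Y_*=0\ (s=0).$$ For $\varphi\in C_c^2(\mathbb{R}_{\ge0})$: $$\mathcal{K}_\lambda^\varepsilon[\varphi](x,y,z)=W_{\Phi_\lambda^\varepsilon}(x,y,z)\big(\varphi(x)+\varphi(x_* )-\varphi(y)-\varphi(z)\big),\qquad\mathcal{J}_\lambda^\varepsilon[\varphi](y,z)=\frac12\int_0^{y+z}\mathcal{K}_\lambda^\varepsilon[\varphi](x,y,z)\sqrt x\,dx,$$ $$L[\varphi](x,y)=\frac{4\pi}{\sqrt{x\vee y}}\Big(\tfrac23\big(\varphi''(x)+\varphi''(y)\big)(x\wedge y)-\big(\varphi'(x)-\varphi'(y)\big)\mathrm{sgn}(x-y)\Big),\qquad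 L[\varphi](0,0)=0 .$$ **Measure-valued isotropic weak solution of Eq.(BE)**: a family $\{F_t^\varepsilon\}_{t\ge0}\subset\mathcal{B}_1^+(\mathbb{R}_{\ge0})$ with $\int(1,x)\,dF_t^\varepsilon(x)=\int(1,x)\,dF_0^\varepsilon(x)$ for all $t\ge0$ and such that for every $\varphi\in C_c^2(\mathbb{R}_{\ge0})$ the function $t\mapsto\int\varphi\,dF_t^\varepsilon$ is in $C^1([0,\infty))$ and for all $t\in[0,\infty)$ $$\frac{d}{dt}\int\varphi\,dF_t^\varepsilon=\int_{\mathbb{R}_{\ge0}^2}\mathcal{J}_{+1}^\varepsilon[\varphi]\,d(F_t^\varepsilon\otimes F_t^\varepsilon)+\varepsilon^3\int_{\mathbb{R}_{\ge0}^3}\mathcal{K}_{+1}^\varepsilon[\varphi]\,d(F_t^\varepsilon\otimes F_t^\varepsilon\otimes F_t^\varepsilon).$$ **Measure-valued isotropic weak solution of Eq.(FPL)**: a family $\{F_t\}_{t\ge0}\subset\mathcal{B}_1^+(\mathbb{R}_{\ge0})$ with $\int(1,x)\,dF_t(x)=\int(1,x)\,dF_0(x)$ for all $t\ge0$ and such that for every $\varphi\in C_c^2(\mathbb{R}_{\ge0})$ the function $t\mapsto\int\varphi\,dF_t$ is in $C^1([0,\infty))$ and $\frac{d}{dt}\int\varphi\,dF_t=\int_{\mathbb{R}_{\ge0}^2}L[\varphi](x,y)\,dF_t(x)\,dF_t(y)$ for all $t\in[0,\infty)$. *)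

theory Defs
  imports "HOL-Analysis.Analysis"
begin

text \<open>
  Throughout, functions on \<open>[0,\<infinity>)\<close> are HOL functions on \<open>real\<close> of which only the values
  on \<open>{0..}\<close> matter, and families indexed by \<open>t \<ge> 0\<close> are functions on \<open>real\<close> of which
  only the members with \<open>t \<ge> 0\<close> matter.
\<close>

subsection \<open>Function spaces and measures on the half line\<close>

definition half_line_Cb :: "(real \<Rightarrow> real) set" where
  "half_line_Cb = {f. continuous_on {0..} f \<and> bounded (f ` {0..})}"

definition half_line_Cc :: "(real \<Rightarrow> real) set" where
  "half_line_Cc = {f. continuous_on {0..} f \<and> (\<exists>R. \<forall>x\<ge>0. R \<le> x \<longrightarrow> f x = 0)}"

text \<open>Derivative of a function on \<open>[0,\<infinity>)\<close>; at the end point \<open>0\<close> it is the right derivative.\<close>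

definition half_line_deriv :: "(real \<Rightarrow> real) \<Rightarrow> real \<Rightarrow> real" where
  "half_line_deriv f x = vector_derivative f (at x within {0..})"

definition half_line_C1 :: "(real \<Rightarrow> real) set" where
  "half_line_C1 = {f. f differentiable_on {0..} \<and> continuous_on {0..} (half_line_deriv f)}"

definition half_line_Cc2 :: "(real \<Rightarrow> real) set" where
  "half_line_Cc2 = {f \<in> half_line_Cc. f \<in> half_line_C1 \<and> half_line_deriv f \<in> half_line_C1}"

definition half_line_B1 :: "real measure set" where
  "half_line_B1 = {F. sets F = sets (restrict_space borel {0..}) \<and> finite_measure F \<and>
                      integrable F (\<lambda>x. 1 + x)}"

text \<open>
  Weak convergence of finite measures, i.e. tested against bounded continuous functions.  (The
  relation of the same purpose in HOL-Probability is phrased by distribution functions and is meant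
  for probability measures on the whole line.)
\<close>

definition half_line_weak_conv :: "(nat \<Rightarrow> real measure) \<Rightarrow> real measure \<Rightarrow> bool" where
  "half_line_weak_conv M N \<longleftrightarrow>
     (\<forall>f\<in>half_line_Cb. (\<lambda>n. \<integral>x. f x \<partial>M n) \<longlonglongrightarrow> (\<integral>x. f x \<partial>N))"

subsection \<open>Collision kernels\<close>

definition Phi :: "(real \<Rightarrow> real) \<Rightarrow> real \<Rightarrow> real \<Rightarrow> real \<Rightarrow> real \<Rightarrow> real" where
  "Phi phihat eps lam r rho = (phihat (r / eps) + lam * phihat (rho / eps))\<^sup>2 / eps ^ 4"

definition x_star :: "real \<Rightarrow> real \<Rightarrow> real \<Rightarrow> real" where
  "x_star x y z = max (y + z - x) 0"

definition Y_star :: "real \<Rightarrow> real \<Rightarrow> real \<Rightarrow> real \<Rightarrow> real \<Rightarrow> real" where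
  "Y_star x y z s \<theta> =
     (if s > 0 then
        cmod (complex_of_real (sqrt (max (z - (x - y + s\<^sup>2)\<^sup>2 / (4 * s\<^sup>2)) 0)) +
              exp (\<i> * complex_of_real \<theta>) *
              complex_of_real (sqrt (max (x - (x - y + s\<^sup>2)\<^sup>2 / (4 * s\<^sup>2)) 0)))
      else 0)"

text \<open>
  For \<open>x, y, z, x_star x y z > 0\<close> one has \<open>x + x_star x y z = y + z\<close>, so the lower limit
  of the \<open>s\<close>-integral never exceeds the upper one and a set integral may be used.
\<close>

definition W :: "(real \<Rightarrow> real \<Rightarrow> real) \<Rightarrow> real \<Rightarrow> real \<Rightarrow> real \<Rightarrow> real" where
  "W \<Phi> x y z =
     (let xs = x_star x y z in
      if xs > 0 \<and> x > 0 \<and> y > 0 \<and> z > 0 then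
        4 * pi / sqrt (x * y * z) *
        (LBINT s:{max \<bar>sqrt x - sqrt y\<bar> \<bar>sqrt xs - sqrt z\<bar> ..
                  min (sqrt x + sqrt y) (sqrt xs + sqrt z)}.
           (LBINT \<theta>:{0..2 * pi}. \<Phi> (sqrt 2 * s) (sqrt 2 * Y_star x y z s \<theta>)))
      else if x = 0 \<and> y > 0 \<and> z > 0 then
        (4 * pi)\<^sup>2 / sqrt (y * z) * \<Phi> (sqrt (2 * y)) (sqrt (2 * z))
      else if y = 0 \<and> z > x \<and> x > 0 then
        (4 * pi)\<^sup>2 / sqrt (x * z) * \<Phi> (sqrt (2 * x)) (sqrt (2 * (z - x)))
      else if z = 0 \<and> y > x \<and> x > 0 then
        (4 * pi)\<^sup>2 / sqrt (x * y) * \<Phi> (sqrt (2 * (y - x))) (sqrt (2 * x))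
      else 0)"

definition K_op :: "(real \<Rightarrow> real) \<Rightarrow> real \<Rightarrow> real \<Rightarrow> (real \<Rightarrow> real) \<Rightarrow> real \<Rightarrow> real \<Rightarrow> real \<Rightarrow> real"
where
  "K_op phihat eps lam \<phi> x y z =
     W (Phi phihat eps lam) x y z * (\<phi> x + \<phi> (x_star x y z) - \<phi> y - \<phi> z)"

definition J_op :: "(real \<Rightarrow> real) \<Rightarrow> real \<Rightarrow> real \<Rightarrow> (real \<Rightarrow> real) \<Rightarrow> real \<Rightarrow> real \<Rightarrow> real" where
  "J_op phihat eps lam \<phi> y z =
     1 / 2 * (LBINT x:{0..y + z}. K_op phihat eps lam \<phi> x y z * sqrt x)"

definition L_op :: "(real \<Rightarrow> real) \<Rightarrow> real \<Rightarrow> real \<Rightarrow> real" where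
  "L_op \<phi> x y =
     (if x = 0 \<and> y = 0 then 0
      else 4 * pi / sqrt (max x y) *
        (2 / 3 * (half_line_deriv (half_line_deriv \<phi>) x + half_line_deriv (half_line_deriv \<phi>) y)
           * min x y
         - (half_line_deriv \<phi> x - half_line_deriv \<phi> y) * sgn (x - y)))"

subsection \<open>Measure-valued isotropic weak solutions\<close>

definition conservative_family :: "(real \<Rightarrow> real measure) \<Rightarrow> bool" where
  "conservative_family F \<longleftrightarrow>
     (\<forall>t\<ge>0. F t \<in> half_line_B1 \<and>
        (\<integral>x. 1 \<partial>F t) = (\<integral>x. (1::real) \<partial>F 0) \<and> (\<integral>x. x \<partial>F t) = (\<integral>x. x \<partial>F 0))"

definition BE_weak_solution ::
  "(real \<Rightarrow> real) \<Rightarrow> real \<Rightarrow> (real \<Rightarrow> real measure) \<Rightarrow> bool" where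
  "BE_weak_solution phihat eps F \<longleftrightarrow>
     conservative_family F \<and>
     (\<forall>\<phi>\<in>half_line_Cc2.
        (\<lambda>t. \<integral>x. \<phi> x \<partial>F t) \<in> half_line_C1 \<and>
        (\<forall>t\<ge>0. half_line_deriv (\<lambda>t. \<integral>x. \<phi> x \<partial>F t) t =
           (\<integral>(y, z). J_op phihat eps 1 \<phi> y z \<partial>(F t \<Otimes>\<^sub>M F t)) +
           eps ^ 3 * (\<integral>(x, y, z). K_op phihat eps 1 \<phi> x y z \<partial>(F t \<Otimes>\<^sub>M F t \<Otimes>\<^sub>M F t))))"

definition FPL_weak_solution :: "(real \<Rightarrow> real measure) \<Rightarrow> bool" where
  "FPL_weak_solution F \<longleftrightarrow>
     conservative_family F \<and>
     (\<forall>\<phi>\<in>half_line_Cc2.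
        (\<lambda>t. \<integral>x. \<phi> x \<partial>F t) \<in> half_line_C1 \<and>
        (\<forall>t\<ge>0. half_line_deriv (\<lambda>t. \<integral>x. \<phi> x \<partial>F t) t =
           (\<integral>(x, y). L_op \<phi> x y \<partial>(F t \<Otimes>\<^sub>M F t))))"

end

theory Submission
  imports Defs "HOL-Probability.Probability"
begin

text \<open>
  The quadratic term. In the variables \<open>\<sigma> = s\<^sup>2\<close>, \<open>\<pi> = Y_*\<^sup>2\<close> the kernel measure becomes \<open>d\<sigma> d\<pi> / sqrt P\<close>
  with a polynomial \<open>P\<close> that is quadratic in \<open>x\<close>, so integrating over \<open>x\<close> first turns \<open>J\<close> into an integral
  over the relative speed \<open>w\<close>, the transferred part \<open>\<sigma> < w\<^sup>2\<close> and an angle \<open>\<psi>\<close>. The angular mean of the collision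
  difference of \<open>\<phi>\<close> is \<open>O(\<sigma>)\<close>; after scaling \<open>\<sigma> = \<epsilon>\<^sup>2 r\<^sup>2 / 2\<close> the weight is \<open>r\<^sup>3 phihat(r)\<^sup>2\<close>, whose integral is
  normalised, and the second-order Taylor coefficient gives \<open>L\<close>. This yields \<open>\<bar>J\<bar> \<le> const * sqrt (max y z)\<close>
  uniformly in \<open>\<epsilon>\<close> and continuous convergence \<open>J \<rightarrow> L\<close>.

  The cubic term. The decay of \<open>phihat\<close> bounds \<open>\<epsilon>\<^sup>3 K\<close> by a constant and makes it small, except where two of the
  energies are below \<open>\<epsilon>\<close>, one of them being \<open>x\<close>; there it cancels to leading order after symmetrisation in the
  variables, which the product measure permits.

  Compactness. Both bounds make \<open>t \<mapsto> \<integral>\<phi> dF_t\<close> Lipschitz uniformly in \<open>\<epsilon>\<close>, so a diagonal sequence converges weakly for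
  all times. Passing to the limit in the integrated equation gives the weak FPL equation, and energy is conserved
  because the truncations \<open>\<phi>\<close> of \<open>x\<close> at height \<open>R\<close> satisfy \<open>L[\<phi>] = O(1 / sqrt R)\<close>.
\<close>

subsection \<open>Integral substitutions\<close>

text \<open>The polynomial \<open>gram\<close> is four times the Gram determinant of vectors a, b, c
  with a orthogonal to b and squared lengths \<open>\<sigma>\<close>, \<open>\<pi>\<close>,
  \<open>x\<close>, where \<open>y\<close> and \<open>z\<close> are the squared lengths of c - a and
  c - b: the collision rectangle. The density \<open>1 / sqrt gram\<close> blows up at the edge of
  its support, but in \<open>x\<close> it is an arcsine density, so that integrating
  \<open>x\<close> out leaves a uniform angle and no singularity. This is done with nonnegative
  integrals, where Tonelli needs no integrability; signs return in \<open>J_op_eq\<close>. In the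
  square \<open>(p r + p \<rho>)\<^sup>2\<close> the reduction to
  \<open>\<sigma> < w\<^sup>2 / 2\<close> forces \<open>\<rho> > w / \<epsilon>\<close>. The second
  term then sees only the tail of the normalised weight, and the limit retains
  \<open>(p r)\<^sup>2\<close> alone. In the cubic term, boundedness of
  \<open>r * \<bar>p r\<bar>\<close> gives no gain for \<open>r\<close> of order one. For
  \<open>x, y < \<epsilon> \<le> z\<close> the weighted kernel is merely bounded, whence the need
  for a cancellation. In the compactness part the energy bound gives tightness, hence convergence of
  masses, but weak convergence alone could lose energy at infinity; conservation has to come from
  the limit equation.\<close>

lemma nn_integral_square_substitution:
  fixes h :: "real \<Rightarrow> ennreal"
  assumes [measurable]: "h \<in> borel_measurable borel"
  shows "(\<integral>\<^sup>+s. ennreal (2 * s) * h (s\<^sup>2) * indicator {0<..} s \<partial>lborel)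
       = (\<integral>\<^sup>+\<sigma>. h \<sigma> * indicator {0<..} \<sigma> \<partial>lborel)"
proof -
  \<comment> \<open>The substitution is made on compact intervals; the half line follows by monotone
    convergence on both sides, so the integrals may be infinite. The point 0 is a null set.\<close>
  have fin: "(\<integral>\<^sup>+\<sigma>. h \<sigma> * indicator {0..(real (Suc n))\<^sup>2} \<sigma> \<partial>lborel)
      = (\<integral>\<^sup>+s. ennreal (2 * s) * h (s\<^sup>2) * indicator {0..real (Suc n)} s \<partial>lborel)" for n
  proof -
    have "(\<integral>\<^sup>+x. h x * indicator {(\<lambda>s. s\<^sup>2) 0..(\<lambda>s. s\<^sup>2) (real (Suc n))} x \<partial>lborel) =
             (\<integral>\<^sup>+x. h ((\<lambda>s. s\<^sup>2) x) * (\<lambda>s. 2 * s) x * indicator {0..real (Suc n)} x \<partial>lborel)"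
      by (rule nn_integral_substitution_aux)
        (auto intro!: derivative_eq_intros continuous_intros)
    then show ?thesis by (simp add: mult_ac)
  qed
  have "(\<integral>\<^sup>+\<sigma>. h \<sigma> * indicator {0<..} \<sigma> \<partial>lborel) = (\<integral>\<^sup>+\<sigma>. (SUP n. h \<sigma> * indicator {0..(real (Suc n))\<^sup>2} \<sigma>) \<partial>lborel)"
  proof (intro nn_integral_cong_AE, rule AE_mp[OF AE_lborel_singleton[of 0]], intro AE_I2 impI)
    fix x :: real assume "x \<noteq> 0"
    show "h x * indicator {0<..} x = (SUP n. h x * indicator {0..(real (Suc n))\<^sup>2} x)"
    proof (cases "x > 0")
      case True
      obtain n where n: "x \<le> real n" using real_arch_simple by blast
      have "x \<le> (real (Suc n))\<^sup>2" using n by (auto simp: power2_eq_square algebra_simps add_increasing)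
      then have "(SUP n. h x * indicator {0..(real (Suc n))\<^sup>2} x) = h x"
        using True
        by (intro antisym SUP_least SUP_upper2[of n]) (auto split: split_indicator)
      then show ?thesis using True by simp
    qed (use \<open>x \<noteq> 0\<close> in simp)
  qed
  also have "\<dots> = (SUP n. \<integral>\<^sup>+\<sigma>. h \<sigma> * indicator {0..(real (Suc n))\<^sup>2} \<sigma> \<partial>lborel)"
  proof (rule nn_integral_monotone_convergence_SUP)
    have "real (Suc i) ^ 2 \<le> real (Suc j) ^ 2" if "i \<le> j" for i j
      using that by (simp add: power_mono)
    then show "incseq (\<lambda>n \<sigma>. h \<sigma> * indicator {0..(real (Suc n))\<^sup>2} \<sigma>)"
      by (auto simp: incseq_def le_fun_def split: split_indicator intro: order_trans)
  qed simp
  also have "\<dots> = (SUP n. \<integral>\<^sup>+s. ennreal (2 * s) * h (s\<^sup>2) * indicator {0..real (Suc n)} s \<partial>lborel)"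
    by (simp only: fin)
  also have "\<dots> = (\<integral>\<^sup>+s. (SUP n. ennreal (2 * s) * h (s\<^sup>2) * indicator {0..real (Suc n)} s) \<partial>lborel)"
  proof (rule nn_integral_monotone_convergence_SUP[symmetric])
    show "incseq (\<lambda>n s. ennreal (2 * s) * h (s\<^sup>2) * indicator {0..real (Suc n)} s)"
      unfolding incseq_def le_fun_def
      by (intro allI impI mult_left_mono) (auto split: split_indicator)
  qed simp
  also have "\<dots> = (\<integral>\<^sup>+s. ennreal (2 * s) * h (s\<^sup>2) * indicator {0<..} s \<partial>lborel)"
  proof (intro nn_integral_cong_AE, rule AE_mp[OF AE_lborel_singleton[of 0]], intro AE_I2 impI)
    fix x :: real assume "x \<noteq> 0"
    show "(SUP n. ennreal (2 * x) * h (x\<^sup>2) * indicator {0..real (Suc n)} x) = ennreal (2 * x) * h (x\<^sup>2) * indicator {0<..} x"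
    proof (cases "x > 0")
      case True
      obtain n where n: "x \<le> real n" using real_arch_simple by blast
      then have "(SUP n. ennreal (2 * x) * h (x\<^sup>2) * indicator {0..real (Suc n)} x) = ennreal (2 * x) * h (x\<^sup>2)"
        using True by (intro antisym SUP_least SUP_upper2[of n]) (auto split: split_indicator)
      then show ?thesis using True by simp
    qed (use \<open>x \<noteq> 0\<close> in simp)
  qed
  finally show ?thesis by simp
qed

text \<open>The minus sign makes \<open>a - b * cos \<theta>\<close> increasing on
  \<open>{0..pi}\<close>. Its derivative \<open>b * sin \<theta>\<close> is the square root of
  \<open>b\<^sup>2 - (u - a)\<^sup>2\<close>, so the weight cancels the Jacobian away from the two
  end points.\<close>

lemma nn_integral_cos_half:
  fixes h :: "real \<Rightarrow> ennreal" and a b :: real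
  assumes [measurable]: "h \<in> borel_measurable borel" and b: "b > 0"
  shows "(\<integral>\<^sup>+\<theta>. h (a - b * cos \<theta>) * indicator {0..pi} \<theta> \<partial>lborel)
       = (\<integral>\<^sup>+u. h u * ennreal (if (u - a)\<^sup>2 < b\<^sup>2 then 1 / sqrt (b\<^sup>2 - (u - a)\<^sup>2) else 0) \<partial>lborel)"
proof -
  define w where "w u = (if (u - a)\<^sup>2 < b\<^sup>2 then 1 / sqrt (b\<^sup>2 - (u - a)\<^sup>2) else 0)" for u
  have [measurable]: "w \<in> borel_measurable borel" unfolding w_def by measurable
  have "(\<integral>\<^sup>+u. (h u * ennreal (w u)) * indicator {(\<lambda>\<theta>. a - b * cos \<theta>) 0..(\<lambda>\<theta>. a - b * cos \<theta>) pi} u \<partial>lborel)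
     = (\<integral>\<^sup>+\<theta>. (h (a - b * cos \<theta>) * ennreal (w (a - b * cos \<theta>))) * ennreal (b * sin \<theta>) * indicator {0..pi} \<theta> \<partial>lborel)"
    by (rule nn_integral_substitution_aux)
      (use b in \<open>auto intro!: derivative_eq_intros continuous_intros simp: sin_ge_zero\<close>)
  also have "\<dots> = (\<integral>\<^sup>+\<theta>. h (a - b * cos \<theta>) * indicator {0..pi} \<theta> \<partial>lborel)"
  proof (intro nn_integral_cong_AE, rule AE_mp[OF AE_lborel_singleton[of 0]],
      rule AE_mp[OF AE_lborel_singleton[of pi]], intro AE_I2 impI)
    fix t :: real assume "t \<noteq> 0" "t \<noteq> pi"
    show "h (a - b * cos t) * ennreal (w (a - b * cos t)) * ennreal (b * sin t) * indicator {0..pi} t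
      = h (a - b * cos t) * indicator {0..pi} t"
    proof (cases "t \<in> {0..pi}")
      case True
      then have s: "sin t > 0" using \<open>t \<noteq> 0\<close> \<open>t \<noteq> pi\<close> by (auto intro!: sin_gt_zero)
      have eq: "b\<^sup>2 - (a - b * cos t - a)\<^sup>2 = (b * sin t)\<^sup>2"
        by (simp add: power_mult_distrib sin_squared_eq algebra_simps)
      have "(b * sin t)\<^sup>2 > 0" using s b by simp
      then have "(a - b * cos t - a)\<^sup>2 < b\<^sup>2" using eq by linarith
      then have "w (a - b * cos t) = 1 / (b * sin t)"
        unfolding w_def eq using s b by (simp add: real_sqrt_mult)
      then have "ennreal (w (a - b * cos t)) * ennreal (b * sin t) = 1"
        using s b by (simp add: ennreal_mult'[symmetric])
      then show ?thesis by (simp add: mult.assoc)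
    qed simp
  qed
  also have "(\<integral>\<^sup>+u. (h u * ennreal (w u)) * indicator {(\<lambda>\<theta>. a - b * cos \<theta>) 0..(\<lambda>\<theta>. a - b * cos \<theta>) pi} u \<partial>lborel)
      = (\<integral>\<^sup>+u. h u * ennreal (w u) \<partial>lborel)"
  proof (intro nn_integral_cong)
    fix u :: real
    have "w u = 0" if "u \<notin> {a - b..a + b}"
    proof -
      have "\<bar>b\<bar> \<le> \<bar>u - a\<bar>" using that b by auto
      then have "b\<^sup>2 \<le> (u - a)\<^sup>2" by (simp add: abs_le_square_iff)
      then show ?thesis by (simp add: w_def)
    qed
    then show "h u * ennreal (w u) * indicator {a - b * cos 0..a - b * cos pi} u = h u * ennreal (w u)"
      by (auto split: split_indicator)
  qed
  finally show ?thesis by (simp add: w_def)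
qed

text \<open>The reflection \<open>\<theta> = pi - t\<close> on the first half circle and the
  translation \<open>\<theta> = pi + t\<close> on the second bring both to the increasing branch.
  The sign of \<open>b\<close> is free, which \<open>nn_integral_cos_sign\<close> exploits.\<close>

lemma nn_integral_cos_flip:
  fixes h :: "real \<Rightarrow> ennreal" and a b :: real
  assumes [measurable]: "h \<in> borel_measurable borel"
  shows "(\<integral>\<^sup>+\<theta>. h (a + b * cos \<theta>) * indicator {0..2 * pi} \<theta> \<partial>lborel)
       = 2 * (\<integral>\<^sup>+\<theta>. h (a - b * cos \<theta>) * indicator {0..pi} \<theta> \<partial>lborel)"
proof -
  have "h (a + b * cos (pi + - 1 * t)) * indicator {0..pi} (pi + - 1 * t) = h (a - b * cos t) * indicator {0..pi} t" for t
    by (simp add: cos_diff indicator_def conj_commute)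
  then have 1: "(\<integral>\<^sup>+\<theta>. h (a + b * cos \<theta>) * indicator {0..pi} \<theta> \<partial>lborel)
      = (\<integral>\<^sup>+\<theta>. h (a - b * cos \<theta>) * indicator {0..pi} \<theta> \<partial>lborel)"
    by (subst nn_integral_real_affine[where c="-1" and t=pi]) simp_all
  have "h (a + b * cos (pi + 1 * t)) * indicator {pi..2*pi} (pi + 1 * t) = h (a - b * cos t) * indicator {0..pi} t" for t
    by (simp add: cos_add indicator_def)
  then have 2: "(\<integral>\<^sup>+\<theta>. h (a + b * cos \<theta>) * indicator {pi..2*pi} \<theta> \<partial>lborel)
      = (\<integral>\<^sup>+\<theta>. h (a - b * cos \<theta>) * indicator {0..pi} \<theta> \<partial>lborel)"
    by (subst nn_integral_real_affine[where c=1 and t=pi]) simp_all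
  have "(\<integral>\<^sup>+\<theta>. h (a + b * cos \<theta>) * indicator {0..2 * pi} \<theta> \<partial>lborel)
     = (\<integral>\<^sup>+\<theta>. h (a + b * cos \<theta>) * indicator {0..pi} \<theta> + h (a + b * cos \<theta>) * indicator {pi..2*pi} \<theta> \<partial>lborel)"
  proof (intro nn_integral_cong_AE, rule AE_mp[OF AE_lborel_singleton[of pi]], intro AE_I2 impI)
    fix t :: real assume "t \<noteq> pi"
    then have "(indicator {0..2 * pi} t :: ennreal) = indicator {0..pi} t + indicator {pi..2*pi} t"
      using pi_gt_zero by (auto simp add: indicator_def simp del: pi_gt_zero)
    then show "h (a + b * cos t) * indicator {0..2 * pi} t
      = h (a + b * cos t) * indicator {0..pi} t + h (a + b * cos t) * indicator {pi..2*pi} t"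
      by (simp only: distrib_left)
  qed
  also have "\<dots> = (\<integral>\<^sup>+\<theta>. h (a + b * cos \<theta>) * indicator {0..pi} \<theta> \<partial>lborel)
     + (\<integral>\<^sup>+\<theta>. h (a + b * cos \<theta>) * indicator {pi..2*pi} \<theta> \<partial>lborel)"
    by (rule nn_integral_add) measurable
  also have "\<dots> = 2 * (\<integral>\<^sup>+\<theta>. h (a - b * cos \<theta>) * indicator {0..pi} \<theta> \<partial>lborel)"
    unfolding 1 2 by (rule mult_2[symmetric])
  finally show ?thesis .
qed

text \<open>This is the arcsine law of \<open>a + b * cos \<theta>\<close>. It serves in both
  directions: from the angle of the kernel to \<open>\<pi>\<close>, and from the energy
  \<open>x\<close> to the new angle \<open>\<psi>\<close>.\<close>

lemma nn_integral_arcsine: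
  fixes h :: "real \<Rightarrow> ennreal" and a b :: real
  assumes [measurable]: "h \<in> borel_measurable borel" and b: "b > 0"
  shows "(\<integral>\<^sup>+\<theta>. h (a + b * cos \<theta>) * indicator {0..2 * pi} \<theta> \<partial>lborel)
       = 2 * (\<integral>\<^sup>+u. h u * ennreal (if (u - a)\<^sup>2 < b\<^sup>2 then 1 / sqrt (b\<^sup>2 - (u - a)\<^sup>2) else 0) \<partial>lborel)"
  by (simp add: nn_integral_cos_flip nn_integral_cos_half[OF _ b])

subsection \<open>The collision measure\<close>

text \<open>In the variables \<open>\<sigma> = s\<^sup>2\<close>, \<open>\<pi> = Y_*\<^sup>2\<close> the measure \<open>ds d\<theta>\<close> of the kernel has the density
  \<open>1 / sqrt gram\<close>. It is invariant under the simultaneous exchange of \<open>\<sigma>, \<pi>\<close> and of \<open>y, z\<close>.\<close>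

definition gram :: "real \<Rightarrow> real \<Rightarrow> real \<Rightarrow> real \<Rightarrow> real \<Rightarrow> real" where
  "gram x y z \<sigma> \<pi> = 4 * \<pi> * \<sigma> * x - \<sigma> * (\<pi> + x - z)\<^sup>2 - \<pi> * (\<sigma> + x - y)\<^sup>2"

definition gram_density :: "real \<Rightarrow> real \<Rightarrow> real \<Rightarrow> real \<Rightarrow> real \<Rightarrow> real" where
  "gram_density x y z \<sigma> \<pi> =
     (if 0 < \<sigma> \<and> 0 < \<pi> \<and> 0 < gram x y z \<sigma> \<pi> then 1 / sqrt (gram x y z \<sigma> \<pi>) else 0)"

lemma gram_swap: "gram x y z \<sigma> \<pi> = gram x z y \<pi> \<sigma>"
  by (simp add: gram_def algebra_simps)

lemma gram_density_swap: "gram_density x y z \<sigma> \<pi> = gram_density x z y \<pi> \<sigma>"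
  by (auto simp: gram_density_def gram_swap)

lemma gram_density_nonneg: "0 \<le> gram_density x y z \<sigma> \<pi>"
  by (simp add: gram_density_def)

lemma gram_density_measurable [measurable]:
  assumes [measurable]: "f1 \<in> borel_measurable M" "f2 \<in> borel_measurable M" "f3 \<in> borel_measurable M"
    "f4 \<in> borel_measurable M" "f5 \<in> borel_measurable M"
  shows "(\<lambda>w. gram_density (f1 w) (f2 w) (f3 w) (f4 w) (f5 w)) \<in> borel_measurable M"
  unfolding gram_density_def gram_def by measurable

section \<open>The integration limits of the kernel as triangle conditions\<close>

definition s_low :: "real \<Rightarrow> real \<Rightarrow> real \<Rightarrow> real" where
  "s_low x y z = max \<bar>sqrt x - sqrt y\<bar> \<bar>sqrt (x_star x y z) - sqrt z\<bar>"

definition s_high :: "real \<Rightarrow> real \<Rightarrow> real \<Rightarrow> real" where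
  "s_high x y z = min (sqrt x + sqrt y) (sqrt (x_star x y z) + sqrt z)"

text \<open>In a triangle with sides \<open>a\<close>, \<open>b\<close>, \<open>s\<close> the
  projection of side \<open>a\<close> onto side \<open>s\<close> has length
  \<open>\<bar>a\<^sup>2 - b\<^sup>2 + s\<^sup>2\<bar> / (2 * s)\<close>. It is shorter than
  \<open>a\<close> exactly when the triangle is nondegenerate.\<close>

lemma chord_iff:
  fixes a b s :: real
  assumes "a > 0" "b > 0" "s > 0"
  shows "(a\<^sup>2 - b\<^sup>2 + s\<^sup>2)\<^sup>2 / (4 * s\<^sup>2) < a\<^sup>2 \<longleftrightarrow> \<bar>a - b\<bar> < s \<and> s < a + b"
proof -
  have "(a\<^sup>2 - b\<^sup>2 + s\<^sup>2)\<^sup>2 / (4 * s\<^sup>2) < a\<^sup>2 \<longleftrightarrow> (a\<^sup>2 - b\<^sup>2 + s\<^sup>2)\<^sup>2 < a\<^sup>2 * (4 * s\<^sup>2)"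
    using assms by (simp add: pos_divide_less_eq)
  also have "\<dots> \<longleftrightarrow> (a\<^sup>2 - b\<^sup>2 + s\<^sup>2)\<^sup>2 < (2 * a * s)\<^sup>2"
    by (simp add: power_mult_distrib algebra_simps)
  also have "\<dots> \<longleftrightarrow> \<bar>a\<^sup>2 - b\<^sup>2 + s\<^sup>2\<bar> < \<bar>2 * a * s\<bar>"
    using abs_le_square_iff[of "2 * a * s" "a\<^sup>2 - b\<^sup>2 + s\<^sup>2"] by linarith
  also have "\<dots> \<longleftrightarrow> (a - s)\<^sup>2 < b\<^sup>2 \<and> b\<^sup>2 < (a + s)\<^sup>2"
    using assms by (simp add: abs_less_iff power2_eq_square algebra_simps)
  also have "(a - s)\<^sup>2 < b\<^sup>2 \<longleftrightarrow> \<bar>a - s\<bar> < b"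
    using abs_le_square_iff[of b "a - s"] assms by auto
  also have "b\<^sup>2 < (a + s)\<^sup>2 \<longleftrightarrow> b < a + s"
    using assms by (intro iffI) (auto intro: power2_less_imp_less power_strict_mono)
  also have "\<bar>a - s\<bar> < b \<and> b < a + s \<longleftrightarrow> \<bar>a - b\<bar> < s \<and> s < a + b" by auto
  finally show ?thesis .
qed

text \<open>The triangles with sides \<open>sqrt x\<close>, \<open>sqrt y\<close>, \<open>s\<close>
  and \<open>sqrt z\<close>, \<open>sqrt (x_star x y z)\<close>, \<open>s\<close> have the same
  projection onto \<open>s\<close>, because \<open>z - x_star x y z = x - y\<close>. Strictly
  between the limits the truncations at 0 inside \<open>Y_star\<close> are therefore
  inactive.\<close>

lemma s_range_iff:
  assumes "x > 0" "y > 0" "z > 0" "x < y + z" "s > 0"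
  shows "s_low x y z < s \<and> s < s_high x y z \<longleftrightarrow>
    (x - y + s\<^sup>2)\<^sup>2 / (4 * s\<^sup>2) < x \<and> (x - y + s\<^sup>2)\<^sup>2 / (4 * s\<^sup>2) < z"
proof -
  have xs: "x_star x y z = y + z - x" using assms by (simp add: x_star_def)
  have 1: "(x - y + s\<^sup>2)\<^sup>2 / (4 * s\<^sup>2) < x \<longleftrightarrow> \<bar>sqrt x - sqrt y\<bar> < s \<and> s < sqrt x + sqrt y"
    using chord_iff[of "sqrt x" "sqrt y" s] assms by simp
  have 2: "(z - (y + z - x) + s\<^sup>2)\<^sup>2 / (4 * s\<^sup>2) < z \<longleftrightarrow>
      \<bar>sqrt z - sqrt (y + z - x)\<bar> < s \<and> s < sqrt z + sqrt (y + z - x)"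
    using chord_iff[of "sqrt z" "sqrt (y + z - x)" s] assms by simp
  have "z - (y + z - x) = x - y" by simp
  with 1 2 show ?thesis unfolding s_low_def s_high_def xs by auto
qed

text \<open>Law of cosines for the components orthogonal to the direction of \<open>s\<close>, whose
  squared lengths are \<open>z - q\<close> and \<open>x - q\<close>.\<close>

lemma Y_star_sq:
  assumes "s > 0" "q = (x - y + s\<^sup>2)\<^sup>2 / (4 * s\<^sup>2)" "q \<le> x" "q \<le> z"
  shows "(Y_star x y z s \<theta>)\<^sup>2 = (z - q) + (x - q) + 2 * sqrt ((z - q) * (x - q)) * cos \<theta>"
proof -
  define a where "a = sqrt (z - q)"
  define b where "b = sqrt (x - q)"
  have Y: "Y_star x y z s \<theta> = cmod (complex_of_real a + exp (\<i> * complex_of_real \<theta>) * complex_of_real b)"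
    using assms by (simp add: Y_star_def a_def b_def max_def)
  have "(Y_star x y z s \<theta>)\<^sup>2 = (a + cos \<theta> * b)\<^sup>2 + (sin \<theta> * b)\<^sup>2"
    unfolding Y by (simp add: cmod_power2 cis_conv_exp[symmetric])
  also have "\<dots> = a\<^sup>2 + b\<^sup>2 * (cos \<theta> ^ 2 + sin \<theta> ^ 2) + 2 * (a * b) * cos \<theta>"
    by algebra
  also have "\<dots> = (z - q) + (x - q) + 2 * sqrt ((z - q) * (x - q)) * cos \<theta>"
    using assms by (simp add: a_def b_def real_sqrt_mult)
  finally show ?thesis .
qed

text \<open>As a function of \<open>\<pi>\<close>, \<open>gram\<close> is a downward parabola whose
  centre and half-width are those of the range of \<open>Y_star\<^sup>2\<close> in
  \<open>Y_star_sq\<close>. This is why the arcsine law produces exactly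
  \<open>1 / sqrt gram\<close>.\<close>

lemma gram_eq_chord:
  assumes "s \<noteq> 0" "q = (x - y + s\<^sup>2)\<^sup>2 / (4 * s\<^sup>2)"
  shows "gram x y z (s\<^sup>2) \<pi> = s\<^sup>2 * (4 * ((z - q) * (x - q)) - (\<pi> - ((z - q) + (x - q)))\<^sup>2)"
proof -
  have q: "4 * s\<^sup>2 * q = (x - y + s\<^sup>2)\<^sup>2" using assms by simp
  have "s\<^sup>2 * (4 * ((z - q) * (x - q)) - (\<pi> - ((z - q) + (x - q)))\<^sup>2)
     = s\<^sup>2 * (4 * z * x - (\<pi> - z - x)\<^sup>2) - \<pi> * (4 * s\<^sup>2 * q)"
    by (simp add: power2_eq_square algebra_simps)
  also have "\<dots> = gram x y z (s\<^sup>2) \<pi>"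
    unfolding q gram_def by (simp add: power2_eq_square algebra_simps)
  finally show ?thesis by simp
qed

text \<open>The arcsine law turns \<open>\<theta>\<close> into \<open>\<pi>\<close>. Its factor 2
  and the factor \<open>s\<close> that splits off from \<open>sqrt gram\<close> combine to the
  Jacobian \<open>2 * s\<close> of \<open>\<sigma> = s\<^sup>2\<close>.\<close>

lemma nn_integral_s_theta:
  fixes h :: "real \<Rightarrow> real \<Rightarrow> ennreal"
  assumes h[measurable]: "case_prod h \<in> borel_measurable (borel \<Otimes>\<^sub>M borel)"
    and pos: "x > 0" "y > 0" "z > 0" "x < y + z"
  shows "(\<integral>\<^sup>+s. (\<integral>\<^sup>+\<theta>. h (s\<^sup>2) ((Y_star x y z s \<theta>)\<^sup>2) * indicator {0..2 * pi} \<theta> \<partial>lborel)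
             * indicator {s_low x y z..s_high x y z} s \<partial>lborel)
       = (\<integral>\<^sup>+\<sigma>. \<integral>\<^sup>+\<pi>. h \<sigma> \<pi> * ennreal (gram_density x y z \<sigma> \<pi>) \<partial>lborel \<partial>lborel)"
proof -
  have low: "s_low x y z \<ge> 0" by (simp add: s_low_def)
  have [measurable]: "h c \<in> borel_measurable borel" for c
    using h by simp
  have inner: "(\<integral>\<^sup>+\<theta>. h (s\<^sup>2) ((Y_star x y z s \<theta>)\<^sup>2) * indicator {0..2 * pi} \<theta> \<partial>lborel)
       * indicator {s_low x y z..s_high x y z} s
     = ennreal (2 * s) * (\<integral>\<^sup>+\<pi>. h (s\<^sup>2) \<pi> * ennreal (gram_density x y z (s\<^sup>2) \<pi>) \<partial>lborel) * indicator {0<..} s"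
    if s: "s \<noteq> s_low x y z" "s \<noteq> s_high x y z" "s \<noteq> 0" for s
  proof (cases "s > 0")
    case False
    then show ?thesis using low s by auto
  next
    case s0: True
    define q where "q = (x - y + s\<^sup>2)\<^sup>2 / (4 * s\<^sup>2)"
    note iff = s_range_iff[OF pos s0, folded q_def]
    note gc = gram_eq_chord[OF s(3) q_def]
    define a b where "a = (z - q) + (x - q)" and "b = 2 * sqrt ((z - q) * (x - q))"
    show ?thesis
    proof (cases "q < x \<and> q < z")
      case True
      then have rng: "s \<in> {s_low x y z..s_high x y z}" using iff by simp
      have b0: "b > 0" using True by (simp add: b_def)
      have b2: "b\<^sup>2 = 4 * ((z - q) * (x - q))" using True by (simp add: b_def power_mult_distrib)
      have G: "gram x y z (s\<^sup>2) \<pi> = s\<^sup>2 * (b\<^sup>2 - (\<pi> - a)\<^sup>2)" for \<pi>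
        using gc[of z \<pi>] by (simp add: b2 a_def)
      have ba: "b \<le> a"
        using arith_geo_mean_sqrt[of "z - q" "x - q"] True by (simp add: a_def b_def)
      have dens: "2 * (if (\<pi> - a)\<^sup>2 < b\<^sup>2 then 1 / sqrt (b\<^sup>2 - (\<pi> - a)\<^sup>2) else 0)
          = 2 * s * gram_density x y z (s\<^sup>2) \<pi>" for \<pi>
      proof (cases "(\<pi> - a)\<^sup>2 < b\<^sup>2")
        case True
        then have "\<bar>\<pi> - a\<bar> < b" using b0 abs_le_square_iff[of b "\<pi> - a"] by auto
        then have "\<pi> > 0" using ba by auto
        moreover have "gram x y z (s\<^sup>2) \<pi> > 0" using G True s0 by simp
        ultimately have "gram_density x y z (s\<^sup>2) \<pi> = 1 / (s * sqrt (b\<^sup>2 - (\<pi> - a)\<^sup>2))"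
          using s0 by (simp add: gram_density_def) (simp add: G real_sqrt_mult)
        then show ?thesis using True s0 by simp
      next
        case False
        then have "\<not> gram x y z (s\<^sup>2) \<pi> > 0" using s0 by (simp add: G zero_less_mult_iff)
        then show ?thesis using False by (simp add: gram_density_def)
      qed
      have "(\<integral>\<^sup>+\<theta>. h (s\<^sup>2) ((Y_star x y z s \<theta>)\<^sup>2) * indicator {0..2 * pi} \<theta> \<partial>lborel)
         = (\<integral>\<^sup>+\<theta>. h (s\<^sup>2) (a + b * cos \<theta>) * indicator {0..2 * pi} \<theta> \<partial>lborel)"
        using Y_star_sq[OF s0 q_def] True by (simp add: a_def b_def)
      also have "\<dots> = 2 * (\<integral>\<^sup>+u. h (s\<^sup>2) u * ennreal (if (u - a)\<^sup>2 < b\<^sup>2 then 1 / sqrt (b\<^sup>2 - (u - a)\<^sup>2) else 0) \<partial>lborel)"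
        by (rule nn_integral_arcsine[OF _ b0]) simp
      also have "\<dots> = (\<integral>\<^sup>+u. h (s\<^sup>2) u * (2 * ennreal (if (u - a)\<^sup>2 < b\<^sup>2 then 1 / sqrt (b\<^sup>2 - (u - a)\<^sup>2) else 0)) \<partial>lborel)"
        by (subst nn_integral_cmult[symmetric]) (auto simp: mult_ac)
      also have "\<dots> = (\<integral>\<^sup>+u. h (s\<^sup>2) u * (ennreal (2 * s) * ennreal (gram_density x y z (s\<^sup>2) u)) \<partial>lborel)"
        using s0 unfolding ennreal_mult''[symmetric, OF gram_density_nonneg] dens[symmetric]
        by (subst ennreal_mult) (auto simp: ennreal_numeral)
      also have "\<dots> = ennreal (2 * s) * (\<integral>\<^sup>+u. h (s\<^sup>2) u * ennreal (gram_density x y z (s\<^sup>2) u) \<partial>lborel)"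
        by (subst nn_integral_cmult[symmetric]) (auto simp: mult_ac)
      finally show ?thesis using rng s0 by simp
    next
      case False
      then have rng: "s \<notin> {s_low x y z..s_high x y z}" using iff s by auto
      have "gram_density x y z (s\<^sup>2) \<pi> = 0" for \<pi>
      proof (rule ccontr)
        assume "gram_density x y z (s\<^sup>2) \<pi> \<noteq> 0"
        then have p: "\<pi> > 0" "gram x y z (s\<^sup>2) \<pi> > 0" by (auto simp: gram_density_def split: if_splits)
        have "(\<pi> - a)\<^sup>2 < 4 * ((z - q) * (x - q))"
          using p(2) s0 by (simp add: gc a_def zero_less_mult_iff)
        moreover have "0 \<le> (\<pi> - a)\<^sup>2" by simp
        ultimately have "(z - q) * (x - q) > 0" by linarith
        \<comment> \<open>Two negative factors would also give a positive product. In that case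
          \<open>a < 0 < \<pi>\<close>, so \<open>(\<pi> - a)\<^sup>2 \<ge> a\<^sup>2\<close>, and
          \<open>a\<^sup>2\<close> already dominates four times the product by the
          arithmetic-geometric mean inequality.\<close>
        with False have "z - q < 0" "x - q < 0" by (auto simp: zero_less_mult_iff)
        then have "a\<^sup>2 \<le> (\<pi> - a)\<^sup>2"
          using p(1) by (intro abs_le_square_iff[THEN iffD1]) (auto simp: a_def)
        moreover have "4 * ((z - q) * (x - q)) \<le> a\<^sup>2"
          using zero_le_power2[of "(z - q) - (x - q)"] by (simp add: a_def power2_eq_square algebra_simps)
        ultimately show False using \<open>(\<pi> - a)\<^sup>2 < 4 * ((z - q) * (x - q))\<close> by linarith
      qed
      then show ?thesis using rng by simp
    qed
  qed
  have "(\<integral>\<^sup>+s. (\<integral>\<^sup>+\<theta>. h (s\<^sup>2) ((Y_star x y z s \<theta>)\<^sup>2) * indicator {0..2 * pi} \<theta> \<partial>lborel)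
             * indicator {s_low x y z..s_high x y z} s \<partial>lborel)
     = (\<integral>\<^sup>+s. ennreal (2 * s) * (\<integral>\<^sup>+\<pi>. h (s\<^sup>2) \<pi> * ennreal (gram_density x y z (s\<^sup>2) \<pi>) \<partial>lborel) * indicator {0<..} s \<partial>lborel)"
    by (intro nn_integral_cong_AE, rule AE_mp[OF AE_lborel_singleton[of "s_low x y z"]],
        rule AE_mp[OF AE_lborel_singleton[of "s_high x y z"]], rule AE_mp[OF AE_lborel_singleton[of 0]])
      (intro AE_I2 impI inner)
  also have "\<dots> = (\<integral>\<^sup>+\<sigma>. (\<integral>\<^sup>+\<pi>. h \<sigma> \<pi> * ennreal (gram_density x y z \<sigma> \<pi>) \<partial>lborel) * indicator {0<..} \<sigma> \<partial>lborel)"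
    by (rule nn_integral_square_substitution) measurable
  also have "\<dots> = (\<integral>\<^sup>+\<sigma>. (\<integral>\<^sup>+\<pi>. h \<sigma> \<pi> * ennreal (gram_density x y z \<sigma> \<pi>) \<partial>lborel) \<partial>lborel)"
    by (intro nn_integral_cong) (auto simp: gram_density_def split: split_indicator)
  finally show ?thesis .
qed

section \<open>Integrating out the energy \<open>x\<close>\<close>

text \<open>As a function of \<open>x\<close>, \<open>gram\<close> is a concave quadratic; with \<open>u = \<sigma> + \<pi>\<close> it is positive exactly on the
  interval swept out by \<open>post\<close> as \<open>\<psi>\<close> varies, which is nonempty iff \<open>gap > 0\<close>.\<close>

definition gap :: "real \<Rightarrow> real \<Rightarrow> real \<Rightarrow> real" where
  "gap y z u = 4 * y * z - (u - y - z)\<^sup>2"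

definition post :: "real \<Rightarrow> real \<Rightarrow> real \<Rightarrow> real \<Rightarrow> real \<Rightarrow> real" where
  "post y z \<sigma> u \<psi> = y + \<sigma> / u * (z - y) + sqrt (\<sigma> * (u - \<sigma>) * gap y z u) / u * cos \<psi>"

lemma gap_measurable [measurable]:
  assumes [measurable]: "f1 \<in> borel_measurable M" "f2 \<in> borel_measurable M" "f3 \<in> borel_measurable M"
  shows "(\<lambda>w. gap (f1 w) (f2 w) (f3 w)) \<in> borel_measurable M"
  unfolding gap_def by measurable

lemma post_measurable [measurable]:
  assumes [measurable]: "f1 \<in> borel_measurable M" "f2 \<in> borel_measurable M" "f3 \<in> borel_measurable M"
    "f4 \<in> borel_measurable M" "f5 \<in> borel_measurable M"
  shows "(\<lambda>w. post (f1 w) (f2 w) (f3 w) (f4 w) (f5 w)) \<in> borel_measurable M"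
  unfolding post_def by measurable

text \<open>Completing the square in \<open>x\<close> gives
  \<open>gram = u * (R\<^sup>2 - (x - c)\<^sup>2)\<close> with \<open>u = \<sigma> + \<pi>\<close>,
  so \<open>x\<close> is distributed by the arcsine law around \<open>c\<close>. The prefactor
  collects \<open>sqrt u\<close> and the 2 of that law; no singular density remains.\<close>

lemma nn_integral_gram_density:
  fixes f :: "real \<Rightarrow> ennreal"
  assumes [measurable]: "f \<in> borel_measurable borel" and pos: "\<sigma> > 0" "\<pi> > 0"
  shows "(\<integral>\<^sup>+x. f x * ennreal (gram_density x y z \<sigma> \<pi>) \<partial>lborel)
       = ennreal (if gap y z (\<sigma> + \<pi>) > 0 then 1 / (2 * sqrt (\<sigma> + \<pi>)) else 0) *
         (\<integral>\<^sup>+\<psi>. f (post y z \<sigma> (\<sigma> + \<pi>) \<psi>) * indicator {0..2*pi} \<psi> \<partial>lborel)"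
proof -
  define u where "u = \<sigma> + \<pi>"
  define D where "D = gap y z u"
  define c where "c = y + \<sigma> / u * (z - y)"
  have u: "u > 0" using pos by (simp add: u_def)
  have uc: "u * c = \<sigma> * z + \<pi> * y"
    using u unfolding c_def by (simp add: field_simps) (simp add: u_def algebra_simps)
  have id: "u * gram x y z \<sigma> \<pi> = \<sigma> * \<pi> * D - (u * (x - c))\<^sup>2" for x
  proof -
    have e: "u * (x - c) = u * x - (\<sigma> * z + \<pi> * y)" using uc by (simp add: algebra_simps)
    show ?thesis
      unfolding e unfolding gram_def D_def gap_def u_def by (simp add: power2_eq_square algebra_simps)
  qed
  have G: "gram x y z \<sigma> \<pi> = u * (\<sigma> * \<pi> * D / u\<^sup>2 - (x - c)\<^sup>2)" for x
  proof -
    have "gram x y z \<sigma> \<pi> = (\<sigma> * \<pi> * D - (u * (x - c))\<^sup>2) / u"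
      using id[of x] u by (simp add: field_simps)
    also have "\<dots> = u * (\<sigma> * \<pi> * D / u\<^sup>2 - (x - c)\<^sup>2)"
      using u by (simp add: field_simps power2_eq_square)
    finally show ?thesis .
  qed
  show ?thesis
  proof (cases "D > 0")
    case True
    define R where "R = sqrt (\<sigma> * \<pi> * D) / u"
    have R: "R > 0" using True pos u by (simp add: R_def)
    have R2: "R\<^sup>2 = \<sigma> * \<pi> * D / u\<^sup>2" using True pos by (simp add: R_def power_divide)
    have p: "post y z \<sigma> u \<psi> = c + R * cos \<psi>" for \<psi>
      by (simp add: post_def c_def R_def D_def u_def)
    have dens: "ennreal (gram_density x y z \<sigma> \<pi>) = ennreal (1 / (2 * sqrt u)) *
       (2 * ennreal (if (x - c)\<^sup>2 < R\<^sup>2 then 1 / sqrt (R\<^sup>2 - (x - c)\<^sup>2) else 0))" for x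
    proof -
      have "gram_density x y z \<sigma> \<pi> = 1 / (2 * sqrt u) * (2 * (if (x - c)\<^sup>2 < R\<^sup>2 then 1 / sqrt (R\<^sup>2 - (x - c)\<^sup>2) else 0))"
        unfolding gram_density_def G R2[symmetric] using pos u
        by (auto simp: zero_less_mult_iff real_sqrt_mult)
      note g = this
      have E: "ennreal (a * (2 * v)) = ennreal a * (2 * ennreal v)" if "a \<ge> 0" "v \<ge> 0" for a v :: real
        using that by (simp add: ennreal_mult)
      show ?thesis unfolding g by (rule E) (use u in auto)
    qed
    have "(\<integral>\<^sup>+x. f x * ennreal (gram_density x y z \<sigma> \<pi>) \<partial>lborel)
      = ennreal (1 / (2 * sqrt u)) * (2 * (\<integral>\<^sup>+x. f x * ennreal (if (x - c)\<^sup>2 < R\<^sup>2 then 1 / sqrt (R\<^sup>2 - (x - c)\<^sup>2) else 0) \<partial>lborel))"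
      unfolding dens mult.left_commute[of "f _"] by (simp add: nn_integral_cmult)
    also have "\<dots> = ennreal (1 / (2 * sqrt u)) * (\<integral>\<^sup>+\<psi>. f (c + R * cos \<psi>) * indicator {0..2*pi} \<psi> \<partial>lborel)"
      by (subst nn_integral_arcsine[OF _ R]) simp_all
    finally show ?thesis using True by (simp add: D_def u_def[symmetric] p)
  next
    case False
    have "gram x y z \<sigma> \<pi> \<le> 0" for x
    proof -
      have "\<sigma> * \<pi> * D \<le> 0" using False pos by (simp add: mult_nonneg_nonpos)
      then have "u * gram x y z \<sigma> \<pi> \<le> 0" unfolding id by (smt (verit) zero_le_power2)
      then show ?thesis using u by (simp add: mult_le_0_iff)
    qed
    then have "gram_density x y z \<sigma> \<pi> = 0" for x by (simp add: gram_density_def not_less)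
    then show ?thesis using False by (simp add: D_def u_def)
  qed
qed

text \<open>The polynomial is unchanged when \<open>x\<close> is replaced by
  \<open>y + z - x\<close> and \<open>y\<close>, \<open>z\<close> are exchanged, which passes to the
  opposite vertex of the collision rectangle. Both bounds thus follow from the same sign
  argument.\<close>

lemma gram_density_support:
  assumes "gram_density x y z \<sigma> \<pi> \<noteq> 0"
  shows "0 < x" "x < y + z"
proof -
  from assms have p: "0 < \<sigma>" "0 < \<pi>" "0 < gram x y z \<sigma> \<pi>"
    by (auto simp: gram_density_def split: if_splits)
  have nn: "0 \<le> \<sigma> * t\<^sup>2" "0 \<le> \<pi> * t\<^sup>2" for t using p by simp_all
  have "0 < 4 * \<pi> * \<sigma> * x" using p(3) nn(1)[of "\<pi> + x - z"] nn(2)[of "\<sigma> + x - y"]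
    unfolding gram_def by linarith
  moreover have "0 < 4 * \<pi> * \<sigma>" using p by simp
  ultimately show "0 < x" using zero_less_mult_pos by blast
  have "gram x y z \<sigma> \<pi> = 4 * \<pi> * \<sigma> * (y + z - x) - \<sigma> * (\<pi> + (y + z - x) - y)\<^sup>2 - \<pi> * (\<sigma> + (y + z - x) - z)\<^sup>2"
    unfolding gram_def by (simp add: power2_eq_square algebra_simps)
  then have "0 < 4 * \<pi> * \<sigma> * (y + z - x)"
    using p(3) nn(1)[of "\<pi> + (y + z - x) - y"] nn(2)[of "\<sigma> + (y + z - x) - z"] by linarith
  moreover have "0 < 4 * \<pi> * \<sigma>" using p by simp
  ultimately have "0 < y + z - x" using zero_less_mult_pos by blast
  then show "x < y + z" by simp
qed

text \<open>Heron's formula: \<open>gap y z u\<close> is sixteen times the squared area of a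
  triangle with squared sides \<open>y\<close>, \<open>z\<close>, \<open>u\<close>. Its positivity
  says that \<open>w\<close> is a nondegenerate relative speed of two particles with speeds
  \<open>a\<close> and \<open>b\<close>.\<close>

lemma gap_factor:
  assumes "y = a\<^sup>2" "z = b\<^sup>2"
  shows "gap y z (w\<^sup>2) = (w\<^sup>2 - (a - b)\<^sup>2) * ((a + b)\<^sup>2 - w\<^sup>2)"
  unfolding gap_def assms by (simp add: power2_eq_square algebra_simps)

text \<open>Tonelli moves \<open>x\<close> innermost, where \<open>nn_integral_gram_density\<close>
  applies; then \<open>\<pi>\<close> is traded for \<open>u = \<sigma> + \<pi>\<close> and
  \<open>u\<close> for \<open>w\<^sup>2\<close>. Writing \<open>w = M + m * \<tau>\<close> keeps the
  range of \<open>\<tau>\<close> independent of \<open>y\<close> and \<open>z\<close>, which later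
  allows dominated convergence in these variables, even as \<open>m\<close> tends to 0.\<close>

lemma nn_integral_collision:
  fixes h :: "real \<Rightarrow> real \<Rightarrow> ennreal" and f :: "real \<Rightarrow> ennreal"
  assumes h[measurable]: "case_prod h \<in> borel_measurable (borel \<Otimes>\<^sub>M borel)"
    and f[measurable]: "f \<in> borel_measurable borel"
    and pos: "y > 0" "z > 0"
  defines "M \<equiv> sqrt (max y z)" and "m \<equiv> sqrt (min y z)"
  shows "(\<integral>\<^sup>+x. (\<integral>\<^sup>+\<sigma>. \<integral>\<^sup>+\<pi>. h \<sigma> \<pi> * ennreal (gram_density x y z \<sigma> \<pi>) \<partial>lborel \<partial>lborel) * f x \<partial>lborel)
       = ennreal m * (\<integral>\<^sup>+\<tau>. (\<integral>\<^sup>+\<sigma>. (\<integral>\<^sup>+\<psi>. h \<sigma> ((M + m * \<tau>)\<^sup>2 - \<sigma>) * f (post y z \<sigma> ((M + m * \<tau>)\<^sup>2) \<psi>)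
            * indicator {0..2*pi} \<psi> \<partial>lborel) * indicator {0<..<(M + m * \<tau>)\<^sup>2} \<sigma> \<partial>lborel)
            * indicator {-1<..<1} \<tau> \<partial>lborel)"
proof -
  have m: "m > 0" "M \<ge> m" using pos by (auto simp: m_def M_def)
  define \<Psi> where "\<Psi> \<sigma> u = (\<integral>\<^sup>+\<psi>. f (post y z \<sigma> u \<psi>) * indicator {0..2*pi} \<psi> \<partial>lborel)" for \<sigma> u
  have \<Psi>m[measurable]: "(\<lambda>w. \<Psi> (g1 w) (g2 w)) \<in> borel_measurable N"
    if [measurable]: "g1 \<in> borel_measurable N" "g2 \<in> borel_measurable N" for g1 g2 and N :: "'c measure"
    unfolding \<Psi>_def by measurable
  have hm[measurable]: "(\<lambda>w. h (g1 w) (g2 w)) \<in> borel_measurable N"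
    if [measurable]: "g1 \<in> borel_measurable N" "g2 \<in> borel_measurable N" for g1 g2 and N :: "'c measure"
    using measurable_compose[OF _ h, of "\<lambda>w. (g1 w, g2 w)" N] by simp
  define g where "g u = (if gap y z u > 0 then 1 / (2 * sqrt u) else 0)" for u
  have [measurable]: "g \<in> borel_measurable borel" unfolding g_def by measurable
  have g0: "g u \<ge> 0 \<or> u < 0" for u by (auto simp: g_def)
  have fub2: "(\<integral>\<^sup>+x. \<integral>\<^sup>+\<sigma>. F x \<sigma> \<partial>lborel \<partial>lborel) = (\<integral>\<^sup>+\<sigma>. \<integral>\<^sup>+x. F x \<sigma> \<partial>lborel \<partial>lborel)"
    if "case_prod F \<in> borel_measurable (lborel \<Otimes>\<^sub>M lborel)" for F :: "real \<Rightarrow> real \<Rightarrow> ennreal"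
    using lborel_pair.Fubini'[OF that] by simp
  have "(\<integral>\<^sup>+x. (\<integral>\<^sup>+\<sigma>. \<integral>\<^sup>+\<pi>. h \<sigma> \<pi> * ennreal (gram_density x y z \<sigma> \<pi>) \<partial>lborel \<partial>lborel) * f x \<partial>lborel)
     = (\<integral>\<^sup>+x. \<integral>\<^sup>+\<sigma>. \<integral>\<^sup>+\<pi>. h \<sigma> \<pi> * ennreal (gram_density x y z \<sigma> \<pi>) * f x \<partial>lborel \<partial>lborel \<partial>lborel)"
    by (simp add: nn_integral_multc)
  also have "\<dots> = (\<integral>\<^sup>+\<sigma>. \<integral>\<^sup>+x. \<integral>\<^sup>+\<pi>. h \<sigma> \<pi> * ennreal (gram_density x y z \<sigma> \<pi>) * f x \<partial>lborel \<partial>lborel \<partial>lborel)"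
    by (rule fub2) measurable
  also have "\<dots> = (\<integral>\<^sup>+\<sigma>. \<integral>\<^sup>+\<pi>. \<integral>\<^sup>+x. h \<sigma> \<pi> * ennreal (gram_density x y z \<sigma> \<pi>) * f x \<partial>lborel \<partial>lborel \<partial>lborel)"
    by (intro nn_integral_cong fub2) measurable
  also have "\<dots> = (\<integral>\<^sup>+\<sigma>. \<integral>\<^sup>+\<pi>. h \<sigma> \<pi> * (\<integral>\<^sup>+x. f x * ennreal (gram_density x y z \<sigma> \<pi>) \<partial>lborel) \<partial>lborel \<partial>lborel)"
    by (subst nn_integral_cmult[symmetric]) (auto simp: mult_ac)
  also have "\<dots> = (\<integral>\<^sup>+\<sigma>. (\<integral>\<^sup>+\<pi>. h \<sigma> \<pi> * (ennreal (g (\<sigma> + \<pi>)) * \<Psi> \<sigma> (\<sigma> + \<pi>)) * indicator {0<..} \<pi> \<partial>lborel) * indicator {0<..} \<sigma> \<partial>lborel)"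
  proof (intro nn_integral_cong)
    fix \<sigma> :: real
    show "(\<integral>\<^sup>+\<pi>. h \<sigma> \<pi> * (\<integral>\<^sup>+x. f x * ennreal (gram_density x y z \<sigma> \<pi>) \<partial>lborel) \<partial>lborel)
      = (\<integral>\<^sup>+\<pi>. h \<sigma> \<pi> * (ennreal (g (\<sigma> + \<pi>)) * \<Psi> \<sigma> (\<sigma> + \<pi>)) * indicator {0<..} \<pi> \<partial>lborel) * indicator {0<..} \<sigma>"
    proof (cases "\<sigma> > 0")
      case True
      have "h \<sigma> \<pi> * (\<integral>\<^sup>+x. f x * ennreal (gram_density x y z \<sigma> \<pi>) \<partial>lborel)
          = h \<sigma> \<pi> * (ennreal (g (\<sigma> + \<pi>)) * \<Psi> \<sigma> (\<sigma> + \<pi>)) * indicator {0<..} \<pi>" for \<pi>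
        using nn_integral_gram_density[OF f True, of \<pi> y z]
        by (cases "\<pi> > 0") (auto simp: g_def \<Psi>_def gram_density_def)
      then show ?thesis using True by simp
    qed (simp add: gram_density_def)
  qed
  also have "\<dots> = (\<integral>\<^sup>+\<sigma>. (\<integral>\<^sup>+w. h \<sigma> (w\<^sup>2 - \<sigma>) * \<Psi> \<sigma> (w\<^sup>2) * indicator {0<..<w\<^sup>2} \<sigma> *
        indicator {w. w > 0 \<and> gap y z (w\<^sup>2) > 0} w \<partial>lborel) \<partial>lborel)"
  proof (intro nn_integral_cong)
    fix \<sigma> :: real
    show "(\<integral>\<^sup>+\<pi>. h \<sigma> \<pi> * (ennreal (g (\<sigma> + \<pi>)) * \<Psi> \<sigma> (\<sigma> + \<pi>)) * indicator {0<..} \<pi> \<partial>lborel) * indicator {0<..} \<sigma>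
      = (\<integral>\<^sup>+w. h \<sigma> (w\<^sup>2 - \<sigma>) * \<Psi> \<sigma> (w\<^sup>2) * indicator {0<..<w\<^sup>2} \<sigma> * indicator {w. w > 0 \<and> gap y z (w\<^sup>2) > 0} w \<partial>lborel)"
    proof (cases "\<sigma> > 0")
      case True
      define H where "H u = h \<sigma> (u - \<sigma>) * (ennreal (g u) * \<Psi> \<sigma> u) * indicator {\<sigma><..} u" for u
      have [measurable]: "H \<in> borel_measurable borel" unfolding H_def by measurable
      have "(\<integral>\<^sup>+\<pi>. h \<sigma> \<pi> * (ennreal (g (\<sigma> + \<pi>)) * \<Psi> \<sigma> (\<sigma> + \<pi>)) * indicator {0<..} \<pi> \<partial>lborel)
        = (\<integral>\<^sup>+\<pi>. H (\<sigma> + 1 * \<pi>) \<partial>lborel)"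
        by (intro nn_integral_cong) (simp add: H_def indicator_def)
      also have "\<dots> = (\<integral>\<^sup>+u. H u \<partial>lborel)"
        by (subst nn_integral_real_affine[of H 1 \<sigma>]) simp_all
      also have "\<dots> = (\<integral>\<^sup>+u. H u * indicator {0<..} u \<partial>lborel)"
        using True by (intro nn_integral_cong) (auto simp: H_def indicator_def)
      also have "\<dots> = (\<integral>\<^sup>+w. ennreal (2 * w) * H (w\<^sup>2) * indicator {0<..} w \<partial>lborel)"
        by (rule nn_integral_square_substitution[symmetric]) simp
      also have "\<dots> = (\<integral>\<^sup>+w. h \<sigma> (w\<^sup>2 - \<sigma>) * \<Psi> \<sigma> (w\<^sup>2) * indicator {0<..<w\<^sup>2} \<sigma> * indicator {w. w > 0 \<and> gap y z (w\<^sup>2) > 0} w \<partial>lborel)"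
      proof (intro nn_integral_cong)
        fix w :: real
        \<comment> \<open>The Jacobian \<open>2 * w\<close> cancels the prefactor
          \<open>1 / (2 * sqrt u)\<close>: the relative speed carries a uniform weight.\<close>
        have "ennreal (2 * w) * ennreal (g (w\<^sup>2)) = indicator {w. w > 0 \<and> gap y z (w\<^sup>2) > 0} w" if "w > 0"
          using that by (auto simp: g_def ennreal_mult'[symmetric])
        moreover have "ennreal (2 * w) * H (w\<^sup>2) = (ennreal (2 * w) * ennreal (g (w\<^sup>2))) *
            (h \<sigma> (w\<^sup>2 - \<sigma>) * \<Psi> \<sigma> (w\<^sup>2) * indicator {0<..<w\<^sup>2} \<sigma>)"
          using True by (cases "\<sigma> < w\<^sup>2") (simp_all add: H_def mult_ac)
        ultimately show "ennreal (2 * w) * H (w\<^sup>2) * indicator {0<..} w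
          = h \<sigma> (w\<^sup>2 - \<sigma>) * \<Psi> \<sigma> (w\<^sup>2) * indicator {0<..<w\<^sup>2} \<sigma> * indicator {w. w > 0 \<and> gap y z (w\<^sup>2) > 0} w"
          by (cases "w > 0") (simp_all add: mult.commute)
      qed
      finally show ?thesis using True by simp
    qed (simp add: indicator_def)
  qed
  also have "\<dots> = (\<integral>\<^sup>+w. (\<integral>\<^sup>+\<sigma>. h \<sigma> (w\<^sup>2 - \<sigma>) * \<Psi> \<sigma> (w\<^sup>2) * indicator {0<..<w\<^sup>2} \<sigma> *
        indicator {w. w > 0 \<and> gap y z (w\<^sup>2) > 0} w \<partial>lborel) \<partial>lborel)"
    by (rule fub2, unfold indicator_def greaterThanLessThan_iff mem_Collect_eq, measurable)
  also have "\<dots> = (\<integral>\<^sup>+w. (\<integral>\<^sup>+\<sigma>. h \<sigma> (w\<^sup>2 - \<sigma>) * \<Psi> \<sigma> (w\<^sup>2) * indicator {0<..<w\<^sup>2} \<sigma> \<partial>lborel) *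
        indicator {w. w > 0 \<and> gap y z (w\<^sup>2) > 0} w \<partial>lborel)"
    by (subst nn_integral_multc[symmetric]) auto
  also have "\<dots> = ennreal m * (\<integral>\<^sup>+\<tau>. (\<integral>\<^sup>+\<sigma>. h \<sigma> ((M + m * \<tau>)\<^sup>2 - \<sigma>) * \<Psi> \<sigma> ((M + m * \<tau>)\<^sup>2) * indicator {0<..<(M + m * \<tau>)\<^sup>2} \<sigma> \<partial>lborel) *
        indicator {w. w > 0 \<and> gap y z (w\<^sup>2) > 0} (M + m * \<tau>) \<partial>lborel)"
    by (subst nn_integral_real_affine[where c=m and t=M], unfold indicator_def greaterThanLessThan_iff mem_Collect_eq)
      (use m in \<open>simp_all add: if_distrib\<close>)
  also have "(\<integral>\<^sup>+\<tau>. (\<integral>\<^sup>+\<sigma>. h \<sigma> ((M + m * \<tau>)\<^sup>2 - \<sigma>) * \<Psi> \<sigma> ((M + m * \<tau>)\<^sup>2) * indicator {0<..<(M + m * \<tau>)\<^sup>2} \<sigma> \<partial>lborel) *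
        indicator {w. w > 0 \<and> gap y z (w\<^sup>2) > 0} (M + m * \<tau>) \<partial>lborel)
     = (\<integral>\<^sup>+\<tau>. (\<integral>\<^sup>+\<sigma>. (\<integral>\<^sup>+\<psi>. h \<sigma> ((M + m * \<tau>)\<^sup>2 - \<sigma>) * f (post y z \<sigma> ((M + m * \<tau>)\<^sup>2) \<psi>)
            * indicator {0..2*pi} \<psi> \<partial>lborel) * indicator {0<..<(M + m * \<tau>)\<^sup>2} \<sigma> \<partial>lborel)
            * indicator {-1<..<1} \<tau> \<partial>lborel)"
  proof (intro nn_integral_cong arg_cong2[where f="(*)"])
    fix \<tau> :: real
    show "(indicator {w. w > 0 \<and> gap y z (w\<^sup>2) > 0} (M + m * \<tau>) :: ennreal) = indicator {-1<..<1} \<tau>"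
    proof -
      define w where "w = M + m * \<tau>"
      have g: "gap y z (w\<^sup>2) = (w\<^sup>2 - (M - m)\<^sup>2) * ((M + m)\<^sup>2 - w\<^sup>2)"
      proof (cases "y \<le> z")
        case True
        then have "y = m\<^sup>2" "z = M\<^sup>2" using pos by (auto simp: m_def M_def)
        from gap_factor[OF this] show ?thesis by (simp add: power2_commute add.commute)
      next
        case False
        then have "y = M\<^sup>2" "z = m\<^sup>2" using pos by (auto simp: m_def M_def)
        from gap_factor[OF this] show ?thesis by simp
      qed
      have "w > 0 \<and> gap y z (w\<^sup>2) > 0 \<longleftrightarrow> M - m < w \<and> w < M + m"
      proof
        assume a: "M - m < w \<and> w < M + m"
        then have "(M - m)\<^sup>2 < w\<^sup>2" "w\<^sup>2 < (M + m)\<^sup>2" using m by (auto intro!: power_strict_mono)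
        then show "w > 0 \<and> gap y z (w\<^sup>2) > 0" using a m g by auto
      next
        assume a: "w > 0 \<and> gap y z (w\<^sup>2) > 0"
        \<comment> \<open>As in every sign analysis of a product, the case of two negative factors
          has to be ruled out; it would make \<open>M + m\<close> smaller than \<open>M - m\<close>
          in square.\<close>
        have "\<not> (w\<^sup>2 - (M - m)\<^sup>2 < 0 \<and> (M + m)\<^sup>2 - w\<^sup>2 < 0)"
        proof
          assume "w\<^sup>2 - (M - m)\<^sup>2 < 0 \<and> (M + m)\<^sup>2 - w\<^sup>2 < 0"
          then have "(M + m)\<^sup>2 < (M - m)\<^sup>2" by linarith
          moreover have "(M - m)\<^sup>2 \<le> (M + m)\<^sup>2" using m by (intro power_mono) auto
          ultimately show False by simp
        qed
        then have "(M - m)\<^sup>2 < w\<^sup>2" "w\<^sup>2 < (M + m)\<^sup>2"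
          using a unfolding g by (auto simp: zero_less_mult_iff)
        then show "M - m < w \<and> w < M + m" using a m by (auto intro: power2_less_imp_less)
      qed
      also have "\<dots> \<longleftrightarrow> m * (-1) < m * \<tau> \<and> m * \<tau> < m * 1" unfolding w_def by auto
      also have "\<dots> \<longleftrightarrow> -1 < \<tau> \<and> \<tau> < 1" using m by (simp only: mult_less_cancel_left_pos)
      finally show ?thesis by (simp add: w_def indicator_def)
    qed
    show "h \<sigma> ((M + m * \<tau>)\<^sup>2 - \<sigma>) * \<Psi> \<sigma> ((M + m * \<tau>)\<^sup>2)
      = (\<integral>\<^sup>+\<psi>. h \<sigma> ((M + m * \<tau>)\<^sup>2 - \<sigma>) * f (post y z \<sigma> ((M + m * \<tau>)\<^sup>2) \<psi>) * indicator {0..2*pi} \<psi> \<partial>lborel)" for \<sigma>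
      unfolding \<Psi>_def by (subst nn_integral_cmult[symmetric]) (auto simp: mult_ac)
  qed simp_all
  finally show ?thesis .
qed

lemma nn_integral_cos_sign:
  fixes h :: "real \<Rightarrow> ennreal" and a b :: real
  assumes [measurable]: "h \<in> borel_measurable borel"
  shows "(\<integral>\<^sup>+\<theta>. h (a - b * cos \<theta>) * indicator {0..2 * pi} \<theta> \<partial>lborel)
       = (\<integral>\<^sup>+\<theta>. h (a + b * cos \<theta>) * indicator {0..2 * pi} \<theta> \<partial>lborel)"
proof -
  have "h (a + b * cos (pi + - 1 * t)) * indicator {0..pi} (pi + - 1 * t) = h (a - b * cos t) * indicator {0..pi} t" for t
    by (simp add: cos_diff indicator_def conj_commute)
  then have "(\<integral>\<^sup>+\<theta>. h (a + b * cos \<theta>) * indicator {0..pi} \<theta> \<partial>lborel)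
      = (\<integral>\<^sup>+\<theta>. h (a - b * cos \<theta>) * indicator {0..pi} \<theta> \<partial>lborel)"
    by (subst nn_integral_real_affine[where c="-1" and t=pi]) simp_all
  then show ?thesis
    using nn_integral_cos_flip[of h a b] nn_integral_cos_flip[of h a "-b"] by simp
qed

lemma nn_integral_symmetric_half:
  fixes H :: "real \<Rightarrow> ennreal"
  assumes [measurable]: "H \<in> borel_measurable borel"
    and sym: "\<And>\<sigma>. 0 < \<sigma> \<Longrightarrow> \<sigma> < u \<Longrightarrow> H (u - \<sigma>) = H \<sigma>"
  shows "(\<integral>\<^sup>+\<sigma>. H \<sigma> * indicator {0<..<u} \<sigma> \<partial>lborel) = 2 * (\<integral>\<^sup>+\<sigma>. H \<sigma> * indicator {0<..<u/2} \<sigma> \<partial>lborel)"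
proof (cases "u > 0")
  case True
  have "(\<integral>\<^sup>+\<sigma>. H \<sigma> * indicator {0<..<u} \<sigma> \<partial>lborel)
     = (\<integral>\<^sup>+\<sigma>. H \<sigma> * indicator {0<..<u/2} \<sigma> + H \<sigma> * indicator {u/2<..<u} \<sigma> \<partial>lborel)"
  proof (intro nn_integral_cong_AE, rule AE_mp[OF AE_lborel_singleton[of "u/2"]], intro AE_I2 impI)
    fix t :: real assume "t \<noteq> u/2"
    then have "(indicator {0<..<u} t :: ennreal) = indicator {0<..<u/2} t + indicator {u/2<..<u} t"
      using True by (auto simp: indicator_def)
    then show "H t * indicator {0<..<u} t = H t * indicator {0<..<u/2} t + H t * indicator {u/2<..<u} t"
      by (simp only: distrib_left)
  qed
  also have "\<dots> = (\<integral>\<^sup>+\<sigma>. H \<sigma> * indicator {0<..<u/2} \<sigma> \<partial>lborel) + (\<integral>\<^sup>+\<sigma>. H \<sigma> * indicator {u/2<..<u} \<sigma> \<partial>lborel)"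
    by (rule nn_integral_add) measurable
  also have "(\<integral>\<^sup>+\<sigma>. H \<sigma> * indicator {u/2<..<u} \<sigma> \<partial>lborel) = (\<integral>\<^sup>+\<sigma>. H (u + (-1) * \<sigma>) * indicator {u/2<..<u} (u + (-1) * \<sigma>) \<partial>lborel)"
    by (subst nn_integral_real_affine[where c="-1" and t=u]) simp_all
  also have "\<dots> = (\<integral>\<^sup>+\<sigma>. H \<sigma> * indicator {0<..<u/2} \<sigma> \<partial>lborel)"
  proof (intro nn_integral_cong)
    fix t :: real
    show "H (u + (-1) * t) * indicator {u/2<..<u} (u + (-1) * t) = H t * indicator {0<..<u/2} t"
      using sym[of t] True by (cases "0 < t \<and> t < u/2") (auto simp: indicator_def)
  qed
  finally show ?thesis by (simp only: mult_2)
qed simp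

text \<open>The factor 1/2 is dictated by the kernel, which evaluates \<open>p\<close> at
  \<open>sqrt (2 * \<sigma>) / e\<close>; with this substitution that argument is
  \<open>r\<close>.\<close>

lemma nn_integral_half_square_substitution:
  fixes g :: "real \<Rightarrow> ennreal"
  assumes [measurable]: "g \<in> borel_measurable borel" and e: "e > 0"
  shows "(\<integral>\<^sup>+\<sigma>. g \<sigma> * indicator {0<..} \<sigma> \<partial>lborel)
       = (\<integral>\<^sup>+r. ennreal (e\<^sup>2 * r) * g (e\<^sup>2 * r\<^sup>2 / 2) * indicator {0<..} r \<partial>lborel)"
proof -
  define c where "c = e / sqrt 2"
  have c: "c > 0" using e by (simp add: c_def)
  have c2: "c\<^sup>2 = e\<^sup>2 / 2" by (simp add: c_def power_divide)
  have "(\<integral>\<^sup>+\<sigma>. g \<sigma> * indicator {0<..} \<sigma> \<partial>lborel)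
      = (\<integral>\<^sup>+s. ennreal (2 * s) * g (s\<^sup>2) * indicator {0<..} s \<partial>lborel)"
    by (rule nn_integral_square_substitution[symmetric]) simp
  also have "\<dots> = ennreal c * (\<integral>\<^sup>+r. ennreal (2 * (0 + c * r)) * g ((0 + c * r)\<^sup>2) * indicator {0<..} (0 + c * r) \<partial>lborel)"
    by (subst nn_integral_real_affine[where c=c and t=0]) (use c in simp_all)
  also have "\<dots> = (\<integral>\<^sup>+r. ennreal c * (ennreal (2 * (0 + c * r)) * g ((0 + c * r)\<^sup>2) * indicator {0<..} (0 + c * r)) \<partial>lborel)"
    by (rule nn_integral_cmult[symmetric]) simp
  also have "\<dots> = (\<integral>\<^sup>+r. ennreal (e\<^sup>2 * r) * g (e\<^sup>2 * r\<^sup>2 / 2) * indicator {0<..} r \<partial>lborel)"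
  proof (intro nn_integral_cong)
    fix r :: real
    show "ennreal c * (ennreal (2 * (0 + c * r)) * g ((0 + c * r)\<^sup>2) * indicator {0<..} (0 + c * r))
      = ennreal (e\<^sup>2 * r) * g (e\<^sup>2 * r\<^sup>2 / 2) * indicator {0<..} r"
    proof (cases "r > 0")
      case True
      have "ennreal c * ennreal (2 * (c * r)) = ennreal (e\<^sup>2 * r)"
        using c True c2 by (simp add: ennreal_mult[symmetric] power2_eq_square)
      moreover have sq: "(c * r)\<^sup>2 = e\<^sup>2 * r\<^sup>2 / 2" by (simp add: power_mult_distrib c2)
      ultimately show ?thesis using True c by (simp add: sq mult.assoc[symmetric])
    qed (use c in \<open>simp add: zero_less_mult_iff\<close>)
  qed
  finally show ?thesis .
qed

section \<open>Reduced form, measurability and symmetry of \<open>W\<close>\<close>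

lemma ennreal_set_integral_bounded:
  fixes f :: "real \<Rightarrow> real"
  assumes [measurable]: "f \<in> borel_measurable borel" and b: "\<And>x. 0 \<le> f x" "\<And>x. f x \<le> B"
  shows "ennreal (LBINT x:{a..b}. f x) = (\<integral>\<^sup>+x. ennreal (f x) * indicator {a..b} x \<partial>lborel)"
proof -
  have B: "norm (f x) \<le> B" for x using b[of x] by simp
  have "integrable lborel (\<lambda>x. indicator {a..b} x *\<^sub>R f x)"
    by (rule integrableI_bounded_set_indicator[where B=B]) (auto simp: emeasure_lborel_Icc_eq intro!: AE_I2 B[unfolded real_norm_def])
  then show ?thesis
    unfolding set_lebesgue_integral_def
    by (subst nn_integral_eq_integral[symmetric])
      (auto intro!: nn_integral_cong simp: b split: split_indicator)
qed

lemma Y_star_measurable [measurable]: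
  assumes [measurable]: "f1 \<in> borel_measurable M" "f2 \<in> borel_measurable M" "f3 \<in> borel_measurable M"
    "f4 \<in> borel_measurable M" "f5 \<in> borel_measurable M"
  shows "(\<lambda>w. Y_star (f1 w) (f2 w) (f3 w) (f4 w) (f5 w)) \<in> borel_measurable M"
  unfolding Y_star_def by measurable

lemma W_measurable [measurable]:
  fixes f1 f2 f3 :: "'a \<Rightarrow> real"
  assumes P: "case_prod \<Phi> \<in> borel_measurable (borel \<Otimes>\<^sub>M borel)"
    and [measurable]: "f1 \<in> borel_measurable M" "f2 \<in> borel_measurable M" "f3 \<in> borel_measurable M"
  shows "(\<lambda>w. W \<Phi> (f1 w) (f2 w) (f3 w)) \<in> borel_measurable M"
proof -
  have [measurable]: "(\<lambda>w. \<Phi> (g1 w) (g2 w)) \<in> borel_measurable N"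
    if [measurable]: "g1 \<in> borel_measurable N" "g2 \<in> borel_measurable N" for g1 g2 and N :: "'c measure"
    using measurable_compose[OF _ P, of "\<lambda>w. (g1 w, g2 w)" N] by simp
  show ?thesis
    unfolding W_def Let_def set_lebesgue_integral_def x_star_def indicator_def atLeastAtMost_iff
    by measurable
qed

lemma Y_star_nonneg: "Y_star x y z s \<theta> \<ge> 0"
  by (simp add: Y_star_def)

text \<open>The kernel reads \<open>\<Phi>\<close> only at nonnegative arguments. This permits
  replacing \<open>phihat\<close>, which is arbitrary on the negative axis, by the measurable
  function \<open>phihat (max 0 r)\<close>.\<close>

lemma W_cong:
  assumes "\<And>r \<rho>. 0 \<le> r \<Longrightarrow> 0 \<le> \<rho> \<Longrightarrow> \<Phi> r \<rho> = \<Phi>' r \<rho>"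
  shows "W \<Phi> x y z = W \<Phi>' x y z"
proof -
  have 1: "(LBINT s:{max \<bar>a\<bar> b..c}. (LBINT \<theta>:{0..2 * pi}. \<Phi> (sqrt 2 * s) (sqrt 2 * Y_star x y z s \<theta>)))
     = (LBINT s:{max \<bar>a\<bar> b..c}. (LBINT \<theta>:{0..2 * pi}. \<Phi>' (sqrt 2 * s) (sqrt 2 * Y_star x y z s \<theta>)))" for a b c :: real
    using assms by (intro set_lebesgue_integral_cong ballI allI impI) (auto intro!: assms mult_nonneg_nonneg Y_star_nonneg intro: order_trans[OF abs_ge_zero])
  show ?thesis unfolding W_def Let_def 1 using assms by simp
qed

lemma W_nonneg:
  assumes "\<And>r \<rho>. 0 \<le> \<Phi> r \<rho>"
  shows "0 \<le> W \<Phi> x y z"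
  unfolding W_def Let_def set_lebesgue_integral_def using assms
  by (auto intro!: mult_nonneg_nonneg divide_nonneg_nonneg Bochner_Integration.integral_nonneg)

text \<open>The bound \<open>B\<close> makes the nested Bochner integrals in \<open>W\<close>
  finite, so that they coincide with nonnegative integrals and \<open>nn_integral_s_theta\<close>
  becomes applicable.\<close>

lemma ennreal_W_interior:
  fixes \<Phi> :: "real \<Rightarrow> real \<Rightarrow> real"
  assumes P: "case_prod \<Phi> \<in> borel_measurable (borel \<Otimes>\<^sub>M borel)"
    and b: "\<And>r \<rho>. 0 \<le> \<Phi> r \<rho>" "\<And>r \<rho>. \<Phi> r \<rho> \<le> B"
    and pos: "x > 0" "y > 0" "z > 0" "x < y + z"
  shows "ennreal (W \<Phi> x y z) = ennreal (4 * pi / sqrt (x * y * z)) *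
    (\<integral>\<^sup>+\<sigma>. \<integral>\<^sup>+\<pi>. ennreal (\<Phi> (sqrt (2 * \<sigma>)) (sqrt (2 * \<pi>))) * ennreal (gram_density x y z \<sigma> \<pi>) \<partial>lborel \<partial>lborel)"
proof -
  have Pm[measurable]: "(\<lambda>w. \<Phi> (g1 w) (g2 w)) \<in> borel_measurable N"
    if [measurable]: "g1 \<in> borel_measurable N" "g2 \<in> borel_measurable N" for g1 g2 and N :: "'c measure"
    using measurable_compose[OF _ P, of "\<lambda>w. (g1 w, g2 w)" N] by simp
  define I where "I s = (LBINT \<theta>:{0..2 * pi}. \<Phi> (sqrt 2 * s) (sqrt 2 * Y_star x y z s \<theta>))" for s
  have I: "ennreal (I s) = (\<integral>\<^sup>+\<theta>. ennreal (\<Phi> (sqrt 2 * s) (sqrt 2 * Y_star x y z s \<theta>)) * indicator {0..2*pi} \<theta> \<partial>lborel)" for s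
    unfolding I_def by (rule ennreal_set_integral_bounded[where B=B]) (auto simp: b)
  have I0: "0 \<le> I s" for s
    unfolding I_def set_lebesgue_integral_def by (intro Bochner_Integration.integral_nonneg) (auto simp: b)
  have B0: "B \<ge> 0" using b[of 0 0] by linarith
  have "ennreal (I s) \<le> (\<integral>\<^sup>+\<theta>. ennreal B * indicator {0..2*pi} \<theta> \<partial>lborel)" for s
    unfolding I by (intro nn_integral_mono) (auto split: split_indicator simp: b intro!: ennreal_leI)
  also have "\<dots> = ennreal (B * (2 * pi))"
    by (simp add: nn_integral_cmult_indicator ennreal_mult' B0)
  finally have IB: "I s \<le> B * (2 * pi)" for s using B0 by (simp add: ennreal_le_iff)
  have Im[measurable]: "I \<in> borel_measurable borel"
    unfolding I_def set_lebesgue_integral_def by measurable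
  have xs: "x_star x y z > 0" using pos by (simp add: x_star_def)
  have "W \<Phi> x y z = 4 * pi / sqrt (x * y * z) * (LBINT s:{s_low x y z..s_high x y z}. I s)"
    using pos xs by (simp add: W_def Let_def I_def s_low_def s_high_def)
  moreover have "0 \<le> 4 * pi / sqrt (x * y * z)" using pos by simp
  ultimately have "ennreal (W \<Phi> x y z) = ennreal (4 * pi / sqrt (x * y * z)) * ennreal (LBINT s:{s_low x y z..s_high x y z}. I s)"
    by (simp only: ennreal_mult')
  also have "ennreal (LBINT s:{s_low x y z..s_high x y z}. I s) = (\<integral>\<^sup>+s. ennreal (I s) * indicator {s_low x y z..s_high x y z} s \<partial>lborel)"
    by (rule ennreal_set_integral_bounded[where B="B * (2 * pi)"]) (auto simp: I0 IB)
  also have "\<dots> = (\<integral>\<^sup>+s. (\<integral>\<^sup>+\<theta>. ennreal (\<Phi> (sqrt (2 * s\<^sup>2)) (sqrt (2 * (Y_star x y z s \<theta>)\<^sup>2))) * indicator {0..2 * pi} \<theta> \<partial>lborel)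
             * indicator {s_low x y z..s_high x y z} s \<partial>lborel)"
  proof (intro nn_integral_cong)
    fix s :: real
    have "s \<ge> 0" if "s \<in> {s_low x y z..s_high x y z}" using that by (auto simp: s_low_def)
    then show "ennreal (I s) * indicator {s_low x y z..s_high x y z} s = (\<integral>\<^sup>+\<theta>. ennreal (\<Phi> (sqrt (2 * s\<^sup>2)) (sqrt (2 * (Y_star x y z s \<theta>)\<^sup>2))) * indicator {0..2 * pi} \<theta> \<partial>lborel)
             * indicator {s_low x y z..s_high x y z} s"
      unfolding I by (auto split: split_indicator simp: real_sqrt_mult Y_star_nonneg)
  qed
  also have "\<dots> = (\<integral>\<^sup>+\<sigma>. \<integral>\<^sup>+\<pi>. ennreal (\<Phi> (sqrt (2 * \<sigma>)) (sqrt (2 * \<pi>))) * ennreal (gram_density x y z \<sigma> \<pi>) \<partial>lborel \<partial>lborel)"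
    using nn_integral_s_theta[of "\<lambda>\<sigma> \<pi>. ennreal (\<Phi> (sqrt (2 * \<sigma>)) (sqrt (2 * \<pi>)))", OF _ pos] by simp
  finally show ?thesis .
qed

text \<open>In the interior this is the exchange invariance of \<open>gram_density\<close>; on the
  boundary the cases \<open>y = 0\<close> and \<open>z = 0\<close> in the definition of
  \<open>W\<close> are interchanged.\<close>

lemma W_swap_last:
  fixes \<Phi> :: "real \<Rightarrow> real \<Rightarrow> real"
  assumes P[measurable]: "case_prod \<Phi> \<in> borel_measurable (borel \<Otimes>\<^sub>M borel)"
    and b: "\<And>r \<rho>. 0 \<le> \<Phi> r \<rho>" "\<And>r \<rho>. \<Phi> r \<rho> \<le> B"
    and nn: "x \<ge> 0" "y \<ge> 0" "z \<ge> 0"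
  shows "W (\<lambda>r \<rho>. \<Phi> \<rho> r) x y z = W \<Phi> x z y"
proof (cases "x > 0 \<and> y > 0 \<and> z > 0 \<and> x < y + z")
  case True
  have Pm[measurable]: "(\<lambda>w. \<Phi> (g1 w) (g2 w)) \<in> borel_measurable N"
    if [measurable]: "g1 \<in> borel_measurable N" "g2 \<in> borel_measurable N" for g1 g2 and N :: "'c measure"
    using measurable_compose[OF _ P, of "\<lambda>w. (g1 w, g2 w)" N] by simp
  have "ennreal (W (\<lambda>r \<rho>. \<Phi> \<rho> r) x y z) = ennreal (4 * pi / sqrt (x * y * z)) *
    (\<integral>\<^sup>+\<sigma>. \<integral>\<^sup>+\<pi>. ennreal (\<Phi> (sqrt (2 * \<pi>)) (sqrt (2 * \<sigma>))) * ennreal (gram_density x y z \<sigma> \<pi>) \<partial>lborel \<partial>lborel)"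
    using True b by (intro ennreal_W_interior[where B=B]) auto
  also have "\<dots> = ennreal (4 * pi / sqrt (x * z * y)) *
    (\<integral>\<^sup>+\<pi>. \<integral>\<^sup>+\<sigma>. ennreal (\<Phi> (sqrt (2 * \<pi>)) (sqrt (2 * \<sigma>))) * ennreal (gram_density x z y \<pi> \<sigma>) \<partial>lborel \<partial>lborel)"
    by (subst lborel_pair.Fubini') (simp_all add: gram_density_swap[of x y z] mult_ac)
  also have "\<dots> = ennreal (W \<Phi> x z y)"
    using True b by (intro ennreal_W_interior[symmetric, where B=B]) auto
  finally show ?thesis by (simp add: W_nonneg b)
next
  case False
  have xs: "x_star x z y = x_star x y z" by (simp add: x_star_def add.commute)
  show ?thesis
    using False nn unfolding W_def Let_def xs by (auto simp: x_star_def mult.commute)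
qed

subsection \<open>Integrating the kernel\<close>

lemma nn_integral_unit_interval_const:
  "(\<integral>\<^sup>+\<tau>. c * indicator {-1<..<1::real} \<tau> \<partial>lborel) = 2 * c"
  by (simp add: nn_integral_cmult_indicator mult.commute)

text \<open>With one incoming energy zero, \<open>x\<close> itself determines the transfer:
  \<open>\<sigma> = x\<close> if \<open>y = 0\<close>, and \<open>\<sigma> = v - x\<close> if
  \<open>z = 0\<close>. In both cases \<open>x = y + \<sigma> / v * (z - y)\<close>, which is
  \<open>post\<close> at \<open>gap = 0\<close>.\<close>

lemma nn_integral_W_degenerate:
  fixes \<Phi> :: "real \<Rightarrow> real \<Rightarrow> real" and f :: "real \<Rightarrow> ennreal"
  assumes P: "case_prod \<Phi> \<in> borel_measurable (borel \<Otimes>\<^sub>M borel)"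
    and b: "\<And>r \<rho>. 0 \<le> \<Phi> r \<rho>"
    and [measurable]: "f \<in> borel_measurable borel"
    and yz: "y = 0 \<and> z = v \<or> z = 0 \<and> y = v" "v > 0"
  shows "(\<integral>\<^sup>+x. ennreal (W \<Phi> x y z * sqrt x) * f x * indicator {0<..<y+z} x \<partial>lborel)
       = ennreal ((4 * pi)\<^sup>2 / sqrt v) * (\<integral>\<^sup>+\<sigma>. ennreal (\<Phi> (sqrt (2 * \<sigma>)) (sqrt (2 * (v - \<sigma>)))) *
           f (y + \<sigma> / v * (z - y)) * indicator {0<..<v} \<sigma> \<partial>lborel)"
proof -
  have Pm[measurable]: "(\<lambda>w. \<Phi> (g1 w) (g2 w)) \<in> borel_measurable N"
    if [measurable]: "g1 \<in> borel_measurable N" "g2 \<in> borel_measurable N" for g1 g2 and N :: "'c measure"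
    using measurable_compose[OF _ P, of "\<lambda>w. (g1 w, g2 w)" N] by simp
  from yz(1) show ?thesis
  proof
    assume y: "y = 0 \<and> z = v"
    have "W \<Phi> x y z * sqrt x = (4 * pi)\<^sup>2 / sqrt v * \<Phi> (sqrt (2 * x)) (sqrt (2 * (v - x)))" if "x \<in> {0<..<v}" for x
      using that y by (simp add: W_def Let_def real_sqrt_mult)
    then have E: "ennreal (W \<Phi> x y z * sqrt x) = ennreal ((4 * pi)\<^sup>2 / sqrt v) * ennreal (\<Phi> (sqrt (2 * x)) (sqrt (2 * (v - x))))" if "x \<in> {0<..<v}" for x
      using that yz(2) by (simp only:, intro ennreal_mult) (auto simp: b)
    then have "ennreal (W \<Phi> x y z * sqrt x) * f x * indicator {0<..<y+z} x
      = ennreal ((4 * pi)\<^sup>2 / sqrt v) * (ennreal (\<Phi> (sqrt (2 * x)) (sqrt (2 * (v - x)))) * f (y + x / v * (z - y)) * indicator {0<..<v} x)" for x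
      using y yz(2) by (cases "x \<in> {0<..<v}") (simp_all add: E mult_ac)
    then show ?thesis by (simp add: nn_integral_cmult)
  next
    assume y: "z = 0 \<and> y = v"
    have "W \<Phi> x y z * sqrt x = (4 * pi)\<^sup>2 / sqrt v * \<Phi> (sqrt (2 * (v - x))) (sqrt (2 * x))" if "x \<in> {0<..<v}" for x
      using that y by (simp add: W_def Let_def real_sqrt_mult)
    then have E: "ennreal (W \<Phi> x y z * sqrt x) = ennreal ((4 * pi)\<^sup>2 / sqrt v) * ennreal (\<Phi> (sqrt (2 * (v - x))) (sqrt (2 * x)))" if "x \<in> {0<..<v}" for x
      using that yz(2) by (simp only:, intro ennreal_mult) (auto simp: b)
    then have e: "ennreal (W \<Phi> x y z * sqrt x) * f x * indicator {0<..<y+z} x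
      = ennreal ((4 * pi)\<^sup>2 / sqrt v) * (ennreal (\<Phi> (sqrt (2 * (v - x))) (sqrt (2 * x))) * f x * indicator {0<..<v} x)" for x
      using y yz(2) by (cases "x \<in> {0<..<v}") (simp_all add: E mult_ac)
    have "(\<integral>\<^sup>+x. ennreal (\<Phi> (sqrt (2 * (v - x))) (sqrt (2 * x))) * f x * indicator {0<..<v} x \<partial>lborel)
      = (\<integral>\<^sup>+\<sigma>. ennreal (\<Phi> (sqrt (2 * (v - (v + (-1) * \<sigma>)))) (sqrt (2 * (v + (-1) * \<sigma>)))) * f (v + (-1) * \<sigma>) * indicator {0<..<v} (v + (-1) * \<sigma>) \<partial>lborel)"
      by (subst nn_integral_real_affine[where c="-1" and t=v]) simp_all
    also have "\<dots> = (\<integral>\<^sup>+\<sigma>. ennreal (\<Phi> (sqrt (2 * \<sigma>)) (sqrt (2 * (v - \<sigma>)))) *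
           f (y + \<sigma> / v * (z - y)) * indicator {0<..<v} \<sigma> \<partial>lborel)"
      using y yz(2) by (intro nn_integral_cong) (auto split: split_indicator)
    finally show ?thesis unfolding e by (simp add: nn_integral_cmult)
  qed
qed

lemma nn_integral_W:
  fixes \<Phi> :: "real \<Rightarrow> real \<Rightarrow> real" and f :: "real \<Rightarrow> ennreal"
  assumes P: "case_prod \<Phi> \<in> borel_measurable (borel \<Otimes>\<^sub>M borel)"
    and b: "\<And>r \<rho>. 0 \<le> \<Phi> r \<rho>" "\<And>r \<rho>. \<Phi> r \<rho> \<le> B"
    and f[measurable]: "f \<in> borel_measurable borel"
    and pos: "y \<ge> 0" "z \<ge> 0" "y + z > 0"
  defines "M \<equiv> sqrt (max y z)" and "m \<equiv> sqrt (min y z)"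
  shows "(\<integral>\<^sup>+x. ennreal (W \<Phi> x y z * sqrt x) * f x * indicator {0<..<y+z} x \<partial>lborel)
       = ennreal (4 * pi / M) * (\<integral>\<^sup>+\<tau>. (\<integral>\<^sup>+\<sigma>. (\<integral>\<^sup>+\<psi>. ennreal (\<Phi> (sqrt (2 * \<sigma>)) (sqrt (2 * ((M + m * \<tau>)\<^sup>2 - \<sigma>)))) * f (post y z \<sigma> ((M + m * \<tau>)\<^sup>2) \<psi>)
            * indicator {0..2*pi} \<psi> \<partial>lborel) * indicator {0<..<(M + m * \<tau>)\<^sup>2} \<sigma> \<partial>lborel)
            * indicator {-1<..<1} \<tau> \<partial>lborel)" (is "?L = _ * ?R")
proof -
  have Pm[measurable]: "(\<lambda>w. \<Phi> (g1 w) (g2 w)) \<in> borel_measurable N"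
    if [measurable]: "g1 \<in> borel_measurable N" "g2 \<in> borel_measurable N" for g1 g2 and N :: "'c measure"
    using measurable_compose[OF _ P, of "\<lambda>w. (g1 w, g2 w)" N] by simp
  show ?thesis
  proof (cases "y > 0 \<and> z > 0")
    case True
    then have yz: "y > 0" "z > 0" by auto
    define G where "G x = (\<integral>\<^sup>+\<sigma>. \<integral>\<^sup>+\<pi>. ennreal (\<Phi> (sqrt (2 * \<sigma>)) (sqrt (2 * \<pi>))) * ennreal (gram_density x y z \<sigma> \<pi>) \<partial>lborel \<partial>lborel)" for x
    have [measurable]: "G \<in> borel_measurable borel" unfolding G_def by measurable
    have e: "ennreal (W \<Phi> x y z * sqrt x) * f x * indicator {0<..<y+z} x = ennreal (4 * pi / sqrt (y * z)) * (G x * f x)" for x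
    proof (cases "x \<in> {0<..<y+z}")
      case True
      then have "ennreal (W \<Phi> x y z * sqrt x) = ennreal (4 * pi / sqrt (x * y * z)) * ennreal (sqrt x) * G x"
        using ennreal_W_interior[OF P b, of x y z] yz
        by (simp add: G_def ennreal_mult W_nonneg b mult_ac)
      also have "ennreal (4 * pi / sqrt (x * y * z)) * ennreal (sqrt x) = ennreal (4 * pi / sqrt (y * z))"
        using True yz by (subst ennreal_mult[symmetric]) (auto simp: real_sqrt_mult)
      finally show ?thesis using True by (simp add: mult_ac)
    next
      case False
      then have "gram_density x y z \<sigma> \<pi> = 0" for \<sigma> \<pi> using gram_density_support by fastforce
      then show ?thesis using False by (simp add: G_def)
    qed
    have Mm: "M > 0" "m > 0" "sqrt (y * z) = M * m"
      using yz by (auto simp: M_def m_def real_sqrt_mult max_def min_def)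
    have "?L = ennreal (4 * pi / sqrt (y * z)) * (\<integral>\<^sup>+x. G x * f x \<partial>lborel)"
      unfolding e by (rule nn_integral_cmult) simp
    also have "(\<integral>\<^sup>+x. G x * f x \<partial>lborel) = ennreal m * ?R"
      unfolding G_def M_def m_def
      using nn_integral_collision[of "\<lambda>\<sigma> \<pi>. ennreal (\<Phi> (sqrt (2 * \<sigma>)) (sqrt (2 * \<pi>)))" f y z] yz by simp
    also have "ennreal (4 * pi / sqrt (y * z)) * (ennreal m * ?R) = ennreal (4 * pi / M) * ?R"
      unfolding mult.assoc[symmetric] using Mm by (subst ennreal_mult[symmetric]) auto
    finally show ?thesis .
  next
    case False
    define v where "v = y + z"
    have v: "v > 0" "y = 0 \<and> z = v \<or> z = 0 \<and> y = v" "m = 0" "M = sqrt v"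
      using False pos by (auto simp: v_def m_def M_def max_def min_def)
    have M2: "(M + m * \<tau>)\<^sup>2 = v" for \<tau> using v by simp
    have gap: "gap y z v = 0" using v(2) by (auto simp: gap_def)
    have p: "post y z \<sigma> v \<psi> = y + \<sigma> / v * (z - y)" for \<sigma> \<psi> by (simp add: post_def gap)
    define g where "g \<sigma> = ennreal (\<Phi> (sqrt (2 * \<sigma>)) (sqrt (2 * (v - \<sigma>)))) * f (y + \<sigma> / v * (z - y))" for \<sigma>
    have [measurable]: "g \<in> borel_measurable borel" unfolding g_def by measurable
    have "?R = (\<integral>\<^sup>+\<tau>. (\<integral>\<^sup>+\<sigma>. (\<integral>\<^sup>+\<psi>. g \<sigma> * indicator {0..2*pi} \<psi> \<partial>lborel) * indicator {0<..<v} \<sigma> \<partial>lborel) * indicator {-1<..<1::real} \<tau> \<partial>lborel)"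
      unfolding M2 p g_def ..
    also have "\<dots> = 2 * (ennreal (2 * pi) * (\<integral>\<^sup>+\<sigma>. g \<sigma> * indicator {0<..<v} \<sigma> \<partial>lborel))"
      by (simp add: nn_integral_unit_interval_const nn_integral_cmult_indicator)
        (simp add: nn_integral_cmult[symmetric] mult_ac)
    finally have R: "?R = 2 * (ennreal (2 * pi) * (\<integral>\<^sup>+\<sigma>. g \<sigma> * indicator {0<..<v} \<sigma> \<partial>lborel))" .
    \<comment> \<open>The boundary constant of \<open>W\<close> is the interior one times the length
      2 of the \<open>\<tau>\<close>-interval and the full angle \<open>2 * pi\<close>. This is what
      lets a single formula cover both cases.\<close>
    have "ennreal ((4 * pi)\<^sup>2 / sqrt v) = ennreal (4 * pi / M * (2 * (2 * pi)))"
      using v by (simp add: power2_eq_square)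
    also have "\<dots> = ennreal (4 * pi / M) * (2 * ennreal (2 * pi))"
      using v by (subst ennreal_mult) (auto simp: ennreal_mult)
    finally show ?thesis
      unfolding R using nn_integral_W_degenerate[OF P b(1) f v(2,1)] by (simp add: g_def mult.assoc)
  qed
qed

text \<open>The kernel after the substitution \<open>\<sigma> = \<epsilon>\<^sup>2 r\<^sup>2 / 2\<close>, where \<open>w\<close> is the relative speed; the symmetry
  \<open>\<sigma> \<leftrightarrow> w\<^sup>2 - \<sigma>\<close> has been used to keep only \<open>\<sigma> < w\<^sup>2 / 2\<close>, i.e. small transferred energies.\<close>

definition grazing_weight :: "(real \<Rightarrow> real) \<Rightarrow> real \<Rightarrow> real \<Rightarrow> real \<Rightarrow> real" where
  "grazing_weight p e w r =
     (if 0 < r \<and> e * r < w then r / e\<^sup>2 * (p r + p (sqrt (2 * w\<^sup>2 / e\<^sup>2 - r\<^sup>2)))\<^sup>2 else 0)"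

lemma grazing_weight_nonneg: "grazing_weight p e w r \<ge> 0"
  by (simp add: grazing_weight_def)

lemma grazing_weight_measurable [measurable]:
  assumes [measurable]: "p \<in> borel_measurable borel" "g1 \<in> borel_measurable N" "g2 \<in> borel_measurable N"
  shows "(\<lambda>w. grazing_weight p e (g1 w) (g2 w)) \<in> borel_measurable N"
  unfolding grazing_weight_def by measurable

lemma Phi_measurable [measurable]:
  assumes [measurable]: "p \<in> borel_measurable borel"
  shows "case_prod (Phi p e l) \<in> borel_measurable (borel \<Otimes>\<^sub>M borel)"
  unfolding Phi_def by measurable

lemma Phi_nonneg: "0 \<le> Phi p e l r \<rho>"
  by (simp add: Phi_def)

lemma Phi_le:
  assumes "\<And>r. \<bar>p r\<bar> \<le> c"
  shows "Phi p e 1 r \<rho> \<le> (2 * c)\<^sup>2 / e ^ 4"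
proof -
  have "\<bar>p (r / e) + p (\<rho> / e)\<bar> \<le> 2 * c" using assms[of "r/e"] assms[of "\<rho>/e"] by linarith
  then have "(p (r / e) + p (\<rho> / e))\<^sup>2 \<le> (2 * c)\<^sup>2" by (rule abs_le_square_iff[THEN iffD1, OF order_trans]) simp
  then show ?thesis by (simp add: Phi_def divide_right_mono)
qed

text \<open>By \<open>sym\<close> and \<open>supp\<close>, \<open>f\<close> is invariant on the
  whole line under reflection of \<open>x\<close> to \<open>y + z - x\<close>. Exchanging
  \<open>\<sigma>\<close> with \<open>w\<^sup>2 - \<sigma>\<close> reflects \<open>post\<close> in
  this way, up to the sign of the cosine, and leaves \<open>Phi p e 1\<close> unchanged, since its
  two arguments enter symmetrically. Half of the range therefore suffices, and \<open>4 * pi\<close>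
  becomes \<open>8 * pi\<close>.\<close>

lemma nn_integral_W_Phi:
  fixes p :: "real \<Rightarrow> real" and f :: "real \<Rightarrow> ennreal"
  assumes [measurable]: "p \<in> borel_measurable borel"
    and c: "\<And>r. \<bar>p r\<bar> \<le> c"
    and f[measurable]: "f \<in> borel_measurable borel"
    and sym: "\<And>x. 0 < x \<Longrightarrow> x < y + z \<Longrightarrow> f (y + z - x) = f x"
    and supp: "\<And>x. x \<le> 0 \<or> y + z \<le> x \<Longrightarrow> f x = f 0"
    and pos: "y \<ge> 0" "z \<ge> 0" "y + z > 0" and e: "e > 0"
  defines "M \<equiv> sqrt (max y z)" and "m \<equiv> sqrt (min y z)"
  shows "(\<integral>\<^sup>+x. ennreal (W (Phi p e 1) x y z * sqrt x) * f x * indicator {0<..<y+z} x \<partial>lborel)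
       = ennreal (8 * pi / M) * (\<integral>\<^sup>+\<tau>. (\<integral>\<^sup>+r. ennreal (grazing_weight p e (M + m * \<tau>) r) *
            (\<integral>\<^sup>+\<psi>. f (post y z (e\<^sup>2 * r\<^sup>2 / 2) ((M + m * \<tau>)\<^sup>2) \<psi>) * indicator {0..2*pi} \<psi> \<partial>lborel) \<partial>lborel)
            * indicator {-1<..<1} \<tau> \<partial>lborel)"
proof -
  have M: "M > 0" "0 \<le> m" "m \<le> M" using pos by (auto simp: M_def m_def max_def min_def)
  have sym': "f (y + z - x) = f x" for x
    using sym[of x] supp[of x] supp[of "y + z - x"] by (cases "0 < x \<and> x < y + z") auto
  define h where "h \<sigma> \<pi> = ennreal (Phi p e 1 (sqrt (2 * \<sigma>)) (sqrt (2 * \<pi>)))" for \<sigma> \<pi>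
  have hm[measurable]: "(\<lambda>w. h (g1 w) (g2 w)) \<in> borel_measurable N"
    if [measurable]: "g1 \<in> borel_measurable N" "g2 \<in> borel_measurable N" for g1 g2 and N :: "'c measure"
    unfolding h_def Phi_def by measurable
  have inner: "(\<integral>\<^sup>+\<sigma>. (\<integral>\<^sup>+\<psi>. h \<sigma> (w\<^sup>2 - \<sigma>) * f (post y z \<sigma> (w\<^sup>2) \<psi>)
            * indicator {0..2*pi} \<psi> \<partial>lborel) * indicator {0<..<w\<^sup>2} \<sigma> \<partial>lborel)
     = 2 * (\<integral>\<^sup>+r. ennreal (grazing_weight p e w r) *
            (\<integral>\<^sup>+\<psi>. f (post y z (e\<^sup>2 * r\<^sup>2 / 2) (w\<^sup>2) \<psi>) * indicator {0..2*pi} \<psi> \<partial>lborel) \<partial>lborel)" if w: "w > 0" for w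
  proof -
    define A where "A \<sigma> = (\<integral>\<^sup>+\<psi>. f (post y z \<sigma> (w\<^sup>2) \<psi>) * indicator {0..2*pi} \<psi> \<partial>lborel)" for \<sigma>
    have [measurable]: "A \<in> borel_measurable borel" unfolding A_def by measurable
    have Asym: "A (w\<^sup>2 - \<sigma>) = A \<sigma>" for \<sigma>
    proof -
      define c R where "c = y + \<sigma> / w\<^sup>2 * (z - y)" and "R = sqrt (\<sigma> * (w\<^sup>2 - \<sigma>) * gap y z (w\<^sup>2)) / w\<^sup>2"
      have 1: "post y z \<sigma> (w\<^sup>2) \<psi> = c + R * cos \<psi>" for \<psi> by (simp add: post_def c_def R_def)
      have 2: "post y z (w\<^sup>2 - \<sigma>) (w\<^sup>2) \<psi> = y + z - (c - R * cos \<psi>)" for \<psi>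
      proof -
        define k where "k = \<sigma> / w\<^sup>2"
        have d: "(w\<^sup>2 - \<sigma>) / w\<^sup>2 = 1 - k" using w by (simp add: k_def diff_divide_distrib)
        have s: "(w\<^sup>2 - \<sigma>) * (w\<^sup>2 - (w\<^sup>2 - \<sigma>)) = \<sigma> * (w\<^sup>2 - \<sigma>)" by simp
        show ?thesis unfolding post_def d s c_def R_def k_def[symmetric] by (simp add: algebra_simps)
      qed
      show ?thesis unfolding A_def 1 2 sym' by (rule nn_integral_cos_sign) simp
    qed
    have "(\<integral>\<^sup>+\<sigma>. (\<integral>\<^sup>+\<psi>. h \<sigma> (w\<^sup>2 - \<sigma>) * f (post y z \<sigma> (w\<^sup>2) \<psi>)
            * indicator {0..2*pi} \<psi> \<partial>lborel) * indicator {0<..<w\<^sup>2} \<sigma> \<partial>lborel)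
       = (\<integral>\<^sup>+\<sigma>. h \<sigma> (w\<^sup>2 - \<sigma>) * A \<sigma> * indicator {0<..<w\<^sup>2} \<sigma> \<partial>lborel)"
      unfolding A_def by (simp add: nn_integral_cmult mult.assoc)
    also have "\<dots> = 2 * (\<integral>\<^sup>+\<sigma>. h \<sigma> (w\<^sup>2 - \<sigma>) * A \<sigma> * indicator {0<..<w\<^sup>2/2} \<sigma> \<partial>lborel)"
      by (rule nn_integral_symmetric_half) (auto simp: Asym h_def Phi_def add.commute)
    also have "(\<integral>\<^sup>+\<sigma>. h \<sigma> (w\<^sup>2 - \<sigma>) * A \<sigma> * indicator {0<..<w\<^sup>2/2} \<sigma> \<partial>lborel)
       = (\<integral>\<^sup>+\<sigma>. (h \<sigma> (w\<^sup>2 - \<sigma>) * A \<sigma> * indicator {..<w\<^sup>2/2} \<sigma>) * indicator {0<..} \<sigma> \<partial>lborel)"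
      by (intro nn_integral_cong) (auto split: split_indicator)
    also have "\<dots> = (\<integral>\<^sup>+r. ennreal (e\<^sup>2 * r) * (h (e\<^sup>2 * r\<^sup>2 / 2) (w\<^sup>2 - (e\<^sup>2 * r\<^sup>2 / 2)) * A (e\<^sup>2 * r\<^sup>2 / 2) * indicator {..<w\<^sup>2/2} (e\<^sup>2 * r\<^sup>2 / 2)) * indicator {0<..} r \<partial>lborel)"
      by (rule nn_integral_half_square_substitution[OF _ e]) measurable
    also have "\<dots> = (\<integral>\<^sup>+r. ennreal (grazing_weight p e w r) * A (e\<^sup>2 * r\<^sup>2 / 2) \<partial>lborel)"
    proof (intro nn_integral_cong)
      fix r :: real
      have iff: "e\<^sup>2 * r\<^sup>2 / 2 < w\<^sup>2 / 2 \<longleftrightarrow> e * r < w" if "r > 0"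
      proof -
        have "e\<^sup>2 * r\<^sup>2 / 2 < w\<^sup>2 / 2 \<longleftrightarrow> (e * r)\<^sup>2 < w\<^sup>2" by (simp add: power_mult_distrib)
        also have "\<dots> \<longleftrightarrow> e * r < w" using that e w by (intro iffI) (auto intro: power2_less_imp_less power_strict_mono)
        finally show ?thesis .
      qed
      have "ennreal (e\<^sup>2 * r) * h (e\<^sup>2 * r\<^sup>2 / 2) (w\<^sup>2 - (e\<^sup>2 * r\<^sup>2 / 2)) = ennreal (grazing_weight p e w r)"
        if r: "r > 0" "e * r < w"
      proof -
        have 1: "sqrt (2 * (e\<^sup>2 * r\<^sup>2 / 2)) / e = r" using e r by (simp add: real_sqrt_mult)
        have "2 * w\<^sup>2 / e\<^sup>2 - r\<^sup>2 = (2 * (w\<^sup>2 - (e\<^sup>2 * r\<^sup>2 / 2))) / e\<^sup>2" using e by (simp add: field_simps)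
        then have 2: "sqrt (2 * (w\<^sup>2 - (e\<^sup>2 * r\<^sup>2 / 2))) / e = sqrt (2 * w\<^sup>2 / e\<^sup>2 - r\<^sup>2)"
          using e by (simp add: real_sqrt_divide)
        have 3: "e\<^sup>2 * r * ((p r + p (sqrt (2 * w\<^sup>2 / e\<^sup>2 - r\<^sup>2)))\<^sup>2 / e ^ 4) = grazing_weight p e w r"
          using e r by (simp add: grazing_weight_def power2_eq_square power4_eq_xxxx)
        show ?thesis
          unfolding h_def Phi_def 1 2 mult_1 using e r by (subst ennreal_mult[symmetric]) (simp_all add: 3 del: times_divide_eq_right)
      qed
      then show "ennreal (e\<^sup>2 * r) * (h (e\<^sup>2 * r\<^sup>2 / 2) (w\<^sup>2 - (e\<^sup>2 * r\<^sup>2 / 2)) * A (e\<^sup>2 * r\<^sup>2 / 2) * indicator {..<w\<^sup>2/2} (e\<^sup>2 * r\<^sup>2 / 2)) * indicator {0<..} r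
        = ennreal (grazing_weight p e w r) * A (e\<^sup>2 * r\<^sup>2 / 2)"
        using iff by (cases "r > 0"; cases "e * r < w") (simp_all add: grazing_weight_def mult.assoc[symmetric])
    qed
    finally show ?thesis unfolding A_def .
  qed
  have "(\<integral>\<^sup>+x. ennreal (W (Phi p e 1) x y z * sqrt x) * f x * indicator {0<..<y+z} x \<partial>lborel)
     = ennreal (4 * pi / M) * (\<integral>\<^sup>+\<tau>. (\<integral>\<^sup>+\<sigma>. (\<integral>\<^sup>+\<psi>. h \<sigma> ((M + m * \<tau>)\<^sup>2 - \<sigma>) * f (post y z \<sigma> ((M + m * \<tau>)\<^sup>2) \<psi>)
            * indicator {0..2*pi} \<psi> \<partial>lborel) * indicator {0<..<(M + m * \<tau>)\<^sup>2} \<sigma> \<partial>lborel)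
            * indicator {-1<..<1} \<tau> \<partial>lborel)"
    unfolding M_def m_def h_def by (rule nn_integral_W[OF Phi_measurable Phi_nonneg Phi_le[OF c] f pos]) fact
  also have "\<dots> = ennreal (4 * pi / M) * (\<integral>\<^sup>+\<tau>. 2 * ((\<integral>\<^sup>+r. ennreal (grazing_weight p e (M + m * \<tau>) r) *
            (\<integral>\<^sup>+\<psi>. f (post y z (e\<^sup>2 * r\<^sup>2 / 2) ((M + m * \<tau>)\<^sup>2) \<psi>) * indicator {0..2*pi} \<psi> \<partial>lborel) \<partial>lborel)
            * indicator {-1<..<1} \<tau>) \<partial>lborel)"
  proof (rule arg_cong2[where f="(*)", OF refl], rule nn_integral_cong)
    fix \<tau> :: real
    show "(\<integral>\<^sup>+\<sigma>. (\<integral>\<^sup>+\<psi>. h \<sigma> ((M + m * \<tau>)\<^sup>2 - \<sigma>) * f (post y z \<sigma> ((M + m * \<tau>)\<^sup>2) \<psi>)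
            * indicator {0..2*pi} \<psi> \<partial>lborel) * indicator {0<..<(M + m * \<tau>)\<^sup>2} \<sigma> \<partial>lborel)
            * indicator {-1<..<1} \<tau> = 2 * ((\<integral>\<^sup>+r. ennreal (grazing_weight p e (M + m * \<tau>) r) *
            (\<integral>\<^sup>+\<psi>. f (post y z (e\<^sup>2 * r\<^sup>2 / 2) ((M + m * \<tau>)\<^sup>2) \<psi>) * indicator {0..2*pi} \<psi> \<partial>lborel) \<partial>lborel)
            * indicator {-1<..<1} \<tau>)"
    proof (cases "\<tau> \<in> {-1<..<1}")
      case True
      have "M + m * \<tau> > 0"
      proof (cases "m = 0")
        case False
        then have "m * (-1) < m * \<tau>" using True M by (intro mult_strict_left_mono) auto
        then show ?thesis using M by linarith
      qed (use M in simp)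
      from inner[OF this] True show ?thesis by simp
    qed simp
  qed
  also have "\<dots> = ennreal (4 * pi / M) * (2 * (\<integral>\<^sup>+\<tau>. ((\<integral>\<^sup>+r. ennreal (grazing_weight p e (M + m * \<tau>) r) *
            (\<integral>\<^sup>+\<psi>. f (post y z (e\<^sup>2 * r\<^sup>2 / 2) ((M + m * \<tau>)\<^sup>2) \<psi>) * indicator {0..2*pi} \<psi> \<partial>lborel) \<partial>lborel)
            * indicator {-1<..<1} \<tau>) \<partial>lborel))"
    by (subst nn_integral_cmult) simp_all
  also have "ennreal (4 * pi / M) * (2 * X) = ennreal (8 * pi / M) * X" for X
  proof -
    have "ennreal (8 * pi / M) = ennreal (4 * pi / M * 2)" by simp
    also have "\<dots> = ennreal (4 * pi / M) * 2" using M by (subst ennreal_mult) auto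
    finally show ?thesis by (simp add: mult.assoc)
  qed
  finally show ?thesis .
qed

subsection \<open>Test functions\<close>

lemma half_line_within_nontrivial: "x \<ge> 0 \<Longrightarrow> at (x::real) within {0..} \<noteq> bot"
proof -
  assume "x \<ge> 0"
  then have "at_right x \<le> at x within {0..}" by (intro at_le) auto
  moreover have "at_right x \<noteq> bot" by simp
  ultimately show ?thesis using le_bot[of "at_right x"] by auto
qed

lemma half_line_deriv_eq:
  assumes "x \<ge> 0" "(f has_real_derivative d) (at x within {0..})"
  shows "half_line_deriv f x = d"
  unfolding half_line_deriv_def
  by (rule vector_derivative_within[OF half_line_within_nontrivial[OF assms(1)]])
    (use assms(2) in \<open>simp add: has_real_derivative_iff_has_vector_derivative\<close>)

lemma half_line_C1_has_derivative:
  assumes "f \<in> half_line_C1" "x \<ge> 0"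
  shows "(f has_real_derivative half_line_deriv f x) (at x within {0..})"
proof -
  have "f differentiable (at x within {0..})"
    using assms by (auto simp: half_line_C1_def differentiable_on_def)
  then show ?thesis
    unfolding half_line_deriv_def has_real_derivative_iff_has_vector_derivative
    by (rule vector_derivative_works[THEN iffD1])
qed

lemma half_line_C1I:
  assumes "\<And>x. x \<ge> 0 \<Longrightarrow> (f has_real_derivative f' x) (at x within {0..})" "continuous_on {0..} f'"
  shows "f \<in> half_line_C1"
proof -
  have "continuous_on {0..} (half_line_deriv f)"
    using assms(2) by (rule continuous_on_eq) (use half_line_deriv_eq[OF _ assms(1)] in auto)
  moreover have "f differentiable_on {0..}"
    unfolding differentiable_on_def real_differentiable_def using assms(1) by blast
  ultimately show ?thesis by (simp add: half_line_C1_def)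
qed

text \<open>What compact support provides for the collision estimates is collected in the single
  bound \<open>C\<close>. The derivatives are one-sided at 0, as in
  \<open>half_line_deriv\<close>.\<close>

locale test_function =
  fixes \<phi> d1 d2 :: "real \<Rightarrow> real" and C :: real
  assumes d1: "\<And>x. x \<ge> 0 \<Longrightarrow> (\<phi> has_real_derivative d1 x) (at x within {0..})"
    and d2: "\<And>x. x \<ge> 0 \<Longrightarrow> (d1 has_real_derivative d2 x) (at x within {0..})"
    and cont_d2: "continuous_on {0..} d2"
    and bound0: "\<And>x. x \<ge> 0 \<Longrightarrow> \<bar>\<phi> x\<bar> \<le> C"
    and bound1: "\<And>x. x \<ge> 0 \<Longrightarrow> \<bar>d1 x\<bar> \<le> C"
    and bound2: "\<And>x. x \<ge> 0 \<Longrightarrow> \<bar>d2 x\<bar> \<le> C"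

lemma vanishing_deriv:
  assumes "f \<in> half_line_C1" "\<And>x. x \<ge> R \<Longrightarrow> f x = 0" "x > R" "R \<ge> 0"
  shows "half_line_deriv f x = 0"
proof (rule half_line_deriv_eq)
  have "(f has_real_derivative 0) (at x)"
    by (rule has_field_derivative_transform_within_open[of "\<lambda>_. 0" 0 x "{R<..}"]) (use assms in simp_all)
  then show "(f has_real_derivative 0) (at x within {0..})" by (rule has_field_derivative_at_within)
qed (use assms in simp)

lemma bounded_on_half_line:
  fixes f :: "real \<Rightarrow> real"
  assumes "continuous_on {0..} f" "\<And>x. x > R \<Longrightarrow> f x = 0"
  shows "\<exists>B. \<forall>x\<ge>0. \<bar>f x\<bar> \<le> B"
proof -
  have "compact (f ` {0..max R 0})"
    by (intro compact_continuous_image continuous_on_subset[OF assms(1)]) auto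
  then obtain B where B: "\<And>y. y \<in> f ` {0..max R 0} \<Longrightarrow> norm y \<le> B"
    using compact_imp_bounded bounded_iff by metis
  have "\<bar>f x\<bar> \<le> max B 0" if "x \<ge> 0" for x
  proof (cases "x \<le> max R 0")
    case True
    then have "f x \<in> f ` {0..max R 0}" using that by auto
    then show ?thesis using B[of "f x"] by auto
  next
    case False
    then show ?thesis using assms(2)[of x] by auto
  qed
  then show ?thesis by blast
qed

lemma half_line_Cc2_test_function:
  assumes "\<phi> \<in> half_line_Cc2"
  obtains C where "test_function \<phi> (half_line_deriv \<phi>) (half_line_deriv (half_line_deriv \<phi>)) C"
proof -
  let ?d1 = "half_line_deriv \<phi>" and ?d2 = "half_line_deriv (half_line_deriv \<phi>)"
  have 1: "\<phi> \<in> half_line_C1" "?d1 \<in> half_line_C1" "\<phi> \<in> half_line_Cc"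
    using assms by (auto simp: half_line_Cc2_def)
  then obtain R0 where R0: "\<And>x. x \<ge> 0 \<Longrightarrow> R0 \<le> x \<Longrightarrow> \<phi> x = 0" by (auto simp: half_line_Cc_def)
  define R where "R = max R0 0"
  have z0: "\<phi> x = 0" if "x \<ge> R" for x using R0[of x] that by (auto simp: R_def)
  have z1: "?d1 x = 0" if "x > R" for x
    by (rule vanishing_deriv[OF 1(1) z0 that]) (auto simp: R_def)
  \<comment> \<open>So far \<open>?d1\<close> is known to vanish strictly beyond \<open>R\<close>,
    whereas \<open>vanishing_deriv\<close> asks for a closed half line; hence the shift to
    \<open>R + 1\<close>.\<close>
  have z2: "?d2 x = 0" if "x > R + 1" for x
    by (rule vanishing_deriv[OF 1(2) z1 that]) (auto simp: R_def)
  have c: "continuous_on {0..} \<phi>" "continuous_on {0..} ?d1" "continuous_on {0..} ?d2"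
    using 1 by (auto simp: half_line_Cc_def half_line_C1_def)
  obtain B0 where B0: "\<And>x. x \<ge> 0 \<Longrightarrow> \<bar>\<phi> x\<bar> \<le> B0"
    using bounded_on_half_line[OF c(1), of R, OF z0[OF less_imp_le]] by auto
  obtain B1 where B1: "\<And>x. x \<ge> 0 \<Longrightarrow> \<bar>?d1 x\<bar> \<le> B1"
    using bounded_on_half_line[OF c(2), of R, OF z1] by auto
  obtain B2 where B2: "\<And>x. x \<ge> 0 \<Longrightarrow> \<bar>?d2 x\<bar> \<le> B2"
    using bounded_on_half_line[OF c(3), of "R+1", OF z2] by auto
  have "test_function \<phi> ?d1 ?d2 (max B0 (max B1 B2))"
  proof
    fix x :: real assume x: "x \<ge> 0"
    show "(\<phi> has_real_derivative ?d1 x) (at x within {0..})" "(?d1 has_real_derivative ?d2 x) (at x within {0..})"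
      using half_line_C1_has_derivative[OF 1(1) x] half_line_C1_has_derivative[OF 1(2) x] .
    show "\<bar>\<phi> x\<bar> \<le> max B0 (max B1 B2)" "\<bar>?d1 x\<bar> \<le> max B0 (max B1 B2)" "\<bar>?d2 x\<bar> \<le> max B0 (max B1 B2)"
      using B0[OF x] B1[OF x] B2[OF x] by linarith+
  qed (rule c)
  then show ?thesis by (rule that)
qed

context test_function
begin

lemma C_nonneg: "C \<ge> 0"
  using bound0[of 0] by simp

lemma deriv_eq: "x \<ge> 0 \<Longrightarrow> half_line_deriv \<phi> x = d1 x"
  by (intro half_line_deriv_eq d1)

lemma deriv2_eq: "x \<ge> 0 \<Longrightarrow> half_line_deriv (half_line_deriv \<phi>) x = d2 x"
proof (intro half_line_deriv_eq)
  assume "x \<ge> 0"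
  then show "(half_line_deriv \<phi> has_real_derivative d2 x) (at x within {0..})"
    using has_field_derivative_transform_within[OF d2, of x 1 "half_line_deriv \<phi>"] by (auto simp: deriv_eq)
qed

lemma cont: "continuous_on {0..} \<phi>" and cont_d1: "continuous_on {0..} d1"
  using d1 d2 by (auto intro!: DERIV_continuous_on)

lemma bound_increment:
  assumes "convex S" "\<And>x. x \<in> S \<Longrightarrow> (f has_real_derivative f' x) (at x within S)"
    "\<And>x. x \<in> S \<Longrightarrow> \<bar>f' x\<bar> \<le> B" "x \<in> S" "y \<in> S"
  shows "\<bar>f x - f y\<bar> \<le> B * \<bar>x - y\<bar>"
  using field_differentiable_bound[OF assms(1,2) _ assms(5,4), of B] assms(3) by (simp add: abs_minus_commute)

lemma lipschitz: "x \<ge> 0 \<Longrightarrow> y \<ge> 0 \<Longrightarrow> \<bar>\<phi> x - \<phi> y\<bar> \<le> C * \<bar>x - y\<bar>"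
  using d1 bound1 by (intro bound_increment[of "{0..}"]) auto

lemma lipschitz_d1: "x \<ge> 0 \<Longrightarrow> y \<ge> 0 \<Longrightarrow> \<bar>d1 x - d1 y\<bar> \<le> C * \<bar>x - y\<bar>"
  using d2 bound2 by (intro bound_increment[of "{0..}"]) auto

text \<open>With \<open>d = x - y\<close> the expression is the increment of
  \<open>\<lambda>t. \<phi> (t + d) - \<phi> t\<close> between \<open>z - d\<close> and
  \<open>y\<close>. That function has derivative at most \<open>C * \<bar>d\<bar>\<close>, and the
  two points are \<open>\<bar>x - z\<bar>\<close> apart. The set \<open>S\<close> is the half line
  on which both \<open>t\<close> and \<open>t + d\<close> are admissible.\<close>

lemma second_difference:
  assumes "x \<ge> 0" "y \<ge> 0" "z \<ge> 0" "x \<le> y + z"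
  shows "\<bar>\<phi> x + \<phi> (y + z - x) - \<phi> y - \<phi> z\<bar> \<le> C * \<bar>x - y\<bar> * \<bar>x - z\<bar>"
proof -
  define d where "d = x - y"
  define S where "S = {max 0 (- d)..}"
  have S: "t \<ge> 0" "t + d \<ge> 0" if "t \<in> S" for t using that by (auto simp: S_def)
  have "\<bar>(\<phi> (y + d) - \<phi> y) - (\<phi> ((z - d) + d) - \<phi> (z - d))\<bar> \<le> (C * \<bar>d\<bar>) * \<bar>y - (z - d)\<bar>"
  proof (rule bound_increment[where S=S and f="\<lambda>t. \<phi> (t + d) - \<phi> t" and f'="\<lambda>t. d1 (t + d) - d1 t"])
    fix t assume t: "t \<in> S"
    have "((\<phi> \<circ> (\<lambda>t. t + d)) has_real_derivative d1 (t + d) * 1) (at t within S)"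
    proof (rule DERIV_image_chain)
      show "((\<lambda>t. t + d) has_real_derivative 1) (at t within S)" by (auto intro!: derivative_eq_intros)
      show "(\<phi> has_real_derivative d1 (t + d)) (at (t + d) within (\<lambda>t. t + d) ` S)"
        using S t by (intro DERIV_subset[OF d1]) auto
    qed
    then have "((\<lambda>t. \<phi> (t + d)) has_real_derivative d1 (t + d)) (at t within S)" by (simp add: o_def)
    moreover have "(\<phi> has_real_derivative d1 t) (at t within S)"
      using S t by (intro DERIV_subset[OF d1]) auto
    ultimately show "((\<lambda>t. \<phi> (t + d) - \<phi> t) has_real_derivative d1 (t + d) - d1 t) (at t within S)"
      using DERIV_diff by fastforce
    show "\<bar>d1 (t + d) - d1 t\<bar> \<le> C * \<bar>d\<bar>" using lipschitz_d1[OF S(2,1)[OF t]] by simp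
  qed (use assms in \<open>auto simp: S_def d_def\<close>)
  then show ?thesis by (simp add: d_def algebra_simps)
qed

lemma first_difference:
  assumes "x \<ge> 0" "y \<ge> 0" "z \<ge> 0" "x \<le> y + z"
  shows "\<bar>\<phi> x + \<phi> (y + z - x) - \<phi> y - \<phi> z\<bar> \<le> 2 * C * \<bar>x - y\<bar>"
proof -
  have "\<bar>(\<phi> x - \<phi> y) + (\<phi> (y + z - x) - \<phi> z)\<bar> \<le> C * \<bar>x - y\<bar> + C * \<bar>y + z - x - z\<bar>"
    using lipschitz[of x y] lipschitz[of "y + z - x" z] assms by (intro order_trans[OF abs_triangle_ineq] add_mono) auto
  moreover have "\<bar>y + z - x - z\<bar> = \<bar>x - y\<bar>" by simp
  moreover have "(\<phi> x - \<phi> y) + (\<phi> (y + z - x) - \<phi> z) = \<phi> x + \<phi> (y + z - x) - \<phi> y - \<phi> z" by simp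
  ultimately show ?thesis by (simp only: mult_2 distrib_right)
qed

text \<open>The mean value inequality is used twice, for the first derivative and then for the
  function. The reference value \<open>\<kappa>\<close> is left free: \<open>\<kappa> = 0\<close>,
  \<open>\<eta> = C\<close> gives crude bounds, and \<open>\<kappa>\<close> equal to the second
  derivative at a limit point gives the asymptotics.\<close>

lemma taylor:
  assumes y: "y \<ge> 0" "y + \<delta> \<ge> 0"
    and k: "\<And>\<xi>. \<xi> \<ge> 0 \<Longrightarrow> \<bar>\<xi> - y\<bar> \<le> \<bar>\<delta>\<bar> \<Longrightarrow> \<bar>d2 \<xi> - \<kappa>\<bar> \<le> \<eta>"
  shows "\<bar>\<phi> (y + \<delta>) - \<phi> y - d1 y * \<delta> - \<kappa> * \<delta>\<^sup>2 / 2\<bar> \<le> \<eta> * \<delta>\<^sup>2"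
proof -
  define S where "S = {min y (y + \<delta>)..max y (y + \<delta>)}"
  have S: "t \<ge> 0" "\<bar>t - y\<bar> \<le> \<bar>\<delta>\<bar>" if "t \<in> S" for t using that y by (auto simp: S_def abs_if split: if_splits)
  have S0: "S \<subseteq> {0..}" using S by auto
  have yS: "y \<in> S" "y + \<delta> \<in> S" by (auto simp: S_def)
  have e0: "\<eta> \<ge> 0" using order_trans[OF abs_ge_zero k[of y]] y by simp
  have 1: "\<bar>(d1 t - \<kappa> * t) - (d1 y - \<kappa> * y)\<bar> \<le> \<eta> * \<bar>t - y\<bar>" if t: "t \<in> S" for t
  proof (rule bound_increment[where S=S and f'="\<lambda>t. d2 t - \<kappa>" and f="\<lambda>t. d1 t - \<kappa> * t"])
    fix x assume x: "x \<in> S"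
    show "((\<lambda>t. d1 t - \<kappa> * t) has_real_derivative d2 x - \<kappa>) (at x within S)"
      using DERIV_subset[OF d2 S0] S x by (auto intro!: derivative_eq_intros)
    show "\<bar>d2 x - \<kappa>\<bar> \<le> \<eta>" using S x by (intro k) auto
  qed (use t yS in \<open>auto simp: S_def\<close>)
  have "\<bar>(\<phi> (y + \<delta>) - d1 y * (y + \<delta>) - \<kappa> * ((y + \<delta>) - y)\<^sup>2 / 2) - (\<phi> y - d1 y * y - \<kappa> * (y - y)\<^sup>2 / 2)\<bar> \<le> (\<eta> * \<bar>\<delta>\<bar>) * \<bar>(y + \<delta>) - y\<bar>"
  proof (rule bound_increment[where S=S and f="\<lambda>t. \<phi> t - d1 y * t - \<kappa> * (t - y)\<^sup>2 / 2" and f'="\<lambda>t. d1 t - d1 y - \<kappa> * (t - y)"])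
    fix t assume t: "t \<in> S"
    show "((\<lambda>t. \<phi> t - d1 y * t - \<kappa> * (t - y)\<^sup>2 / 2) has_real_derivative d1 t - d1 y - \<kappa> * (t - y)) (at t within S)"
      using DERIV_subset[OF d1 S0] S t by (auto intro!: derivative_eq_intros simp: field_simps)
    have "\<bar>d1 t - d1 y - \<kappa> * (t - y)\<bar> \<le> \<eta> * \<bar>t - y\<bar>" using 1[OF t] by (simp add: algebra_simps)
    also have "\<dots> \<le> \<eta> * \<bar>\<delta>\<bar>" using S(2)[OF t] e0 by (rule mult_left_mono)
    finally show "\<bar>d1 t - d1 y - \<kappa> * (t - y)\<bar> \<le> \<eta> * \<bar>\<delta>\<bar>" .
  qed (use yS in \<open>auto simp: S_def\<close>)
  moreover have "(\<phi> (y + \<delta>) - d1 y * (y + \<delta>) - \<kappa> * ((y + \<delta>) - y)\<^sup>2 / 2) - (\<phi> y - d1 y * y - \<kappa> * (y - y)\<^sup>2 / 2)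
     = \<phi> (y + \<delta>) - \<phi> y - d1 y * \<delta> - \<kappa> * \<delta>\<^sup>2 / 2"
    by (simp add: distrib_left)
  moreover have "(\<eta> * \<bar>\<delta>\<bar>) * \<bar>(y + \<delta>) - y\<bar> = \<eta> * \<delta>\<^sup>2"
    by (simp add: mult.assoc power2_eq_square)
  ultimately show ?thesis by (simp only:)
qed

end

section \<open>The angular mean of the collision difference\<close>

lemma gap_bounds:
  assumes "y \<ge> 0" "z \<ge> 0" "0 \<le> gap y z u"
  shows "(z - y)\<^sup>2 \<le> 2 * u * (y + z)" "gap y z u \<le> 2 * u * (y + z)"
proof -
  \<comment> \<open>Both bounds come from the identity
    \<open>gap y z u + (z - y)\<^sup>2 + u\<^sup>2 = 2 * u * (y + z)\<close>.\<close>
  have "(z - y)\<^sup>2 = (2 * u * (y + z) - u\<^sup>2) - gap y z u"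
    by (simp add: gap_def power2_eq_square algebra_simps)
  then show "(z - y)\<^sup>2 \<le> 2 * u * (y + z)" using assms by (smt (verit) zero_le_power2)
  have "gap y z u = 2 * u * (y + z) - u\<^sup>2 - (z - y)\<^sup>2"
    by (simp add: gap_def power2_eq_square algebra_simps)
  then show "gap y z u \<le> 2 * u * (y + z)" by (smt (verit) zero_le_power2)
qed

text \<open>For the lower bound, the squared centre minus the squared amplitude of
  \<open>u * post\<close> is a sum of squares with nonnegative weights. The upper bound is the lower
  bound for the partner energy, obtained by exchanging \<open>y\<close>, \<open>z\<close> and
  shifting the angle by \<open>pi\<close>.\<close>

lemma post_range:
  assumes nn: "y \<ge> 0" "z \<ge> 0" and s: "0 \<le> \<sigma>" "\<sigma> \<le> u" "0 < u" and g: "0 \<le> gap y z u"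
  shows "0 \<le> post y z \<sigma> u \<psi>" "post y z \<sigma> u \<psi> \<le> y + z"
proof -
  have low: "0 \<le> post y z \<sigma> u \<psi>" if nn: "y \<ge> 0" "z \<ge> 0" and s: "0 \<le> \<sigma>" "\<sigma> \<le> u" and g: "0 \<le> gap y z u"
    for y z \<sigma> \<psi>
  proof -
    define R where "R = sqrt (\<sigma> * (u - \<sigma>) * gap y z u)"
    define c where "c = \<sigma> * z + (u - \<sigma>) * y"
    have R0: "0 \<le> \<sigma> * (u - \<sigma>) * gap y z u" using s g by simp
    then have R: "R\<^sup>2 = \<sigma> * (u - \<sigma>) * gap y z u" by (simp add: R_def)
    have c0: "c \<ge> 0" using nn s by (simp add: c_def)
    have "c\<^sup>2 - R\<^sup>2 = u * (\<sigma> * ((u - \<sigma>) - z)\<^sup>2 + (u - \<sigma>) * (\<sigma> - y)\<^sup>2)"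
      unfolding R c_def gap_def by (simp add: power2_eq_square algebra_simps)
    moreover have "0 \<le> u * (\<sigma> * ((u - \<sigma>) - z)\<^sup>2 + (u - \<sigma>) * (\<sigma> - y)\<^sup>2)"
      using s \<open>0 < u\<close> by simp
    ultimately have "R\<^sup>2 \<le> c\<^sup>2" by linarith
    then have "R \<le> c" using c0 by (rule power2_le_imp_le)
    moreover have "- R \<le> R * cos \<psi>"
      using mult_left_mono[OF cos_ge_minus_one[of \<psi>], of R] R0 by (simp add: R_def)
    ultimately have "0 \<le> (c + R * cos \<psi>) / u" using \<open>0 < u\<close> by simp
    also have "\<dots> = post y z \<sigma> u \<psi>"
      using \<open>0 < u\<close> by (simp add: post_def c_def R_def field_simps)
    finally show ?thesis .
  qed
  show "0 \<le> post y z \<sigma> u \<psi>" by (rule low) (use assms in auto)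
  have "0 \<le> post z y \<sigma> u (\<psi> + pi)"
    by (rule low) (use assms in \<open>auto simp: gap_def power2_eq_square algebra_simps\<close>)
  moreover have "post z y \<sigma> u (\<psi> + pi) = y + z - post y z \<sigma> u \<psi>"
  proof -
    have "gap z y u = gap y z u" by (simp add: gap_def power2_eq_square algebra_simps)
    then show ?thesis by (simp add: post_def right_diff_distrib add.commute)
  qed
  ultimately show "post y z \<sigma> u \<psi> \<le> y + z" by simp
qed

lemma cos_moment_1: "(LBINT \<psi>:{0..2*pi}. a + b * cos \<psi>) = 2 * pi * a"
proof -
  have "(\<integral>\<psi>. (a + b * cos \<psi>) * indicator {0..2*pi} \<psi> \<partial>lborel) = (a * (2*pi) + b * sin (2*pi)) - (a * 0 + b * sin 0)"
    by (rule integral_FTC_Icc_real) (auto intro!: derivative_eq_intros continuous_intros)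
  then show ?thesis by (simp add: set_lebesgue_integral_def mult.commute)
qed

lemma cos_moment_2: "(LBINT \<psi>:{0..2*pi}. (a + b * cos \<psi>)\<^sup>2) = 2 * pi * a\<^sup>2 + pi * b\<^sup>2"
proof -
  define F where "F t = a\<^sup>2 * t + 2 * a * b * sin t + b\<^sup>2 * ((t + sin t * cos t) / 2)" for t
  have "(\<integral>\<psi>. (a + b * cos \<psi>)\<^sup>2 * indicator {0..2*pi} \<psi> \<partial>lborel) = F (2*pi) - F 0"
  proof (rule integral_FTC_Icc_real)
    fix t :: real
    have "(F has_real_derivative a\<^sup>2 + 2 * a * b * cos t + b\<^sup>2 * ((1 + (cos t * cos t - sin t * sin t)) / 2)) (at t)"
      unfolding F_def by (auto intro!: derivative_eq_intros)
    also have "1 + (cos t * cos t - sin t * sin t) = 2 * (cos t)\<^sup>2"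
      using sin_cos_squared_add[of t] by (simp add: power2_eq_square)
    also have "a\<^sup>2 + 2 * a * b * cos t + b\<^sup>2 * (2 * (cos t)\<^sup>2 / 2) = (a + b * cos t)\<^sup>2"
      by (simp add: power2_eq_square algebra_simps)
    finally show "(F has_real_derivative (a + b * cos t)\<^sup>2) (at t)" .
  qed (auto intro!: continuous_intros)
  then show ?thesis by (simp add: F_def set_lebesgue_integral_def mult.commute)
qed

context test_function
begin

definition cdiff :: "real \<Rightarrow> real \<Rightarrow> real \<Rightarrow> real" where
  "cdiff y z x = \<phi> x + \<phi> (y + z - x) - \<phi> y - \<phi> z"

definition cavg :: "real \<Rightarrow> real \<Rightarrow> real \<Rightarrow> real \<Rightarrow> real" where
  "cavg y z \<sigma> u = (LBINT \<psi>:{0..2*pi}. cdiff y z (post y z \<sigma> u \<psi>))"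

text \<open>The energy transfer is \<open>\<delta> = a + b * cos \<psi>\<close>, and
  \<open>taylor\<close> is applied at \<open>y\<close> with \<open>\<delta>\<close> and at
  \<open>z\<close> with \<open>- \<delta>\<close>. The first-order terms combine to
  \<open>(d1 y - d1 z) * \<delta>\<close>, whose mean retains only \<open>a\<close>; the
  second-order ones yield the second moment of \<open>\<delta>\<close>.\<close>

lemma cavg_estimate:
  assumes nn: "y \<ge> 0" "z \<ge> 0" and s: "0 \<le> \<sigma>" "\<sigma> \<le> u" "0 < u" and g: "0 \<le> gap y z u"
  defines "a \<equiv> \<sigma> / u * (z - y)" and "b \<equiv> sqrt (\<sigma> * (u - \<sigma>) * gap y z u) / u"
  assumes k1: "\<And>\<xi>. \<xi> \<ge> 0 \<Longrightarrow> \<bar>\<xi> - y\<bar> \<le> \<bar>a\<bar> + \<bar>b\<bar> \<Longrightarrow> \<bar>d2 \<xi> - \<kappa>1\<bar> \<le> \<eta>"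
    and k2: "\<And>\<xi>. \<xi> \<ge> 0 \<Longrightarrow> \<bar>\<xi> - z\<bar> \<le> \<bar>a\<bar> + \<bar>b\<bar> \<Longrightarrow> \<bar>d2 \<xi> - \<kappa>2\<bar> \<le> \<eta>"
  shows "\<bar>cavg y z \<sigma> u - (2 * pi * a * (d1 y - d1 z) + (\<kappa>1 + \<kappa>2) / 2 * (2 * pi * a\<^sup>2 + pi * b\<^sup>2))\<bar>
     \<le> 2 * \<eta> * (2 * pi * a\<^sup>2 + pi * b\<^sup>2)"
proof -
  define \<delta> where "\<delta> \<psi> = a + b * cos \<psi>" for \<psi>
  have post: "post y z \<sigma> u \<psi> = y + \<delta> \<psi>" for \<psi> by (simp add: post_def \<delta>_def a_def b_def)
  have rng: "0 \<le> y + \<delta> \<psi>" "0 \<le> z - \<delta> \<psi>" for \<psi>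
    using post_range[OF nn s g, of \<psi>] by (simp_all add: post)
  have dl: "\<bar>\<delta> \<psi>\<bar> \<le> \<bar>a\<bar> + \<bar>b\<bar>" for \<psi>
  proof -
    have "\<bar>b * cos \<psi>\<bar> \<le> \<bar>b\<bar>" by (simp add: abs_mult mult_left_le)
    then show ?thesis unfolding \<delta>_def by linarith
  qed
  define f where "f \<psi> = cdiff y z (y + \<delta> \<psi>)" for \<psi>
  define g where "g \<psi> = (d1 y - d1 z) * \<delta> \<psi> + (\<kappa>1 + \<kappa>2) / 2 * (\<delta> \<psi>)\<^sup>2" for \<psi>
  have pt: "\<bar>f \<psi> - g \<psi>\<bar> \<le> 2 * \<eta> * (\<delta> \<psi>)\<^sup>2" for \<psi>
  proof -
    have "\<bar>\<phi> (y + \<delta> \<psi>) - \<phi> y - d1 y * \<delta> \<psi> - \<kappa>1 * (\<delta> \<psi>)\<^sup>2 / 2\<bar> \<le> \<eta> * (\<delta> \<psi>)\<^sup>2"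
      using rng dl by (intro taylor nn k1) (auto intro: order_trans)
    moreover have "\<bar>\<phi> (z + - \<delta> \<psi>) - \<phi> z - d1 z * - \<delta> \<psi> - \<kappa>2 * (- \<delta> \<psi>)\<^sup>2 / 2\<bar> \<le> \<eta> * (- \<delta> \<psi>)\<^sup>2"
      using rng dl by (intro taylor nn k2) (auto intro: order_trans)
    moreover have "f \<psi> - g \<psi> = (\<phi> (y + \<delta> \<psi>) - \<phi> y - d1 y * \<delta> \<psi> - \<kappa>1 * (\<delta> \<psi>)\<^sup>2 / 2)
       + (\<phi> (z + - \<delta> \<psi>) - \<phi> z - d1 z * - \<delta> \<psi> - \<kappa>2 * (- \<delta> \<psi>)\<^sup>2 / 2)"
    proof -
      have "y + z - (y + \<delta> \<psi>) = z + - \<delta> \<psi>" by simp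
      then show ?thesis unfolding f_def g_def cdiff_def by (simp add: field_simps)
    qed
    ultimately show ?thesis by (simp add: abs_le_iff)
  qed
  have cf: "continuous_on {0..2*pi} f"
  proof -
    have "continuous_on {0..2*pi} (\<lambda>\<psi>. \<phi> (y + \<delta> \<psi>))" "continuous_on {0..2*pi} (\<lambda>\<psi>. \<phi> (z - \<delta> \<psi>))"
      using rng by (auto intro!: continuous_on_compose2[OF cont] continuous_intros simp: \<delta>_def)
    moreover have "f = (\<lambda>\<psi>. \<phi> (y + \<delta> \<psi>) + \<phi> (z - \<delta> \<psi>) - \<phi> y - \<phi> z)"
      by (auto simp: f_def cdiff_def algebra_simps)
    ultimately show ?thesis by (auto intro!: continuous_intros)
  qed
  have cg: "continuous_on {0..2*pi} g" and cd: "continuous_on {0..2*pi} (\<lambda>\<psi>. 2 * \<eta> * (\<delta> \<psi>)\<^sup>2)"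
    and cd1: "continuous_on {0..2*pi} (\<lambda>\<psi>. (d1 y - d1 z) * \<delta> \<psi>)"
    and cd2: "continuous_on {0..2*pi} (\<lambda>\<psi>. (\<kappa>1 + \<kappa>2) / 2 * (\<delta> \<psi>)\<^sup>2)"
    unfolding g_def \<delta>_def by (auto intro!: continuous_intros)
  note int = borel_integrable_atLeastAtMost'
  have "\<bar>(LBINT \<psi>:{0..2*pi}. f \<psi>) - (LBINT \<psi>:{0..2*pi}. g \<psi>)\<bar> = \<bar>LBINT \<psi>:{0..2*pi}. f \<psi> - g \<psi>\<bar>"
    by (subst set_integral_diff(2)) (auto intro: int cf cg)
  also have "\<dots> \<le> (LBINT \<psi>:{0..2*pi}. \<bar>f \<psi> - g \<psi>\<bar>)"
    using set_integral_norm_bound[OF int[OF continuous_on_diff[OF cf cg]]] by simp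
  also have "\<dots> \<le> (LBINT \<psi>:{0..2*pi}. 2 * \<eta> * (\<delta> \<psi>)\<^sup>2)"
    by (intro set_integral_mono int cd continuous_on_rabs continuous_on_diff cf cg pt)
  also have "\<dots> = 2 * \<eta> * (2 * pi * a\<^sup>2 + pi * b\<^sup>2)"
    using cos_moment_2[of a b] by (simp add: \<delta>_def)
  also have "(LBINT \<psi>:{0..2*pi}. g \<psi>) = 2 * pi * a * (d1 y - d1 z) + (\<kappa>1 + \<kappa>2) / 2 * (2 * pi * a\<^sup>2 + pi * b\<^sup>2)"
    unfolding g_def using cos_moment_1[of a b] cos_moment_2[of a b]
    by (subst set_integral_add(2)[OF int[OF cd1] int[OF cd2]]) (simp add: \<delta>_def)
  finally show ?thesis by (simp add: cavg_def f_def post)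
qed

text \<open>The divisions by \<open>u\<close> are absorbed by \<open>gap_bounds\<close>, so the
  bounds stay uniform as the relative speed tends to 0.\<close>

lemma shift_bounds:
  assumes nn: "y \<ge> 0" "z \<ge> 0" and s: "0 \<le> \<sigma>" "\<sigma> \<le> u" "0 < u" and g: "0 \<le> gap y z u"
  shows "(\<sigma> / u * (z - y))\<^sup>2 \<le> 2 * \<sigma> * (y + z)"
    "(sqrt (\<sigma> * (u - \<sigma>) * gap y z u) / u)\<^sup>2 \<le> 2 * \<sigma> * (y + z)"
proof -
  note gb = gap_bounds[OF nn g]
  have "(\<sigma> / u * (z - y))\<^sup>2 = \<sigma> / u * (\<sigma> * ((z - y)\<^sup>2 / u))" by (simp add: power2_eq_square)
  also have "\<dots> \<le> 1 * (\<sigma> * (2 * (y + z)))"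
    using s gb(1) nn by (intro mult_mono mult_left_mono) (auto simp: pos_divide_le_eq mult_ac)
  finally show "(\<sigma> / u * (z - y))\<^sup>2 \<le> 2 * \<sigma> * (y + z)" by (simp add: algebra_simps)
  have "(sqrt (\<sigma> * (u - \<sigma>) * gap y z u) / u)\<^sup>2 = (u - \<sigma>) / u * (\<sigma> * (gap y z u / u))"
    using s g by (simp add: power_divide) (simp add: power2_eq_square)
  also have "\<dots> \<le> 1 * (\<sigma> * (2 * (y + z)))"
    using s gb(2) nn g by (intro mult_mono mult_left_mono) (auto simp: pos_divide_le_eq mult_ac)
  finally show "(sqrt (\<sigma> * (u - \<sigma>) * gap y z u) / u)\<^sup>2 \<le> 2 * \<sigma> * (y + z)" by (simp add: algebra_simps)
qed

text \<open>This is \<open>cavg_estimate\<close> with reference value 0. By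
  \<open>shift_bounds\<close> alone \<open>a\<close> would be of order \<open>sqrt \<sigma>\<close>;
  its companion \<open>d1 y - d1 z\<close> supplies another factor \<open>\<bar>y - z\<bar>\<close>,
  and \<open>(z - y)\<^sup>2 / u\<close> is bounded, so the first-order term is of order
  \<open>\<sigma>\<close> as well.\<close>

lemma cavg_bound:
  assumes nn: "y \<ge> 0" "z \<ge> 0" and s: "0 \<le> \<sigma>" "\<sigma> \<le> u" "0 < u" and g: "0 \<le> gap y z u"
  shows "\<bar>cavg y z \<sigma> u\<bar> \<le> 16 * pi * C * \<sigma> * (y + z)"
proof -
  define a b where "a = \<sigma> / u * (z - y)" and "b = sqrt (\<sigma> * (u - \<sigma>) * gap y z u) / u"
  have ab: "a\<^sup>2 \<le> 2 * \<sigma> * (y + z)" "b\<^sup>2 \<le> 2 * \<sigma> * (y + z)"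
    using shift_bounds[OF assms] by (simp_all add: a_def b_def)
  have "\<bar>cavg y z \<sigma> u - (2 * pi * a * (d1 y - d1 z) + (0 + 0) / 2 * (2 * pi * a\<^sup>2 + pi * b\<^sup>2))\<bar>
     \<le> 2 * C * (2 * pi * a\<^sup>2 + pi * b\<^sup>2)"
    unfolding a_def b_def by (rule cavg_estimate[OF nn s g]) (simp_all add: bound2)
  then have "\<bar>cavg y z \<sigma> u - X\<bar> \<le> B" if "X = 2 * pi * a * (d1 y - d1 z)" "B = 2 * C * (2 * pi * a\<^sup>2 + pi * b\<^sup>2)" for X B
    using that by simp
  then have "\<bar>cavg y z \<sigma> u\<bar> \<le> \<bar>X\<bar> + B" if "X = 2 * pi * a * (d1 y - d1 z)" "B = 2 * C * (2 * pi * a\<^sup>2 + pi * b\<^sup>2)" for X B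
    using that by (smt (verit))
  then have "\<bar>cavg y z \<sigma> u\<bar> \<le> \<bar>2 * pi * a * (d1 y - d1 z)\<bar> + 2 * C * (2 * pi * a\<^sup>2 + pi * b\<^sup>2)"
    by blast
  also have "\<bar>2 * pi * a * (d1 y - d1 z)\<bar> \<le> 2 * pi * C * (2 * \<sigma> * (y + z))"
  proof -
    have "\<bar>2 * pi * a * (d1 y - d1 z)\<bar> = 2 * pi * (\<bar>a\<bar> * \<bar>d1 y - d1 z\<bar>)" by (simp add: abs_mult)
    also have "\<dots> \<le> 2 * pi * (\<bar>a\<bar> * (C * \<bar>y - z\<bar>))"
      by (intro mult_left_mono lipschitz_d1 nn) auto
    also have "\<bar>a\<bar> * (C * \<bar>y - z\<bar>) = C * (\<sigma> * ((z - y)\<^sup>2 / u))"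
      using s by (simp add: a_def abs_mult abs_minus_commute[of y z] power2_eq_square)
    also have "2 * pi * (C * (\<sigma> * ((z - y)\<^sup>2 / u))) \<le> 2 * pi * (C * (\<sigma> * (2 * (y + z))))"
      using s gap_bounds[OF nn g] C_nonneg by (intro mult_left_mono) (auto simp: pos_divide_le_eq mult_ac)
    finally show ?thesis by (simp add: mult_ac)
  qed
  also have "2 * C * (2 * pi * a\<^sup>2 + pi * b\<^sup>2) \<le> 2 * C * (2 * pi * (2 * \<sigma> * (y + z)) + pi * (2 * \<sigma> * (y + z)))"
    using ab C_nonneg by (intro mult_left_mono add_mono) auto
  finally show ?thesis by (simp add: algebra_simps)
qed

end

context test_function
begin

text \<open>The limit of \<open>cavg y z \<sigma> u / \<sigma>\<close> as \<open>\<sigma> \<rightarrow> 0\<close>.\<close>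

definition cavg_lim :: "real \<Rightarrow> real \<Rightarrow> real \<Rightarrow> real" where
  "cavg_lim y z u = 2 * pi * ((z - y) / u) * (d1 y - d1 z) + (d2 y + d2 z) / 2 * (pi * (gap y z u / u))"

lemma d2_near:
  assumes "y \<ge> 0" "\<eta> > 0"
  obtains \<delta> where "\<delta> > 0" "\<And>\<xi>. \<xi> \<ge> 0 \<Longrightarrow> \<bar>\<xi> - y\<bar> < \<delta> \<Longrightarrow> \<bar>d2 \<xi> - d2 y\<bar> \<le> \<eta>"
proof -
  obtain \<delta> where "\<delta> > 0" "\<And>x. x \<in> {0..} \<Longrightarrow> dist x y < \<delta> \<Longrightarrow> dist (d2 x) (d2 y) < \<eta>"
    using cont_d2[unfolded continuous_on_iff, rule_format, of y \<eta>] assms by auto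
  then show ?thesis by (intro that[of \<delta>]) (auto simp: dist_real_def intro: less_imp_le)
qed

text \<open>After division by \<open>\<sigma>\<close>, \<open>a\<^sup>2\<close> vanishes in the
  limit while \<open>b\<^sup>2\<close> tends to \<open>gap / u\<close>. All arguments vary with
  \<open>n\<close> because continuous convergence is needed later, and the reference values for
  \<open>cavg_estimate\<close> are the second derivatives at the limit points.\<close>

lemma cavg_limit:
  fixes yn zn un sn :: "nat \<Rightarrow> real"
  assumes lim: "yn \<longlonglongrightarrow> y" "zn \<longlonglongrightarrow> z" "un \<longlonglongrightarrow> u" "sn \<longlonglongrightarrow> 0"
    and nn: "\<And>n. yn n \<ge> 0" "\<And>n. zn n \<ge> 0" and u: "u > 0"
    and ev: "\<forall>\<^sub>F n in sequentially. 0 < sn n \<and> sn n < un n \<and> 0 \<le> gap (yn n) (zn n) (un n)"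
  shows "(\<lambda>n. cavg (yn n) (zn n) (sn n) (un n) / sn n) \<longlonglongrightarrow> cavg_lim y z u"
proof -
  have yz: "y \<ge> 0" "z \<ge> 0"
    using lim(1,2) nn by (auto intro: LIMSEQ_le_const)
  define a where "a n = sn n / un n * (zn n - yn n)" for n
  define b where "b n = sqrt (sn n * (un n - sn n) * gap (yn n) (zn n) (un n)) / un n" for n
  define Q where "Q n = 2 * pi * (sn n * ((zn n - yn n) / un n)\<^sup>2) + pi * ((un n - sn n) * gap (yn n) (zn n) (un n) / (un n)\<^sup>2)" for n
  define T where "T n = 2 * pi * ((zn n - yn n) / un n) * (d1 (yn n) - d1 (zn n)) + (d2 y + d2 z) / 2 * Q n" for n
  have gl: "(\<lambda>n. gap (yn n) (zn n) (un n)) \<longlonglongrightarrow> gap y z u"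
    unfolding gap_def by (intro tendsto_intros lim)
  have d1l: "(\<lambda>n. d1 (yn n)) \<longlonglongrightarrow> d1 y" "(\<lambda>n. d1 (zn n)) \<longlonglongrightarrow> d1 z"
    using yz nn by (auto intro!: continuous_on_tendsto_compose[OF cont_d1] lim)
  have Ql: "Q \<longlonglongrightarrow> 2 * pi * (0 * ((z - y) / u)\<^sup>2) + pi * ((u - 0) * gap y z u / u\<^sup>2)"
    unfolding Q_def using u by (intro tendsto_intros lim gl) auto
  have Ql': "Q \<longlonglongrightarrow> pi * (gap y z u / u)"
    using Ql u by (simp add: power2_eq_square)
  have Tl: "T \<longlonglongrightarrow> cavg_lim y z u"
    unfolding T_def cavg_lim_def using u by (intro tendsto_intros lim d1l Ql') auto
  have al: "a \<longlonglongrightarrow> 0 / u * (z - y)"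
    unfolding a_def using u by (intro tendsto_intros lim) auto
  have bl: "b \<longlonglongrightarrow> sqrt (0 * (u - 0) * gap y z u) / u"
    unfolding b_def using u by (intro tendsto_intros lim gl) auto
  have abl: "(\<lambda>n. \<bar>a n\<bar> + \<bar>b n\<bar>) \<longlonglongrightarrow> 0"
    using tendsto_add[OF tendsto_rabs[OF al] tendsto_rabs[OF bl]] by simp
  have "(\<lambda>n. cavg (yn n) (zn n) (sn n) (un n) / sn n - T n) \<longlonglongrightarrow> 0"
  proof (rule tendstoI)
    fix e :: real assume e: "e > 0"
    \<comment> \<open>\<open>K\<close> is an eventual bound of \<open>Q\<close>, positive by the
      added 1. The choice of \<open>\<eta>\<close> makes the error \<open>2 * \<eta> * K\<close>
      equal to \<open>e / 2\<close>.\<close>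
    define K where "K = \<bar>pi * (gap y z u / u)\<bar> + 1"
    have K: "K > 0" unfolding K_def by (intro add_nonneg_pos) auto
    define \<eta> where "\<eta> = e / (4 * K)"
    have \<eta>: "\<eta> > 0" using e K by (simp add: \<eta>_def)
    obtain \<delta>1 where \<delta>1: "\<delta>1 > 0" "\<And>\<xi>. \<xi> \<ge> 0 \<Longrightarrow> \<bar>\<xi> - y\<bar> < \<delta>1 \<Longrightarrow> \<bar>d2 \<xi> - d2 y\<bar> \<le> \<eta>"
      using d2_near[OF yz(1) \<eta>] by blast
    obtain \<delta>2 where \<delta>2: "\<delta>2 > 0" "\<And>\<xi>. \<xi> \<ge> 0 \<Longrightarrow> \<bar>\<xi> - z\<bar> < \<delta>2 \<Longrightarrow> \<bar>d2 \<xi> - d2 z\<bar> \<le> \<eta>"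
      using d2_near[OF yz(2) \<eta>] by blast
    define \<delta> where "\<delta> = min \<delta>1 \<delta>2 / 2"
    have \<delta>: "\<delta> > 0" using \<delta>1 \<delta>2 by (simp add: \<delta>_def)
    have e1: "\<forall>\<^sub>F n in sequentially. \<bar>a n\<bar> + \<bar>b n\<bar> < \<delta>"
      using order_tendstoD(2)[OF abl \<delta>] .
    have e2: "\<forall>\<^sub>F n in sequentially. \<bar>yn n - y\<bar> < \<delta>" "\<forall>\<^sub>F n in sequentially. \<bar>zn n - z\<bar> < \<delta>"
      using tendstoD[OF lim(1) \<delta>] tendstoD[OF lim(2) \<delta>] by (simp_all add: dist_real_def)
    have e3: "\<forall>\<^sub>F n in sequentially. Q n < K"
      by (rule order_tendstoD(2)[OF Ql'], unfold K_def) linarith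
    show "\<forall>\<^sub>F n in sequentially. dist (cavg (yn n) (zn n) (sn n) (un n) / sn n - T n) 0 < e"
      using ev e1 e2 e3
    proof eventually_elim
      case (elim n)
      then have s: "0 \<le> sn n" "sn n \<le> un n" "0 < un n" "0 \<le> gap (yn n) (zn n) (un n)" "0 < sn n" by auto
      have ab: "2 * pi * (a n)\<^sup>2 + pi * (b n)\<^sup>2 = sn n * Q n"
      proof -
        have "(b n)\<^sup>2 = sn n * ((un n - sn n) * gap (yn n) (zn n) (un n) / (un n)\<^sup>2)"
          using s by (simp add: b_def power_divide mult.assoc)
        moreover have "(a n)\<^sup>2 = sn n * (sn n * ((zn n - yn n) / un n)\<^sup>2)"
          by (simp add: a_def power2_eq_square)
        ultimately show ?thesis by (simp only: Q_def distrib_left mult.left_commute)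
      qed
      have aT: "2 * pi * a n * (d1 (yn n) - d1 (zn n)) + (d2 y + d2 z) / 2 * (2 * pi * (a n)\<^sup>2 + pi * (b n)\<^sup>2) = sn n * T n"
      proof -
        have a: "a n = sn n * ((zn n - yn n) / un n)" by (simp add: a_def)
        show ?thesis unfolding ab unfolding a T_def by (simp only: distrib_left mult_ac)
      qed
      have "\<bar>cavg (yn n) (zn n) (sn n) (un n) - sn n * T n\<bar> \<le> 2 * \<eta> * (sn n * Q n)"
        unfolding ab[symmetric] aT[symmetric] a_def b_def
      proof (rule cavg_estimate[OF nn s(1-4)])
        fix \<xi> :: real assume x: "\<xi> \<ge> 0"
        assume "\<bar>\<xi> - yn n\<bar> \<le> \<bar>sn n / un n * (zn n - yn n)\<bar> + \<bar>sqrt (sn n * (un n - sn n) * gap (yn n) (zn n) (un n)) / un n\<bar>"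
        then have "\<bar>\<xi> - y\<bar> < \<delta>1" using elim \<delta>1 \<delta>2 unfolding \<delta>_def a_def b_def by linarith
        then show "\<bar>d2 \<xi> - d2 y\<bar> \<le> \<eta>" using \<delta>1(2)[OF x] by blast
      next
        fix \<xi> :: real assume x: "\<xi> \<ge> 0"
        assume "\<bar>\<xi> - zn n\<bar> \<le> \<bar>sn n / un n * (zn n - yn n)\<bar> + \<bar>sqrt (sn n * (un n - sn n) * gap (yn n) (zn n) (un n)) / un n\<bar>"
        then have "\<bar>\<xi> - z\<bar> < \<delta>2" using elim \<delta>1 \<delta>2 unfolding \<delta>_def a_def b_def by linarith
        then show "\<bar>d2 \<xi> - d2 z\<bar> \<le> \<eta>" using \<delta>2(2)[OF x] by blast
      qed
      also have "\<dots> \<le> 2 * \<eta> * (sn n * K)"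
        using \<eta> s elim by (intro mult_left_mono) auto
      finally have "\<bar>sn n * (cavg (yn n) (zn n) (sn n) (un n) / sn n - T n)\<bar> \<le> sn n * (2 * \<eta> * K)"
        using s by (simp add: right_diff_distrib mult_ac)
      then have "\<bar>cavg (yn n) (zn n) (sn n) (un n) / sn n - T n\<bar> \<le> 2 * \<eta> * K"
        using s by (simp add: abs_mult)
      also have "\<dots> < e" using e K by (simp add: \<eta>_def)
      finally show ?case by (simp add: dist_real_def)
    qed
  qed
  from tendsto_add[OF this Tl] show ?thesis by simp
qed

end

section \<open>Averaging over the relative speed: the operator \<open>L\<close>\<close>

lemma gap_mean:
  fixes M m :: real
  assumes "0 \<le> m" "m < M"
  shows "(LBINT \<tau>:{-1..1}. 1 / (M + m * \<tau>)\<^sup>2) = 2 / (M\<^sup>2 - m\<^sup>2)"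
proof (cases "m = 0")
  case True
  then show ?thesis using assms by (simp add: set_lebesgue_integral_def)
next
  case False
  have pos: "M + m * t > 0" if "-1 \<le> t" for t
  proof -
    have "m * (-1) \<le> m * t" using that assms by (intro mult_left_mono) auto
    then show ?thesis using assms by linarith
  qed
  have "(\<integral>\<tau>. (1 / (M + m * \<tau>)\<^sup>2) * indicator {-1..1} \<tau> \<partial>lborel) = - 1 / (m * (M + m * 1)) - (- 1 / (m * (M + m * (-1))))"
  proof (rule integral_FTC_Icc_real)
    fix t :: real assume t: "-1 \<le> t" "t \<le> 1"
    show "((\<lambda>t. - 1 / (m * (M + m * t))) has_real_derivative 1 / (M + m * t)\<^sup>2) (at t)"
      using pos[OF t(1)] False by (auto intro!: derivative_eq_intros simp: power2_eq_square)
    show "isCont (\<lambda>t. 1 / (M + m * t)\<^sup>2) t"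
      using pos[OF t(1)] by (intro continuous_intros) auto
  qed simp
  also have "\<dots> = 2 / (M\<^sup>2 - m\<^sup>2)"
  proof -
    have "M + m \<noteq> 0" "M - m \<noteq> 0" "M\<^sup>2 - m\<^sup>2 = (M + m) * (M - m)" using assms by (auto simp: power2_eq_square algebra_simps)
    then show ?thesis using False by (simp add: divide_simps)
  qed
  finally show ?thesis by (simp add: set_lebesgue_integral_def mult.commute)
qed

lemma square_mean:
  "(LBINT \<tau>:{-1..1}. A - (M + m * \<tau>)\<^sup>2) = 2 * A - 2 * M\<^sup>2 - 2 / 3 * m\<^sup>2" for A M m :: real
proof -
  define F where "F t = A * t - (M\<^sup>2 * t + M * m * t\<^sup>2 + m\<^sup>2 * t ^ 3 / 3)" for t
  have "(\<integral>\<tau>. (A - (M + m * \<tau>)\<^sup>2) * indicator {-1..1} \<tau> \<partial>lborel) = F 1 - F (-1)"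
  proof (rule integral_FTC_Icc_real)
    fix t :: real
    show "(F has_real_derivative A - (M + m * t)\<^sup>2) (at t)"
      unfolding F_def by (auto intro!: derivative_eq_intros simp: power2_eq_square algebra_simps)
  qed (auto intro!: continuous_intros)
  then show ?thesis by (simp add: F_def set_lebesgue_integral_def mult.commute)
qed

text \<open>Sorting by powers of \<open>w\<close> leaves a constant, \<open>w\<^sup>2\<close> and
  the inverse square of \<open>w\<close>, whose means over \<open>\<tau>\<close> are
  \<open>square_mean\<close> and \<open>gap_mean\<close>.\<close>

lemma gap_ratio:
  assumes "y \<ge> 0" "z \<ge> 0" "w \<noteq> 0"
  defines "M \<equiv> sqrt (max y z)" and "m \<equiv> sqrt (min y z)"
  shows "gap y z (w\<^sup>2) / w\<^sup>2 = 2 * (M\<^sup>2 + m\<^sup>2) - w\<^sup>2 - (M\<^sup>2 - m\<^sup>2)\<^sup>2 * (1 / w\<^sup>2)"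
proof -
  have "M\<^sup>2 = max y z" "m\<^sup>2 = min y z" using assms by (auto simp: M_def m_def)
  then have "M\<^sup>2 + m\<^sup>2 = y + z" "(M\<^sup>2 - m\<^sup>2)\<^sup>2 = (y - z)\<^sup>2"
    by (auto simp: max_def min_def power2_commute)
  moreover have "gap y z (w\<^sup>2) = w\<^sup>2 * (2 * (y + z) - w\<^sup>2) - (y - z)\<^sup>2"
    by (simp add: gap_def power2_eq_square algebra_simps)
  ultimately show ?thesis using assms(3) by (simp add: diff_divide_distrib)
qed

lemma set_integral_cong_AE_point:
  fixes f g :: "real \<Rightarrow> real"
  assumes "\<And>x. x \<in> A \<Longrightarrow> x \<noteq> c \<Longrightarrow> f x = g x" "f \<in> borel_measurable borel" "g \<in> borel_measurable borel" "A \<in> sets borel"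
  shows "(LBINT x:A. f x) = (LBINT x:A. g x)"
  unfolding set_lebesgue_integral_def
proof (rule integral_cong_AE)
  show "AE x in lborel. indicator A x *\<^sub>R f x = indicator A x *\<^sub>R g x"
    by (rule AE_mp[OF AE_lborel_singleton[of c]]) (auto simp: assms(1) indicator_def)
qed (use assms(2-) in auto)

context test_function
begin

text \<open>The inverse square with coefficient \<open>c1\<close> integrates to the first-derivative
  term of \<open>L\<close>, since \<open>c1\<close> carries the factor \<open>z - y\<close> and
  \<open>M\<^sup>2 - m\<^sup>2 = \<bar>y - z\<bar>\<close>. In the terms with \<open>c2\<close> all
  multiples of \<open>M\<^sup>2\<close> cancel, leaving \<open>16 / 3 * m\<^sup>2\<close>, which is
  the source of the 2/3 in \<open>L\<close>.\<close>

lemma L_op_eq: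
  assumes nn: "y \<ge> 0" "z \<ge> 0" "y + z > 0"
  defines "M \<equiv> sqrt (max y z)" and "m \<equiv> sqrt (min y z)"
  shows "L_op \<phi> y z = (1 / M) * (LBINT \<tau>:{-1..1}. cavg_lim y z ((M + m * \<tau>)\<^sup>2))"
proof -
  have Mm: "M > 0" "0 \<le> m" "m \<le> M" "M\<^sup>2 = max y z" "m\<^sup>2 = min y z"
    using nn by (auto simp: M_def m_def max_def min_def)
  define c2 where "c2 = (d2 y + d2 z) / 2 * pi"
  define c1 where "c1 = 2 * pi * (z - y) * (d1 y - d1 z)"
  have L: "L_op \<phi> y z = 4 * pi / M * (2 / 3 * (d2 y + d2 z) * m\<^sup>2 - (d1 y - d1 z) * sgn (y - z))"
    using nn by (simp add: L_op_def deriv_eq deriv2_eq Mm(5) M_def)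
  have cl: "cavg_lim y z (w\<^sup>2) = c1 * (1 / w\<^sup>2) + c2 * (2 * (M\<^sup>2 + m\<^sup>2) - w\<^sup>2 - (M\<^sup>2 - m\<^sup>2)\<^sup>2 * (1 / w\<^sup>2))"
    if "w \<noteq> 0" for w
    unfolding cavg_lim_def gap_ratio[OF nn(1,2) that, folded M_def m_def] c1_def c2_def by simp
  note int = borel_integrable_atLeastAtMost'
  have [measurable]: "(\<lambda>\<tau>. cavg_lim y z ((M + m * \<tau>)\<^sup>2)) \<in> borel_measurable borel"
    unfolding cavg_lim_def by measurable
  show ?thesis
  proof (cases "m < M")
    case True
    have pos: "M + m * t \<noteq> 0" if "t \<in> {-1..1}" for t
    proof -
      have "m * (-1) \<le> m * t" using that Mm by (intro mult_left_mono) auto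
      then show ?thesis using True by linarith
    qed
    define k where "k = (M\<^sup>2 - m\<^sup>2)\<^sup>2"
    have "(LBINT \<tau>:{-1..1}. cavg_lim y z ((M + m * \<tau>)\<^sup>2))
       = (LBINT \<tau>:{-1..1}. (c1 - c2 * k) * (1 / (M + m * \<tau>)\<^sup>2) + c2 * (2 * (M\<^sup>2 + m\<^sup>2) - (M + m * \<tau>)\<^sup>2))"
      using pos by (intro set_lebesgue_integral_cong) (auto simp: cl k_def algebra_simps)
    also have "\<dots> = (c1 - c2 * k) * (2 / (M\<^sup>2 - m\<^sup>2)) + c2 * (2 * (2 * (M\<^sup>2 + m\<^sup>2)) - 2 * M\<^sup>2 - 2 / 3 * m\<^sup>2)"
    proof (subst set_integral_add(2))
      show "set_integrable lborel {-1..1} (\<lambda>\<tau>. (c1 - c2 * k) * (1 / (M + m * \<tau>)\<^sup>2))"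
        "set_integrable lborel {-1..1} (\<lambda>\<tau>. c2 * (2 * (M\<^sup>2 + m\<^sup>2) - (M + m * \<tau>)\<^sup>2))"
        using pos by (auto intro!: int continuous_intros)
    qed (simp only: set_integral_mult_right square_mean gap_mean[OF Mm(2) True])
    also have "(c1 - c2 * k) * (2 / (M\<^sup>2 - m\<^sup>2)) = 2 * c1 / (M\<^sup>2 - m\<^sup>2) - 2 * c2 * (M\<^sup>2 - m\<^sup>2)"
    proof -
      have "m\<^sup>2 < M\<^sup>2" using True Mm(2) by (intro power_strict_mono) auto
      then have "M\<^sup>2 - m\<^sup>2 \<noteq> 0" by linarith
      moreover have "(c1 - c2 * d\<^sup>2) * (2 / d) = 2 * c1 / d - 2 * c2 * d" if "d \<noteq> 0" for d
        using that by (simp add: field_simps power2_eq_square)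
      ultimately show ?thesis unfolding k_def by blast
    qed
    also have "2 * c1 / (M\<^sup>2 - m\<^sup>2) = - 4 * pi * (d1 y - d1 z) * sgn (y - z)"
    proof -
      have "y \<noteq> z" using True by (auto simp: M_def m_def)
      then show ?thesis unfolding Mm c1_def by (cases "y < z") (auto simp: max_def min_def field_simps)
    qed
    finally have I: "(LBINT \<tau>:{-1..1}. cavg_lim y z ((M + m * \<tau>)\<^sup>2)) = - 4 * pi * (d1 y - d1 z) * sgn (y - z) + c2 * (16 / 3 * m\<^sup>2)"
      by (simp add: algebra_simps)
    show ?thesis unfolding I L c2_def using Mm(1) by (simp add: field_simps)
  next
    case False
    then have eq: "m = M" using Mm by simp
    then have yz: "y = z" using Mm by (auto simp: max_def min_def split: if_splits)
    then have c10: "c1 = 0" by (simp add: c1_def)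
    have "(LBINT \<tau>:{-1..1}. cavg_lim y z ((M + m * \<tau>)\<^sup>2)) = (LBINT \<tau>:{-1..1}. c2 * (4 * M\<^sup>2 - (M + m * \<tau>)\<^sup>2))"
    proof (rule set_integral_cong_AE_point[where c="-1"])
      fix t :: real assume t: "t \<in> {-1..1}" "t \<noteq> -1"
      have "M + m * t = M * (1 + t)" by (simp add: eq distrib_left)
      then have "M + m * t \<noteq> 0" using t Mm by auto
      then show "cavg_lim y z ((M + m * t)\<^sup>2) = c2 * (4 * M\<^sup>2 - (M + m * t)\<^sup>2)"
        by (subst cl) (auto simp: c10 eq)
    qed auto
    also have "\<dots> = c2 * (16 / 3 * M\<^sup>2)" by (simp add: square_mean eq)
    finally have I: "(LBINT \<tau>:{-1..1}. cavg_lim y z ((M + m * \<tau>)\<^sup>2)) = c2 * (16 / 3 * M\<^sup>2)" .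
    show ?thesis unfolding I L c2_def using yz by (simp add: eq field_simps)
  qed
qed

end

section \<open>\<open>J\<close> as an integral over relative speed and transfer\<close>

lemma integral_eq_of_nn_integral_parts:
  assumes "integrable M f" "integrable N g" "c \<ge> 0"
    and "(\<integral>\<^sup>+x. ennreal (f x) \<partial>M) = ennreal c * (\<integral>\<^sup>+x. ennreal (g x) \<partial>N)"
    and "(\<integral>\<^sup>+x. ennreal (- f x) \<partial>M) = ennreal c * (\<integral>\<^sup>+x. ennreal (- g x) \<partial>N)"
  shows "(\<integral>x. f x \<partial>M) = c * (\<integral>x. g x \<partial>N)"
  using assms by (simp add: real_lebesgue_integral_def enn2real_mult right_diff_distrib)

text \<open>A crude bound that degenerates with \<open>e\<close>; it serves only to establish
  integrability for fixed \<open>e\<close>.\<close>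

lemma grazing_weight_le:
  assumes "\<And>r. \<bar>p r\<bar> \<le> c" "e > 0" "w \<le> B"
  shows "grazing_weight p e w r \<le> (B / e) / e\<^sup>2 * (2 * c)\<^sup>2 * indicator {0..B / e} r"
proof (cases "0 < r \<and> e * r < w")
  case True
  have r: "r \<le> B / e" using True assms by (simp add: pos_le_divide_eq mult.commute)
  have "0 < e * r" using True assms by simp
  then have B0: "0 \<le> B" using True assms by linarith
  define v where "v = sqrt (2 * w\<^sup>2 / e\<^sup>2 - r\<^sup>2)"
  have "\<bar>p r + p v\<bar> \<le> 2 * c" using assms(1)[of r] assms(1)[of v] by linarith
  then have "(p r + p v)\<^sup>2 \<le> (2 * c)\<^sup>2" by (rule abs_le_square_iff[THEN iffD1, OF order_trans]) simp
  then have "r / e\<^sup>2 * (p r + p v)\<^sup>2 \<le> (B / e) / e\<^sup>2 * (2 * c)\<^sup>2"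
    using r True B0 assms(2) by (intro mult_mono divide_right_mono) auto
  then show ?thesis using True r by (simp add: grazing_weight_def v_def)
next
  case False
  have "0 \<le> B" if "0 \<le> r" "r \<le> B / e"
    using order_trans[OF that] assms(2) by (simp add: zero_le_divide_iff)
  then have "0 \<le> (B / e) / e\<^sup>2 * (2 * c)\<^sup>2 * indicator {0..B / e} r"
    using assms(2) by (cases "r \<in> {0..B/e}") auto
  moreover have "grazing_weight p e w r = 0"
    unfolding grazing_weight_def using False by (rule if_not_P)
  ultimately show ?thesis by simp
qed

lemma w_bounds:
  assumes "y \<ge> 0" "z \<ge> 0" "y + z > 0" "-1 < \<tau>" "\<tau> < 1"
  defines "M \<equiv> sqrt (max y z)" and "m \<equiv> sqrt (min y z)"
  shows "M + m * \<tau> > 0" "M + m * \<tau> \<le> 2 * M" "0 \<le> gap y z ((M + m * \<tau>)\<^sup>2)"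
proof -
  define w where "w = M + m * \<tau>"
  have Mm: "M > 0" "0 \<le> m" "m \<le> M" "M\<^sup>2 = max y z" "m\<^sup>2 = min y z"
    using assms by (auto simp: M_def m_def max_def min_def)
  have "m * (-1) \<le> m * \<tau>" "m * \<tau> \<le> m * 1" using assms(4,5) mult_left_mono[OF _ Mm(2), of "-1" \<tau>] mult_left_mono[OF _ Mm(2), of \<tau> 1] by auto
  then have w: "M - m \<le> w" "w \<le> M + m" by (auto simp: w_def)
  show "M + m * \<tau> \<le> 2 * M" using w Mm by (simp add: w_def)
  show "M + m * \<tau> > 0"
  proof (cases "m = 0")
    case False
    then have "m * (-1) < m * \<tau>" using assms Mm by (intro mult_strict_left_mono) auto
    then show ?thesis using Mm by linarith
  qed (use Mm in simp)
  have "gap y z (w\<^sup>2) = (w\<^sup>2 - (M - m)\<^sup>2) * ((M + m)\<^sup>2 - w\<^sup>2)"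
  proof (cases "y \<le> z")
    case True
    then have "y = m\<^sup>2" "z = M\<^sup>2" using Mm by auto
    from gap_factor[OF this] show ?thesis by (simp add: power2_commute add.commute)
  next
    case False
    then have "y = M\<^sup>2" "z = m\<^sup>2" using Mm by auto
    from gap_factor[OF this] show ?thesis by simp
  qed
  moreover have "(M - m)\<^sup>2 \<le> w\<^sup>2" "w\<^sup>2 \<le> (M + m)\<^sup>2" using w Mm by (auto intro!: power_mono)
  ultimately show "0 \<le> gap y z ((M + m * \<tau>)\<^sup>2)" by (simp add: w_def)
qed

context test_function
begin

text \<open>The collision difference has no sign, so \<open>nn_integral_W_Phi\<close> is applied to
  its positive and negative parts and the two identities are subtracted. Fubini then performs the
  angular integral, which is \<open>cavg\<close>.\<close>

lemma J_op_eq: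
  fixes p :: "real \<Rightarrow> real"
  assumes [measurable]: "p \<in> borel_measurable borel" and c: "\<And>r. \<bar>p r\<bar> \<le> c"
    and pos: "y \<ge> 0" "z \<ge> 0" "y + z > 0" and e: "e > 0"
  defines "M \<equiv> sqrt (max y z)" and "m \<equiv> sqrt (min y z)"
  defines "k \<equiv> (\<lambda>(\<tau>, r). indicator {-1<..<1} \<tau> * grazing_weight p e (M + m * \<tau>) r
             * cavg y z (e\<^sup>2 * r\<^sup>2 / 2) ((M + m * \<tau>)\<^sup>2))"
  shows "J_op p e 1 \<phi> y z = 4 * pi / M * (\<integral>q. k q \<partial>(lborel \<Otimes>\<^sub>M lborel))"
    and "integrable (lborel \<Otimes>\<^sub>M lborel) k"
proof -
  have M: "M > 0" "0 \<le> m" using pos by (auto simp: M_def m_def max_def min_def)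
  \<comment> \<open>Clamping \<open>x\<close> to the interval from 0 to \<open>y + z\<close> extends
    the collision difference continuously to the line, keeps the reflection symmetry and makes it
    constant outside, as \<open>nn_integral_W_Phi\<close> requires.\<close>
  define D where "D x = cdiff y z (max 0 (min x (y + z)))" for x
  have cD: "continuous_on UNIV D"
    unfolding D_def cdiff_def using pos
    by (intro continuous_intros continuous_on_compose2[OF cont]) auto
  then have Dm[measurable]: "D \<in> borel_measurable borel" by (rule borel_measurable_continuous_onI)
  have Deq: "D x = cdiff y z x" if "0 \<le> x" "x \<le> y + z" for x using that by (simp add: D_def)
  have DB: "\<bar>D x\<bar> \<le> 4 * C" for x
  proof -
    define x' where "x' = max 0 (min x (y + z))"
    have x': "0 \<le> x'" "0 \<le> y + z - x'" using pos by (auto simp: x'_def)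
    show ?thesis unfolding D_def cdiff_def x'_def[symmetric]
      using bound0[OF x'(1)] bound0[OF x'(2)] bound0[OF pos(1)] bound0[OF pos(2)] by linarith
  qed
  have Dsym: "D (y + z - x) = D x" for x
    unfolding D_def cdiff_def by (cases "x \<le> 0"; cases "x \<le> y + z") (use pos in auto)
  have Dout: "D x = D 0" if "x \<le> 0 \<or> y + z \<le> x" for x
    using that pos by (auto simp: D_def cdiff_def)
  define V where "V x = W (Phi p e 1) x y z * sqrt x" for x
  have Vm[measurable]: "V \<in> borel_measurable borel" unfolding V_def by measurable
  have V0: "0 \<le> V x" if "0 < x" for x using that by (simp add: V_def W_nonneg Phi_nonneg)
  define g where "g x = V x * D x * indicator {0<..<y+z} x" for x
  have [measurable]: "g \<in> borel_measurable borel" unfolding g_def by measurable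
  define h where "h q = indicator {-1<..<1} (fst (fst q)) * grazing_weight p e (M + m * fst (fst q)) (snd (fst q))
       * (indicator {0..2*pi} (snd q) * D (post y z (e\<^sup>2 * (snd (fst q))\<^sup>2 / 2) ((M + m * fst (fst q))\<^sup>2) (snd q)))"
    for q :: "(real \<times> real) \<times> real"
  have hm[measurable]: "h \<in> borel_measurable ((lborel \<Otimes>\<^sub>M lborel) \<Otimes>\<^sub>M lborel)"
    unfolding h_def by measurable
  \<comment> \<open>The sign \<open>s\<close> is a parameter so that \<open>s = 1\<close> and
    \<open>s = -1\<close> give the positive and the negative part at once.\<close>
  have parts: "(\<integral>\<^sup>+x. ennreal (V x) * ennreal (s * D x) * indicator {0<..<y+z} x \<partial>lborel)
      = ennreal (8 * pi / M) * (\<integral>\<^sup>+q. ennreal (s * h q) \<partial>((lborel \<Otimes>\<^sub>M lborel) \<Otimes>\<^sub>M lborel))" for s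
  proof -
    interpret P: pair_sigma_finite "lborel \<Otimes>\<^sub>M lborel :: (real \<times> real) measure" "lborel :: real measure"
      unfolding lborel_prod by standard
    have "(\<integral>\<^sup>+q. ennreal (s * h q) \<partial>((lborel \<Otimes>\<^sub>M lborel) \<Otimes>\<^sub>M lborel))
       = (\<integral>\<^sup>+a. \<integral>\<^sup>+\<psi>. ennreal (s * h (a, \<psi>)) \<partial>lborel \<partial>(lborel \<Otimes>\<^sub>M lborel))"
      by (rule lborel.nn_integral_fst[symmetric]) measurable
    also have "\<dots> = (\<integral>\<^sup>+\<tau>. \<integral>\<^sup>+r. \<integral>\<^sup>+\<psi>. ennreal (s * h ((\<tau>, r), \<psi>)) \<partial>lborel \<partial>lborel \<partial>lborel)"
      by (rule lborel.nn_integral_fst[symmetric]) measurable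
    also have "\<dots> = (\<integral>\<^sup>+\<tau>. (\<integral>\<^sup>+r. ennreal (grazing_weight p e (M + m * \<tau>) r) *
            (\<integral>\<^sup>+\<psi>. ennreal (s * D (post y z (e\<^sup>2 * r\<^sup>2 / 2) ((M + m * \<tau>)\<^sup>2) \<psi>)) * indicator {0..2*pi} \<psi> \<partial>lborel) \<partial>lborel)
            * indicator {-1<..<1} \<tau> \<partial>lborel)"
    proof (intro nn_integral_cong)
      fix \<tau> :: real
      have "(\<integral>\<^sup>+\<psi>. ennreal (s * h ((\<tau>, r), \<psi>)) \<partial>lborel) = ennreal (grazing_weight p e (M + m * \<tau>) r) *
            (\<integral>\<^sup>+\<psi>. ennreal (s * D (post y z (e\<^sup>2 * r\<^sup>2 / 2) ((M + m * \<tau>)\<^sup>2) \<psi>)) * indicator {0..2*pi} \<psi> \<partial>lborel)"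
        if "\<tau> \<in> {-1<..<1}" for r
      proof -
        have "s * h ((\<tau>, r), \<psi>) = grazing_weight p e (M + m * \<tau>) r * (s * D (post y z (e\<^sup>2 * r\<^sup>2 / 2) ((M + m * \<tau>)\<^sup>2) \<psi>)) * indicator {0..2*pi} \<psi>" for \<psi>
          using that by (simp add: h_def)
        note eq = this
        have "ennreal (s * h ((\<tau>, r), \<psi>)) = ennreal (grazing_weight p e (M + m * \<tau>) r) * (ennreal (s * D (post y z (e\<^sup>2 * r\<^sup>2 / 2) ((M + m * \<tau>)\<^sup>2) \<psi>)) * indicator {0..2*pi} \<psi>)" for \<psi>
          unfolding eq by (cases "\<psi> \<in> {0..2*pi}") (simp_all add: ennreal_mult' grazing_weight_nonneg)
        then show ?thesis by (simp add: nn_integral_cmult)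
      qed
      then show "(\<integral>\<^sup>+r. \<integral>\<^sup>+\<psi>. ennreal (s * h ((\<tau>, r), \<psi>)) \<partial>lborel \<partial>lborel) = (\<integral>\<^sup>+r. ennreal (grazing_weight p e (M + m * \<tau>) r) *
            (\<integral>\<^sup>+\<psi>. ennreal (s * D (post y z (e\<^sup>2 * r\<^sup>2 / 2) ((M + m * \<tau>)\<^sup>2) \<psi>)) * indicator {0..2*pi} \<psi> \<partial>lborel) \<partial>lborel)
            * indicator {-1<..<1} \<tau>"
        by (cases "\<tau> \<in> {-1<..<1}") (simp_all add: h_def)
    qed
    finally have eq: "(\<integral>\<^sup>+q. ennreal (s * h q) \<partial>((lborel \<Otimes>\<^sub>M lborel) \<Otimes>\<^sub>M lborel)) = \<dots>" .
    show ?thesis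
      unfolding eq V_def M_def m_def
    proof (rule nn_integral_W_Phi[OF _ c _ _ _ pos e])
      show "ennreal (s * D (y + z - x)) = ennreal (s * D x)" for x by (simp only: Dsym)
      show "ennreal (s * D x) = ennreal (s * D 0)" if "x \<le> 0 \<or> y + z \<le> x" for x by (simp only: Dout[OF that])
    qed simp_all
  qed
  define B where "B = (2 * M / e) / e\<^sup>2 * (2 * c)\<^sup>2 * (4 * C)"
  have hB: "norm (h q) \<le> B * indicator (({-1..1::real} \<times> {0..2 * M / e}) \<times> {0..2*pi}) q" for q
  proof -
    obtain \<tau> r \<psi> where q: "q = ((\<tau>, r), \<psi>)" by (metis surj_pair)
    show ?thesis
    proof (cases "\<tau> \<in> {-1<..<1} \<and> \<psi> \<in> {0..2*pi}")
      case True
      have gw: "grazing_weight p e (M + m * \<tau>) r \<le> (2 * M / e) / e\<^sup>2 * (2 * c)\<^sup>2 * indicator {0..2 * M / e} r"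
        using w_bounds(2)[OF pos, of \<tau>] True by (intro grazing_weight_le c e) (auto simp: M_def m_def)
      have "norm (h q) = grazing_weight p e (M + m * \<tau>) r * \<bar>D (post y z (e\<^sup>2 * r\<^sup>2 / 2) ((M + m * \<tau>)\<^sup>2) \<psi>)\<bar>"
        using True by (simp add: h_def q abs_mult grazing_weight_nonneg)
      also have "\<dots> \<le> (2 * M / e) / e\<^sup>2 * (2 * c)\<^sup>2 * indicator {0..2 * M / e} r * (4 * C)"
        using gw order_trans[OF grazing_weight_nonneg gw] DB by (intro mult_mono) (auto simp: grazing_weight_nonneg)
      also have "\<dots> = B * indicator (({-1..1::real} \<times> {0..2 * M / e}) \<times> {0..2*pi}) q"
        using True by (simp add: q B_def indicator_times)
      finally show ?thesis .
    next
      case False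
      have "0 \<le> B" using M e C_nonneg by (simp add: B_def)
      then show ?thesis using False by (auto simp: q h_def indicator_def)
    qed
  qed
  have hint: "integrable ((lborel \<Otimes>\<^sub>M lborel) \<Otimes>\<^sub>M lborel) h"
  proof (rule Bochner_Integration.integrable_bound[where f="\<lambda>q. B * indicator (({-1..1::real} \<times> {0..2 * M / e}) \<times> {0..2*pi}) q"])
    interpret P: pair_sigma_finite "lborel \<Otimes>\<^sub>M lborel :: (real \<times> real) measure" "lborel :: real measure"
      unfolding lborel_prod by standard
    have "emeasure ((lborel \<Otimes>\<^sub>M lborel) \<Otimes>\<^sub>M lborel) (({-1..1::real} \<times> {0..2 * M / e}) \<times> {0..2*pi})
      = emeasure lborel {-1..1::real} * emeasure lborel {0..2 * M / e} * emeasure lborel {0..2*pi}"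
    proof -
      have A: "{-1..1::real} \<times> {0..2 * M / e} \<in> sets (lborel \<Otimes>\<^sub>M lborel)" by (intro pair_measureI) auto
      show ?thesis
        by (subst lborel.emeasure_pair_measure_Times[OF A]) (simp_all add: lborel.emeasure_pair_measure_Times)
    qed
    also have "\<dots> < \<infinity>" by (simp add: emeasure_lborel_Icc_eq ennreal_mult_less_top)
    finally show "integrable ((lborel \<Otimes>\<^sub>M lborel) \<Otimes>\<^sub>M lborel) (\<lambda>q. B * indicator (({-1..1::real} \<times> {0..2 * M / e}) \<times> {0..2*pi}) q)"
      by (intro integrable_mult_right integrable_real_indicator) auto
    show "AE q in (lborel \<Otimes>\<^sub>M lborel) \<Otimes>\<^sub>M lborel. norm (h q) \<le> norm (B * indicator (({-1..1::real} \<times> {0..2 * M / e}) \<times> {0..2*pi}) q)"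
      using hB by (intro AE_I2) (metis abs_ge_self order_trans real_norm_def)
  qed simp
  have es: "ennreal (s * g x) = ennreal (V x) * ennreal (s * D x) * indicator {0<..<y+z} x" for s x
    by (cases "0 < x") (auto simp: g_def indicator_def ennreal_mult'[OF V0, symmetric] mult_ac)
  \<comment> \<open>The absolute value of \<open>g\<close> is the sum of its two parts, and
    \<open>parts\<close> expresses their integrals through those of the bounded, compactly supported
    \<open>h\<close>.\<close>
  have gint: "integrable lborel g"
  proof (rule integrableI_bounded)
    have "ennreal (norm (g x)) \<le> ennreal (1 * g x) + ennreal (-1 * g x)" for x
      by (cases "g x \<ge> 0") (auto simp: ennreal_neg)
    then have "(\<integral>\<^sup>+x. ennreal (norm (g x)) \<partial>lborel) \<le> (\<integral>\<^sup>+x. ennreal (1 * g x) + ennreal (-1 * g x) \<partial>lborel)"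
      by (intro nn_integral_mono)
    also have "\<dots> = (\<integral>\<^sup>+x. ennreal (1 * g x) \<partial>lborel) + (\<integral>\<^sup>+x. ennreal (-1 * g x) \<partial>lborel)"
      by (rule nn_integral_add) auto
    also have "\<dots> < \<infinity>"
    proof -
      have "(\<integral>\<^sup>+q. ennreal (s * h q) \<partial>((lborel \<Otimes>\<^sub>M lborel) \<Otimes>\<^sub>M lborel)) < \<infinity>" for s
      proof -
        have "integrable ((lborel \<Otimes>\<^sub>M lborel) \<Otimes>\<^sub>M lborel) (\<lambda>q. s * h q)"
          using hint by (rule integrable_mult_right)
        then show ?thesis unfolding real_integrable_def by (simp only: less_top infinity_ennreal_def)
      qed
      from this[of 1] this[of "-1"] show ?thesis
        unfolding es parts by (simp add: ennreal_mult_less_top)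
    qed
    finally show "(\<integral>\<^sup>+x. ennreal (norm (g x)) \<partial>lborel) < \<infinity>" .
  qed simp
  have main: "(\<integral>x. g x \<partial>lborel) = 8 * pi / M * (\<integral>q. h q \<partial>((lborel \<Otimes>\<^sub>M lborel) \<Otimes>\<^sub>M lborel))"
  proof (rule integral_eq_of_nn_integral_parts[OF gint hint])
    show "(\<integral>\<^sup>+x. ennreal (g x) \<partial>lborel) = ennreal (8 * pi / M) * (\<integral>\<^sup>+q. ennreal (h q) \<partial>((lborel \<Otimes>\<^sub>M lborel) \<Otimes>\<^sub>M lborel))"
      using parts[of 1] es[of 1] by simp
    show "(\<integral>\<^sup>+x. ennreal (- g x) \<partial>lborel) = ennreal (8 * pi / M) * (\<integral>\<^sup>+q. ennreal (- h q) \<partial>((lborel \<Otimes>\<^sub>M lborel) \<Otimes>\<^sub>M lborel))"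
      using parts[of "-1"] es[of "-1"] by simp
  qed (use M in simp)
  have inner: "(\<integral>\<psi>. h (a, \<psi>) \<partial>lborel) = k a" for a
  proof -
    obtain \<tau> r where a: "a = (\<tau>, r)" by (cases a)
    define w where "w = M + m * \<tau>"
    show ?thesis
    proof (cases "\<tau> \<in> {-1<..<1} \<and> 0 < r \<and> e * r < w")
      case True
      have w: "w > 0" "0 \<le> gap y z (w\<^sup>2)" using w_bounds[OF pos, of \<tau>] True by (auto simp: w_def M_def m_def)
      have "(e * r)\<^sup>2 \<le> w\<^sup>2" using True e by (intro power_mono) auto
      then have "e\<^sup>2 * r\<^sup>2 \<le> w\<^sup>2" by (simp add: power_mult_distrib)
      moreover have "0 \<le> e\<^sup>2 * r\<^sup>2" by simp
      ultimately have s: "0 \<le> e\<^sup>2 * r\<^sup>2 / 2" "e\<^sup>2 * r\<^sup>2 / 2 \<le> w\<^sup>2" by linarith+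
      have "(\<integral>\<psi>. h (a, \<psi>) \<partial>lborel) = grazing_weight p e w r * (\<integral>\<psi>. indicator {0..2*pi} \<psi> * D (post y z (e\<^sup>2 * r\<^sup>2 / 2) (w\<^sup>2) \<psi>) \<partial>lborel)"
        using True by (simp add: h_def a w_def)
      also have "(\<integral>\<psi>. indicator {0..2*pi} \<psi> * D (post y z (e\<^sup>2 * r\<^sup>2 / 2) (w\<^sup>2) \<psi>) \<partial>lborel) = cavg y z (e\<^sup>2 * r\<^sup>2 / 2) (w\<^sup>2)"
        using post_range[OF pos(1,2) s _ w(2)] w(1)
        by (simp add: cavg_def set_lebesgue_integral_def Deq)
      finally show ?thesis using True by (simp add: k_def a w_def)
    next
      case False
      then have "h (a, \<psi>) = 0" "k a = 0" for \<psi>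
        by (auto simp: h_def k_def a grazing_weight_def w_def indicator_def)
      then show ?thesis by simp
    qed
  qed
  interpret P: pair_sigma_finite "lborel \<Otimes>\<^sub>M lborel :: (real \<times> real) measure" "lborel :: real measure"
    unfolding lborel_prod by standard
  have "(\<integral>q. h q \<partial>((lborel \<Otimes>\<^sub>M lborel) \<Otimes>\<^sub>M lborel)) = (\<integral>a. k a \<partial>(lborel \<Otimes>\<^sub>M lborel))"
    using P.integral_fst'[OF hint] by (simp add: inner)
  moreover have "J_op p e 1 \<phi> y z = 1 / 2 * (\<integral>x. g x \<partial>lborel)"
  proof -
    have "(LBINT x:{0..y + z}. K_op p e 1 \<phi> x y z * sqrt x) = (\<integral>x. g x \<partial>lborel)"
      unfolding set_lebesgue_integral_def
    proof (rule integral_cong_AE)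
      show "AE x in lborel. indicator {0..y + z} x *\<^sub>R (K_op p e 1 \<phi> x y z * sqrt x) = g x"
      proof (rule AE_mp[OF AE_lborel_singleton[of 0]], rule AE_mp[OF AE_lborel_singleton[of "y+z"]], intro AE_I2 impI)
        fix x :: real assume "x \<noteq> y + z" "x \<noteq> 0"
        then show "indicator {0..y + z} x *\<^sub>R (K_op p e 1 \<phi> x y z * sqrt x) = g x"
          by (auto simp: g_def V_def K_op_def Deq cdiff_def x_star_def indicator_def)
      qed
      define \<phi>0 where "\<phi>0 x = \<phi> (max 0 x)" for x
      have "continuous_on UNIV \<phi>0" unfolding \<phi>0_def by (intro continuous_on_compose2[OF cont] continuous_intros) auto
      then have [measurable]: "\<phi>0 \<in> borel_measurable borel" by (rule borel_measurable_continuous_onI)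
      have "(\<lambda>x. indicator {0..y + z} x *\<^sub>R (K_op p e 1 \<phi> x y z * sqrt x))
        = (\<lambda>x. indicator {0..y + z} x *\<^sub>R (W (Phi p e 1) x y z * (\<phi>0 x + \<phi>0 (y + z - x) - \<phi> y - \<phi> z) * sqrt x))"
        by (auto simp: K_op_def indicator_def x_star_def \<phi>0_def max_def)
      then show "(\<lambda>x. indicator {0..y + z} x *\<^sub>R (K_op p e 1 \<phi> x y z * sqrt x)) \<in> borel_measurable lborel"
        by simp
    qed simp
    then show ?thesis by (simp add: J_op_def)
  qed
  ultimately show "J_op p e 1 \<phi> y z = 4 * pi / M * (\<integral>q. k q \<partial>(lborel \<Otimes>\<^sub>M lborel))"
    using main by simp
  show "integrable (lborel \<Otimes>\<^sub>M lborel) k"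
    using P.integrable_fst'[OF hint] by (simp add: inner)
qed

end

subsection \<open>The grazing limit of the quadratic term\<close>

text \<open>Instantiated with \<open>phihat (max 0 r)\<close>, so that measurability and the bound
  \<open>c0\<close> hold on the whole line.\<close>

locale profile =
  fixes p :: "real \<Rightarrow> real" and c0 c1 :: real
  assumes p_measurable [measurable]: "p \<in> borel_measurable borel"
    and p_bound: "\<And>r. \<bar>p r\<bar> \<le> c0"
    and p_decay: "\<And>r. r \<ge> 0 \<Longrightarrow> r * \<bar>p r\<bar> \<le> c1"
    and p_normalized: "2 * pi * (LBINT r:{0..}. r ^ 3 * \<bar>p r\<bar>\<^sup>2) = 1"
begin

definition dens :: "real \<Rightarrow> real" where
  "dens r = indicator {0<..} r * (r ^ 3 * (p r)\<^sup>2)"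

lemma dens_measurable [measurable]: "dens \<in> borel_measurable borel"
  unfolding dens_def by measurable

lemma dens_nonneg: "dens r \<ge> 0"
  by (simp add: dens_def indicator_def)

lemma dens_integral: "(\<integral>r. dens r \<partial>lborel) = 1 / (2 * pi)" and dens_integrable: "integrable lborel dens"
proof -
  have "(LBINT r:{0..}. r ^ 3 * \<bar>p r\<bar>\<^sup>2) = (\<integral>r. dens r \<partial>lborel)"
    unfolding set_lebesgue_integral_def dens_def
  proof (rule integral_cong_AE)
    show "AE r in lborel. indicator {0..} r *\<^sub>R (r ^ 3 * \<bar>p r\<bar>\<^sup>2) = indicator {0<..} r * (r ^ 3 * (p r)\<^sup>2)"
      by (rule AE_mp[OF AE_lborel_singleton[of 0]]) (auto simp: indicator_def)
  qed simp_all
  then show *: "(\<integral>r. dens r \<partial>lborel) = 1 / (2 * pi)"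
    using p_normalized by (simp add: field_simps)
  \<comment> \<open>Integrability is read off from the normalisation: a function that is not
    integrable has Bochner integral 0, not \<open>1 / (2 * pi)\<close>.\<close>
  then show "integrable lborel dens"
    using not_integrable_integral_eq[of lborel dens] by auto
qed

definition tail :: "real \<Rightarrow> real" where
  "tail k = (\<integral>r. indicator {k<..} r * dens r \<partial>lborel)"

lemma tail_integrable: "integrable lborel (\<lambda>r. indicator {k<..} r * dens r)"
  using integrable_mult_indicator[OF _ dens_integrable, of "{k<..}"] by simp

lemma tail_bounds: "0 \<le> tail k" "tail k \<le> 1 / (2 * pi)"
proof -
  show "0 \<le> tail k" unfolding tail_def by (intro Bochner_Integration.integral_nonneg) (simp add: dens_nonneg)
  show "tail k \<le> 1 / (2 * pi)"
    unfolding tail_def dens_integral[symmetric]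
    by (intro integral_mono tail_integrable dens_integrable) (auto simp: indicator_def dens_nonneg)
qed

lemma tail_tendsto:
  assumes "filterlim kn at_top sequentially"
  shows "(\<lambda>n. tail (kn n)) \<longlonglongrightarrow> 0"
proof -
  have "(\<lambda>n. \<integral>r. indicator {kn n<..} r * dens r \<partial>lborel) \<longlonglongrightarrow> (\<integral>r. (0::real) \<partial>(lborel :: real measure))"
  proof (rule integral_dominated_convergence[where w=dens and s="\<lambda>n r. indicator {kn n<..} r * dens r" and f="\<lambda>_. 0"])
    show "AE r in lborel. (\<lambda>n. indicator {kn n<..} r * dens r) \<longlonglongrightarrow> 0"
    proof (intro AE_I2)
      fix r :: real
      have "\<forall>\<^sub>F n in sequentially. r < kn n"
        using assms by (simp add: filterlim_at_top_dense)
      then have "\<forall>\<^sub>F n in sequentially. indicator {kn n<..} r * dens r = 0"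
        by eventually_elim simp
      then show "(\<lambda>n. indicator {kn n<..} r * dens r) \<longlonglongrightarrow> 0" by (rule tendsto_eventually)
    qed
  qed (auto simp: dens_integrable dens_nonneg indicator_def)
  then show ?thesis by (simp add: tail_def)
qed

text \<open>The part of the mass of \<open>dens\<close> seen through the second argument of the kernel; it is a piece of the
  tail of \<open>dens\<close>, hence negligible.\<close>

definition dens_refl :: "real \<Rightarrow> real \<Rightarrow> real" where
  "dens_refl k r = indicator {0<..<k} r * (r ^ 3 * (p (sqrt (2 * k\<^sup>2 - r\<^sup>2)))\<^sup>2)"

lemma dens_refl_measurable [measurable]:
  assumes [measurable]: "f \<in> borel_measurable M" "g \<in> borel_measurable M"
  shows "(\<lambda>w. dens_refl (f w) (g w)) \<in> borel_measurable M"
  unfolding dens_refl_def indicator_def greaterThanLessThan_iff by measurable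

lemma dens_refl_nonneg: "dens_refl k r \<ge> 0"
  by (simp add: dens_refl_def indicator_def)

text \<open>The substitution \<open>\<rho>\<^sup>2 = 2 * k\<^sup>2 - r\<^sup>2\<close> carries
  arguments below \<open>k\<close> to arguments above \<open>k\<close>, preserves
  \<open>r dr\<close> up to sign and satisfies \<open>r \<le> \<rho>\<close>. The cubic weight in
  \<open>r\<close> is therefore dominated by the cubic weight in \<open>\<rho>\<close>. The
  computation runs through \<open>t = \<rho>\<^sup>2 / 2\<close>.\<close>

lemma nn_integral_dens_refl: "(\<integral>\<^sup>+r. ennreal (dens_refl k r) \<partial>lborel) \<le> ennreal (tail k)"
proof (cases "k > 0")
  case True
  define G where "G t = ennreal (2 * t * (p (sqrt (2 * t)))\<^sup>2) * indicator {k\<^sup>2 / 2<..<k\<^sup>2} t" for t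
  have [measurable]: "G \<in> borel_measurable borel" unfolding G_def by measurable
  have "(\<integral>\<^sup>+r. ennreal (dens_refl k r) \<partial>lborel)
     \<le> (\<integral>\<^sup>+r. ennreal (1\<^sup>2 * r) * G (k\<^sup>2 - 1\<^sup>2 * r\<^sup>2 / 2) * indicator {0<..} r \<partial>lborel)"
  proof (intro nn_integral_mono)
    fix r :: real
    show "ennreal (dens_refl k r) \<le> ennreal (1\<^sup>2 * r) * G (k\<^sup>2 - 1\<^sup>2 * r\<^sup>2 / 2) * indicator {0<..} r"
    proof (cases "r \<in> {0<..<k}")
      case r: True
      then have rk: "r\<^sup>2 < k\<^sup>2" by (intro power_strict_mono) auto
      define t where "t = k\<^sup>2 - r\<^sup>2 / 2"
      have 2: "2 * t = 2 * k\<^sup>2 - r\<^sup>2" by (simp add: t_def)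
      have rp: "r\<^sup>2 > 0" using r by simp
      have tt: "t \<in> {k\<^sup>2 / 2<..<k\<^sup>2}" using rk rp by (simp add: t_def)
      have "dens_refl k r = r * (r\<^sup>2 * (p (sqrt (2 * t)))\<^sup>2)"
        using r by (simp add: dens_refl_def 2 power3_eq_cube power2_eq_square)
      also have "\<dots> \<le> r * (2 * t * (p (sqrt (2 * t)))\<^sup>2)"
        using r rk by (intro mult_left_mono mult_right_mono) (auto simp: 2)
      finally have "ennreal (dens_refl k r) \<le> ennreal (r * (2 * t * (p (sqrt (2 * t)))\<^sup>2))"
        by (rule ennreal_leI)
      also have "\<dots> = ennreal r * ennreal (2 * t * (p (sqrt (2 * t)))\<^sup>2)"
        using r by (intro ennreal_mult') simp
      finally show ?thesis using r tt by (simp add: G_def t_def)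
    qed (simp add: dens_refl_def)
  qed
  also have "\<dots> = (\<integral>\<^sup>+t. G (k\<^sup>2 - t) * indicator {0<..} t \<partial>lborel)"
    by (rule nn_integral_half_square_substitution[symmetric]) simp_all
  also have "\<dots> \<le> (\<integral>\<^sup>+t. G (k\<^sup>2 + (-1) * t) \<partial>lborel)"
    by (intro nn_integral_mono) (auto split: split_indicator)
  also have "\<dots> = (\<integral>\<^sup>+t. G t \<partial>lborel)"
    by (subst nn_integral_real_affine[where c="-1" and t="k\<^sup>2" and f=G]) simp_all
  also have "\<dots> \<le> (\<integral>\<^sup>+t. (ennreal (2 * t * (p (sqrt (2 * t)))\<^sup>2) * indicator {k\<^sup>2 / 2<..} t) * indicator {0<..} t \<partial>lborel)"
  proof (intro nn_integral_mono)
    fix t :: real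
    have "0 < t" if "k\<^sup>2 / 2 < t" using that True zero_le_power2[of k] by linarith
    then show "G t \<le> (ennreal (2 * t * (p (sqrt (2 * t)))\<^sup>2) * indicator {k\<^sup>2 / 2<..} t) * indicator {0<..} t"
      by (auto simp: G_def split: split_indicator)
  qed
  also have "\<dots> = (\<integral>\<^sup>+r. ennreal (1\<^sup>2 * r) * (ennreal (2 * (1\<^sup>2 * r\<^sup>2 / 2) * (p (sqrt (2 * (1\<^sup>2 * r\<^sup>2 / 2))))\<^sup>2) * indicator {k\<^sup>2 / 2<..} (1\<^sup>2 * r\<^sup>2 / 2)) * indicator {0<..} r \<partial>lborel)"
    by (rule nn_integral_half_square_substitution) simp_all
  also have "\<dots> = (\<integral>\<^sup>+r. ennreal (indicator {k<..} r * dens r) \<partial>lborel)"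
  proof (intro nn_integral_cong)
    fix r :: real
    show "ennreal (1\<^sup>2 * r) * (ennreal (2 * (1\<^sup>2 * r\<^sup>2 / 2) * (p (sqrt (2 * (1\<^sup>2 * r\<^sup>2 / 2))))\<^sup>2) * indicator {k\<^sup>2 / 2<..} (1\<^sup>2 * r\<^sup>2 / 2)) * indicator {0<..} r
      = ennreal (indicator {k<..} r * dens r)"
    proof (cases "r > 0")
      case r: True
      have "k\<^sup>2 < r\<^sup>2 \<longleftrightarrow> k < r" using r True by (intro iffI) (auto intro: power2_less_imp_less power_strict_mono)
      then show ?thesis
        using r by (auto simp: dens_def indicator_def ennreal_mult'[symmetric] power3_eq_cube power2_eq_square)
    qed (use True in \<open>auto simp: dens_def indicator_def\<close>)
  qed
  also have "\<dots> = ennreal (tail k)"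
    unfolding tail_def by (rule nn_integral_eq_integral[OF tail_integrable]) (simp add: dens_nonneg)
  finally show ?thesis .
qed (simp add: dens_refl_def)

lemma dens_refl_integrable: "integrable lborel (dens_refl k)"
  and dens_refl_integral: "(\<integral>r. dens_refl k r \<partial>lborel) \<le> tail k"
proof -
  show i: "integrable lborel (dens_refl k)"
    by (rule integrableI_nonneg) (auto simp: dens_refl_nonneg intro: le_less_trans[OF nn_integral_dens_refl])
  have "ennreal (\<integral>r. dens_refl k r \<partial>lborel) = (\<integral>\<^sup>+r. ennreal (dens_refl k r) \<partial>lborel)"
    by (rule nn_integral_eq_integral[symmetric, OF i]) (simp add: dens_refl_nonneg)
  then show "(\<integral>r. dens_refl k r \<partial>lborel) \<le> tail k"
    using nn_integral_dens_refl[of k] ennreal_le_iff[OF tail_bounds(1)] by metis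
qed

end

lemma integrable_product_iterated:
  fixes f :: "real \<Rightarrow> real \<Rightarrow> real"
  assumes m: "case_prod f \<in> borel_measurable (lborel \<Otimes>\<^sub>M lborel)" and nn: "\<And>x r. 0 \<le> f x r"
    and i: "\<And>x. integrable lborel (f x)" and b: "\<And>x. (\<integral>r. f x r \<partial>lborel) \<le> g x" and g: "integrable lborel g"
  shows "integrable (lborel \<Otimes>\<^sub>M lborel) (case_prod f)"
    and "(\<integral>q. case_prod f q \<partial>(lborel \<Otimes>\<^sub>M lborel)) \<le> (\<integral>x. g x \<partial>lborel)"
proof -
  have g0: "0 \<le> (\<integral>r. f x r \<partial>lborel)" for x by (intro Bochner_Integration.integral_nonneg nn)
  have mi: "(\<lambda>x. \<integral>r. f x r \<partial>lborel) \<in> borel_measurable lborel"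
    using m by measurable
  have gi: "integrable lborel (\<lambda>x. \<integral>r. f x r \<partial>lborel)"
    by (rule Bochner_Integration.integrable_bound[OF g mi]) (use g0 in \<open>auto intro!: AE_I2 simp: abs_of_nonneg intro: order_trans[OF b abs_ge_self]\<close>)
  show 1: "integrable (lborel \<Otimes>\<^sub>M lborel) (case_prod f)"
    by (rule lborel_pair.Fubini_integrable[OF m]) (use gi i nn in simp_all)
  show "(\<integral>q. case_prod f q \<partial>(lborel \<Otimes>\<^sub>M lborel)) \<le> (\<integral>x. g x \<partial>lborel)"
    using lborel_pair.integral_fst'[OF 1] integral_mono[OF gi g b] by simp
qed

lemma integrable_product_times:
  fixes f g :: "real \<Rightarrow> real"
  assumes "integrable lborel f" "integrable lborel g"
  shows "integrable (lborel \<Otimes>\<^sub>M lborel) (\<lambda>(x, y). f x * g y)"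
    and "(\<integral>q. (\<lambda>(x, y). f x * g y) q \<partial>(lborel \<Otimes>\<^sub>M lborel)) = (\<integral>x. f x \<partial>lborel) * (\<integral>y. g y \<partial>lborel)"
proof -
  have [measurable]: "f \<in> borel_measurable borel" "g \<in> borel_measurable borel" using assms by auto
  show 1: "integrable (lborel \<Otimes>\<^sub>M lborel) (\<lambda>(x, y). f x * g y)"
  proof (rule lborel_pair.Fubini_integrable)
    show "integrable lborel (\<lambda>x. \<integral>y. norm (case (x, y) of (x, y) \<Rightarrow> f x * g y) \<partial>lborel)"
      using assms by (simp add: abs_mult)
    show "AE x in lborel. integrable lborel (\<lambda>y. case (x, y) of (x, y) \<Rightarrow> f x * g y)"
      using assms by simp
  qed measurable
  show "(\<integral>q. (\<lambda>(x, y). f x * g y) q \<partial>(lborel \<Otimes>\<^sub>M lborel)) = (\<integral>x. f x \<partial>lborel) * (\<integral>y. g y \<partial>lborel)"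
    using lborel_pair.integral_fst'[OF 1] by simp
qed

text \<open>This is the form in which Young's inequality with a free weight \<open>\<eta>\<close>
  enters: for fixed \<open>\<eta>\<close> the bound tends to \<open>A * \<eta>\<close>, and
  \<open>\<eta>\<close> is arbitrary.\<close>

lemma tendsto_zero_tradeoff:
  fixes a X :: "nat \<Rightarrow> real"
  assumes X: "X \<longlonglongrightarrow> 0" and A: "A \<ge> 0"
    and b: "\<And>\<eta>. \<eta> > 0 \<Longrightarrow> \<forall>\<^sub>F n in sequentially. \<bar>a n\<bar> \<le> A * (\<eta> + (1 + 1 / \<eta>) * X n)"
  shows "a \<longlonglongrightarrow> 0"
proof (rule tendstoI)
  fix e :: real assume e: "e > 0"
  define \<eta> where "\<eta> = e / (2 * (A + 1))"
  have \<eta>: "\<eta> > 0" using e A by (simp add: \<eta>_def)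
  have "(\<lambda>n. A * (\<eta> + (1 + 1 / \<eta>) * X n)) \<longlonglongrightarrow> A * (\<eta> + (1 + 1 / \<eta>) * 0)"
    by (intro tendsto_intros X)
  moreover have "A * (\<eta> + (1 + 1 / \<eta>) * 0) < e"
  proof -
    have "A * \<eta> \<le> (A + 1) * \<eta>" using \<eta> by simp
    also have "\<dots> = e / 2" using A by (simp add: \<eta>_def field_simps)
    finally show ?thesis using e by simp
  qed
  ultimately have "\<forall>\<^sub>F n in sequentially. A * (\<eta> + (1 + 1 / \<eta>) * X n) < e"
    by (rule order_tendstoD(2))
  with b[OF \<eta>] show "\<forall>\<^sub>F n in sequentially. dist (a n) 0 < e"
    by eventually_elim (simp add: dist_real_def)
qed

definition rel_speed :: "real \<Rightarrow> real \<Rightarrow> real \<Rightarrow> real" where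
  "rel_speed y z \<tau> = sqrt (max y z) + sqrt (min y z) * \<tau>"

lemma rel_speed_measurable [measurable]: "rel_speed y z \<in> borel_measurable borel"
  unfolding rel_speed_def by measurable

lemma rel_speed_props:
  assumes "y \<ge> 0" "z \<ge> 0" "0 < rel_speed y z \<tau>" "-1 < \<tau>" "\<tau> < 1"
  shows "y + z > 0" "0 \<le> gap y z ((rel_speed y z \<tau>)\<^sup>2)"
proof -
  show "y + z > 0"
  proof (rule ccontr)
    assume "\<not> y + z > 0"
    then have "y = 0" "z = 0" using assms by auto
    then show False using assms by (simp add: rel_speed_def)
  qed
  then show "0 \<le> gap y z ((rel_speed y z \<tau>)\<^sup>2)"
    using w_bounds(3)[OF assms(1,2) _ assms(4,5)] by (simp add: rel_speed_def)
qed

locale collision = profile p c0 c1 + test_function \<phi> d1 d2 C for p c0 c1 \<phi> d1 d2 C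
begin

definition kern :: "real \<Rightarrow> real \<Rightarrow> real \<Rightarrow> real \<times> real \<Rightarrow> real" where
  "kern e y z = (\<lambda>(\<tau>, r). indicator {-1<..<1} \<tau> * grazing_weight p e (rel_speed y z \<tau>) r
     * cavg y z (e\<^sup>2 * r\<^sup>2 / 2) ((rel_speed y z \<tau>)\<^sup>2))"

text \<open>The model kernel retains only \<open>(p r)\<^sup>2\<close> from the square in
  \<open>grazing_weight\<close>. The limit is computed for it, and \<open>kern_diff_tendsto\<close>
  disposes of the rest.\<close>

definition kern0 :: "real \<Rightarrow> real \<Rightarrow> real \<Rightarrow> real \<times> real \<Rightarrow> real" where
  "kern0 e y z = (\<lambda>(\<tau>, r). indicator {-1<..<1} \<tau> *
     (if 0 < r \<and> e * r < rel_speed y z \<tau> then r / e\<^sup>2 * (p r)\<^sup>2 else 0)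
     * cavg y z (e\<^sup>2 * r\<^sup>2 / 2) ((rel_speed y z \<tau>)\<^sup>2))"

lemma J_op_kern:
  assumes "y \<ge> 0" "z \<ge> 0" "y + z > 0" "e > 0"
  shows "J_op p e 1 \<phi> y z = 4 * pi / sqrt (max y z) * (\<integral>q. kern e y z q \<partial>(lborel \<Otimes>\<^sub>M lborel))"
    "integrable (lborel \<Otimes>\<^sub>M lborel) (kern e y z)"
  using J_op_eq[OF p_measurable p_bound assms] by (simp_all add: kern_def rel_speed_def)

lemma cavg_scaled:
  assumes "y \<ge> 0" "z \<ge> 0" "e > 0" "-1 < \<tau>" "\<tau> < 1" "0 < r" "e * r < rel_speed y z \<tau>"
  shows "\<bar>cavg y z (e\<^sup>2 * r\<^sup>2 / 2) ((rel_speed y z \<tau>)\<^sup>2)\<bar> \<le> 8 * pi * C * (y + z) * (e\<^sup>2 * r\<^sup>2)"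
proof -
  have er: "0 < e * r" using assms by simp
  then have w: "rel_speed y z \<tau> > 0" using assms by linarith
  have "(e * r)\<^sup>2 \<le> (rel_speed y z \<tau>)\<^sup>2" using assms er by (intro power_mono) auto
  then have "e\<^sup>2 * r\<^sup>2 \<le> (rel_speed y z \<tau>)\<^sup>2" by (simp add: power_mult_distrib)
  moreover have "0 \<le> e\<^sup>2 * r\<^sup>2" by simp
  ultimately have s: "0 \<le> e\<^sup>2 * r\<^sup>2 / 2" "e\<^sup>2 * r\<^sup>2 / 2 \<le> (rel_speed y z \<tau>)\<^sup>2" by linarith+
  have w2: "0 < (rel_speed y z \<tau>)\<^sup>2" using w by simp
  have eq: "16 * pi * C * (e\<^sup>2 * r\<^sup>2 / 2) * (y + z) = 8 * pi * C * (y + z) * (e\<^sup>2 * r\<^sup>2)" by simp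
  show ?thesis
    using cavg_bound[OF assms(1,2) s w2 rel_speed_props(2)[OF assms(1,2) w assms(4,5)]] unfolding eq .
qed

lemma weighted_square_bound:
  fixes X K e r b B :: real
  assumes X: "\<bar>X\<bar> \<le> K * (e\<^sup>2 * r\<^sup>2)" and e: "e > 0" and r: "r > 0" and K: "K \<ge> 0"
    and B: "\<bar>b\<bar> \<le> B"
  shows "\<bar>r / e\<^sup>2 * b * X\<bar> \<le> K * (r ^ 3 * B)"
proof -
  have "\<bar>r / e\<^sup>2 * b * X\<bar> = r / e\<^sup>2 * (\<bar>b\<bar> * \<bar>X\<bar>)"
    using r by (simp add: abs_mult)
  also have "\<dots> \<le> r / e\<^sup>2 * (B * (K * (e\<^sup>2 * r\<^sup>2)))"
    using r X B by (intro mult_left_mono mult_mono) auto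
  also have "\<dots> = K * (r ^ 3 * B)"
    using e by (simp add: power3_eq_cube power2_eq_square)
  finally show ?thesis .
qed

text \<open>By \<open>cavg_scaled\<close> the angular mean supplies
  \<open>e\<^sup>2 * r\<^sup>2\<close>, which turns \<open>r / e\<^sup>2\<close> into the weight
  \<open>r ^ 3\<close> of \<open>dens\<close>. With \<open>q\<close> the value of \<open>p\<close>
  at the reflected argument, the difference of the kernels contains
  \<open>2 * p r * q + q\<^sup>2\<close>, and Young's inequality with weight \<open>\<eta>\<close>
  handles the mixed term.\<close>

lemma kern_estimates:
  assumes yz: "y \<ge> 0" "z \<ge> 0" and e: "e > 0"
  defines "K \<equiv> 8 * pi * C * (y + z)"
  shows "\<bar>kern e y z (\<tau>, r)\<bar> \<le> K * (2 * (indicator {-1<..<1} \<tau> * (dens r + dens_refl (rel_speed y z \<tau> / e) r)))"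
    and "\<bar>kern0 e y z (\<tau>, r)\<bar> \<le> K * (indicator {-1<..<1} \<tau> * dens r)"
    and "\<eta> > 0 \<Longrightarrow> \<bar>kern e y z (\<tau>, r) - kern0 e y z (\<tau>, r)\<bar> \<le>
      K * (indicator {-1<..<1} \<tau> * (\<eta> * dens r + (1 + 1 / \<eta>) * dens_refl (rel_speed y z \<tau> / e) r))"
proof -
  have K: "K \<ge> 0" using yz C_nonneg by (simp add: K_def)
  define w where "w = rel_speed y z \<tau>"
  define X where "X = cavg y z (e\<^sup>2 * r\<^sup>2 / 2) (w\<^sup>2)"
  define q where "q = p (sqrt (2 * (w / e)\<^sup>2 - r\<^sup>2))"
  have all: "\<bar>kern e y z (\<tau>, r)\<bar> \<le> K * (2 * (indicator {-1<..<1} \<tau> * (dens r + dens_refl (rel_speed y z \<tau> / e) r)))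
    \<and> \<bar>kern0 e y z (\<tau>, r)\<bar> \<le> K * (indicator {-1<..<1} \<tau> * dens r)
    \<and> (\<forall>\<eta>>0. \<bar>kern e y z (\<tau>, r) - kern0 e y z (\<tau>, r)\<bar> \<le>
      K * (indicator {-1<..<1} \<tau> * (\<eta> * dens r + (1 + 1 / \<eta>) * dens_refl (rel_speed y z \<tau> / e) r)))"
  proof (cases "\<tau> \<in> {-1<..<1} \<and> 0 < r \<and> e * r < w")
    case True
    have X: "\<bar>X\<bar> \<le> K * (e\<^sup>2 * r\<^sup>2)"
      unfolding X_def K_def w_def by (rule cavg_scaled) (use assms True in \<open>auto simp: w_def\<close>)
    have rw: "r < w / e" using True e by (simp add: pos_less_divide_eq mult.commute)
    have k: "kern e y z (\<tau>, r) = r / e\<^sup>2 * (p r + q)\<^sup>2 * X"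
      using True by (simp add: kern_def grazing_weight_def w_def[symmetric] X_def q_def power_divide)
    have k0: "kern0 e y z (\<tau>, r) = r / e\<^sup>2 * (p r)\<^sup>2 * X"
      using True by (simp add: kern0_def w_def[symmetric] X_def)
    have d: "dens r = r ^ 3 * (p r)\<^sup>2" "dens_refl (rel_speed y z \<tau> / e) r = r ^ 3 * q\<^sup>2"
      using True rw by (simp_all add: dens_def dens_refl_def q_def w_def)
    have i: "indicator {-1<..<1} \<tau> = (1::real)" using True by simp
    have sq: "2 * p r * q \<le> (p r)\<^sup>2 + q\<^sup>2"
      by (rule sum_squares_bound)
    have "\<bar>(p r + q)\<^sup>2\<bar> \<le> 2 * ((p r)\<^sup>2 + q\<^sup>2)"
    proof -
      have "\<bar>(p r + q)\<^sup>2\<bar> = (p r + q)\<^sup>2" by simp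
      also have "\<dots> \<le> 2 * ((p r)\<^sup>2 + q\<^sup>2)" using sq by (simp add: power2_sum)
      finally show ?thesis .
    qed
    from weighted_square_bound[OF X e _ K this]
    have 1: "\<bar>kern e y z (\<tau>, r)\<bar> \<le> K * (2 * (dens r + dens_refl (rel_speed y z \<tau> / e) r))"
      using True unfolding k d by (simp add: algebra_simps)
    have "\<bar>(p r)\<^sup>2\<bar> \<le> (p r)\<^sup>2" by simp
    from weighted_square_bound[OF X e _ K this]
    have 2: "\<bar>kern0 e y z (\<tau>, r)\<bar> \<le> K * dens r"
      using True unfolding k0 d by simp
    have 3: "\<bar>kern e y z (\<tau>, r) - kern0 e y z (\<tau>, r)\<bar> \<le> K * (\<eta> * dens r + (1 + 1 / \<eta>) * dens_refl (rel_speed y z \<tau> / e) r)"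
      if \<eta>: "\<eta> > 0" for \<eta>
    proof -
      have s: "(sqrt \<eta>)\<^sup>2 = \<eta>" using \<eta> by simp
      have "2 * \<bar>p r\<bar> * \<bar>q\<bar> = 2 * (sqrt \<eta> * \<bar>p r\<bar>) * (\<bar>q\<bar> / sqrt \<eta>)" using \<eta> by simp
      also have "\<dots> \<le> (sqrt \<eta> * \<bar>p r\<bar>)\<^sup>2 + (\<bar>q\<bar> / sqrt \<eta>)\<^sup>2" by (rule sum_squares_bound)
      also have "\<dots> = \<eta> * (p r)\<^sup>2 + q\<^sup>2 / \<eta>" by (simp add: power_mult_distrib power_divide s)
      finally have "2 * \<bar>p r\<bar> * \<bar>q\<bar> \<le> \<eta> * (p r)\<^sup>2 + q\<^sup>2 / \<eta>" .
      moreover have "\<bar>2 * p r * q + q\<^sup>2\<bar> \<le> 2 * \<bar>p r\<bar> * \<bar>q\<bar> + q\<^sup>2"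
        using abs_triangle_ineq[of "2 * p r * q" "q\<^sup>2"] by (simp add: abs_mult)
      ultimately have b: "\<bar>2 * p r * q + q\<^sup>2\<bar> \<le> \<eta> * (p r)\<^sup>2 + (1 + 1 / \<eta>) * q\<^sup>2"
        by (simp add: distrib_right)
      have "kern e y z (\<tau>, r) - kern0 e y z (\<tau>, r) = r / e\<^sup>2 * (2 * p r * q + q\<^sup>2) * X"
        unfolding k k0 by (simp add: power2_sum algebra_simps add_divide_distrib)
      also have "\<bar>\<dots>\<bar> \<le> K * (r ^ 3 * (\<eta> * (p r)\<^sup>2 + (1 + 1 / \<eta>) * q\<^sup>2))"
        using True by (intro weighted_square_bound[OF X e _ K b]) auto
      also have "\<dots> = K * (\<eta> * dens r + (1 + 1 / \<eta>) * dens_refl (rel_speed y z \<tau> / e) r)"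
        unfolding d by (simp add: distrib_left mult_ac)
      finally show ?thesis .
    qed
    show ?thesis unfolding i mult_1 using 1 2 3 by auto
  next
    case False
    have "kern e y z (\<tau>, r) = 0"
    proof (cases "\<tau> \<in> {-1<..<1}")
      case True
      then have "grazing_weight p e w r = 0" using False unfolding grazing_weight_def by (intro if_not_P) auto
      then show ?thesis by (simp add: kern_def w_def)
    qed (simp add: kern_def)
    moreover have "kern0 e y z (\<tau>, r) = 0"
      using False by (auto simp: kern0_def w_def)
    ultimately show ?thesis using K dens_nonneg dens_refl_nonneg by (simp add: add_nonneg_nonneg)
  qed
  then show "\<bar>kern e y z (\<tau>, r)\<bar> \<le> K * (2 * (indicator {-1<..<1} \<tau> * (dens r + dens_refl (rel_speed y z \<tau> / e) r)))"
    "\<bar>kern0 e y z (\<tau>, r)\<bar> \<le> K * (indicator {-1<..<1} \<tau> * dens r)"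
    "\<eta> > 0 \<Longrightarrow> \<bar>kern e y z (\<tau>, r) - kern0 e y z (\<tau>, r)\<bar> \<le>
      K * (indicator {-1<..<1} \<tau> * (\<eta> * dens r + (1 + 1 / \<eta>) * dens_refl (rel_speed y z \<tau> / e) r))"
    by blast+
qed

lemma unit_indicator_integral: "integrable lborel (indicator {-1<..<1} :: real \<Rightarrow> real)"
  "(\<integral>\<tau>. indicator {-1<..<1::real} \<tau> \<partial>lborel) = (2::real)"
  by (simp_all add: measure_lborel_Ioo)

lemma tail_measurable [measurable]: "tail \<in> borel_measurable borel"
  unfolding tail_def indicator_def greaterThan_iff by measurable

text \<open>Bounds the total contribution of the reflected argument: by
  \<open>dens_refl_integral\<close> each relative speed \<open>w\<close> sees at most the part of
  \<open>dens\<close> beyond \<open>w / e\<close>.\<close>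

definition tail_mean :: "real \<Rightarrow> real \<Rightarrow> real \<Rightarrow> real" where
  "tail_mean e y z = (\<integral>\<tau>. indicator {-1<..<1} \<tau> * tail (rel_speed y z \<tau> / e) \<partial>lborel)"

lemma tail_mean_integrable: "integrable lborel (\<lambda>\<tau>. indicator {-1<..<1} \<tau> * tail (rel_speed y z \<tau> / e))"
proof (rule Bochner_Integration.integrable_bound[where f="\<lambda>\<tau>. indicator {-1<..<1} \<tau> * (1 / (2 * pi))"])
  show "integrable lborel (\<lambda>\<tau>. indicator {-1<..<1::real} \<tau> * (1 / (2 * pi)))"
    by (intro integrable_mult_left unit_indicator_integral)
  show "AE \<tau> in lborel. norm (indicator {-1<..<1} \<tau> * tail (rel_speed y z \<tau> / e)) \<le> norm (indicator {-1<..<1} \<tau> * (1 / (2 * pi)))"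
    using tail_bounds by (intro AE_I2) (auto simp: indicator_def)
qed measurable

lemma refl_product:
  shows "integrable (lborel \<Otimes>\<^sub>M lborel) (\<lambda>(\<tau>, r). indicator {-1<..<1} \<tau> * dens_refl (rel_speed y z \<tau> / e) r)"
    and "(\<integral>q. (\<lambda>(\<tau>, r). indicator {-1<..<1} \<tau> * dens_refl (rel_speed y z \<tau> / e) r) q \<partial>(lborel \<Otimes>\<^sub>M lborel)) \<le> tail_mean e y z"
proof -
  have m: "(\<lambda>(\<tau>, r). indicator {-1<..<1} \<tau> * dens_refl (rel_speed y z \<tau> / e) r) \<in> borel_measurable (lborel \<Otimes>\<^sub>M lborel)"
    by measurable
  have i: "integrable lborel (\<lambda>r. indicator {-1<..<1} \<tau> * dens_refl (rel_speed y z \<tau> / e) r)" for \<tau>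
    by (intro integrable_mult_right dens_refl_integrable)
  have b: "(\<integral>r. indicator {-1<..<1} \<tau> * dens_refl (rel_speed y z \<tau> / e) r \<partial>lborel) \<le> indicator {-1<..<1} \<tau> * tail (rel_speed y z \<tau> / e)" for \<tau>
    by (auto simp: indicator_def intro!: dens_refl_integral)
  note * = integrable_product_iterated[OF m _ i b tail_mean_integrable]
  show "integrable (lborel \<Otimes>\<^sub>M lborel) (\<lambda>(\<tau>, r). indicator {-1<..<1} \<tau> * dens_refl (rel_speed y z \<tau> / e) r)"
    by (rule *(1)) (simp add: dens_refl_nonneg)
  show "(\<integral>q. (\<lambda>(\<tau>, r). indicator {-1<..<1} \<tau> * dens_refl (rel_speed y z \<tau> / e) r) q \<partial>(lborel \<Otimes>\<^sub>M lborel)) \<le> tail_mean e y z"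
    unfolding tail_mean_def by (rule *(2)) (simp add: dens_refl_nonneg)
qed

lemma dens_product:
  shows "integrable (lborel \<Otimes>\<^sub>M lborel) (\<lambda>(\<tau>, r). indicator {-1<..<1::real} \<tau> * dens r)"
    and "(\<integral>q. (\<lambda>(\<tau>, r). indicator {-1<..<1::real} \<tau> * dens r) q \<partial>(lborel \<Otimes>\<^sub>M lborel)) = 1 / pi"
  using integrable_product_times[OF unit_indicator_integral(1) dens_integrable]
  by (simp_all add: dens_integral)

lemma tail_mean_le: "tail_mean e y z \<le> 1 / pi"
proof -
  have "tail_mean e y z \<le> (\<integral>\<tau>. indicator {-1<..<1::real} \<tau> * (1 / (2 * pi)) \<partial>lborel)"
    unfolding tail_mean_def using tail_bounds
    by (intro integral_mono tail_mean_integrable integrable_mult_left unit_indicator_integral)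
      (auto simp: indicator_def)
  then show ?thesis by simp
qed

text \<open>The integral of the majorant is of order \<open>y + z\<close>, uniformly in
  \<open>e\<close> because the full masses of \<open>dens\<close> and \<open>dens_refl\<close> are
  used; dividing by \<open>sqrt (max y z)\<close> leaves the stated growth. At
  \<open>y = z = 0\<close> the domain of the \<open>x\<close>-integral is a single point.\<close>

lemma J_op_bound:
  assumes "y \<ge> 0" "z \<ge> 0" "e > 0"
  shows "\<bar>J_op p e 1 \<phi> y z\<bar> \<le> 256 * pi * C * sqrt (max y z)"
proof (cases "y + z > 0")
  case False
  then have "y = 0" "z = 0" using assms by auto
  moreover have "AE x in lborel. x \<noteq> (0::real)" by (rule AE_lborel_singleton)
  then have "(LBINT x:{0..0}. K_op p e 1 \<phi> x 0 0 * sqrt x) = 0"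
    unfolding set_lebesgue_integral_def by (intro integral_eq_zero_AE) (auto simp: indicator_def)
  ultimately show ?thesis by (simp add: J_op_def)
next
  case True
  define M where "M = sqrt (max y z)"
  define K where "K = 8 * pi * C * (y + z)"
  have M: "M > 0" "M\<^sup>2 = max y z" using True assms by (auto simp: M_def)
  have K: "0 \<le> K" using assms C_nonneg by (simp add: K_def)
  define F where "F = (\<lambda>q. K * (2 * ((\<lambda>(\<tau>, r). indicator {-1<..<1} \<tau> * dens r) q + (\<lambda>(\<tau>, r). indicator {-1<..<1} \<tau> * dens_refl (rel_speed y z \<tau> / e) r) q)))"
  have Fi: "integrable (lborel \<Otimes>\<^sub>M lborel) F"
    unfolding F_def by (intro integrable_mult_right Bochner_Integration.integrable_add dens_product refl_product)
  have "norm (\<integral>q. kern e y z q \<partial>(lborel \<Otimes>\<^sub>M lborel)) \<le> (\<integral>q. F q \<partial>(lborel \<Otimes>\<^sub>M lborel))"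
  proof (rule Bochner_Integration.integral_norm_bound_integral[OF J_op_kern(2)[OF assms(1,2) True assms(3)] Fi])
    fix q :: "real \<times> real"
    obtain \<tau> r where q: "q = (\<tau>, r)" by (cases q)
    show "norm (kern e y z q) \<le> F q"
      using kern_estimates(1)[OF assms, of \<tau> r] by (simp add: q F_def K_def distrib_left)
  qed
  also have "(\<integral>q. F q \<partial>(lborel \<Otimes>\<^sub>M lborel)) \<le> K * (2 * (1 / pi + 1 / pi))"
    unfolding F_def using refl_product(2)[of y z e] tail_mean_le[of e y z] dens_product(2) K
    by (subst integral_mult_right_zero, subst integral_mult_right_zero, subst Bochner_Integration.integral_add[OF dens_product(1) refl_product(1)])
      (intro mult_left_mono, simp_all)
  finally have "\<bar>\<integral>q. kern e y z q \<partial>(lborel \<Otimes>\<^sub>M lborel)\<bar> \<le> K * 4 / pi" by simp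
  then have "4 * pi / M * \<bar>\<integral>q. kern e y z q \<partial>(lborel \<Otimes>\<^sub>M lborel)\<bar> \<le> 4 * pi / M * (K * 4 / pi)"
    using M by (intro mult_left_mono) auto
  moreover have "\<bar>J_op p e 1 \<phi> y z\<bar> = 4 * pi / M * \<bar>\<integral>q. kern e y z q \<partial>(lborel \<Otimes>\<^sub>M lborel)\<bar>"
    using M unfolding J_op_kern(1)[OF assms(1,2) True assms(3)] M_def[symmetric] by (simp add: abs_mult)
  ultimately have "\<bar>J_op p e 1 \<phi> y z\<bar> \<le> 4 * pi / M * (K * 4 / pi)" by simp
  also have "\<dots> = 128 * pi * C * ((y + z) / M)" by (simp add: K_def)
  also have "\<dots> \<le> 128 * pi * C * (2 * M)"
  proof (intro mult_left_mono)
    have "y + z \<le> 2 * M\<^sup>2" unfolding M(2) by auto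
    then show "(y + z) / M \<le> 2 * M" using M(1) by (simp add: pos_divide_le_eq power2_eq_square)
  qed (use C_nonneg in simp)
  finally show ?thesis by (simp add: M_def)
qed

end

section \<open>Passage to the limit in \<open>J\<close>\<close>

context collision
begin

definition \<phi>0 :: "real \<Rightarrow> real" where "\<phi>0 x = \<phi> (max 0 x)"

lemma \<phi>0_measurable [measurable]: "\<phi>0 \<in> borel_measurable borel"
proof -
  have "continuous_on UNIV \<phi>0" unfolding \<phi>0_def by (intro continuous_on_compose2[OF cont] continuous_intros) auto
  then show ?thesis by (rule borel_measurable_continuous_onI)
qed

text \<open>Outside the admissible parameters \<open>post\<close> may be negative, where
  \<open>\<phi>\<close> is arbitrary. With the extension \<open>\<phi>0\<close> the angular mean is
  measurable in its parameters, and it agrees with \<open>cavg\<close> wherever \<open>kern0\<close>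
  does not vanish.\<close>

definition cavg0 :: "real \<Rightarrow> real \<Rightarrow> real \<Rightarrow> real \<Rightarrow> real" where
  "cavg0 y z \<sigma> u = (\<integral>\<psi>. indicator {0..2*pi} \<psi> * (\<phi>0 (post y z \<sigma> u \<psi>) + \<phi>0 (y + z - post y z \<sigma> u \<psi>) - \<phi> y - \<phi> z) \<partial>lborel)"

lemma cavg0_eq:
  assumes "y \<ge> 0" "z \<ge> 0" "0 \<le> \<sigma>" "\<sigma> \<le> u" "0 < u" "0 \<le> gap y z u"
  shows "cavg0 y z \<sigma> u = cavg y z \<sigma> u"
  unfolding cavg0_def cavg_def set_lebesgue_integral_def \<phi>0_def cdiff_def
  using post_range[OF assms] by simp

lemma kern0_eq:
  assumes "y \<ge> 0" "z \<ge> 0" "e > 0"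
  shows "kern0 e y z = (\<lambda>(\<tau>, r). indicator {-1<..<1} \<tau> *
     (if 0 < r \<and> e * r < rel_speed y z \<tau> then r / e\<^sup>2 * (p r)\<^sup>2 else 0)
     * cavg0 y z (e\<^sup>2 * r\<^sup>2 / 2) ((rel_speed y z \<tau>)\<^sup>2))"
proof (intro ext, clarify)
  fix \<tau> r :: real
  show "kern0 e y z (\<tau>, r) = indicator {-1<..<1} \<tau> *
     (if 0 < r \<and> e * r < rel_speed y z \<tau> then r / e\<^sup>2 * (p r)\<^sup>2 else 0)
     * cavg0 y z (e\<^sup>2 * r\<^sup>2 / 2) ((rel_speed y z \<tau>)\<^sup>2)"
  proof (cases "\<tau> \<in> {-1<..<1} \<and> 0 < r \<and> e * r < rel_speed y z \<tau>")
    case True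
    then have er: "0 < e * r" using assms by simp
    then have w: "rel_speed y z \<tau> > 0" using True by linarith
    have "(e * r)\<^sup>2 \<le> (rel_speed y z \<tau>)\<^sup>2" using True er by (intro power_mono) auto
    then have "e\<^sup>2 * r\<^sup>2 \<le> (rel_speed y z \<tau>)\<^sup>2" by (simp add: power_mult_distrib)
    moreover have "0 \<le> e\<^sup>2 * r\<^sup>2" by simp
    ultimately have s: "0 \<le> e\<^sup>2 * r\<^sup>2 / 2" "e\<^sup>2 * r\<^sup>2 / 2 \<le> (rel_speed y z \<tau>)\<^sup>2" by linarith+
    have "cavg0 y z (e\<^sup>2 * r\<^sup>2 / 2) ((rel_speed y z \<tau>)\<^sup>2) = cavg y z (e\<^sup>2 * r\<^sup>2 / 2) ((rel_speed y z \<tau>)\<^sup>2)"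
      using True w by (intro cavg0_eq assms s rel_speed_props(2)) auto
    then show ?thesis by (simp add: kern0_def)
  qed (auto simp: kern0_def)
qed

lemma kern0_measurable:
  assumes "y \<ge> 0" "z \<ge> 0" "e > 0"
  shows "kern0 e y z \<in> borel_measurable (lborel \<Otimes>\<^sub>M lborel)"
  unfolding kern0_eq[OF assms] cavg0_def by measurable

lemma cavg_lim_bound:
  assumes "y \<ge> 0" "z \<ge> 0" "0 < u" "0 \<le> gap y z u"
  shows "\<bar>cavg_lim y z u\<bar> \<le> 6 * pi * C * (y + z)"
proof -
  note gb = gap_bounds[OF assms(1,2,4)]
  have "\<bar>2 * pi * ((z - y) / u) * (d1 y - d1 z)\<bar> = 2 * pi * (\<bar>z - y\<bar> * \<bar>d1 y - d1 z\<bar> / u)"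
    using assms by (simp add: abs_mult)
  also have "\<dots> \<le> 2 * pi * (\<bar>z - y\<bar> * (C * \<bar>y - z\<bar>) / u)"
    using assms by (intro mult_left_mono divide_right_mono lipschitz_d1) auto
  also have "\<bar>z - y\<bar> * (C * \<bar>y - z\<bar>) / u = C * ((z - y)\<^sup>2 / u)"
    by (simp add: abs_minus_commute[of y z] power2_eq_square)
  also have "2 * pi * (C * ((z - y)\<^sup>2 / u)) \<le> 2 * pi * (C * (2 * (y + z)))"
    using assms gb(1) C_nonneg by (intro mult_left_mono) (auto simp: pos_divide_le_eq mult_ac)
  also have "\<dots> = 4 * pi * C * (y + z)" by simp
  finally have 1: "\<bar>2 * pi * ((z - y) / u) * (d1 y - d1 z)\<bar> \<le> 4 * pi * C * (y + z)" .
  have "\<bar>(d2 y + d2 z) / 2\<bar> \<le> C" using bound2[OF assms(1)] bound2[OF assms(2)] by simp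
  moreover have "\<bar>pi * (gap y z u / u)\<bar> \<le> pi * (2 * (y + z))"
    using assms gb(2) by (simp add: abs_mult pos_divide_le_eq mult_ac)
  ultimately have "\<bar>(d2 y + d2 z) / 2\<bar> * \<bar>pi * (gap y z u / u)\<bar> \<le> C * (pi * (2 * (y + z)))"
    by (intro mult_mono) (use C_nonneg in auto)
  then have 2: "\<bar>(d2 y + d2 z) / 2 * (pi * (gap y z u / u))\<bar> \<le> 2 * pi * C * (y + z)"
    unfolding abs_mult by (simp only: mult_ac)
  have "\<bar>cavg_lim y z u\<bar> \<le> 4 * pi * C * (y + z) + 2 * pi * C * (y + z)"
    unfolding cavg_lim_def by (rule order_trans[OF abs_triangle_ineq add_mono[OF 1 2]])
  then show ?thesis by (simp add: algebra_simps)
qed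

lemma cavg_lim_integrable:
  assumes "y \<ge> 0" "z \<ge> 0" "y + z > 0"
  shows "integrable lborel (\<lambda>\<tau>. indicator {-1<..<1} \<tau> * cavg_lim y z ((rel_speed y z \<tau>)\<^sup>2))"
proof (rule Bochner_Integration.integrable_bound[where f="\<lambda>\<tau>. indicator {-1<..<1} \<tau> * (6 * pi * C * (y + z))"])
  show "integrable lborel (\<lambda>\<tau>. indicator {-1<..<1::real} \<tau> * (6 * pi * C * (y + z)))"
    by (intro integrable_mult_left unit_indicator_integral)
  show "AE \<tau> in lborel. norm (indicator {-1<..<1} \<tau> * cavg_lim y z ((rel_speed y z \<tau>)\<^sup>2)) \<le> norm (indicator {-1<..<1} \<tau> * (6 * pi * C * (y + z)))"
  proof (intro AE_I2)
    fix \<tau> :: real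
    show "norm (indicator {-1<..<1} \<tau> * cavg_lim y z ((rel_speed y z \<tau>)\<^sup>2)) \<le> norm (indicator {-1<..<1} \<tau> * (6 * pi * C * (y + z)))"
    proof (cases "\<tau> \<in> {-1<..<1}")
      case True
      then have w: "0 < rel_speed y z \<tau>" using w_bounds(1)[OF assms] by (simp add: rel_speed_def)
      have "\<bar>cavg_lim y z ((rel_speed y z \<tau>)\<^sup>2)\<bar> \<le> 6 * pi * C * (y + z)"
        using w True by (intro cavg_lim_bound rel_speed_props(2) assms) auto
      then show ?thesis using True by simp
    qed simp
  qed
qed (unfold cavg_lim_def, measurable)

text \<open>For each \<open>\<tau>\<close> in the open interval the limiting relative speed is
  positive, so the cut-off tends to infinity and the tail vanishes; the total mass of
  \<open>dens\<close> dominates.\<close>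

lemma tail_mean_tendsto:
  assumes lim: "yn \<longlonglongrightarrow> y" "zn \<longlonglongrightarrow> z" "en \<longlonglongrightarrow> 0" and e: "\<And>n. en n > 0"
    and yz: "y \<ge> 0" "z \<ge> 0" "y + z > 0"
  shows "(\<lambda>n. tail_mean (en n) (yn n) (zn n)) \<longlonglongrightarrow> 0"
proof -
  have "(\<lambda>n. \<integral>\<tau>. indicator {-1<..<1} \<tau> * tail (rel_speed (yn n) (zn n) \<tau> / en n) \<partial>lborel) \<longlonglongrightarrow> (\<integral>\<tau>. (0::real) \<partial>(lborel :: real measure))"
  proof (rule integral_dominated_convergence[where w="\<lambda>\<tau>. indicator {-1<..<1} \<tau> * (1 / (2 * pi))"])
    show "integrable lborel (\<lambda>\<tau>. indicator {-1<..<1::real} \<tau> * (1 / (2 * pi)))"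
      by (intro integrable_mult_left unit_indicator_integral)
    show "AE \<tau> in lborel. norm (indicator {-1<..<1} \<tau> * tail (rel_speed (yn n) (zn n) \<tau> / en n)) \<le> indicator {-1<..<1} \<tau> * (1 / (2 * pi))" for n
      using tail_bounds by (intro AE_I2) (auto simp: indicator_def)
    show "AE \<tau> in lborel. (\<lambda>n. indicator {-1<..<1} \<tau> * tail (rel_speed (yn n) (zn n) \<tau> / en n)) \<longlonglongrightarrow> 0"
    proof (intro AE_I2)
      fix \<tau> :: real
      show "(\<lambda>n. indicator {-1<..<1} \<tau> * tail (rel_speed (yn n) (zn n) \<tau> / en n)) \<longlonglongrightarrow> 0"
      proof (cases "\<tau> \<in> {-1<..<1}")
        case True
        have w: "0 < rel_speed y z \<tau>" using w_bounds(1)[OF yz] True by (simp add: rel_speed_def)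
        have "(\<lambda>n. rel_speed (yn n) (zn n) \<tau>) \<longlonglongrightarrow> rel_speed y z \<tau>"
          unfolding rel_speed_def by (intro tendsto_intros lim)
        moreover have "filterlim en (at_right 0) sequentially"
        proof -
          have "en n \<noteq> 0" for n using e[of n] by simp
          then show ?thesis using lim(3) e by (auto simp: filterlim_at)
        qed
        ultimately have "filterlim (\<lambda>n. rel_speed (yn n) (zn n) \<tau> / en n) at_top sequentially"
          using w by (intro filterlim_tendsto_pos_mult_at_top[of _ _ _ "\<lambda>n. inverse (en n)", folded divide_inverse]
              filterlim_compose[OF filterlim_inverse_at_top_right]) auto
        from tail_tendsto[OF this] show ?thesis using True by simp
      qed simp
    qed
  qed measurable
  then show ?thesis by (simp add: tail_mean_def)
qed

text \<open>With \<open>\<sigma> = e\<^sup>2 * r\<^sup>2 / 2\<close> the kernel is the quotient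
  \<open>cavg / \<sigma>\<close> times \<open>dens r / 2\<close>, and \<open>cavg_limit\<close>
  gives its pointwise limit. The normalisation enters through the integral
  \<open>1 / (4 * pi)\<close> of \<open>dens / 2\<close>, which cancels the \<open>4 * pi\<close> in
  front of \<open>J\<close>.\<close>

lemma kern0_tendsto:
  assumes lim: "yn \<longlonglongrightarrow> y" "zn \<longlonglongrightarrow> z" "en \<longlonglongrightarrow> 0" and e: "\<And>n. en n > 0"
    and nn: "\<And>n. yn n \<ge> 0" "\<And>n. zn n \<ge> 0" and yz: "y \<ge> 0" "z \<ge> 0" "y + z > 0"
    and S: "\<And>n. yn n + zn n \<le> S"
  shows "(\<lambda>n. \<integral>q. kern0 (en n) (yn n) (zn n) q \<partial>(lborel \<Otimes>\<^sub>M lborel)) \<longlonglongrightarrow>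
    (\<integral>\<tau>. indicator {-1<..<1} \<tau> * cavg_lim y z ((rel_speed y z \<tau>)\<^sup>2) \<partial>lborel) * (1 / (4 * pi))"
proof -
  define f where "f = (\<lambda>(\<tau>, r). (indicator {-1<..<1} \<tau> * cavg_lim y z ((rel_speed y z \<tau>)\<^sup>2)) * (dens r / 2))"
  have "(\<lambda>n. \<integral>q. kern0 (en n) (yn n) (zn n) q \<partial>(lborel \<Otimes>\<^sub>M lborel)) \<longlonglongrightarrow> (\<integral>q. f q \<partial>(lborel \<Otimes>\<^sub>M lborel))"
  proof (rule integral_dominated_convergence[where w="\<lambda>q. 8 * pi * C * S * (\<lambda>(\<tau>, r). indicator {-1<..<1::real} \<tau> * dens r) q"])
    show "f \<in> borel_measurable (lborel \<Otimes>\<^sub>M lborel)" unfolding f_def cavg_lim_def by measurable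
    show "kern0 (en n) (yn n) (zn n) \<in> borel_measurable (lborel \<Otimes>\<^sub>M lborel)" for n
      by (rule kern0_measurable[OF nn e])
    show "integrable (lborel \<Otimes>\<^sub>M lborel) (\<lambda>q. 8 * pi * C * S * (\<lambda>(\<tau>, r). indicator {-1<..<1::real} \<tau> * dens r) q)"
      by (intro integrable_mult_right dens_product)
    show "AE q in lborel \<Otimes>\<^sub>M lborel. norm (kern0 (en n) (yn n) (zn n) q) \<le> 8 * pi * C * S * (\<lambda>(\<tau>, r). indicator {-1<..<1} \<tau> * dens r) q" for n
    proof (intro AE_I2)
      fix q :: "real \<times> real"
      obtain \<tau> r where q: "q = (\<tau>, r)" by (cases q)
      have "norm (kern0 (en n) (yn n) (zn n) q) \<le> 8 * pi * C * (yn n + zn n) * (indicator {-1<..<1} \<tau> * dens r)"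
        using kern_estimates(2)[OF nn e, of n n n \<tau> r] by (simp add: q)
      also have "\<dots> \<le> 8 * pi * C * S * (indicator {-1<..<1} \<tau> * dens r)"
        using S[of n] C_nonneg dens_nonneg by (intro mult_right_mono mult_left_mono) auto
      finally show "norm (kern0 (en n) (yn n) (zn n) q) \<le> 8 * pi * C * S * (\<lambda>(\<tau>, r). indicator {-1<..<1} \<tau> * dens r) q"
        by (simp add: q)
    qed
    show "AE q in lborel \<Otimes>\<^sub>M lborel. (\<lambda>n. kern0 (en n) (yn n) (zn n) q) \<longlonglongrightarrow> f q"
    proof (intro AE_I2)
      fix q :: "real \<times> real"
      obtain \<tau> r where q: "q = (\<tau>, r)" by (cases q)
      show "(\<lambda>n. kern0 (en n) (yn n) (zn n) q) \<longlonglongrightarrow> f q"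
      proof (cases "\<tau> \<in> {-1<..<1} \<and> 0 < r")
        case True
        have w: "0 < rel_speed y z \<tau>" using w_bounds(1)[OF yz] True by (simp add: rel_speed_def)
        have wl: "(\<lambda>n. rel_speed (yn n) (zn n) \<tau>) \<longlonglongrightarrow> rel_speed y z \<tau>"
          unfolding rel_speed_def by (intro tendsto_intros lim)
        have "(\<lambda>n. rel_speed (yn n) (zn n) \<tau> - en n * r) \<longlonglongrightarrow> rel_speed y z \<tau> - 0 * r"
          by (intro tendsto_intros wl lim)
        then have ev: "\<forall>\<^sub>F n in sequentially. 0 < rel_speed (yn n) (zn n) \<tau> - en n * r"
          using w by (intro order_tendstoD(1)) auto
        have "(\<lambda>n. cavg (yn n) (zn n) ((en n)\<^sup>2 * r\<^sup>2 / 2) ((rel_speed (yn n) (zn n) \<tau>)\<^sup>2) / ((en n)\<^sup>2 * r\<^sup>2 / 2)) \<longlonglongrightarrow> cavg_lim y z ((rel_speed y z \<tau>)\<^sup>2)"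
        proof (rule cavg_limit[OF lim(1,2) _ _ nn])
          show "(\<lambda>n. (rel_speed (yn n) (zn n) \<tau>)\<^sup>2) \<longlonglongrightarrow> (rel_speed y z \<tau>)\<^sup>2" by (intro tendsto_intros wl)
          have "(\<lambda>n. (en n)\<^sup>2 * r\<^sup>2 / 2) \<longlonglongrightarrow> 0\<^sup>2 * r\<^sup>2 / 2" by (intro tendsto_intros lim) auto
          then show "(\<lambda>n. (en n)\<^sup>2 * r\<^sup>2 / 2) \<longlonglongrightarrow> 0" by simp
          show "(rel_speed y z \<tau>)\<^sup>2 > 0" using w by simp
          show "\<forall>\<^sub>F n in sequentially. 0 < (en n)\<^sup>2 * r\<^sup>2 / 2 \<and> (en n)\<^sup>2 * r\<^sup>2 / 2 < (rel_speed (yn n) (zn n) \<tau>)\<^sup>2 \<and> 0 \<le> gap (yn n) (zn n) ((rel_speed (yn n) (zn n) \<tau>)\<^sup>2)"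
            using ev
          proof eventually_elim
            case (elim n)
            have er: "0 < en n * r" using e[of n] True by simp
            then have wn: "rel_speed (yn n) (zn n) \<tau> > 0" using elim by linarith
            have "(en n * r)\<^sup>2 < (rel_speed (yn n) (zn n) \<tau>)\<^sup>2" using elim er by (intro power_strict_mono) auto
            then have "(en n)\<^sup>2 * r\<^sup>2 < (rel_speed (yn n) (zn n) \<tau>)\<^sup>2" by (simp add: power_mult_distrib)
            moreover have "0 < (en n)\<^sup>2 * r\<^sup>2" using e[of n] True by simp
            ultimately show ?case using rel_speed_props(2)[OF nn wn] True by auto
          qed
        qed
        then have l1: "(\<lambda>n. (cavg (yn n) (zn n) ((en n)\<^sup>2 * r\<^sup>2 / 2) ((rel_speed (yn n) (zn n) \<tau>)\<^sup>2) / ((en n)\<^sup>2 * r\<^sup>2 / 2)) * (dens r / 2)) \<longlonglongrightarrow> cavg_lim y z ((rel_speed y z \<tau>)\<^sup>2) * (dens r / 2)"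
          by (intro tendsto_intros)
        have ev2: "\<forall>\<^sub>F n in sequentially. (cavg (yn n) (zn n) ((en n)\<^sup>2 * r\<^sup>2 / 2) ((rel_speed (yn n) (zn n) \<tau>)\<^sup>2) / ((en n)\<^sup>2 * r\<^sup>2 / 2)) * (dens r / 2)
            = kern0 (en n) (yn n) (zn n) q"
          using ev
        proof eventually_elim
          case (elim n)
          have "c / ((en n)\<^sup>2 * r\<^sup>2 / 2) * (r ^ 3 * P / 2) = r / (en n)\<^sup>2 * P * c" for c P
            using e[of n] True by (simp add: power3_eq_cube power2_eq_square)
          then show ?case using elim True by (simp add: q kern0_def dens_def)
        qed
        have fq: "f q = cavg_lim y z ((rel_speed y z \<tau>)\<^sup>2) * (dens r / 2)" using True by (simp add: q f_def)
        show ?thesis using Lim_transform_eventually[OF l1 ev2] by (simp only: fq)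
      next
        case False
        then have "kern0 (en n) (yn n) (zn n) q = 0" for n by (auto simp: q kern0_def)
        moreover have "f q = 0" using False by (auto simp: q f_def dens_def)
        ultimately show ?thesis by simp
      qed
    qed
  qed
  also have "(\<integral>q. f q \<partial>(lborel \<Otimes>\<^sub>M lborel)) = (\<integral>\<tau>. indicator {-1<..<1} \<tau> * cavg_lim y z ((rel_speed y z \<tau>)\<^sup>2) \<partial>lborel) * (\<integral>r. dens r / 2 \<partial>lborel)"
    unfolding f_def by (intro integrable_product_times(2) cavg_lim_integrable yz integrable_divide dens_integrable)
  finally show ?thesis by (simp add: dens_integral)
qed

text \<open>The part of the difference proportional to \<open>dens\<close> carries the free factor
  \<open>\<eta>\<close>, the rest is a multiple of \<open>tail_mean\<close>;
  \<open>tendsto_zero_tradeoff\<close> concludes.\<close>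

lemma kern_diff_tendsto:
  assumes lim: "yn \<longlonglongrightarrow> y" "zn \<longlonglongrightarrow> z" "en \<longlonglongrightarrow> 0" and e: "\<And>n. en n > 0"
    and nn: "\<And>n. yn n \<ge> 0" "\<And>n. zn n \<ge> 0" and yz: "y \<ge> 0" "z \<ge> 0" "y + z > 0"
    and S: "\<And>n. yn n + zn n \<le> S"
  shows "(\<lambda>n. (\<integral>q. kern (en n) (yn n) (zn n) q \<partial>(lborel \<Otimes>\<^sub>M lborel)) - (\<integral>q. kern0 (en n) (yn n) (zn n) q \<partial>(lborel \<Otimes>\<^sub>M lborel))) \<longlonglongrightarrow> 0"
proof (rule tendsto_zero_tradeoff)
  let ?K = "8 * pi * C * S"
  have S0: "0 \<le> S" using S[of 0] nn[of 0] by linarith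
  then show K: "0 \<le> ?K" using C_nonneg by simp
  show "(\<lambda>n. tail_mean (en n) (yn n) (zn n)) \<longlonglongrightarrow> 0" by (rule tail_mean_tendsto) (use assms in auto)
  fix \<eta> :: real assume \<eta>: "\<eta> > 0"
  have "(\<lambda>n. yn n + zn n) \<longlonglongrightarrow> y + z" by (intro tendsto_intros lim)
  then have "\<forall>\<^sub>F n in sequentially. 0 < yn n + zn n" using yz(3) by (rule order_tendstoD(1))
  then show "\<forall>\<^sub>F n in sequentially. \<bar>(\<integral>q. kern (en n) (yn n) (zn n) q \<partial>(lborel \<Otimes>\<^sub>M lborel)) - (\<integral>q. kern0 (en n) (yn n) (zn n) q \<partial>(lborel \<Otimes>\<^sub>M lborel))\<bar>
    \<le> ?K * (\<eta> + (1 + 1 / \<eta>) * tail_mean (en n) (yn n) (zn n))"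
  proof eventually_elim
    case (elim n)
    define A where "A = (\<lambda>(\<tau>, r). indicator {-1<..<1::real} \<tau> * dens r)"
    define R where "R = (\<lambda>(\<tau>, r). indicator {-1<..<1} \<tau> * dens_refl (rel_speed (yn n) (zn n) \<tau> / en n) r)"
    have Ai: "integrable (lborel \<Otimes>\<^sub>M lborel) A" "(\<integral>q. A q \<partial>(lborel \<Otimes>\<^sub>M lborel)) = 1 / pi"
      using dens_product by (simp_all add: A_def)
    have Ri: "integrable (lborel \<Otimes>\<^sub>M lborel) R" "(\<integral>q. R q \<partial>(lborel \<Otimes>\<^sub>M lborel)) \<le> tail_mean (en n) (yn n) (zn n)"
      using refl_product[of "yn n" "zn n" "en n"] by (simp_all add: R_def)
    have ki: "integrable (lborel \<Otimes>\<^sub>M lborel) (kern (en n) (yn n) (zn n))"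
      by (rule J_op_kern(2)[OF nn elim e])
    have k0i: "integrable (lborel \<Otimes>\<^sub>M lborel) (kern0 (en n) (yn n) (zn n))"
    proof (rule Bochner_Integration.integrable_bound[where f="\<lambda>q. 8 * pi * C * (yn n + zn n) * A q"])
      show "integrable (lborel \<Otimes>\<^sub>M lborel) (\<lambda>q. 8 * pi * C * (yn n + zn n) * A q)"
        by (intro integrable_mult_right Ai)
      show "AE q in lborel \<Otimes>\<^sub>M lborel. norm (kern0 (en n) (yn n) (zn n) q) \<le> norm (8 * pi * C * (yn n + zn n) * A q)"
      proof (intro AE_I2)
        fix q :: "real \<times> real"
        obtain \<tau> r where q: "q = (\<tau>, r)" by (cases q)
        show "norm (kern0 (en n) (yn n) (zn n) q) \<le> norm (8 * pi * C * (yn n + zn n) * A q)"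
          using order_trans[OF kern_estimates(2)[OF nn e, of n n n \<tau> r] abs_ge_self] by (simp add: q A_def)
      qed
    qed (rule kern0_measurable[OF nn e])
    have "\<bar>(\<integral>q. kern (en n) (yn n) (zn n) q \<partial>(lborel \<Otimes>\<^sub>M lborel)) - (\<integral>q. kern0 (en n) (yn n) (zn n) q \<partial>(lborel \<Otimes>\<^sub>M lborel))\<bar>
      = norm (\<integral>q. kern (en n) (yn n) (zn n) q - kern0 (en n) (yn n) (zn n) q \<partial>(lborel \<Otimes>\<^sub>M lborel))"
      by (subst Bochner_Integration.integral_diff[OF ki k0i]) simp
    also have "\<dots> \<le> (\<integral>q. ?K * (\<eta> * A q + (1 + 1 / \<eta>) * R q) \<partial>(lborel \<Otimes>\<^sub>M lborel))"
    proof (rule Bochner_Integration.integral_norm_bound_integral)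
      show "integrable (lborel \<Otimes>\<^sub>M lborel) (\<lambda>q. ?K * (\<eta> * A q + (1 + 1 / \<eta>) * R q))"
        by (intro integrable_mult_right Bochner_Integration.integrable_add Ai Ri)
      fix q :: "real \<times> real"
      obtain \<tau> r where q: "q = (\<tau>, r)" by (cases q)
      have "norm (kern (en n) (yn n) (zn n) q - kern0 (en n) (yn n) (zn n) q) \<le> 8 * pi * C * (yn n + zn n) * (\<eta> * A q + (1 + 1 / \<eta>) * R q)"
        using kern_estimates(3)[OF nn e \<eta>, of n n n \<tau> r] by (simp add: q A_def R_def distrib_left mult_ac)
      also have "\<dots> \<le> ?K * (\<eta> * A q + (1 + 1 / \<eta>) * R q)"
        using S[of n] C_nonneg \<eta> dens_nonneg dens_refl_nonneg
        by (intro mult_right_mono mult_left_mono) (auto simp: q A_def R_def)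
      finally show "norm (kern (en n) (yn n) (zn n) q - kern0 (en n) (yn n) (zn n) q) \<le> ?K * (\<eta> * A q + (1 + 1 / \<eta>) * R q)" .
    qed (intro Bochner_Integration.integrable_diff ki k0i)
    also have "\<dots> = ?K * (\<eta> * (\<integral>q. A q \<partial>(lborel \<Otimes>\<^sub>M lborel)) + (1 + 1 / \<eta>) * (\<integral>q. R q \<partial>(lborel \<Otimes>\<^sub>M lborel)))"
      by (simp add: Ai Ri)
    also have "\<dots> \<le> ?K * (\<eta> * 1 + (1 + 1 / \<eta>) * tail_mean (en n) (yn n) (zn n))"
      using K \<eta> Ri(2) pi_gt3 unfolding Ai(2) by (intro mult_left_mono add_mono) auto
    finally show ?case by simp
  qed
qed

lemma J_op_tendsto:
  assumes lim: "yn \<longlonglongrightarrow> y" "zn \<longlonglongrightarrow> z" "en \<longlonglongrightarrow> 0" and e: "\<And>n. en n > 0"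
    and nn: "\<And>n. yn n \<ge> 0" "\<And>n. zn n \<ge> 0"
  shows "(\<lambda>n. J_op p (en n) 1 \<phi> (yn n) (zn n)) \<longlonglongrightarrow> L_op \<phi> y z"
proof -
  have yz: "y \<ge> 0" "z \<ge> 0"
    using lim(1,2) nn by (auto intro: LIMSEQ_le_const)
  have Ml: "(\<lambda>n. sqrt (max (yn n) (zn n))) \<longlonglongrightarrow> sqrt (max y z)"
    by (intro tendsto_intros lim)
  show ?thesis
  proof (cases "y + z > 0")
    case False
    then have 0: "y = 0" "z = 0" using yz by auto
    have "(\<lambda>n. 256 * pi * C * sqrt (max (yn n) (zn n))) \<longlonglongrightarrow> 256 * pi * C * sqrt (max y z)"
      by (intro tendsto_intros Ml)
    then have "(\<lambda>n. 256 * pi * C * sqrt (max (yn n) (zn n))) \<longlonglongrightarrow> 0" by (simp add: 0)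
    then have "(\<lambda>n. J_op p (en n) 1 \<phi> (yn n) (zn n)) \<longlonglongrightarrow> 0"
      by (rule Lim_null_comparison[rotated]) (use J_op_bound[OF nn e] in \<open>simp add: always_eventually\<close>)
    then show ?thesis by (simp add: 0 L_op_def)
  next
    case True
    have "Bseq (\<lambda>n. yn n + zn n)"
      by (rule convergent_imp_Bseq) (use tendsto_add[OF lim(1,2)] in \<open>auto simp: convergent_def\<close>)
    then obtain S where S: "\<And>n. yn n + zn n \<le> S"
      unfolding Bseq_def using abs_le_D1 by (metis real_norm_def)
    define I where "I = (\<integral>\<tau>. indicator {-1<..<1} \<tau> * cavg_lim y z ((rel_speed y z \<tau>)\<^sup>2) \<partial>lborel)"
    have "(\<lambda>n. \<integral>q. kern0 (en n) (yn n) (zn n) q \<partial>(lborel \<Otimes>\<^sub>M lborel)) \<longlonglongrightarrow> I * (1 / (4 * pi))"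
      unfolding I_def by (rule kern0_tendsto[OF lim e nn yz True S])
    from tendsto_add[OF this kern_diff_tendsto[OF lim e nn yz True S]]
    have "(\<lambda>n. \<integral>q. kern (en n) (yn n) (zn n) q \<partial>(lborel \<Otimes>\<^sub>M lborel)) \<longlonglongrightarrow> I * (1 / (4 * pi))" by simp
    then have l: "(\<lambda>n. 4 * pi / sqrt (max (yn n) (zn n)) * (\<integral>q. kern (en n) (yn n) (zn n) q \<partial>(lborel \<Otimes>\<^sub>M lborel)))
       \<longlonglongrightarrow> 4 * pi / sqrt (max y z) * (I * (1 / (4 * pi)))"
      using True yz by (intro tendsto_intros Ml) (auto simp: max_def)
    have "(\<lambda>n. yn n + zn n) \<longlonglongrightarrow> y + z" by (intro tendsto_intros lim)
    then have "\<forall>\<^sub>F n in sequentially. 0 < yn n + zn n" using True by (rule order_tendstoD(1))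
    then have "\<forall>\<^sub>F n in sequentially. 4 * pi / sqrt (max (yn n) (zn n)) * (\<integral>q. kern (en n) (yn n) (zn n) q \<partial>(lborel \<Otimes>\<^sub>M lborel))
        = J_op p (en n) 1 \<phi> (yn n) (zn n)"
      by eventually_elim (simp add: J_op_kern(1)[OF nn _ e])
    from Lim_transform_eventually[OF l this]
    have "(\<lambda>n. J_op p (en n) 1 \<phi> (yn n) (zn n)) \<longlonglongrightarrow> 4 * pi / sqrt (max y z) * (I * (1 / (4 * pi)))" .
    moreover have "I = (LBINT \<tau>:{-1..1}. cavg_lim y z ((rel_speed y z \<tau>)\<^sup>2))"
      unfolding I_def set_lebesgue_integral_def
    proof (rule integral_cong_AE)
      show "AE \<tau> in lborel. indicator {-1<..<1} \<tau> * cavg_lim y z ((rel_speed y z \<tau>)\<^sup>2) = indicator {-1..1} \<tau> *\<^sub>R cavg_lim y z ((rel_speed y z \<tau>)\<^sup>2)"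
        by (rule AE_mp[OF AE_lborel_singleton[of 1]], rule AE_mp[OF AE_lborel_singleton[of "-1"]]) (auto simp: indicator_def)
    qed (unfold cavg_lim_def, measurable)
    moreover have "L_op \<phi> y z = (1 / sqrt (max y z)) * (LBINT \<tau>:{-1..1}. cavg_lim y z ((rel_speed y z \<tau>)\<^sup>2))"
      using L_op_eq[OF yz True] by (simp add: rel_speed_def)
    ultimately show ?thesis by simp
  qed
qed

end

subsection \<open>The cubic term\<close>

text \<open>In the interior by monotonicity of the integral; on the boundary \<open>W\<close> is a
  nonnegative multiple of a single value of \<open>\<Phi>\<close>. It transfers pointwise
  inequalities for the mixed square in \<open>Phi\<close> to the kernel.\<close>

lemma W_combine:
  fixes \<Phi> \<Phi>1 \<Phi>2 :: "real \<Rightarrow> real \<Rightarrow> real"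
  assumes m: "case_prod \<Phi> \<in> borel_measurable (borel \<Otimes>\<^sub>M borel)"
    "case_prod \<Phi>1 \<in> borel_measurable (borel \<Otimes>\<^sub>M borel)" "case_prod \<Phi>2 \<in> borel_measurable (borel \<Otimes>\<^sub>M borel)"
    and b: "\<And>r \<rho>. 0 \<le> \<Phi> r \<rho>" "\<And>r \<rho>. \<Phi> r \<rho> \<le> B" "\<And>r \<rho>. 0 \<le> \<Phi>1 r \<rho>" "\<And>r \<rho>. \<Phi>1 r \<rho> \<le> B"
      "\<And>r \<rho>. 0 \<le> \<Phi>2 r \<rho>" "\<And>r \<rho>. \<Phi>2 r \<rho> \<le> B"
    and ab: "\<alpha> \<ge> 0" "\<beta> \<ge> 0" and le: "\<And>r \<rho>. \<Phi> r \<rho> \<le> \<alpha> * \<Phi>1 r \<rho> + \<beta> * \<Phi>2 r \<rho>"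
    and nn: "x \<ge> 0" "y \<ge> 0" "z \<ge> 0"
  shows "W \<Phi> x y z \<le> \<alpha> * W \<Phi>1 x y z + \<beta> * W \<Phi>2 x y z"
proof (cases "x > 0 \<and> y > 0 \<and> z > 0 \<and> x < y + z")
  case True
  then have pos: "x > 0" "y > 0" "z > 0" "x < y + z" by auto
  have [measurable]: "(\<lambda>w. \<Phi>1 (g1 w) (g2 w)) \<in> borel_measurable N"
    if [measurable]: "g1 \<in> borel_measurable N" "g2 \<in> borel_measurable N" for g1 g2 and N :: "'c measure"
    using measurable_compose[OF _ m(2), of "\<lambda>w. (g1 w, g2 w)" N] by simp
  have [measurable]: "(\<lambda>w. \<Phi>2 (g1 w) (g2 w)) \<in> borel_measurable N"
    if [measurable]: "g1 \<in> borel_measurable N" "g2 \<in> borel_measurable N" for g1 g2 and N :: "'c measure"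
    using measurable_compose[OF _ m(3), of "\<lambda>w. (g1 w, g2 w)" N] by simp
  define I where "I \<Psi> = (\<integral>\<^sup>+\<sigma>. \<integral>\<^sup>+\<pi>. ennreal (\<Psi> (sqrt (2 * \<sigma>)) (sqrt (2 * \<pi>))) * ennreal (gram_density x y z \<sigma> \<pi>) \<partial>lborel \<partial>lborel)"
    for \<Psi> :: "real \<Rightarrow> real \<Rightarrow> real"
  define k where "k = ennreal (4 * pi / sqrt (x * y * z))"
  have "I \<Phi> \<le> (\<integral>\<^sup>+\<sigma>. \<integral>\<^sup>+\<pi>. ennreal \<alpha> * (ennreal (\<Phi>1 (sqrt (2 * \<sigma>)) (sqrt (2 * \<pi>))) * ennreal (gram_density x y z \<sigma> \<pi>))
       + ennreal \<beta> * (ennreal (\<Phi>2 (sqrt (2 * \<sigma>)) (sqrt (2 * \<pi>))) * ennreal (gram_density x y z \<sigma> \<pi>)) \<partial>lborel \<partial>lborel)"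
    unfolding I_def
  proof (intro nn_integral_mono)
    fix \<sigma> \<pi> :: real
    have "ennreal (\<Phi> (sqrt (2 * \<sigma>)) (sqrt (2 * \<pi>))) \<le> ennreal \<alpha> * ennreal (\<Phi>1 (sqrt (2 * \<sigma>)) (sqrt (2 * \<pi>))) + ennreal \<beta> * ennreal (\<Phi>2 (sqrt (2 * \<sigma>)) (sqrt (2 * \<pi>)))"
      using le[of "sqrt (2 * \<sigma>)" "sqrt (2 * \<pi>)"] ab b
      by (simp add: ennreal_mult[symmetric] ennreal_plus[symmetric] ennreal_leI del: ennreal_plus)
    from mult_right_mono[OF this, of "ennreal (gram_density x y z \<sigma> \<pi>)"]
    show "ennreal (\<Phi> (sqrt (2 * \<sigma>)) (sqrt (2 * \<pi>))) * ennreal (gram_density x y z \<sigma> \<pi>)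
      \<le> ennreal \<alpha> * (ennreal (\<Phi>1 (sqrt (2 * \<sigma>)) (sqrt (2 * \<pi>))) * ennreal (gram_density x y z \<sigma> \<pi>))
       + ennreal \<beta> * (ennreal (\<Phi>2 (sqrt (2 * \<sigma>)) (sqrt (2 * \<pi>))) * ennreal (gram_density x y z \<sigma> \<pi>))"
      by (simp only: mult.assoc distrib_right zero_le simp_thms)
  qed
  also have "\<dots> = ennreal \<alpha> * I \<Phi>1 + ennreal \<beta> * I \<Phi>2"
    unfolding I_def by (simp add: nn_integral_add nn_integral_cmult)
  finally have "k * I \<Phi> \<le> k * (ennreal \<alpha> * I \<Phi>1 + ennreal \<beta> * I \<Phi>2)" by (rule mult_left_mono) simp
  also have "\<dots> = ennreal \<alpha> * (k * I \<Phi>1) + ennreal \<beta> * (k * I \<Phi>2)" by (simp add: distrib_left mult_ac)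
  finally have "ennreal (W \<Phi> x y z) \<le> ennreal \<alpha> * ennreal (W \<Phi>1 x y z) + ennreal \<beta> * ennreal (W \<Phi>2 x y z)"
    unfolding k_def I_def
      ennreal_W_interior[OF m(1) b(1,2) pos, symmetric] ennreal_W_interior[OF m(2) b(3,4) pos, symmetric]
      ennreal_W_interior[OF m(3) b(5,6) pos, symmetric] .
  then show ?thesis
    using ab b by (simp add: ennreal_mult[symmetric] ennreal_plus[symmetric] W_nonneg ennreal_le_iff del: ennreal_plus)
next
  case False
  have mono: "c * \<Phi> r \<rho> \<le> \<alpha> * (c * \<Phi>1 r \<rho>) + \<beta> * (c * \<Phi>2 r \<rho>)" if "c \<ge> 0" for c r \<rho>
    using mult_left_mono[OF le that, of r \<rho>] by (simp add: distrib_left mult_ac)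
  have outside: "\<not> (x_star x y z > 0 \<and> x > 0 \<and> y > 0 \<and> z > 0)" using False by (auto simp: x_star_def)
  then show ?thesis
    unfolding W_def Let_def if_not_P[OF outside] using nn by (auto simp: mono simp del: times_divide_eq_left)
qed

lemma nn_integral_inverse_sqrt:
  assumes "0 \<le> a" "a \<le> b"
  shows "(\<integral>\<^sup>+s. ennreal (1 / sqrt s) * indicator {a..b} s \<partial>lborel) \<le> ennreal (2 * (sqrt b - sqrt a))"
proof -
  have "(\<integral>\<^sup>+s. ennreal (1 / sqrt s) * indicator {a..b} s \<partial>lborel) = (\<integral>\<^sup>+s. (ennreal (1 / sqrt s) * indicator {a..b} s) * indicator {0<..} s \<partial>lborel)"
    using assms by (intro nn_integral_cong) (auto simp: indicator_def ennreal_neg)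
  also have "\<dots> = (\<integral>\<^sup>+t. ennreal (2 * t) * (ennreal (1 / sqrt (t\<^sup>2)) * indicator {a..b} (t\<^sup>2)) * indicator {0<..} t \<partial>lborel)"
    by (rule nn_integral_square_substitution[symmetric]) measurable
  also have "\<dots> \<le> (\<integral>\<^sup>+t. 2 * indicator {sqrt a..sqrt b} t \<partial>lborel)"
  proof (intro nn_integral_mono)
    fix t :: real
    show "ennreal (2 * t) * (ennreal (1 / sqrt (t\<^sup>2)) * indicator {a..b} (t\<^sup>2)) * indicator {0<..} t \<le> 2 * indicator {sqrt a..sqrt b} t"
    proof (cases "t > 0 \<and> t\<^sup>2 \<in> {a..b}")
      case True
      then have "sqrt a \<le> t" "t \<le> sqrt b" by (auto intro: real_le_rsqrt real_le_lsqrt)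
      moreover have "ennreal (2 * t) * ennreal (1 / sqrt (t\<^sup>2)) = 2"
        using True by (subst ennreal_mult[symmetric]) auto
      ultimately show ?thesis using True by simp
    qed auto
  qed
  also have "\<dots> = ennreal (2 * (sqrt b - sqrt a))"
  proof -
    have 2: "ennreal (2 * (sqrt b - sqrt a)) = 2 * ennreal (sqrt b - sqrt a)"
      using assms by (subst ennreal_mult) auto
    show ?thesis unfolding 2 using assms by (simp add: nn_integral_cmult_indicator)
  qed
  finally show ?thesis .
qed

section \<open>Weighted bounds for half of the kernel\<close>

context profile
begin

text \<open>Half of the kernel: \<open>Phi\<close> lies below twice the sum of \<open>aS\<close> and its transpose.\<close>

definition aS :: "real \<Rightarrow> real \<Rightarrow> real \<Rightarrow> real" where "aS e r \<rho> = (p (r / e))\<^sup>2 / e ^ 4"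

text \<open>The factor \<open>\<epsilon>\<^sup>3\<close> of the cubic term is built in; together
  with the \<open>e ^ 4\<close> in \<open>aS\<close> it leaves the weight \<open>kS\<close>, which
  carries a single power of \<open>1 / e\<close>.\<close>

definition Ws :: "real \<Rightarrow> real \<Rightarrow> real \<Rightarrow> real \<Rightarrow> real" where
  "Ws e x y z = e ^ 3 * W (aS e) x y z"

definition kS :: "real \<Rightarrow> real \<Rightarrow> real" where "kS e s = (p (sqrt 2 * s / e))\<^sup>2 / e"

text \<open>The two summands are the bounds of \<open>r * (p r)\<^sup>2\<close> and of
  \<open>r * (p r)\<^sup>2 * sqrt r\<close> that follow from \<open>p_bound\<close> and
  \<open>p_decay\<close>.\<close>

definition A0 :: real where "A0 = c1 * c0 + c1 * sqrt (c1 * c0)"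

lemma c_nonneg: "0 \<le> c0" "0 \<le> c1"
  using p_bound[of 0] p_decay[of 0] by auto

lemma aS_measurable: "case_prod (aS e) \<in> borel_measurable (borel \<Otimes>\<^sub>M borel)"
  unfolding aS_def by measurable

lemma aS_swap_measurable: "(\<lambda>(r, \<rho>). aS e \<rho> r) \<in> borel_measurable (borel \<Otimes>\<^sub>M borel)"
  unfolding aS_def by measurable

lemma kS_measurable [measurable]: "kS e \<in> borel_measurable borel"
  unfolding kS_def by measurable

lemma aS_nonneg: "0 \<le> aS e r \<rho>"
  by (simp add: aS_def)

lemma kS_nonneg: "e > 0 \<Longrightarrow> 0 \<le> kS e s"
  by (simp add: kS_def)

lemma aS_le: "aS e r \<rho> \<le> (2 * c0)\<^sup>2 / e ^ 4"
proof -
  have "\<bar>p (r / e)\<bar> \<le> \<bar>2 * c0\<bar>" using p_bound[of "r/e"] c_nonneg by simp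
  then have "(p (r / e))\<^sup>2 \<le> (2 * c0)\<^sup>2" by (rule abs_le_square_iff[THEN iffD1])
  then show ?thesis by (simp add: aS_def divide_right_mono)
qed

lemma Ws_nonneg: "e > 0 \<Longrightarrow> 0 \<le> Ws e x y z"
  by (simp add: Ws_def W_nonneg aS_nonneg)

lemma A0_nonneg: "0 \<le> A0"
  using c_nonneg by (simp add: A0_def)

text \<open>In the scaled variable \<open>r = sqrt 2 * s / e\<close>, the second bound uses the
  decay once in full, \<open>r * \<bar>p r\<bar> \<le> c1\<close>, and once through
  \<open>sqrt (r * (p r)\<^sup>2)\<close>. It improves the first by the factor
  \<open>sqrt (e / s)\<close>, small only for \<open>s\<close> much larger than
  \<open>e\<close>.\<close>

lemma kS_bounds:
  assumes "e > 0" "s \<ge> 0"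
  shows "s * kS e s \<le> A0" "s * kS e s * sqrt s \<le> A0 * sqrt e"
proof -
  define r where "r = sqrt 2 * s / e"
  have r: "r \<ge> 0" using assms by (simp add: r_def)
  have se: "s / e \<le> r" "0 \<le> s / e" using assms by (auto simp: r_def divide_right_mono mult_le_cancel_right1)
  note d = p_decay[OF r]
  have p0: "(p r)\<^sup>2 = \<bar>p r\<bar> * \<bar>p r\<bar>" by (simp add: power2_eq_square)
  have k: "s * kS e s = s / e * (p r)\<^sup>2" by (simp add: kS_def r_def)
  have rp: "r * (p r)\<^sup>2 \<le> c1 * c0"
    unfolding p0 mult.assoc[symmetric] by (intro mult_mono d p_bound c_nonneg) auto
  have "s * kS e s \<le> r * (p r)\<^sup>2" unfolding k using se by (intro mult_right_mono) auto
  then have 1: "s * kS e s \<le> c1 * c0" using rp by linarith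
  then show "s * kS e s \<le> A0" using c_nonneg by (simp add: A0_def add_increasing2)
  have "sqrt s = sqrt (s / e) * sqrt e" using assms by (simp add: real_sqrt_mult[symmetric])
  then have "s * kS e s * sqrt s = (s / e * (p r)\<^sup>2 * sqrt (s / e)) * sqrt e" unfolding k by simp
  also have "\<dots> \<le> (r * (p r)\<^sup>2 * sqrt r) * sqrt e"
    using se r assms by (intro mult_right_mono mult_mono) auto
  also have "r * (p r)\<^sup>2 * sqrt r = (r * \<bar>p r\<bar>) * (sqrt r * \<bar>p r\<bar>)" unfolding p0 by simp
  also have "sqrt r * \<bar>p r\<bar> = sqrt (r * (p r)\<^sup>2)" by (simp add: real_sqrt_mult)
  also have "(r * \<bar>p r\<bar>) * sqrt (r * (p r)\<^sup>2) * sqrt e \<le> c1 * sqrt (c1 * c0) * sqrt e"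
  proof (rule mult_right_mono)
    show "(r * \<bar>p r\<bar>) * sqrt (r * (p r)\<^sup>2) \<le> c1 * sqrt (c1 * c0)"
      by (rule mult_mono[OF d real_sqrt_le_mono[OF rp]]) (use r c_nonneg in auto)
  qed (use assms in simp)
  also have "\<dots> \<le> A0 * sqrt e" using assms c_nonneg by (intro mult_right_mono) (auto simp: A0_def)
  finally show "s * kS e s * sqrt s \<le> A0 * sqrt e" .
qed

text \<open>\<open>aS\<close> ignores its second argument, so the \<open>\<theta>\<close>-integral
  contributes just \<open>2 * pi\<close>.\<close>

lemma Ws_interior:
  assumes e: "e > 0" and pos: "x > 0" "y > 0" "z > 0" "x < y + z"
  shows "ennreal (Ws e x y z) = ennreal (8 * pi\<^sup>2 / sqrt (x * y * z)) * (\<integral>\<^sup>+s. ennreal (kS e s) * indicator {s_low x y z..s_high x y z} s \<partial>lborel)"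
proof -
  have xs: "x_star x y z > 0" using pos by (simp add: x_star_def)
  define a where "a s = 2 * pi * aS e (sqrt 2 * s) 0" for s
  have a: "(LBINT \<theta>:{0..2 * pi}. aS e (sqrt 2 * s) (sqrt 2 * Y_star x y z s \<theta>)) = a s" for s
    unfolding set_lebesgue_integral_def a_def aS_def by simp
  have [measurable]: "a \<in> borel_measurable borel" unfolding a_def aS_def by measurable
  have "W (aS e) x y z = 4 * pi / sqrt (x * y * z) * (LBINT s:{s_low x y z..s_high x y z}. a s)"
    using pos xs by (simp add: W_def Let_def a s_low_def s_high_def)
  then have "Ws e x y z = 4 * pi / sqrt (x * y * z) * (LBINT s:{s_low x y z..s_high x y z}. e ^ 3 * a s)"
    by (simp add: Ws_def)
  also have "(\<lambda>s. e ^ 3 * a s) = (\<lambda>s. 2 * pi * kS e s)"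
    using e by (simp add: fun_eq_iff a_def aS_def kS_def power3_eq_cube power4_eq_xxxx)
  finally have "Ws e x y z = 8 * pi\<^sup>2 / sqrt (x * y * z) * (LBINT s:{s_low x y z..s_high x y z}. kS e s)"
    by (simp add: power2_eq_square)
  moreover have "0 \<le> 8 * pi\<^sup>2 / sqrt (x * y * z)" using pos by simp
  ultimately have "ennreal (Ws e x y z) = ennreal (8 * pi\<^sup>2 / sqrt (x * y * z)) * ennreal (LBINT s:{s_low x y z..s_high x y z}. kS e s)"
    by (simp only: ennreal_mult')
  also have "ennreal (LBINT s:{s_low x y z..s_high x y z}. kS e s) = (\<integral>\<^sup>+s. ennreal (kS e s) * indicator {s_low x y z..s_high x y z} s \<partial>lborel)"
  proof (rule ennreal_set_integral_bounded)
    show "kS e s \<le> (2 * c0)\<^sup>2 / e ^ 4 * e ^ 3" for s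
      using aS_le[of e "sqrt 2 * s" 0] e by (simp add: aS_def kS_def power3_eq_cube power4_eq_xxxx field_simps)
  qed (use e kS_nonneg in auto)
  finally show ?thesis .
qed

text \<open>Since \<open>\<bar>x - y\<bar> = (q - m) * (q + m)\<close> and
  \<open>s \<ge> q - m\<close> on the domain, the factor \<open>q - m\<close> is absorbed into
  \<open>s * kS e s\<close>; the domain then contributes its length \<open>2 * m\<close>. The pair
  \<open>P\<close>, \<open>Q\<close> is kept general because it is used both as \<open>x\<close>,
  \<open>y\<close> and as \<open>x_star x y z\<close>, \<open>z\<close>, which have the same
  difference.\<close>

lemma Ws_interior_bounds:
  assumes e: "e > 0" and pos: "x > 0" "y > 0" "z > 0" "x < y + z"
    and PQ: "P \<ge> 0" "Q \<ge> 0" "P + Q > 0" "\<bar>x - y\<bar> = \<bar>P - Q\<bar>"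
    and rng: "{s_low x y z..s_high x y z} \<subseteq> {\<bar>sqrt P - sqrt Q\<bar>..sqrt P + sqrt Q}"
  defines "q \<equiv> sqrt (max P Q)" and "m \<equiv> sqrt (min P Q)"
  shows "Ws e x y z * \<bar>x - y\<bar> \<le> 32 * pi\<^sup>2 * A0 * (q * m) / sqrt (x * y * z)"
    and "Ws e x y z * \<bar>x - y\<bar> \<le> 64 * pi\<^sup>2 * A0 * sqrt e * (sqrt q * m) / sqrt (x * y * z)"
proof -
  have q: "q > 0" "0 \<le> m" "m \<le> q" "q\<^sup>2 = max P Q" "m\<^sup>2 = min P Q"
    using PQ by (auto simp: q_def m_def max_def min_def)
  have lohi: "\<bar>sqrt P - sqrt Q\<bar> = q - m" "sqrt P + sqrt Q = q + m"
    by (auto simp: q_def m_def max_def min_def)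
  have d: "\<bar>x - y\<bar> = (q - m) * (q + m)"
  proof -
    have "(q - m) * (q + m) = q\<^sup>2 - m\<^sup>2" by (simp add: power2_eq_square algebra_simps)
    then show ?thesis using PQ(4) q(4,5) by (auto simp: max_def min_def)
  qed
  define c where "c = 8 * pi\<^sup>2 / sqrt (x * y * z)"
  have c: "c \<ge> 0" using pos by (simp add: c_def)
  have bound: "Ws e x y z * \<bar>x - y\<bar> \<le> c * X"
    if "(\<integral>\<^sup>+s. ennreal (s * kS e s) * indicator {q - m..q + m} s \<partial>lborel) \<le> ennreal Y" "X = (q + m) * Y" "Y \<ge> 0" for X Y
  proof -
    have "(\<integral>\<^sup>+s. ennreal (kS e s) * indicator {s_low x y z..s_high x y z} s \<partial>lborel) * ennreal \<bar>x - y\<bar>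
      = (\<integral>\<^sup>+s. ennreal (kS e s) * indicator {s_low x y z..s_high x y z} s * ennreal \<bar>x - y\<bar> \<partial>lborel)"
      by (rule nn_integral_multc[symmetric]) measurable
    also have "\<dots> \<le> (\<integral>\<^sup>+s. ennreal (q + m) * (ennreal (s * kS e s) * indicator {q - m..q + m} s) \<partial>lborel)"
    proof (intro nn_integral_mono)
      fix s :: real
      show "ennreal (kS e s) * indicator {s_low x y z..s_high x y z} s * ennreal \<bar>x - y\<bar> \<le> ennreal (q + m) * (ennreal (s * kS e s) * indicator {q - m..q + m} s)"
      proof (cases "s \<in> {s_low x y z..s_high x y z}")
        case True
        then have s: "s \<in> {q - m..q + m}" using rng unfolding lohi by blast
        have "kS e s * \<bar>x - y\<bar> \<le> kS e s * (s * (q + m))"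
          unfolding d using s q kS_nonneg[OF e] by (intro mult_left_mono mult_right_mono) auto
        then have "kS e s * \<bar>x - y\<bar> \<le> (q + m) * (s * kS e s)" by (simp add: mult_ac)
        then have "ennreal (kS e s * \<bar>x - y\<bar>) \<le> ennreal ((q + m) * (s * kS e s))" by (rule ennreal_leI)
        then show ?thesis using True s q by (simp add: ennreal_mult' ennreal_mult'')
      qed simp
    qed
    also have "\<dots> = ennreal (q + m) * (\<integral>\<^sup>+s. ennreal (s * kS e s) * indicator {q - m..q + m} s \<partial>lborel)"
      by (rule nn_integral_cmult) measurable
    also have "\<dots> \<le> ennreal (q + m) * ennreal Y"
      using that by (intro mult_left_mono) auto
    finally have "ennreal c * ((\<integral>\<^sup>+s. ennreal (kS e s) * indicator {s_low x y z..s_high x y z} s \<partial>lborel) * ennreal \<bar>x - y\<bar>)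
      \<le> ennreal c * (ennreal (q + m) * ennreal Y)"
      by (rule mult_left_mono) simp
    moreover have "ennreal (Ws e x y z * \<bar>x - y\<bar>) = ennreal c * ((\<integral>\<^sup>+s. ennreal (kS e s) * indicator {s_low x y z..s_high x y z} s \<partial>lborel) * ennreal \<bar>x - y\<bar>)"
      by (simp add: ennreal_mult'' Ws_interior[OF e pos] c_def mult.assoc)
    ultimately have "ennreal (Ws e x y z * \<bar>x - y\<bar>) \<le> ennreal c * (ennreal (q + m) * ennreal Y)" by simp
    also have "\<dots> = ennreal (c * X)"
      using that q c by (simp add: ennreal_mult)
    finally show ?thesis using that q c by (simp add: ennreal_le_iff)
  qed
  have "(\<integral>\<^sup>+s. ennreal (s * kS e s) * indicator {q - m..q + m} s \<partial>lborel) \<le> (\<integral>\<^sup>+s. ennreal A0 * indicator {q - m..q + m} s \<partial>lborel)"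
  proof (intro nn_integral_mono)
    fix s :: real
    show "ennreal (s * kS e s) * indicator {q - m..q + m} s \<le> ennreal A0 * indicator {q - m..q + m} s"
      using kS_bounds(1)[OF e, of s] q by (auto simp: indicator_def intro!: ennreal_leI)
  qed
  also have "\<dots> = ennreal (A0 * (2 * m))"
    using q A0_nonneg by (simp add: nn_integral_cmult_indicator ennreal_mult)
  finally have i: "(\<integral>\<^sup>+s. ennreal (s * kS e s) * indicator {q - m..q + m} s \<partial>lborel) \<le> ennreal (A0 * (2 * m))" .
  have "Ws e x y z * \<bar>x - y\<bar> \<le> c * ((q + m) * (A0 * (2 * m)))"
    by (rule bound[OF i refl]) (use q A0_nonneg in simp)
  also have "\<dots> \<le> c * ((q + q) * (A0 * (2 * m)))"
    using q A0_nonneg c by (intro mult_left_mono mult_right_mono) auto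
  also have "\<dots> = 32 * pi\<^sup>2 * A0 * (q * m) / sqrt (x * y * z)" by (simp add: c_def)
  finally show "Ws e x y z * \<bar>x - y\<bar> \<le> 32 * pi\<^sup>2 * A0 * (q * m) / sqrt (x * y * z)" .
  have "(\<integral>\<^sup>+s. ennreal (s * kS e s) * indicator {q - m..q + m} s \<partial>lborel)
     \<le> (\<integral>\<^sup>+s. ennreal (A0 * sqrt e) * (ennreal (1 / sqrt s) * indicator {q - m..q + m} s) \<partial>lborel)"
  proof (intro nn_integral_mono)
    fix s :: real
    show "ennreal (s * kS e s) * indicator {q - m..q + m} s \<le> ennreal (A0 * sqrt e) * (ennreal (1 / sqrt s) * indicator {q - m..q + m} s)"
    proof (cases "s \<in> {q - m..q + m} \<and> s > 0")
      case True
      have "s * kS e s \<le> A0 * sqrt e * (1 / sqrt s)"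
        using kS_bounds(2)[OF e, of s] True by (simp add: pos_le_divide_eq)
      then have "ennreal (s * kS e s) \<le> ennreal (A0 * sqrt e * (1 / sqrt s))" by (rule ennreal_leI)
      also have "\<dots> = ennreal (A0 * sqrt e) * ennreal (1 / sqrt s)" using e A0_nonneg True by (intro ennreal_mult) auto
      finally show ?thesis using True by simp
    next
      case False
      then have lhs: "ennreal (s * kS e s) * indicator {q - m..q + m} s = 0"
        using q by (cases "s = 0") (auto simp: indicator_def)
      show ?thesis by (simp only: lhs zero_le)
    qed
  qed
  also have "\<dots> = ennreal (A0 * sqrt e) * (\<integral>\<^sup>+s. ennreal (1 / sqrt s) * indicator {q - m..q + m} s \<partial>lborel)"
    by (rule nn_integral_cmult) measurable
  also have "\<dots> \<le> ennreal (A0 * sqrt e) * ennreal (2 * (sqrt (q + m) - sqrt (q - m)))"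
    using q by (intro mult_left_mono nn_integral_inverse_sqrt) auto
  also have "\<dots> = ennreal (A0 * sqrt e * (2 * (sqrt (q + m) - sqrt (q - m))))"
    using e A0_nonneg q by (intro ennreal_mult[symmetric]) auto
  finally have i: "(\<integral>\<^sup>+s. ennreal (s * kS e s) * indicator {q - m..q + m} s \<partial>lborel) \<le> ennreal (A0 * sqrt e * (2 * (sqrt (q + m) - sqrt (q - m))))" .
  have "Ws e x y z * \<bar>x - y\<bar> \<le> c * ((q + m) * (A0 * sqrt e * (2 * (sqrt (q + m) - sqrt (q - m)))))"
    by (rule bound[OF i refl]) (use q A0_nonneg e in simp)
  also have "\<dots> = c * (A0 * sqrt e) * (2 * ((q + m) * (sqrt (q + m) - sqrt (q - m))))" by simp
  also have "\<dots> \<le> c * (A0 * sqrt e) * (2 * (4 * (sqrt q * m)))"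
  \<comment> \<open>Multiplying by the conjugate turns the difference of square roots into
    \<open>2 * m\<close>, and \<open>a \<le> 2 * sqrt q\<close> because
    \<open>m \<le> q\<close>.\<close>
  proof -
    define a b where "a = sqrt (q + m)" and "b = sqrt (q - m)"
    have ab: "a > 0" "b \<ge> 0" "a\<^sup>2 = q + m" "b\<^sup>2 = q - m" using q by (auto simp: a_def b_def)
    have "(a - b) * a \<le> (a - b) * (a + b)" using ab q by (intro mult_left_mono) (auto simp: a_def b_def)
    also have "\<dots> = 2 * m" using ab by (simp add: power2_eq_square algebra_simps)
    finally have "a * ((a - b) * a) \<le> a * (2 * m)" using ab by (intro mult_left_mono) auto
    also have "\<dots> \<le> (2 * sqrt q) * (2 * m)"
    proof (intro mult_right_mono)
      have "a \<le> sqrt (4 * q)" unfolding a_def using q by (intro real_sqrt_le_mono) auto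
      then show "a \<le> 2 * sqrt q" by (simp add: real_sqrt_mult)
    qed (use q in simp)
    finally have "(q + m) * (a - b) \<le> 4 * (sqrt q * m)"
      unfolding ab(3)[symmetric] by (simp add: power2_eq_square mult_ac)
    then show ?thesis using c A0_nonneg e unfolding a_def b_def by (intro mult_left_mono) auto
  qed
  also have "\<dots> = 64 * pi\<^sup>2 * A0 * sqrt e * (sqrt q * m) / sqrt (x * y * z)" by (simp add: c_def)
  finally show "Ws e x y z * \<bar>x - y\<bar> \<le> 64 * pi\<^sup>2 * A0 * sqrt e * (sqrt q * m) / sqrt (x * y * z)" .
qed

end

lemma min_one_le_sqrt:
  assumes "0 \<le> x"
  shows "min 1 x \<le> sqrt x"
proof (cases "x \<le> 1")
  case True
  then have "x\<^sup>2 \<le> x" using assms by (simp add: power2_eq_square mult_left_le)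
  then show ?thesis using True by (simp add: real_le_rsqrt)
qed simp

text \<open>The right side is the power 3/4 of \<open>x\<close>: half a power cancels
  \<open>sqrt x\<close> in the denominator of the kernel, and the remaining quarter is compared with
  the fourth root of \<open>y\<close> in \<open>Ws_bounds\<close>.\<close>

lemma min_one_le_quartic: "0 \<le> x \<Longrightarrow> min 1 x \<le> sqrt x * sqrt (sqrt x)"
proof (cases "x \<le> 1")
  case True
  assume "0 \<le> x"
  then have "x = sqrt x * sqrt x" by simp
  also have "\<dots> \<le> sqrt x * sqrt (sqrt x)"
    using True \<open>0 \<le> x\<close> min_one_le_sqrt[of "sqrt x"] by (intro mult_left_mono) (auto simp: min_def split: if_splits)
  finally show ?thesis by simp
next
  case False
  then have "1 * 1 \<le> sqrt x * sqrt (sqrt x)" by (intro mult_mono) auto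
  then show ?thesis using False by simp
qed

context profile
begin

text \<open>The factor 128 is reached in the regime \<open>2 * z < x\<close>: 64 from
  \<open>Ws_interior_bounds\<close> times the fourth root of 16.\<close>

definition BS :: real where "BS = 128 * pi\<^sup>2 * A0"

lemma BS_nonneg: "0 \<le> BS" by (simp add: BS_def A0_nonneg)

lemma BS_ge: "k \<le> 128 \<Longrightarrow> X \<le> A0 \<Longrightarrow> 0 \<le> k \<Longrightarrow> k * pi\<^sup>2 * X \<le> BS"
  "k \<le> 128 \<Longrightarrow> 0 \<le> k \<Longrightarrow> e \<ge> 0 \<Longrightarrow> X \<le> A0 * sqrt e \<Longrightarrow> k * pi\<^sup>2 * X \<le> BS * sqrt e"
proof -
  show "k * pi\<^sup>2 * X \<le> BS" if "k \<le> 128" "X \<le> A0" "0 \<le> k"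
  proof -
    have "k * pi\<^sup>2 * X \<le> k * pi\<^sup>2 * A0" using that by (intro mult_left_mono) auto
    also have "\<dots> \<le> BS" unfolding BS_def using that A0_nonneg by (intro mult_right_mono) auto
    finally show ?thesis .
  qed
  show "k * pi\<^sup>2 * X \<le> BS * sqrt e" if "k \<le> 128" "0 \<le> k" "e \<ge> 0" "X \<le> A0 * sqrt e"
  proof -
    have "k * pi\<^sup>2 * X \<le> k * pi\<^sup>2 * (A0 * sqrt e)" using that by (intro mult_left_mono) auto
    also have "\<dots> \<le> 128 * pi\<^sup>2 * (A0 * sqrt e)" using that A0_nonneg by (intro mult_right_mono) auto
    finally show ?thesis by (simp add: BS_def)
  qed
qed

lemma Ws_boundary:
  assumes e: "e > 0"
  shows "y > 0 \<Longrightarrow> z > 0 \<Longrightarrow> Ws e 0 y z = 16 * pi\<^sup>2 / sqrt (y * z) * kS e (sqrt y)"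
    and "x > 0 \<Longrightarrow> x < z \<Longrightarrow> Ws e x 0 z = 16 * pi\<^sup>2 / sqrt (x * z) * kS e (sqrt x)"
    and "x > 0 \<Longrightarrow> x < y \<Longrightarrow> Ws e x y 0 = 16 * pi\<^sup>2 / sqrt (x * y) * kS e (sqrt (y - x))"
proof -
  have k: "e ^ 3 * aS e (sqrt (2 * v)) \<rho> = kS e (sqrt v)" for v \<rho>
    using e by (simp add: aS_def kS_def real_sqrt_mult power3_eq_cube power4_eq_xxxx)
  have r: "e ^ 3 * ((4 * pi)\<^sup>2 / s * A) = 16 * pi\<^sup>2 / s * (e ^ 3 * A)" for s A :: real
    by (simp add: power_mult_distrib)
  show "Ws e 0 y z = 16 * pi\<^sup>2 / sqrt (y * z) * kS e (sqrt y)" if "y > 0" "z > 0"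
  proof -
    have "W (aS e) 0 y z = (4 * pi)\<^sup>2 / sqrt (y * z) * aS e (sqrt (2 * y)) (sqrt (2 * z))"
      using that by (simp add: W_def Let_def)
    then show ?thesis by (simp only: Ws_def r k)
  qed
  show "Ws e x 0 z = 16 * pi\<^sup>2 / sqrt (x * z) * kS e (sqrt x)" if "x > 0" "x < z"
  proof -
    have "W (aS e) x 0 z = (4 * pi)\<^sup>2 / sqrt (x * z) * aS e (sqrt (2 * x)) (sqrt (2 * (z - x)))"
      using that by (simp add: W_def Let_def)
    then show ?thesis by (simp only: Ws_def r k)
  qed
  show "Ws e x y 0 = 16 * pi\<^sup>2 / sqrt (x * y) * kS e (sqrt (y - x))" if "x > 0" "x < y"
  proof -
    have "W (aS e) x y 0 = (4 * pi)\<^sup>2 / sqrt (x * y) * aS e (sqrt (2 * (y - x))) (sqrt (2 * x))"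
      using that by (simp add: W_def Let_def)
    then show ?thesis by (simp only: Ws_def r k)
  qed
qed

lemma Ws_zero:
  assumes "\<not> (x > 0 \<and> y > 0 \<and> z > 0 \<and> x < y + z)" "\<not> (x = 0 \<and> y > 0 \<and> z > 0)"
    "\<not> (y = 0 \<and> 0 < x \<and> x < z)" "\<not> (z = 0 \<and> 0 < x \<and> x < y)"
  shows "W \<Phi> x y z = 0"
proof -
  have 1: "\<not> (x_star x y z > 0 \<and> x > 0 \<and> y > 0 \<and> z > 0)" using assms(1) by (auto simp: x_star_def)
  have 3: "\<not> (y = 0 \<and> x < z \<and> 0 < x)" and 4: "\<not> (z = 0 \<and> x < y \<and> 0 < x)" using assms(3,4) by blast+
  show ?thesis
    unfolding W_def Let_def if_not_P[OF 1] if_not_P[OF assms(2)] if_not_P[OF 3] if_not_P[OF 4] ..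
qed

text \<open>For \<open>x \<le> 2 * z\<close> the pair \<open>x\<close>, \<open>y\<close> is used:
  \<open>q * m = sqrt x * sqrt y\<close>, and the weight \<open>sqrt z\<close> cancels the rest of
  the denominator. For \<open>2 * z < x\<close> the weight is a power of \<open>x\<close>, so the
  factor \<open>sqrt z\<close> must come from the domain; the pair \<open>x_star x y z\<close>,
  \<open>z\<close> gives it through \<open>m' \<le> sqrt z\<close>. The boundary cases follow from
  the explicit values and \<open>kS_bounds\<close>.\<close>

lemma Ws_bounds:
  assumes e: "e > 0" and nn: "x \<ge> 0" "y \<ge> 0" "z \<ge> 0"
  shows "x \<le> 2 * z \<Longrightarrow> Ws e x y z * \<bar>x - y\<bar> * sqrt z \<le> BS"
    and "x \<le> 2 * z \<Longrightarrow> Ws e x y z * \<bar>x - y\<bar> * sqrt z * sqrt (sqrt (max x y)) \<le> BS * sqrt e"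
    and "2 * z < x \<Longrightarrow> Ws e x y z * \<bar>x - y\<bar> * min 1 x \<le> BS * sqrt e"
proof -
  have B: "0 \<le> BS" "0 \<le> BS * sqrt e" using BS_nonneg e by auto
  consider (int) "x > 0" "y > 0" "z > 0" "x < y + z" | (x) "x = 0" "y > 0" "z > 0" | (y) "y = 0" "0 < x" "x < z"
    | (z) "z = 0" "0 < x" "x < y" | (o) "Ws e x y z = 0"
  proof -
    have "Ws e x y z = 0" if "\<not> (x > 0 \<and> y > 0 \<and> z > 0 \<and> x < y + z)" "\<not> (x = 0 \<and> y > 0 \<and> z > 0)"
        "\<not> (y = 0 \<and> 0 < x \<and> x < z)" "\<not> (z = 0 \<and> 0 < x \<and> x < y)"
      unfolding Ws_def Ws_zero[OF that] by simp
    then show ?thesis using that by blast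
  qed
  then have "(x \<le> 2 * z \<longrightarrow> Ws e x y z * \<bar>x - y\<bar> * sqrt z \<le> BS) \<and>
     (x \<le> 2 * z \<longrightarrow> Ws e x y z * \<bar>x - y\<bar> * sqrt z * sqrt (sqrt (max x y)) \<le> BS * sqrt e) \<and>
     (2 * z < x \<longrightarrow> Ws e x y z * \<bar>x - y\<bar> * min 1 x \<le> BS * sqrt e)"
  proof cases
    case o
    then show ?thesis using B by simp
  next
    case x
    have 1: "Ws e x y z * \<bar>x - y\<bar> * sqrt z = 16 * pi\<^sup>2 * (sqrt y * kS e (sqrt y))"
    proof -
      have "Ws e x y z * \<bar>x - y\<bar> * sqrt z = 16 * pi\<^sup>2 * kS e (sqrt y) * (y / sqrt y)"
        using x by (simp add: Ws_boundary(1)[OF e] real_sqrt_mult)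
      also have "y / sqrt y = sqrt y" using x by (simp add: real_div_sqrt)
      finally show ?thesis by simp
    qed
    have "16 * pi\<^sup>2 * (sqrt y * kS e (sqrt y)) \<le> BS" by (intro BS_ge kS_bounds e) (use x in auto)
    moreover have "16 * pi\<^sup>2 * (sqrt y * kS e (sqrt y) * sqrt (sqrt y)) \<le> BS * sqrt e"
      by (intro BS_ge kS_bounds e) (use x e in auto)
    ultimately show ?thesis unfolding 1 using x by (auto simp: mult.assoc)
  next
    case y
    have 1: "Ws e x y z * \<bar>x - y\<bar> * sqrt z = 16 * pi\<^sup>2 * (sqrt x * kS e (sqrt x))"
    proof -
      have "Ws e x y z * \<bar>x - y\<bar> * sqrt z = 16 * pi\<^sup>2 * kS e (sqrt x) * (x / sqrt x)"
        using y by (simp add: Ws_boundary(2)[OF e] real_sqrt_mult)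
      also have "x / sqrt x = sqrt x" using y by (simp add: real_div_sqrt)
      finally show ?thesis by simp
    qed
    have "16 * pi\<^sup>2 * (sqrt x * kS e (sqrt x)) \<le> BS" by (intro BS_ge kS_bounds e) (use y in auto)
    moreover have "16 * pi\<^sup>2 * (sqrt x * kS e (sqrt x) * sqrt (sqrt x)) \<le> BS * sqrt e"
      by (intro BS_ge kS_bounds e) (use y e in auto)
    ultimately show ?thesis unfolding 1 using y by (auto simp: mult.assoc)
  next
    case z
    define s where "s = sqrt (y - x)"
    have s: "s \<ge> 0" "s\<^sup>2 = y - x" using z by (auto simp: s_def)
    have ss: "sqrt s \<le> sqrt (sqrt y)" using z by (simp add: s_def)
    have "Ws e x y z * \<bar>x - y\<bar> * min 1 x = 16 * pi\<^sup>2 / sqrt (x * y) * kS e s * s\<^sup>2 * min 1 x"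
      using z by (simp add: Ws_boundary(3)[OF e] s_def)
    also have "\<dots> = 16 * pi\<^sup>2 * ((s * kS e s * sqrt s) * (sqrt s * min 1 x / sqrt (x * y)))"
    proof -
      have "s * s = s * (sqrt s * sqrt s)" using s(1) by simp
      then have "s\<^sup>2 = s * sqrt s * sqrt s" by (simp only: power2_eq_square mult.assoc)
      then show ?thesis by simp
    qed
    \<comment> \<open>Here \<open>s \<le> sqrt y\<close> and \<open>x < y\<close>, so
      \<open>sqrt s\<close> times the power 3/4 of \<open>x\<close> is at most
      \<open>sqrt (x * y)\<close>.\<close>
    also have "\<dots> \<le> 16 * pi\<^sup>2 * ((A0 * sqrt e) * 1)"
    proof (rule mult_left_mono, rule mult_mono[OF kS_bounds(2)[OF e s(1)]])
      have "sqrt s * min 1 x \<le> sqrt (sqrt y) * (sqrt x * sqrt (sqrt x))"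
        using ss min_one_le_quartic[of x] z s(1) by (intro mult_mono) auto
      also have "\<dots> \<le> sqrt (sqrt y) * (sqrt x * sqrt (sqrt y))"
        using z by (intro mult_left_mono) auto
      also have "\<dots> = sqrt (x * y)" using z by (simp add: real_sqrt_mult)
      finally show "sqrt s * min 1 x / sqrt (x * y) \<le> 1" using z by simp
    qed (use z s A0_nonneg e in auto)
    also have "\<dots> \<le> BS * sqrt e" by (intro BS_ge) (use e in auto)
    finally show ?thesis using z by simp
  next
    case int
    have xs: "x_star x y z = y + z - x" using int by (simp add: x_star_def)
    define q m where "q = sqrt (max x y)" and "m = sqrt (min x y)"
    have q: "q > 0" "m > 0" "q * m = sqrt x * sqrt y"
      using int by (auto simp: q_def m_def max_def min_def)
    have r1: "{s_low x y z..s_high x y z} \<subseteq> {\<bar>sqrt x - sqrt y\<bar>..sqrt x + sqrt y}"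
      by (auto simp: s_low_def s_high_def)
    note I = Ws_interior_bounds[OF e int _ _ _ refl r1, folded q_def m_def]
    have i1: "Ws e x y z * \<bar>x - y\<bar> \<le> 32 * pi\<^sup>2 * A0 * (q * m) / sqrt (x * y * z)" by (rule I(1)) (use int in auto)
    have i2: "Ws e x y z * \<bar>x - y\<bar> \<le> 64 * pi\<^sup>2 * A0 * sqrt e * (sqrt q * m) / sqrt (x * y * z)" by (rule I(2)) (use int in auto)
    have a: "Ws e x y z * \<bar>x - y\<bar> * sqrt z \<le> BS"
    proof -
      have "Ws e x y z * \<bar>x - y\<bar> * sqrt z \<le> 32 * pi\<^sup>2 * A0 * (q * m) / sqrt (x * y * z) * sqrt z"
        using int by (intro mult_right_mono i1) auto
      also have "\<dots> = 32 * pi\<^sup>2 * A0" unfolding q(3) using int by (simp add: real_sqrt_mult)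
      also have "\<dots> \<le> BS" by (intro BS_ge) auto
      finally show ?thesis .
    qed
    have b: "Ws e x y z * \<bar>x - y\<bar> * sqrt z * sqrt q \<le> BS * sqrt e"
    proof -
      have "Ws e x y z * \<bar>x - y\<bar> * sqrt z * sqrt q \<le> 64 * pi\<^sup>2 * A0 * sqrt e * (sqrt q * m) / sqrt (x * y * z) * sqrt z * sqrt q"
        using int q by (intro mult_right_mono i2) auto
      also have "\<dots> = 64 * pi\<^sup>2 * A0 * sqrt e * ((sqrt q * sqrt q) * m) / sqrt (x * y * z) * sqrt z" by (simp only: mult_ac times_divide_eq_left times_divide_eq_right)
      also have "(sqrt q * sqrt q) * m = q * m" using q by simp
      also have "64 * pi\<^sup>2 * A0 * sqrt e * (q * m) / sqrt (x * y * z) * sqrt z = 64 * pi\<^sup>2 * (A0 * sqrt e)"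
        unfolding q(3) using int by (simp add: real_sqrt_mult)
      also have "\<dots> \<le> BS * sqrt e" by (intro BS_ge) (use e in auto)
      finally show ?thesis .
    qed
    have c: "Ws e x y z * \<bar>x - y\<bar> * min 1 x \<le> BS * sqrt e" if zx: "2 * z < x"
    proof -
      define P where "P = y + z - x"
      define q' m' where "q' = sqrt (max P z)" and "m' = sqrt (min P z)"
      have P: "P > 0" "P \<le> y" "z \<le> y" "x \<le> 2 * y" using int zx by (auto simp: P_def)
      have r2: "{s_low x y z..s_high x y z} \<subseteq> {\<bar>sqrt P - sqrt z\<bar>..sqrt P + sqrt z}"
        by (auto simp: s_low_def s_high_def xs P_def)
      have "Ws e x y z * \<bar>x - y\<bar> \<le> 64 * pi\<^sup>2 * A0 * sqrt e * (sqrt q' * m') / sqrt (x * y * z)"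
        unfolding q'_def m'_def by (rule Ws_interior_bounds(2)[OF e int _ _ _ _ r2]) (use int P in \<open>auto simp: P_def\<close>)
      also have "\<dots> \<le> 64 * pi\<^sup>2 * A0 * sqrt e * (sqrt (sqrt y) * sqrt z) / sqrt (x * y * z)"
      proof (intro divide_right_mono mult_left_mono mult_mono)
        show "sqrt q' \<le> sqrt (sqrt y)" "m' \<le> sqrt z" "0 \<le> m'"
          using P int by (auto simp: q'_def m'_def)
      qed (use int e A0_nonneg in auto)
      also have "\<dots> = 64 * pi\<^sup>2 * (A0 * sqrt e) * (sqrt (sqrt y) / (sqrt x * sqrt y))"
        using int by (simp add: real_sqrt_mult)
      also have "sqrt (sqrt y) / (sqrt x * sqrt y) = 1 / (sqrt x * sqrt (sqrt y))"
      proof -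
        have "sqrt y = sqrt (sqrt y) * sqrt (sqrt y)" using int by simp
        then have "sqrt (sqrt y) / (sqrt x * sqrt y) = sqrt (sqrt y) / (sqrt x * (sqrt (sqrt y) * sqrt (sqrt y)))" by simp
        also have "\<dots> = 1 / (sqrt x * sqrt (sqrt y))" using int by (simp del: real_sqrt_mult_self)
        finally show ?thesis .
      qed
      finally have "Ws e x y z * \<bar>x - y\<bar> * min 1 x \<le> 64 * pi\<^sup>2 * (A0 * sqrt e) * (1 / (sqrt x * sqrt (sqrt y))) * min 1 x"
        using int by (intro mult_right_mono) auto
      also have "\<dots> = 64 * pi\<^sup>2 * (A0 * sqrt e) * (min 1 x / (sqrt x * sqrt (sqrt y)))" by simp
      also have "\<dots> \<le> 64 * pi\<^sup>2 * (A0 * sqrt e) * 2"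
      proof (intro mult_left_mono)
        have "sqrt (sqrt x) \<le> 2 * sqrt (sqrt y)"
        proof -
          \<comment> \<open>In this regime even \<open>x \<le> 2 * y\<close> holds; the coefficient
            16 is chosen for its fourth root 2.\<close>
          have "x \<le> 16 * y" using P int by linarith
          then have "sqrt (sqrt x) \<le> sqrt (sqrt (16 * y))" by simp
          also have "sqrt (16 * y) = 4 * sqrt y" using real_sqrt_mult[of 16 y] real_sqrt_abs[of 4] by simp
          also have "sqrt (4 * sqrt y) = 2 * sqrt (sqrt y)" by (simp add: real_sqrt_mult)
          finally show ?thesis .
        qed
        then have "sqrt x * sqrt (sqrt x) \<le> sqrt x * (2 * sqrt (sqrt y))" using int by (intro mult_left_mono) auto
        then have "min 1 x \<le> 2 * (sqrt x * sqrt (sqrt y))" using min_one_le_quartic[of x] int by linarith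
        then show "min 1 x / (sqrt x * sqrt (sqrt y)) \<le> 2" using int by (simp add: pos_divide_le_eq)
      qed (use e A0_nonneg in auto)
      also have "\<dots> = BS * sqrt e" by (simp add: BS_def)
      finally show ?thesis .
    qed
    show ?thesis using a b c by (simp add: q_def)
  qed
  then show "x \<le> 2 * z \<Longrightarrow> Ws e x y z * \<bar>x - y\<bar> * sqrt z \<le> BS"
    "x \<le> 2 * z \<Longrightarrow> Ws e x y z * \<bar>x - y\<bar> * sqrt z * sqrt (sqrt (max x y)) \<le> BS * sqrt e"
    "2 * z < x \<Longrightarrow> Ws e x y z * \<bar>x - y\<bar> * min 1 x \<le> BS * sqrt e"
    by blast+
qed

end

section \<open>Smallness and cancellation in the cubic kernel\<close>

context profile
begin

text \<open>The weight \<open>\<bar>x - y\<bar> * min 1 \<bar>x - z\<bar>\<close> is the common form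
  of \<open>second_difference\<close> and \<open>first_difference\<close>, so \<open>spread\<close>
  majorises half of the cubic kernel up to the constant \<open>2 * C\<close>.\<close>

definition spread :: "real \<Rightarrow> real \<Rightarrow> real \<Rightarrow> real \<Rightarrow> real" where
  "spread e x y z = Ws e x y z * \<bar>x - y\<bar> * min 1 \<bar>x - z\<bar>"

text \<open>Smallness has three sources: for \<open>2 * z < x\<close> the third bound of
  \<open>Ws_bounds\<close>; for \<open>z < e\<close> the weight, at most
  \<open>z \<le> sqrt z * sqrt e\<close>; for \<open>max x y \<ge> e\<close> the second bound, where
  dividing \<open>sqrt e\<close> by its own square root leaves the power 1/4 of \<open>e\<close>.
  Only \<open>x, y < e \<le> z\<close> escapes.\<close>

lemma spread_cases:
  assumes e: "e > 0" "e \<le> 1" and nn: "x \<ge> 0" "y \<ge> 0" "z \<ge> 0"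
  shows "spread e x y z \<le> BS"
    and "\<not> (x < e \<and> y < e \<and> e \<le> z) \<Longrightarrow> spread e x y z \<le> BS * sqrt (sqrt e)"
proof -
  define D where "D = Ws e x y z * \<bar>x - y\<bar>"
  have D: "0 \<le> D" using Ws_nonneg[OF e(1)] by (simp add: D_def)
  have sp: "spread e x y z = D * min 1 \<bar>x - z\<bar>" by (simp add: spread_def D_def)
  have s: "sqrt e \<le> sqrt (sqrt e)" "sqrt e \<le> 1"
    using e min_one_le_sqrt[of "sqrt e"] by (auto simp: min_def split: if_splits)
  have se: "BS * sqrt e \<le> BS * sqrt (sqrt e)" "BS * sqrt e \<le> BS"
    using s BS_nonneg by (auto intro: mult_left_mono mult_left_le)
  show "spread e x y z \<le> BS"
  proof (cases "x \<le> 2 * z")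
    case True
    have "min 1 \<bar>x - z\<bar> \<le> min 1 z" using True nn by auto
    also have "\<dots> \<le> sqrt z" by (rule min_one_le_sqrt) fact
    finally have "spread e x y z \<le> D * sqrt z" unfolding sp using D by (rule mult_left_mono)
    also have "\<dots> \<le> BS" unfolding D_def by (rule Ws_bounds(1)[OF e(1) nn True])
    finally show ?thesis .
  next
    case False
    then have "min 1 \<bar>x - z\<bar> \<le> min 1 x" using nn by auto
    then have "spread e x y z \<le> D * min 1 x" unfolding sp using D by (rule mult_left_mono)
    also have "\<dots> \<le> BS * sqrt e" unfolding D_def by (rule Ws_bounds(3)[OF e(1) nn]) (use False in simp)
    finally show ?thesis using se by simp
  qed
  show "spread e x y z \<le> BS * sqrt (sqrt e)" if c: "\<not> (x < e \<and> y < e \<and> e \<le> z)"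
  proof (cases "x \<le> 2 * z")
    case True
    note ab = Ws_bounds(1,2)[OF e(1) nn True, folded D_def]
    have m: "min 1 \<bar>x - z\<bar> \<le> min 1 z" using True nn by auto
    show ?thesis
    proof (cases "z < e")
      case True
      have "min 1 \<bar>x - z\<bar> \<le> sqrt z * sqrt z" using m nn by simp
      also have "\<dots> \<le> sqrt z * sqrt e" using True nn by (intro mult_left_mono) auto
      finally have "spread e x y z \<le> D * (sqrt z * sqrt e)" unfolding sp using D by (rule mult_left_mono)
      also have "\<dots> \<le> BS * sqrt e" unfolding mult.assoc[symmetric] using ab(1) e by (intro mult_right_mono) auto
      finally show ?thesis using se by simp
    next
      case False
      then have "e \<le> max x y" using c by auto
      then have me: "sqrt (sqrt e) \<le> sqrt (sqrt (max x y))" by simp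
      have "min 1 \<bar>x - z\<bar> \<le> sqrt z" using m min_one_le_sqrt[OF nn(3)] by linarith
      then have "spread e x y z \<le> D * sqrt z" unfolding sp using D by (rule mult_left_mono)
      then have "spread e x y z * sqrt (sqrt e) \<le> (D * sqrt z) * sqrt (sqrt (max x y))"
        using me D nn e by (intro mult_mono) auto
      also have "\<dots> \<le> BS * sqrt e" using ab(2) by simp
      also have "\<dots> = (BS * sqrt (sqrt e)) * sqrt (sqrt e)" using e by simp
      finally show ?thesis using e by simp
    qed
  next
    case False
    then have "min 1 \<bar>x - z\<bar> \<le> min 1 x" using nn by auto
    then have "spread e x y z \<le> D * min 1 x" unfolding sp using D by (rule mult_left_mono)
    also have "\<dots> \<le> BS * sqrt e" unfolding D_def by (rule Ws_bounds(3)[OF e(1) nn]) (use False in simp)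
    finally show ?thesis using se by simp
  qed
qed

definition Wf :: "real \<Rightarrow> real \<Rightarrow> real \<Rightarrow> real \<Rightarrow> real" where
  "Wf e x y z = e ^ 3 * W (Phi p e 1) x y z"

lemma Wf_nonneg: "e > 0 \<Longrightarrow> 0 \<le> Wf e x y z"
  by (simp add: Wf_def W_nonneg Phi_nonneg)

lemma W_aS_swap:
  assumes "x \<ge> 0" "y \<ge> 0" "z \<ge> 0"
  shows "e ^ 3 * W (\<lambda>r \<rho>. aS e \<rho> r) x y z = Ws e x z y"
  unfolding Ws_def using W_swap_last[OF aS_measurable aS_nonneg aS_le assms] by simp

lemma W_Phi_swap:
  assumes "x \<ge> 0" "y \<ge> 0" "z \<ge> 0"
  shows "W (Phi p e 1) x y z = W (Phi p e 1) x z y"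
proof -
  have eq: "(\<lambda>r \<rho>. Phi p e 1 \<rho> r) = Phi p e 1" by (simp add: Phi_def fun_eq_iff add.commute)
  show ?thesis
    using W_swap_last[OF Phi_measurable[OF p_measurable] Phi_nonneg Phi_le[OF p_bound, where e=e] assms] unfolding eq .
qed

text \<open>Young's inequality splits the square in \<open>Phi\<close>. In the second estimate the
  transposed half is paid for with \<open>1 / \<eta>\<close>, which is affordable where that half is
  small; there the kernel is close to \<open>Ws e x y z\<close>.\<close>

lemma Wf_estimates:
  assumes e: "e > 0" and nn: "x \<ge> 0" "y \<ge> 0" "z \<ge> 0"
  shows "Wf e x y z \<le> 2 * Ws e x y z + 2 * Ws e x z y"
    and "0 < \<eta> \<Longrightarrow> \<eta> \<le> 1 \<Longrightarrow> \<bar>Wf e x y z - Ws e x y z\<bar> \<le> 2 * \<eta> * Ws e x y z + 4 / \<eta> * Ws e x z y"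
proof -
  let ?aY = "\<lambda>r \<rho>. aS e \<rho> r"
  have aYm: "case_prod ?aY \<in> borel_measurable (borel \<Otimes>\<^sub>M borel)" using aS_swap_measurable by simp
  note PhiB = Phi_nonneg[of p e 1] Phi_le[OF p_bound, where e=e]
  have e3: "e ^ 3 > 0" using e by simp
  have sq2: "(a + b)\<^sup>2 \<le> 2 * a\<^sup>2 + 2 * b\<^sup>2" for a b :: real
    using sum_squares_bound[of a b] by (simp add: power2_sum)
  have sqn: "(a + b)\<^sup>2 \<le> (1 + \<eta>) * a\<^sup>2 + (1 + 1 / \<eta>) * b\<^sup>2" if "\<eta> > 0" for a b \<eta> :: real
  proof -
    have "2 * (sqrt \<eta> * a) * (b / sqrt \<eta>) \<le> (sqrt \<eta> * a)\<^sup>2 + (b / sqrt \<eta>)\<^sup>2" by (rule sum_squares_bound)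
    then have "2 * a * b \<le> \<eta> * a\<^sup>2 + b\<^sup>2 / \<eta>" using that by (simp add: power_mult_distrib power_divide)
    then show ?thesis by (simp add: power2_sum distrib_right)
  qed
  have P: "Phi p e 1 r \<rho> \<le> \<alpha> * aS e r \<rho> + \<beta> * aS e \<rho> r"
    if "(p (r / e) + p (\<rho> / e))\<^sup>2 \<le> \<alpha> * (p (r / e))\<^sup>2 + \<beta> * (p (\<rho> / e))\<^sup>2" for r \<rho> \<alpha> \<beta>
    using divide_right_mono[OF that, of "e ^ 4"] by (simp add: Phi_def aS_def add_divide_distrib)
  have 1: "W (Phi p e 1) x y z \<le> 2 * W (aS e) x y z + 2 * W ?aY x y z"
    by (rule W_combine[OF Phi_measurable[OF p_measurable] aS_measurable aYm PhiB aS_nonneg aS_le aS_nonneg aS_le _ _ _ nn])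
      (auto intro!: P sq2)
  show I: "Wf e x y z \<le> 2 * Ws e x y z + 2 * Ws e x z y"
    using mult_left_mono[OF 1, of "e ^ 3"] e3
    unfolding Wf_def W_aS_swap[OF nn, symmetric] by (simp add: Ws_def distrib_left mult_ac)
  show "\<bar>Wf e x y z - Ws e x y z\<bar> \<le> 2 * \<eta> * Ws e x y z + 4 / \<eta> * Ws e x z y" if \<eta>: "0 < \<eta>" "\<eta> \<le> 1"
  proof -
    have 2: "W (Phi p e 1) x y z \<le> (1 + \<eta>) * W (aS e) x y z + (1 + 1 / \<eta>) * W ?aY x y z"
      by (rule W_combine[OF Phi_measurable[OF p_measurable] aS_measurable aYm PhiB aS_nonneg aS_le aS_nonneg aS_le _ _ _ nn])
        (use \<eta> in \<open>auto intro!: P sqn\<close>)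
    \<comment> \<open>The reverse comparison writes \<open>p (r / e)\<close> as the sum of the two
      values minus \<open>p (\<rho> / e)\<close> and uses the same inequality.\<close>
    have 3: "W (aS e) x y z \<le> (1 + \<eta>) * W (Phi p e 1) x y z + (1 + 1 / \<eta>) * W ?aY x y z"
    proof (rule W_combine[OF aS_measurable Phi_measurable[OF p_measurable] aYm aS_nonneg aS_le PhiB aS_nonneg aS_le _ _ _ nn])
      fix r \<rho> :: real
      have "(p (r / e))\<^sup>2 \<le> (1 + \<eta>) * (p (r / e) + p (\<rho> / e))\<^sup>2 + (1 + 1 / \<eta>) * (p (\<rho> / e))\<^sup>2"
        using sqn[OF \<eta>(1), of "p (r / e) + p (\<rho> / e)" "- p (\<rho> / e)"] by simp
      from divide_right_mono[OF this, of "e ^ 4"]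
      show "aS e r \<rho> \<le> (1 + \<eta>) * Phi p e 1 r \<rho> + (1 + 1 / \<eta>) * aS e \<rho> r"
        by (simp add: Phi_def aS_def add_divide_distrib)
    qed (use \<eta> in auto)
    define a b where "a = Ws e x y z" and "b = Ws e x z y"
    have ab: "0 \<le> a" "0 \<le> b" using Ws_nonneg[OF e] by (auto simp: a_def b_def)
    have n2: "Wf e x y z \<le> (1 + \<eta>) * a + (1 + 1 / \<eta>) * b"
      using mult_left_mono[OF 2, of "e ^ 3"] e3
      unfolding Wf_def W_aS_swap[OF nn, symmetric] a_def b_def by (simp add: Ws_def distrib_left mult_ac)
    have n3: "a \<le> (1 + \<eta>) * Wf e x y z + (1 + 1 / \<eta>) * b"
      using mult_left_mono[OF 3, of "e ^ 3"] e3
      unfolding Wf_def W_aS_swap[OF nn, symmetric] a_def b_def by (simp add: Ws_def distrib_left mult_ac)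
    have nI: "Wf e x y z \<le> 2 * a + 2 * b" using I by (simp add: a_def b_def)
    have eb: "b \<le> b / \<eta>" "\<eta> * b \<le> b / \<eta>"
    proof -
      show "b \<le> b / \<eta>" using \<eta> ab by (simp add: pos_le_divide_eq mult_left_le)
      moreover have "\<eta> * b \<le> b" using \<eta> ab by (simp add: mult_left_le_one_le)
      ultimately show "\<eta> * b \<le> b / \<eta>" by linarith
    qed
    have "Wf e x y z - a \<le> \<eta> * a + b + b / \<eta>" using n2 by (simp add: distrib_right)
    also have "\<dots> \<le> 2 * (\<eta> * a) + 4 * (b / \<eta>)" using eb(1) ab(2) mult_nonneg_nonneg[of \<eta> a] \<eta> ab(1) by linarith
    finally have u: "Wf e x y z - a \<le> 2 * (\<eta> * a) + 4 * (b / \<eta>)" .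
    have "\<eta> * Wf e x y z \<le> \<eta> * (2 * a + 2 * b)" using nI \<eta> by (intro mult_left_mono) auto
    then have "a - Wf e x y z \<le> 2 * (\<eta> * a) + 2 * (\<eta> * b) + b + b / \<eta>"
      using n3 by (simp add: distrib_right distrib_left)
    also have "\<dots> \<le> 2 * (\<eta> * a) + 4 * (b / \<eta>)" using eb by linarith
    finally have "\<bar>Wf e x y z - a\<bar> \<le> 2 * (\<eta> * a) + 4 * (b / \<eta>)" using u by linarith
    then show ?thesis by (simp add: a_def b_def)
  qed
qed

text \<open>If \<open>z\<close> is the largest energy, the triangle with sides \<open>sqrt z\<close>
  and \<open>sqrt (x_star x y z)\<close> imposes no further restriction on \<open>s\<close>: both
  pairs have the same difference of squares, but it has the larger sum. The domain is then
  determined by \<open>sqrt x\<close> and \<open>sqrt y\<close> symmetrically, and the integrand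
  depends on \<open>s\<close> alone.\<close>

lemma Ws_symmetric:
  assumes e: "e > 0" and x: "x \<ge> 0" "x < z" and y: "y \<ge> 0" "y < z"
  shows "Ws e x y z = Ws e y x z"
proof -
  have rng: "s_low x y z = \<bar>sqrt x - sqrt y\<bar>" "s_high x y z = sqrt x + sqrt y"
    if xy: "x > 0" "x < z" "y > 0" "y < z" for x y
  proof -
    define P where "P = y + z - x"
    have P: "x_star x y z = P" "P > 0" "y \<le> P" using xy by (auto simp: P_def x_star_def)
    have le: "sqrt x + sqrt y \<le> sqrt P + sqrt z" using P xy by (intro add_mono[of "sqrt x" "sqrt z" "sqrt y" "sqrt P", unfolded add.commute[of "sqrt z"]]) auto
    have pos: "sqrt x + sqrt y > 0" using xy by (simp add: add_pos_pos)
    have "\<bar>sqrt P - sqrt z\<bar> * (sqrt P + sqrt z) = \<bar>P - z\<bar>"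
    proof -
      have "(sqrt P - sqrt z) * (sqrt P + sqrt z) = P - z" using P xy by (simp add: algebra_simps)
      then show ?thesis using P xy by (metis abs_mult abs_of_nonneg add_nonneg_nonneg less_imp_le real_sqrt_ge_zero order_trans)
    qed
    moreover have "\<bar>sqrt x - sqrt y\<bar> * (sqrt x + sqrt y) = \<bar>x - y\<bar>"
    proof -
      have "(sqrt x - sqrt y) * (sqrt x + sqrt y) = x - y" using xy by (simp add: algebra_simps)
      then show ?thesis using pos by (metis abs_mult abs_of_pos)
    qed
    moreover have "\<bar>P - z\<bar> = \<bar>x - y\<bar>" by (simp add: P_def)
    ultimately have "\<bar>sqrt P - sqrt z\<bar> * (sqrt P + sqrt z) = \<bar>sqrt x - sqrt y\<bar> * (sqrt x + sqrt y)" by simp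
    also have "\<dots> \<le> \<bar>sqrt x - sqrt y\<bar> * (sqrt P + sqrt z)" using le by (intro mult_left_mono) auto
    finally have "\<bar>sqrt P - sqrt z\<bar> \<le> \<bar>sqrt x - sqrt y\<bar>" using le pos by (simp add: mult_le_cancel_right)
    then show "s_low x y z = \<bar>sqrt x - sqrt y\<bar>" "s_high x y z = sqrt x + sqrt y"
      using le by (simp_all add: s_low_def s_high_def P)
  qed
  consider "x > 0" "y > 0" | "x = 0" "y > 0" | "x > 0" "y = 0" | "x = 0" "y = 0" using x y by linarith
  then show ?thesis
  proof cases
    case 1
    have "ennreal (Ws e x y z) = ennreal (Ws e y x z)"
      using 1 x y by (simp add: Ws_interior[OF e] rng abs_minus_commute add.commute mult.commute)
    then show ?thesis using Ws_nonneg[OF e] by simp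
  next
    case 2
    then show ?thesis using y x by (simp add: Ws_boundary[OF e])
  next
    case 3
    then show ?thesis using y x by (simp add: Ws_boundary[OF e])
  next
    case 4
    then show ?thesis by simp
  qed
qed

end

context collision
begin

definition Ke :: "real \<Rightarrow> real \<Rightarrow> real \<Rightarrow> real \<Rightarrow> real" where
  "Ke e x y z = e ^ 3 * K_op p e 1 \<phi> x y z"

lemma Ke_eq:
  assumes "x \<le> y + z"
  shows "Ke e x y z = Wf e x y z * cdiff y z x"
  using assms by (simp add: Ke_def K_op_def Wf_def cdiff_def x_star_def max_def)

lemma Ke_zero:
  assumes "y \<ge> 0" "z \<ge> 0" "y + z < x"
  shows "Ke e x y z = 0"
  using Ws_zero[of x y z] assms by (simp add: Ke_def K_op_def)

lemma Ke_swap: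
  assumes "x \<ge> 0" "y \<ge> 0" "z \<ge> 0"
  shows "Ke e x y z = Ke e x z y"
  using W_Phi_swap[OF assms] by (simp add: Ke_def K_op_def x_star_def add.commute)

lemma cdiff_bound:
  assumes "x \<ge> 0" "y \<ge> 0" "z \<ge> 0" "x \<le> y + z"
  shows "\<bar>cdiff y z x\<bar> \<le> 2 * C * (\<bar>x - y\<bar> * min 1 \<bar>x - z\<bar>)"
proof (cases "\<bar>x - z\<bar> \<le> 1")
  case True
  have "\<bar>cdiff y z x\<bar> \<le> 1 * (C * \<bar>x - y\<bar> * \<bar>x - z\<bar>)" using second_difference[OF assms] by (simp add: cdiff_def)
  also have "\<dots> \<le> 2 * (C * \<bar>x - y\<bar> * \<bar>x - z\<bar>)" using C_nonneg by (intro mult_right_mono) auto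
  finally show ?thesis using True by (simp add: min_def mult.assoc)
next
  case False
  then show ?thesis using first_difference[OF assms] by (simp add: cdiff_def min_def)
qed

lemma Ws_cdiff:
  assumes "e > 0" "x \<ge> 0" "y \<ge> 0" "z \<ge> 0" "x \<le> y + z"
  shows "Ws e x y z * \<bar>cdiff y z x\<bar> \<le> 2 * C * spread e x y z"
    and "Ws e x z y * \<bar>cdiff y z x\<bar> \<le> 2 * C * spread e x z y"
proof -
  show "Ws e x y z * \<bar>cdiff y z x\<bar> \<le> 2 * C * spread e x y z"
    using mult_left_mono[OF cdiff_bound[OF assms(2-)] Ws_nonneg[OF assms(1), of x y z]]
    by (simp add: spread_def mult_ac)
  have "cdiff y z x = cdiff z y x" by (simp add: cdiff_def add.commute)
  moreover have "x \<le> z + y" using assms by simp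
  ultimately show "Ws e x z y * \<bar>cdiff y z x\<bar> \<le> 2 * C * spread e x z y"
    using mult_left_mono[OF cdiff_bound[OF assms(2,4,3)] Ws_nonneg[OF assms(1), of x z y]]
    by (simp add: spread_def mult_ac)
qed

lemma Ke_bound_spread:
  assumes e: "e > 0" and nn: "x \<ge> 0" "y \<ge> 0" "z \<ge> 0"
  shows "\<bar>Ke e x y z\<bar> \<le> 4 * C * (\<bar>spread e x y z\<bar> + \<bar>spread e x z y\<bar>)"
proof (cases "x \<le> y + z")
  case True
  note w = Ws_cdiff[OF e nn True]
  have "\<bar>Ke e x y z\<bar> = Wf e x y z * \<bar>cdiff y z x\<bar>"
    using Wf_nonneg[OF e] by (simp add: Ke_eq[OF True] abs_mult)
  also have "\<dots> \<le> (2 * Ws e x y z + 2 * Ws e x z y) * \<bar>cdiff y z x\<bar>"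
    by (intro mult_right_mono Wf_estimates(1)[OF e nn]) simp
  also have "\<dots> = 2 * (Ws e x y z * \<bar>cdiff y z x\<bar>) + 2 * (Ws e x z y * \<bar>cdiff y z x\<bar>)" by (simp add: distrib_right)
  also have "\<dots> \<le> 2 * (2 * C * spread e x y z) + 2 * (2 * C * spread e x z y)" using w by simp
  also have "\<dots> = 4 * C * (spread e x y z + spread e x z y)" by (simp add: algebra_simps)
  also have "\<dots> \<le> 4 * C * (\<bar>spread e x y z\<bar> + \<bar>spread e x z y\<bar>)" using C_nonneg by (intro mult_left_mono) auto
  finally show ?thesis .
next
  case False
  then show ?thesis using Ke_zero[OF nn(2,3), of x e] C_nonneg by simp
qed

lemma spread_nonneg: "e > 0 \<Longrightarrow> 0 \<le> spread e x y z"
  by (simp add: spread_def Ws_nonneg)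

lemma Ke_bound:
  assumes "e > 0" "e \<le> 1" "x \<ge> 0" "y \<ge> 0" "z \<ge> 0"
  shows "\<bar>Ke e x y z\<bar> \<le> 8 * C * BS"
proof -
  have "\<bar>Ke e x y z\<bar> \<le> 4 * C * (\<bar>spread e x y z\<bar> + \<bar>spread e x z y\<bar>)"
    by (rule Ke_bound_spread) (use assms in auto)
  also have "\<dots> \<le> 4 * C * (BS + BS)"
    using spread_cases(1)[OF assms] spread_cases(1)[OF assms(1-3) assms(5,4)] spread_nonneg[OF assms(1)] C_nonneg
    by (intro mult_left_mono add_mono) auto
  finally show ?thesis by simp
qed

lemma Ke_small:
  assumes "e > 0" "e \<le> 1" "x \<ge> 0" "y \<ge> 0" "z \<ge> 0"
    and "\<not> (x < e \<and> y < e \<and> e \<le> z)" "\<not> (x < e \<and> z < e \<and> e \<le> y)"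
  shows "\<bar>Ke e x y z\<bar> \<le> 8 * C * BS * sqrt (sqrt e)"
proof -
  have "\<bar>Ke e x y z\<bar> \<le> 4 * C * (\<bar>spread e x y z\<bar> + \<bar>spread e x z y\<bar>)"
    by (rule Ke_bound_spread) (use assms in auto)
  also have "\<dots> \<le> 4 * C * (BS * sqrt (sqrt e) + BS * sqrt (sqrt e))"
    using spread_cases(2)[OF assms(1-6)] spread_cases(2)[OF assms(1-3) assms(5,4,7)] spread_nonneg[OF assms(1)] C_nonneg
    by (intro mult_left_mono add_mono) auto
  finally show ?thesis by (simp add: mult_ac)
qed

text \<open>The terms \<open>K(x, y, z)\<close> with \<open>x, y < \<epsilon> \<le> z\<close> are of order one; they cancel to leading order
  against \<open>K(y, x, z)\<close>.\<close>

lemma Ke_cancel: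
  assumes e: "e > 0" "e \<le> 1" and x: "x \<ge> 0" "x < e" and y: "y \<ge> 0" "y < e" and z: "e \<le> z"
  shows "\<bar>Ke e x y z + Ke e y x z\<bar> \<le> 25 * C * BS * sqrt (sqrt (sqrt e))"
proof -
  \<comment> \<open>\<open>t\<close> is the eighth root of \<open>e\<close>. The transposed half is
    at most \<open>BS * (t * t)\<close> by \<open>spread_cases\<close>, so \<open>\<eta> = t\<close>
    balances the two errors of \<open>Wf_estimates\<close>: 4 from the first and 8 from the second
    add up to 12 times \<open>C * BS * t\<close>.\<close>
  define t where "t = sqrt (sqrt (sqrt e))"
  have t: "0 < t" "t \<le> 1" "sqrt (sqrt e) = t * t" using e by (auto simp: t_def)
  have z0: "z \<ge> 0" "x < z" "y < z" using e x y z by auto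
  have one: "\<bar>Wf e x y z - Ws e x y z\<bar> * \<bar>cdiff y z x\<bar> \<le> 12 * C * BS * t"
    if x: "x \<ge> 0" "x < e" and y: "y \<ge> 0" "y < e" for x y
  proof -
    have xyz: "x \<le> y + z" using x y z by simp
    have sY: "spread e x z y \<le> BS * (t * t)"
      unfolding t(3)[symmetric] by (rule spread_cases(2)[OF e x(1) z0(1) y(1)]) (use z in auto)
    have sX: "spread e x y z \<le> BS" by (rule spread_cases(1)[OF e x(1) y(1) z0(1)])
    have "\<bar>Wf e x y z - Ws e x y z\<bar> * \<bar>cdiff y z x\<bar> \<le> (2 * t * Ws e x y z + 4 / t * Ws e x z y) * \<bar>cdiff y z x\<bar>"
      by (intro mult_right_mono Wf_estimates(2)[OF e(1) x(1) y(1) z0(1)] t) simp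
    also have "\<dots> = 2 * t * (Ws e x y z * \<bar>cdiff y z x\<bar>) + 4 / t * (Ws e x z y * \<bar>cdiff y z x\<bar>)" by (simp add: distrib_right)
    also have "\<dots> \<le> 2 * t * (2 * C * BS) + 4 / t * (2 * C * (BS * (t * t)))"
    proof (intro add_mono mult_left_mono)
      show "Ws e x y z * \<bar>cdiff y z x\<bar> \<le> 2 * C * BS"
        using Ws_cdiff(1)[OF e(1) x(1) y(1) z0(1) xyz] mult_left_mono[OF sX, of "2 * C"] C_nonneg by simp
      show "Ws e x z y * \<bar>cdiff y z x\<bar> \<le> 2 * C * (BS * (t * t))"
        using Ws_cdiff(2)[OF e(1) x(1) y(1) z0(1) xyz] mult_left_mono[OF sY, of "2 * C"] C_nonneg by simp
    qed (use t in auto)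
    also have "\<dots> = 12 * C * BS * t" using t by simp
    finally show ?thesis .
  qed
  have eq: "Ke e x y z + Ke e y x z = (Wf e x y z - Ws e x y z) * cdiff y z x + (Wf e y x z - Ws e y x z) * cdiff x z y
     + Ws e x y z * (cdiff y z x + cdiff x z y)"
    using x y z Ws_symmetric[OF e(1) x(1) z0(2) y(1) z0(3)] by (simp add: Ke_eq algebra_simps)
  have "\<bar>Ke e x y z + Ke e y x z\<bar> \<le> \<bar>(Wf e x y z - Ws e x y z) * cdiff y z x\<bar> + \<bar>(Wf e y x z - Ws e y x z) * cdiff x z y\<bar>
     + \<bar>Ws e x y z * (cdiff y z x + cdiff x z y)\<bar>"
    unfolding eq by linarith
  also have "\<dots> \<le> 12 * C * BS * t + 12 * C * BS * t + C * BS * t"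
  proof (intro add_mono)
    show "\<bar>(Wf e x y z - Ws e x y z) * cdiff y z x\<bar> \<le> 12 * C * BS * t"
      unfolding abs_mult by (rule one[OF x y])
    show "\<bar>(Wf e y x z - Ws e y x z) * cdiff x z y\<bar> \<le> 12 * C * BS * t"
      unfolding abs_mult by (rule one[OF y x])
    \<comment> \<open>The first-order parts cancel: what remains is a symmetric second difference of
      \<open>\<phi>\<close> around \<open>z\<close> with step \<open>y - x\<close>. It supplies an
      extra factor \<open>\<bar>x - y\<bar> < e\<close>.\<close>
    have c: "cdiff y z x + cdiff x z y = \<phi> (z + y - x) + \<phi> (z + z - (z + y - x)) - \<phi> z - \<phi> z"
      by (simp add: cdiff_def algebra_simps)
    have "\<bar>cdiff y z x + cdiff x z y\<bar> \<le> C * \<bar>(z + y - x) - z\<bar> * \<bar>(z + y - x) - z\<bar>"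
      unfolding c by (rule second_difference) (use z0 x y in auto)
    also have "\<dots> = C * \<bar>x - y\<bar> * \<bar>x - y\<bar>" by (simp add: abs_minus_commute)
    finally have c2: "\<bar>cdiff y z x + cdiff x z y\<bar> \<le> C * \<bar>x - y\<bar> * \<bar>x - y\<bar>" .
    have xye: "\<bar>x - y\<bar> \<le> sqrt e * sqrt e" using x y e by auto
    have "\<bar>Ws e x y z * (cdiff y z x + cdiff x z y)\<bar> \<le> Ws e x y z * (C * \<bar>x - y\<bar> * \<bar>x - y\<bar>)"
      using Ws_nonneg[OF e(1), of x y z] c2 by (simp add: abs_mult mult_left_mono)
    also have "\<dots> = C * (Ws e x y z * \<bar>x - y\<bar>) * \<bar>x - y\<bar>" by simp
    also have "\<dots> \<le> C * (Ws e x y z * \<bar>x - y\<bar>) * (sqrt e * sqrt e)"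
      using xye C_nonneg Ws_nonneg[OF e(1), of x y z] by (intro mult_left_mono) auto
    also have "\<dots> \<le> C * (Ws e x y z * \<bar>x - y\<bar>) * (sqrt z * sqrt e)"
      using z e C_nonneg Ws_nonneg[OF e(1), of x y z] by (intro mult_left_mono mult_right_mono) auto
    also have "\<dots> = C * (Ws e x y z * \<bar>x - y\<bar> * sqrt z) * sqrt e" by simp
    also have "\<dots> \<le> C * BS * t"
    proof (intro mult_mono mult_left_mono)
      show "Ws e x y z * \<bar>x - y\<bar> * sqrt z \<le> BS" by (rule Ws_bounds(1)[OF e(1) x(1) y(1) z0(1)]) (use z0 x in auto)
      have "sqrt e = t * t * (t * t)" using e t(3) by (metis abs_of_nonneg less_imp_le real_sqrt_ge_zero real_sqrt_mult_self)
      also have "\<dots> \<le> t * 1 * (1 * 1)" using t by (intro mult_mono) auto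
      finally show "sqrt e \<le> t" by simp
    qed (use C_nonneg BS_nonneg e t z0 Ws_nonneg[OF e(1), of x y z] in auto)
    finally show "\<bar>Ws e x y z * (cdiff y z x + cdiff x z y)\<bar> \<le> C * BS * t" .
  qed
  finally show ?thesis by (simp add: t_def)
qed

end

subsection \<open>Weak compactness of measures with bounded energy\<close>

lemma B1_D:
  assumes "F \<in> half_line_B1"
  shows "sets F = sets (restrict_space borel {0..})" "space F = {0..}" "finite_measure F" "integrable F (\<lambda>x. 1 + x)"
  using assms sets_eq_imp_space_eq[of F "restrict_space borel {0..}"] by (auto simp: half_line_B1_def)

lemma B1_measurable:
  assumes F: "F \<in> half_line_B1" and f: "f \<in> borel_measurable borel"
  shows "f \<in> borel_measurable F"
  using measurable_restrict_space1[OF f] measurable_cong_sets[OF B1_D(1)[OF F] refl] by blast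

lemma B1_sets:
  assumes F: "F \<in> half_line_B1" and A: "A \<in> sets borel"
  shows "A \<inter> {0..} \<in> sets F"
  unfolding B1_D(1)[OF F] sets_restrict_space using A by (auto simp: Int_commute)

lemma B1_integrable_bounded:
  fixes f :: "real \<Rightarrow> real"
  assumes F: "F \<in> half_line_B1" and f: "f \<in> borel_measurable borel" and b: "\<And>x. x \<ge> 0 \<Longrightarrow> \<bar>f x\<bar> \<le> B"
  shows "integrable F f"
proof -
  interpret finite_measure F using B1_D(3)[OF F] .
  show ?thesis
    by (rule integrable_const_bound[where B=B]) (use b B1_D(2)[OF F] B1_measurable[OF F f] in auto)
qed

lemma B1_integrable_id: "F \<in> half_line_B1 \<Longrightarrow> integrable F (\<lambda>x. x)"
proof -
  assume F: "F \<in> half_line_B1"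
  have "integrable F (\<lambda>x. (1 + x) - 1)"
    by (intro Bochner_Integration.integrable_diff B1_D(4)[OF F] B1_integrable_bounded[OF F, of _ 1]) auto
  then show ?thesis by simp
qed

section \<open>Finite measures as probability distributions on the line\<close>

text \<open>A measure \<open>F\<close> of mass at most \<open>C\<close> is encoded as the distribution of \<open>F / C\<close> completed by an atom at
  \<open>-1\<close>, so that tightness and Skorohod's theorem apply; \<open>unlift\<close> is the inverse.\<close>

definition unlift :: "real \<Rightarrow> real measure \<Rightarrow> real measure" where
  "unlift C P = density (restrict_space P {0..}) (\<lambda>_. ennreal C)"

lemma sets_unlift: "sets P = sets borel \<Longrightarrow> sets (unlift C P) = sets (restrict_space borel {0..})"
  by (simp add: unlift_def sets_restrict_space)

lemma nn_integral_unlift: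
  assumes P: "sets P = sets borel" and f: "f \<in> borel_measurable borel"
  shows "(\<integral>\<^sup>+x. f x \<partial>unlift C P) = ennreal C * (\<integral>\<^sup>+x. f x * indicator {0..} x \<partial>P)"
proof -
  have fP: "f \<in> borel_measurable P" using f measurable_cong_sets[OF P refl] by blast
  have "(\<integral>\<^sup>+x. f x \<partial>unlift C P) = ennreal C * (\<integral>\<^sup>+x. f x \<partial>restrict_space P {0..})"
    unfolding unlift_def using fP by (subst nn_integral_density) (auto intro!: nn_integral_cmult measurable_restrict_space1)
  also have "(\<integral>\<^sup>+x. f x \<partial>restrict_space P {0..}) = (\<integral>\<^sup>+x. f x * indicator {0..} x \<partial>P)"
    by (rule nn_integral_restrict_space) (use P in auto)
  finally show ?thesis .
qed

lemma integral_unlift: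
  fixes f :: "real \<Rightarrow> real"
  assumes P: "sets P = sets borel" and f: "f \<in> borel_measurable borel" and C: "C \<ge> 0"
  shows "(\<integral>x. f x \<partial>unlift C P) = C * (\<integral>x. indicator {0..} x * f x \<partial>P)"
proof -
  have fP: "f \<in> borel_measurable P" using f measurable_cong_sets[OF P refl] by blast
  have "(\<integral>x. f x \<partial>unlift C P) = (\<integral>x. C *\<^sub>R f x \<partial>restrict_space P {0..})"
    unfolding unlift_def using fP C by (subst integral_density) (auto intro!: measurable_restrict_space1)
  also have "\<dots> = C * (\<integral>x. f x \<partial>restrict_space P {0..})" by simp
  also have "(\<integral>x. f x \<partial>restrict_space P {0..}) = (\<integral>x. indicator {0..} x *\<^sub>R f x \<partial>P)"
    by (rule integral_restrict_space) (use P in auto)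
  finally show ?thesis by simp
qed

text \<open>The missing mass is truncated at 0 by \<open>ennreal\<close>, so this is a measure for
  every \<open>C\<close>; it is a probability once the mass is at most \<open>C\<close>. The point
  -1 is separated from the half line, which keeps the added atom from merging with mass at
  0.\<close>

definition lift :: "real \<Rightarrow> real measure \<Rightarrow> real measure" where
  "lift C F = measure_of UNIV (sets borel) (\<lambda>A. ennreal (1 / C) * emeasure F (A \<inter> {0..}) +
     ennreal (1 - measure F (space F) / C) * indicator A (-1))"

lemma sets_lift [simp]: "sets (lift C F) = sets borel"
  by (simp add: lift_def sets.sigma_sets_eq[of borel, simplified])

lemma space_lift [simp]: "space (lift C F) = UNIV"
  by (simp add: lift_def)

lemma emeasure_lift:
  assumes F: "F \<in> half_line_B1" and A: "A \<in> sets borel"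
  shows "emeasure (lift C F) A = ennreal (1 / C) * emeasure F (A \<inter> {0..}) +
     ennreal (1 - measure F (space F) / C) * indicator A (-1)"
  unfolding lift_def
proof (rule emeasure_measure_of_sigma)
  show "sigma_algebra UNIV (sets (borel :: real measure))"
    using sets.sigma_algebra_axioms[of "borel :: real measure"] by simp
  show "positive (sets borel) (\<lambda>A. ennreal (1 / C) * emeasure F (A \<inter> {0..}) + ennreal (1 - measure F (space F) / C) * indicator A (-1))"
    by (simp add: positive_def)
  show "countably_additive (sets borel) (\<lambda>A. ennreal (1 / C) * emeasure F (A \<inter> {0..}) + ennreal (1 - measure F (space F) / C) * indicator A (-1))"
  proof (rule countably_additiveI)
    fix A :: "nat \<Rightarrow> real set" assume A: "range A \<subseteq> sets borel" "disjoint_family A" "(\<Union>i. A i) \<in> sets borel"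
    have A': "range (\<lambda>i. A i \<inter> {0..}) \<subseteq> sets F" using A(1) B1_sets[OF F] by auto
    have d': "disjoint_family (\<lambda>i. A i \<inter> {0..})" using A(2) by (auto simp: disjoint_family_on_def)
    have 1: "(\<Sum>i. emeasure F (A i \<inter> {0..})) = emeasure F ((\<Union>i. A i) \<inter> {0..})"
      using suminf_emeasure[OF A' d'] by simp
    have 2: "(\<Sum>i. indicator (A i) (-1::real)) = (indicator (\<Union>i. A i) (-1::real) :: ennreal)"
      by (rule suminf_indicator[OF A(2)])
    show "(\<Sum>i. ennreal (1 / C) * emeasure F (A i \<inter> {0..}) + ennreal (1 - measure F (space F) / C) * indicator (A i) (-1))
      = ennreal (1 / C) * emeasure F ((\<Union>i. A i) \<inter> {0..}) + ennreal (1 - measure F (space F) / C) * indicator (\<Union>i. A i) (-1)"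
      by (subst suminf_add[symmetric]) (auto simp: 1 2)
  qed
qed (rule A)

definition bounded_B1 :: "real \<Rightarrow> real measure set" where
  "bounded_B1 C = {F \<in> half_line_B1. (\<integral>x. 1 + x \<partial>F) \<le> C}"

lemma bounded_B1_D:
  assumes "F \<in> bounded_B1 C"
  shows "F \<in> half_line_B1" "(\<integral>x. 1 + x \<partial>F) \<le> C" "measure F (space F) \<le> C" "(\<integral>x. x \<partial>F) \<le> C" "0 \<le> (\<integral>x. x \<partial>F)"
proof -
  show F: "F \<in> half_line_B1" "(\<integral>x. 1 + x \<partial>F) \<le> C" using assms by (auto simp: bounded_B1_def)
  interpret finite_measure F using B1_D(3)[OF F(1)] .
  have "(\<integral>x. 1 + x \<partial>F) = measure F (space F) + (\<integral>x. x \<partial>F)"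
    using B1_integrable_id[OF F(1)] by simp
  moreover show "0 \<le> (\<integral>x. x \<partial>F)"
    using B1_D(2)[OF F(1)] by (intro integral_nonneg_AE AE_I2) auto
  moreover have "0 \<le> measure F (space F)" by simp
  ultimately show "measure F (space F) \<le> C" "(\<integral>x. x \<partial>F) \<le> C" using F(2) by linarith+
qed

lemma real_distribution_lift:
  assumes F: "F \<in> bounded_B1 C" and C: "C > 0"
  shows "real_distribution (lift C F)"
proof -
  note F1 = bounded_B1_D(1)[OF F]
  interpret F: finite_measure F using B1_D(3)[OF F1] .
  have "emeasure (lift C F) UNIV = ennreal (1 / C) * ennreal (measure F (space F)) + ennreal (1 - measure F (space F) / C)"
    using emeasure_lift[OF F1, of UNIV C] B1_D(2)[OF F1] F.emeasure_eq_measure by simp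
  also have "\<dots> = ennreal (measure F (space F) / C + (1 - measure F (space F) / C))"
    using C bounded_B1_D(3)[OF F] by (subst ennreal_mult[symmetric]) (auto simp: ennreal_plus[symmetric] simp del: ennreal_plus)
  finally have "emeasure (lift C F) UNIV = 1" by simp
  then have "prob_space (lift C F)" by (intro prob_spaceI) simp
  then show ?thesis by (simp add: real_distribution_def real_distribution_axioms_def)
qed

lemma unlift_lift:
  assumes F: "F \<in> half_line_B1" and C: "C > 0"
  shows "unlift C (lift C F) = F"
proof (rule measure_eqI)
  show s: "sets (unlift C (lift C F)) = sets F" by (simp add: sets_unlift B1_D(1)[OF F])
  fix A assume "A \<in> sets (unlift C (lift C F))"
  then have AF: "A \<in> sets F" using s by simp
  then obtain B where B: "A = B \<inter> {0..}" "B \<in> sets borel"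
    unfolding B1_D(1)[OF F] sets_restrict_space by auto
  then have Ab: "A \<in> sets borel" "A \<subseteq> {0..}" by auto
  have "emeasure (unlift C (lift C F)) A = (\<integral>\<^sup>+x. indicator A x \<partial>unlift C (lift C F))"
    using AF s by simp
  also have "\<dots> = ennreal C * (\<integral>\<^sup>+x. indicator A x * indicator {0..} x \<partial>lift C F)"
    by (rule nn_integral_unlift) (use Ab in auto)
  also have "(\<integral>\<^sup>+x. indicator A x * indicator {0..} x \<partial>lift C F) = (\<integral>\<^sup>+x. indicator A x \<partial>lift C F)"
    using Ab by (intro nn_integral_cong) (auto simp: indicator_def)
  also have "\<dots> = emeasure (lift C F) A" using Ab by simp
  also have "\<dots> = ennreal (1 / C) * emeasure F A"
  proof -
    have "A \<inter> {0..} = A" "(-1::real) \<notin> A" using Ab(2) by auto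
    then show ?thesis using emeasure_lift[OF F Ab(1), of C] by simp
  qed
  also have "ennreal C * (ennreal (1 / C) * emeasure F A) = emeasure F A"
    using C by (simp add: mult.assoc[symmetric] ennreal_mult[symmetric])
  finally show "emeasure (unlift C (lift C F)) A = emeasure F A" .
qed

lemma lift_gap_null:
  assumes F: "F \<in> half_line_B1"
  shows "AE x in lift C F. x = -1 \<or> 0 \<le> x"
proof (rule AE_I[where N="{..<0} - {-1}"])
  have "({..<0} - {-1}) \<inter> {0..} = ({}::real set)" by auto
  then show "emeasure (lift C F) ({..<0} - {-1}) = 0"
    using emeasure_lift[OF F, of "{..<0} - {-1}" C] by simp
qed auto

text \<open>\<open>unlift\<close> forgets everything on the negative axis; the hypothesis
  \<open>null\<close> says that only an atom at -1 can have been lost, and total mass 1 restores its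
  size.\<close>

lemma lift_unlift:
  assumes P: "real_distribution P" and null: "AE x in P. x = -1 \<or> 0 \<le> x" and C: "C > 0"
    and D: "unlift C P \<in> half_line_B1"
  shows "lift C (unlift C P) = P"
proof (rule measure_eqI)
  interpret P: real_distribution P by fact
  show "sets (lift C (unlift C P)) = sets P" by simp
  fix A assume "A \<in> sets (lift C (unlift C P))"
  then have A: "A \<in> sets borel" by simp
  have em: "emeasure (unlift C P) (B \<inter> {0..}) = ennreal C * emeasure P (B \<inter> {0..})" if "B \<in> sets borel" for B
  proof -
    have "emeasure (unlift C P) (B \<inter> {0..}) = (\<integral>\<^sup>+x. indicator (B \<inter> {0..}) x \<partial>unlift C P)"
      using B1_sets[OF D that] by simp
    also have "\<dots> = ennreal C * (\<integral>\<^sup>+x. indicator (B \<inter> {0..}) x * indicator {0..} x \<partial>P)"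
      by (rule nn_integral_unlift) (use that in auto)
    also have "(\<integral>\<^sup>+x. indicator (B \<inter> {0..}) x * indicator {0..} x \<partial>P) = (\<integral>\<^sup>+x. indicator (B \<inter> {0..}) x \<partial>P)"
      by (intro nn_integral_cong) (auto simp: indicator_def)
    finally show ?thesis using that by simp
  qed
  have sp: "space (unlift C P) = UNIV \<inter> {0..}" using B1_D(2)[OF D] by simp
  have m: "measure (unlift C P) (space (unlift C P)) / C = P.prob {0..}"
    using em[of UNIV] C unfolding sp by (simp add: measure_def enn2real_mult)
  have one: "1 - P.prob {0..} = P.prob {-1}"
  proof -
    have "P.prob ({-1} \<union> {0..}) = 1"
    proof (subst P.prob_eq_1)
      show "AE x in P. x \<in> {-1} \<union> {0..}" using null by eventually_elim auto
    qed simp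
    moreover have "P.prob ({-1} \<union> {0..}) = P.prob {-1} + P.prob {0..}"
      by (rule P.finite_measure_Union) auto
    ultimately show ?thesis by simp
  qed
  have "emeasure (lift C (unlift C P)) A = emeasure P (A \<inter> {0..}) + ennreal (P.prob {-1}) * indicator A (-1)"
    using emeasure_lift[OF D A, of C] C unfolding m one em[OF A]
    by (simp add: mult.assoc[symmetric] ennreal_mult[symmetric])
  also have "ennreal (P.prob {-1}) * indicator A (-1) = emeasure P (A \<inter> {-1})"
    by (cases "-1 \<in> A") (auto simp: P.emeasure_eq_measure)
  also have "emeasure P (A \<inter> {0..}) + emeasure P (A \<inter> {-1}) = emeasure P ((A \<inter> {0..}) \<union> (A \<inter> {-1}))"
    using A by (intro plus_emeasure) auto
  also have "\<dots> = emeasure P A"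
    using A null by (intro emeasure_eq_AE) (auto elim!: eventually_mono)
  finally show "emeasure (lift C (unlift C P)) A = emeasure P A" .
qed

lemma integral_lift:
  fixes f :: "real \<Rightarrow> real"
  assumes F: "F \<in> half_line_B1" and C: "C > 0" and f: "f \<in> borel_measurable borel" and 0: "\<And>x. x < 0 \<Longrightarrow> f x = 0"
  shows "(\<integral>x. f x \<partial>F) = C * (\<integral>x. f x \<partial>lift C F)"
proof -
  have "(\<integral>x. f x \<partial>F) = (\<integral>x. f x \<partial>unlift C (lift C F))" by (simp add: unlift_lift[OF F C])
  also have "\<dots> = C * (\<integral>x. indicator {0..} x * f x \<partial>lift C F)"
    by (rule integral_unlift) (use f C in auto)
  also have "(\<lambda>x. indicator {0..} x * f x) = f" using 0 by (auto simp: indicator_def fun_eq_iff)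
  finally show ?thesis .
qed

lemma pair_integrable_bounded:
  fixes g :: "real \<Rightarrow> real \<Rightarrow> real"
  assumes F: "F \<in> half_line_B1" and g: "case_prod g \<in> borel_measurable (borel \<Otimes>\<^sub>M borel)"
  shows "case_prod g \<in> borel_measurable (F \<Otimes>\<^sub>M F)" "case_prod g \<in> borel_measurable (borel \<Otimes>\<^sub>M F)"
proof -
  have id: "(\<lambda>x. x) \<in> measurable F borel" using B1_measurable[OF F, of "\<lambda>x. x"] by simp
  have "(\<lambda>q. (fst q, snd q)) \<in> measurable (F \<Otimes>\<^sub>M F) (borel \<Otimes>\<^sub>M borel)"
    by (intro measurable_Pair measurable_compose[OF measurable_fst id] measurable_compose[OF measurable_snd id])
  from measurable_compose[OF this g] show "case_prod g \<in> borel_measurable (F \<Otimes>\<^sub>M F)" by simp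
  have "(\<lambda>q. (fst q, snd q)) \<in> measurable (borel \<Otimes>\<^sub>M F) (borel \<Otimes>\<^sub>M borel)"
    by (intro measurable_Pair measurable_fst measurable_compose[OF measurable_snd id])
  from measurable_compose[OF this g] show "case_prod g \<in> borel_measurable (borel \<Otimes>\<^sub>M F)" by simp
qed

lemma B1_pair_sigma_finite: "F \<in> half_line_B1 \<Longrightarrow> pair_sigma_finite F F"
proof -
  assume "F \<in> half_line_B1"
  then interpret finite_measure F by (rule B1_D(3))
  show ?thesis by standard
qed

lemma moment_product:
  assumes F: "F \<in> bounded_B1 C"
  shows "integrable (F \<Otimes>\<^sub>M F) (\<lambda>(y, z). (1 + y) * (1 + z))"
    and "(\<integral>q. (\<lambda>(y, z). (1 + y) * (1 + z)) q \<partial>(F \<Otimes>\<^sub>M F)) \<le> C * C"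
proof -
  note F1 = bounded_B1_D(1)[OF F]
  interpret P: pair_sigma_finite F F by (rule B1_pair_sigma_finite[OF F1])
  note i = B1_D(4)[OF F1]
  have m: "(\<lambda>(y, z). (1 + y) * (1 + z)) \<in> borel_measurable (F \<Otimes>\<^sub>M F)"
    by (rule pair_integrable_bounded(1)[OF F1]) measurable
  have nn: "0 \<le> (\<integral>x. 1 + x \<partial>F)"
    using B1_D(2)[OF F1] by (intro integral_nonneg_AE AE_I2) auto
  show 1: "integrable (F \<Otimes>\<^sub>M F) (\<lambda>(y, z). (1 + y) * (1 + z))"
  proof (rule P.Fubini_integrable[OF m])
    have "(\<lambda>x. \<integral>y. norm (case (x, y) of (y, z) \<Rightarrow> (1 + y) * (1 + z)) \<partial>F) = (\<lambda>x. \<bar>1 + x\<bar> * (\<integral>y. \<bar>1 + y\<bar> \<partial>F))"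
      by (simp add: abs_mult)
    then show "integrable F (\<lambda>x. \<integral>y. norm (case (x, y) of (y, z) \<Rightarrow> (1 + y) * (1 + z)) \<partial>F)"
      using integrable_abs[OF i] by simp
    show "AE x in F. integrable F (\<lambda>y. case (x, y) of (y, z) \<Rightarrow> (1 + y) * (1 + z))"
      using i by simp
  qed
  have "(\<integral>q. (\<lambda>(y, z). (1 + y) * (1 + z)) q \<partial>(F \<Otimes>\<^sub>M F)) = (\<integral>y. (\<integral>z. (1 + y) * (1 + z) \<partial>F) \<partial>F)"
    using P.integral_fst'[OF 1] by simp
  also have "\<dots> = (\<integral>y. 1 + y \<partial>F) * (\<integral>z. 1 + z \<partial>F)"
    by (subst integral_mult_right_zero) simp
  also have "\<dots> \<le> C * C"
    using nn bounded_B1_D(2)[OF F] by (intro mult_mono) auto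
  finally show "(\<integral>q. (\<lambda>(y, z). (1 + y) * (1 + z)) q \<partial>(F \<Otimes>\<^sub>M F)) \<le> C * C" .
qed

text \<open>The growth of \<open>J\<close> and \<open>L\<close> is thus dominated by a function
  integrable against \<open>F \<Otimes>\<^sub>M F\<close>, and the second estimate makes its
  contribution from large energies uniformly small.\<close>

lemma sqrt_max_le:
  fixes y z :: real
  assumes "y \<ge> 0" "z \<ge> 0"
  shows "sqrt (max y z) \<le> (1 + y) * (1 + z)"
    and "R > 0 \<Longrightarrow> R < max y z \<Longrightarrow> sqrt (max y z) \<le> (1 + y) * (1 + z) / sqrt R"
proof -
  have b: "max y z \<le> (1 + y) * (1 + z)" "1 \<le> (1 + y) * (1 + z)"
    using assms by (auto simp: distrib_left distrib_right mult_nonneg_nonneg add_nonneg_nonneg add_increasing add_increasing2)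
  have "sqrt v \<le> max 1 v" if "v \<ge> 0" for v :: real
  proof (cases "v \<le> 1")
    case False
    then have "v * 1 \<le> v * v" by (intro mult_left_mono) auto
    then have "sqrt v \<le> v" using that by (intro real_le_lsqrt) (auto simp: power2_eq_square)
    then show ?thesis by simp
  qed simp
  from this[of "max y z"] have "sqrt (max y z) \<le> max 1 (max y z)" using assms by simp
  then show "sqrt (max y z) \<le> (1 + y) * (1 + z)" using b by linarith
  assume R: "R > 0" "R < max y z"
  have "sqrt (max y z) * sqrt R \<le> sqrt (max y z) * sqrt (max y z)"
    using R by (intro mult_left_mono) auto
  also have "\<dots> = max y z" using assms by simp
  also have "\<dots> \<le> (1 + y) * (1 + z)" by (rule b)
  finally show "sqrt (max y z) \<le> (1 + y) * (1 + z) / sqrt R" using R by (simp add: pos_le_divide_eq)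
qed

lemma growth_integrable:
  fixes g :: "real \<Rightarrow> real \<Rightarrow> real"
  assumes F: "F \<in> bounded_B1 C" and g: "case_prod g \<in> borel_measurable (borel \<Otimes>\<^sub>M borel)"
    and b: "\<And>y z. y \<ge> 0 \<Longrightarrow> z \<ge> 0 \<Longrightarrow> \<bar>g y z\<bar> \<le> B * ((1 + y) * (1 + z))" and B: "B \<ge> 0"
  shows "integrable (F \<Otimes>\<^sub>M F) (case_prod g)"
    and "\<bar>\<integral>q. case_prod g q \<partial>(F \<Otimes>\<^sub>M F)\<bar> \<le> B * (C * C)"
proof -
  note F1 = bounded_B1_D(1)[OF F]
  have bd: "norm (case_prod g q) \<le> B * (\<lambda>(y, z). (1 + y) * (1 + z)) q" if "q \<in> space (F \<Otimes>\<^sub>M F)" for q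
    using that b B1_D(2)[OF F1] by (auto simp: space_pair_measure)
  have i: "integrable (F \<Otimes>\<^sub>M F) (\<lambda>q. B * (\<lambda>(y, z). (1 + y) * (1 + z)) q)"
    by (intro integrable_mult_right moment_product[OF F])
  show 1: "integrable (F \<Otimes>\<^sub>M F) (case_prod g)"
    by (rule Bochner_Integration.integrable_bound[OF i pair_integrable_bounded(1)[OF F1 g]])
      (use order_trans[OF bd abs_ge_self] in \<open>auto intro!: AE_I2\<close>)
  have "norm (\<integral>q. case_prod g q \<partial>(F \<Otimes>\<^sub>M F)) \<le> (\<integral>q. B * (\<lambda>(y, z). (1 + y) * (1 + z)) q \<partial>(F \<Otimes>\<^sub>M F))"
    by (rule Bochner_Integration.integral_norm_bound_integral[OF 1 i bd])
  also have "\<dots> = B * (\<integral>q. (\<lambda>(y, z). (1 + y) * (1 + z)) q \<partial>(F \<Otimes>\<^sub>M F))" by simp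
  also have "\<dots> \<le> B * (C * C)" using moment_product(2)[OF F] B by (rule mult_left_mono)
  finally show "\<bar>\<integral>q. case_prod g q \<partial>(F \<Otimes>\<^sub>M F)\<bar> \<le> B * (C * C)" by simp
qed

section \<open>Convergence of integrals of varying functions\<close>

definition B1_conv :: "real \<Rightarrow> (nat \<Rightarrow> real measure) \<Rightarrow> real measure \<Rightarrow> bool" where
  "B1_conv C Fn F \<longleftrightarrow> (\<forall>n. Fn n \<in> bounded_B1 C) \<and> F \<in> bounded_B1 C \<and> weak_conv_m (\<lambda>n. lift C (Fn n)) (lift C F)"

text \<open>On a common probability space the measures become almost surely convergent random
  variables, so integrals of functions that change with \<open>n\<close> can be treated by dominated
  convergence. The indicator removes the atom at -1.\<close>

lemma B1_conv_Skorohod: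
  assumes conv: "B1_conv C Fn F" and C: "C > 0"
  obtains \<Omega> :: "real measure" and Yn Y where
    "prob_space \<Omega>" "\<And>n. Yn n \<in> borel_measurable \<Omega>" "Y \<in> borel_measurable \<Omega>"
    "\<And>n f. f \<in> borel_measurable borel \<Longrightarrow> (\<integral>x. f x \<partial>Fn n) = C * (\<integral>\<omega>. indicator {0..} (Yn n \<omega>) * f (Yn n \<omega>) \<partial>\<Omega>)"
    "\<And>f. f \<in> borel_measurable borel \<Longrightarrow> (\<integral>x. f x \<partial>F) = C * (\<integral>\<omega>. indicator {0..} (Y \<omega>) * f (Y \<omega>) \<partial>\<Omega>)"
    "AE \<omega> in \<Omega>. (\<forall>n. Yn n \<omega> = -1 \<or> 0 \<le> Yn n \<omega>) \<and> (\<lambda>n. Yn n \<omega>) \<longlonglongrightarrow> Y \<omega>"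
proof -
  have F: "\<And>n. Fn n \<in> bounded_B1 C" "F \<in> bounded_B1 C" and w: "weak_conv_m (\<lambda>n. lift C (Fn n)) (lift C F)"
    using conv by (auto simp: B1_conv_def)
  have rd: "real_distribution (lift C (Fn n))" "real_distribution (lift C F)" for n
    using real_distribution_lift[OF _ C] F by auto
  obtain \<Omega> :: "real measure" and Yn :: "nat \<Rightarrow> real \<Rightarrow> real" and Y where
    O: "prob_space \<Omega>" "\<And>n. Yn n \<in> measurable \<Omega> borel" "\<And>n. distr \<Omega> borel (Yn n) = lift C (Fn n)"
      "Y \<in> measurable \<Omega> lborel" "distr \<Omega> borel Y = lift C F" "\<And>x. x \<in> space \<Omega> \<Longrightarrow> (\<lambda>n. Yn n x) \<longlonglongrightarrow> Y x"
    using Skorohod[OF rd w] by blast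
  have Ym: "Y \<in> borel_measurable \<Omega>" using O(4) by simp
  have int: "(\<integral>x. f x \<partial>G) = C * (\<integral>\<omega>. indicator {0..} (Z \<omega>) * f (Z \<omega>) \<partial>\<Omega>)"
    if "G \<in> half_line_B1" "distr \<Omega> borel Z = lift C G" "Z \<in> borel_measurable \<Omega>" "f \<in> borel_measurable borel" for G Z and f :: "real \<Rightarrow> real"
  proof -
    have "(\<integral>x. f x \<partial>G) = (\<integral>x. f x \<partial>unlift C (distr \<Omega> borel Z))"
      using unlift_lift[OF that(1) C] that(2) by simp
    also have "\<dots> = C * (\<integral>x. indicator {0..} x * f x \<partial>distr \<Omega> borel Z)"
      by (rule integral_unlift) (use that C in auto)
    also have "(\<integral>x. indicator {0..} x * f x \<partial>distr \<Omega> borel Z) = (\<integral>\<omega>. indicator {0..} (Z \<omega>) * f (Z \<omega>) \<partial>\<Omega>)"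
      by (rule integral_distr) (use that in auto)
    finally show ?thesis .
  qed
  have ae: "AE \<omega> in \<Omega>. Yn n \<omega> = -1 \<or> 0 \<le> Yn n \<omega>" for n
  proof -
    have "AE x in distr \<Omega> borel (Yn n). x = -1 \<or> 0 \<le> x"
      unfolding O(3) by (rule lift_gap_null[OF bounded_B1_D(1)[OF F(1)]])
    then show ?thesis by (subst (asm) AE_distr_iff) (use O(2) in auto)
  qed
  show ?thesis
  proof (rule that[OF O(1) O(2) Ym])
    show "(\<integral>x. f x \<partial>Fn n) = C * (\<integral>\<omega>. indicator {0..} (Yn n \<omega>) * f (Yn n \<omega>) \<partial>\<Omega>)"
      if "f \<in> borel_measurable borel" for n f
      by (rule int[OF bounded_B1_D(1)[OF F(1)] O(3) O(2) that])
    show "(\<integral>x. f x \<partial>F) = C * (\<integral>\<omega>. indicator {0..} (Y \<omega>) * f (Y \<omega>) \<partial>\<Omega>)"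
      if "f \<in> borel_measurable borel" for f
      by (rule int[OF bounded_B1_D(1)[OF F(2)] O(5) Ym that])
    have "AE \<omega> in \<Omega>. \<forall>n. Yn n \<omega> = -1 \<or> 0 \<le> Yn n \<omega>" using ae by (simp add: AE_all_countable)
    then show "AE \<omega> in \<Omega>. (\<forall>n. Yn n \<omega> = -1 \<or> 0 \<le> Yn n \<omega>) \<and> (\<lambda>n. Yn n \<omega>) \<longlonglongrightarrow> Y \<omega>"
      using AE_space by eventually_elim (use O(6) in auto)
  qed
qed

text \<open>Because the values avoid the gap between -1 and 0, a convergent sequence eventually
  stays on one side; -1/2 is just a threshold inside the gap. The indicator of the half line
  therefore causes no discontinuity along such sequences.\<close>

lemma half_line_limit_cases:
  fixes yn :: "nat \<Rightarrow> real"
  assumes l: "yn \<longlonglongrightarrow> y" and r: "\<forall>n. yn n = -1 \<or> 0 \<le> yn n"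
  shows "(0 \<le> y \<and> (\<forall>\<^sub>F n in sequentially. 0 \<le> yn n)) \<or> (y < 0 \<and> (\<forall>\<^sub>F n in sequentially. yn n < 0))"
proof (cases "- (1/2) < y")
  case True
  then have ev: "\<forall>\<^sub>F n in sequentially. - (1/2) < yn n" by (rule order_tendstoD(1)[OF l])
  have ev2: "\<forall>\<^sub>F n in sequentially. 0 \<le> yn n"
    using ev by eventually_elim (use r in \<open>smt (verit) field_sum_of_halves\<close>)
  have "0 \<le> y" by (rule tendsto_lowerbound[OF l ev2]) simp
  then show ?thesis using ev2 by simp
next
  case False
  then have "y < 0" by simp
  then show ?thesis using order_tendstoD(2)[OF l] by simp
qed

text \<open>The hypothesis \<open>cc\<close> is continuous convergence, exactly what almost sure
  convergence of the arguments calls for.\<close>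

lemma B1_conv_integral:
  fixes gn :: "nat \<Rightarrow> real \<Rightarrow> real"
  assumes conv: "B1_conv C Fn F" and C: "C > 0"
    and m: "\<And>n. gn n \<in> borel_measurable borel" "g \<in> borel_measurable borel"
    and b: "\<And>n x. x \<ge> 0 \<Longrightarrow> \<bar>gn n x\<bar> \<le> B"
    and cc: "\<And>xn x. (\<And>n. xn n \<ge> 0) \<Longrightarrow> xn \<longlonglongrightarrow> x \<Longrightarrow> (\<lambda>n. gn n (xn n)) \<longlonglongrightarrow> g x"
  shows "(\<lambda>n. \<integral>x. gn n x \<partial>Fn n) \<longlonglongrightarrow> (\<integral>x. g x \<partial>F)"
proof -
  obtain \<Omega> :: "real measure" and Yn Y where
    O: "prob_space \<Omega>" "\<And>n. Yn n \<in> borel_measurable \<Omega>" "Y \<in> borel_measurable \<Omega>"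
    and i1: "\<And>n f. f \<in> borel_measurable borel \<Longrightarrow> (\<integral>x. f x \<partial>Fn n) = C * (\<integral>\<omega>. indicator {0..} (Yn n \<omega>) * f (Yn n \<omega>) \<partial>\<Omega>)"
    and i2: "\<And>f. f \<in> borel_measurable borel \<Longrightarrow> (\<integral>x. f x \<partial>F) = C * (\<integral>\<omega>. indicator {0..} (Y \<omega>) * f (Y \<omega>) \<partial>\<Omega>)"
    and ae: "AE \<omega> in \<Omega>. (\<forall>n. Yn n \<omega> = -1 \<or> 0 \<le> Yn n \<omega>) \<and> (\<lambda>n. Yn n \<omega>) \<longlonglongrightarrow> Y \<omega>"
    using B1_conv_Skorohod[OF conv C] by blast
  interpret prob_space \<Omega> by (rule O(1))
  have [measurable]: "\<And>n. Yn n \<in> borel_measurable \<Omega>" "Y \<in> borel_measurable \<Omega>" "\<And>n. gn n \<in> borel_measurable borel" "g \<in> borel_measurable borel"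
    using O m by auto
  have B: "B \<ge> 0" using b[of 0 0] by simp
  have "(\<lambda>n. \<integral>\<omega>. indicator {0..} (Yn n \<omega>) * gn n (Yn n \<omega>) \<partial>\<Omega>) \<longlonglongrightarrow> (\<integral>\<omega>. indicator {0..} (Y \<omega>) * g (Y \<omega>) \<partial>\<Omega>)"
  proof (rule integral_dominated_convergence[where w="\<lambda>_. B"])
    show "AE \<omega> in \<Omega>. (\<lambda>n. indicator {0..} (Yn n \<omega>) * gn n (Yn n \<omega>)) \<longlonglongrightarrow> indicator {0..} (Y \<omega>) * g (Y \<omega>)"
      using ae
    proof eventually_elim
      case (elim \<omega>)
      from half_line_limit_cases[OF conjunct2[OF elim] conjunct1[OF elim]]
      show ?case
      proof (elim disjE conjE)
        assume y: "0 \<le> Y \<omega>" and ev: "\<forall>\<^sub>F n in sequentially. 0 \<le> Yn n \<omega>"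
        \<comment> \<open>Clamping at 0 makes all members nonnegative, as \<open>cc\<close> demands,
          and changes only finitely many of them.\<close>
        have "(\<lambda>n. max 0 (Yn n \<omega>)) \<longlonglongrightarrow> max 0 (Y \<omega>)" by (intro tendsto_intros conjunct2[OF elim])
        then have "(\<lambda>n. gn n (max 0 (Yn n \<omega>))) \<longlonglongrightarrow> g (Y \<omega>)" using y by (intro cc) auto
        moreover have "\<forall>\<^sub>F n in sequentially. gn n (max 0 (Yn n \<omega>)) = indicator {0..} (Yn n \<omega>) * gn n (Yn n \<omega>)"
          using ev by eventually_elim simp
        ultimately show ?thesis using y Lim_transform_eventually by fastforce
      next
        assume y: "Y \<omega> < 0" and ev: "\<forall>\<^sub>F n in sequentially. Yn n \<omega> < 0"
        have "\<forall>\<^sub>F n in sequentially. indicator {0..} (Yn n \<omega>) * gn n (Yn n \<omega>) = 0"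
          using ev by eventually_elim simp
        then show ?thesis using y by (simp add: tendsto_eventually)
      qed
    qed
    show "AE \<omega> in \<Omega>. norm (indicator {0..} (Yn n \<omega>) * gn n (Yn n \<omega>)) \<le> B" for n
      using b B by (auto simp: indicator_def)
  qed auto
  then show ?thesis unfolding i1[OF m(1)] i2[OF m(2)] by (intro tendsto_intros)
qed

text \<open>\<open>B1_conv_integral\<close> is applied twice: for convergent outer arguments it
  shows that the inner integrals converge continuously, and this is its own hypothesis for the outer
  integral.\<close>

lemma B1_conv_double_integral_bounded:
  fixes gn :: "nat \<Rightarrow> real \<Rightarrow> real \<Rightarrow> real"
  assumes conv: "B1_conv C Fn F" and C: "C > 0"
    and m: "\<And>n. case_prod (gn n) \<in> borel_measurable (borel \<Otimes>\<^sub>M borel)" "case_prod g \<in> borel_measurable (borel \<Otimes>\<^sub>M borel)"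
    and b: "\<And>n x y. x \<ge> 0 \<Longrightarrow> y \<ge> 0 \<Longrightarrow> \<bar>gn n x y\<bar> \<le> B" "\<And>x y. x \<ge> 0 \<Longrightarrow> y \<ge> 0 \<Longrightarrow> \<bar>g x y\<bar> \<le> B"
    and cc: "\<And>xn x yn y. (\<And>n. xn n \<ge> 0) \<Longrightarrow> (\<And>n. yn n \<ge> 0) \<Longrightarrow> xn \<longlonglongrightarrow> x \<Longrightarrow> yn \<longlonglongrightarrow> y \<Longrightarrow> (\<lambda>n. gn n (xn n) (yn n)) \<longlonglongrightarrow> g x y"
  shows "(\<lambda>n. \<integral>q. case_prod (gn n) q \<partial>(Fn n \<Otimes>\<^sub>M Fn n)) \<longlonglongrightarrow> (\<integral>q. case_prod g q \<partial>(F \<Otimes>\<^sub>M F))"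
proof -
  have Fb: "\<And>n. Fn n \<in> bounded_B1 C" "F \<in> bounded_B1 C" using conv by (auto simp: B1_conv_def)
  have B: "B \<ge> 0" using b(2)[of 0 0] by simp
  have sec: "h x \<in> borel_measurable borel" if "case_prod h \<in> borel_measurable (borel \<Otimes>\<^sub>M borel)" for h :: "real \<Rightarrow> real \<Rightarrow> real" and x
    using measurable_compose[OF measurable_Pair1' that, of x] by simp
  have iter: "(\<integral>q. case_prod h q \<partial>(G \<Otimes>\<^sub>M G)) = (\<integral>x. (\<integral>y. h x y \<partial>G) \<partial>G)"
    and im: "(\<lambda>x. \<integral>y. h x y \<partial>G) \<in> borel_measurable borel"
    and ib: "x \<ge> 0 \<Longrightarrow> \<bar>\<integral>y. h x y \<partial>G\<bar> \<le> B * C"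
    if G: "G \<in> bounded_B1 C" and hm: "case_prod h \<in> borel_measurable (borel \<Otimes>\<^sub>M borel)"
      and hb: "\<And>x y. x \<ge> 0 \<Longrightarrow> y \<ge> 0 \<Longrightarrow> \<bar>h x y\<bar> \<le> B" for G h x
  proof -
    note G1 = bounded_B1_D(1)[OF G]
    interpret G: finite_measure G using B1_D(3)[OF G1] .
    interpret PG: pair_sigma_finite G G by (rule B1_pair_sigma_finite[OF G1])
    have "\<bar>h x y\<bar> \<le> B * ((1 + x) * (1 + y))" if "x \<ge> 0" "y \<ge> 0" for x y
    proof -
      have "1 \<le> (1 + x) * (1 + y)" using mult_mono[of 1 "1 + x" 1 "1 + y"] that by simp
      then have "B * 1 \<le> B * ((1 + x) * (1 + y))" using B by (rule mult_left_mono)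
      then show ?thesis using hb[OF that] by simp
    qed
    then have "integrable (G \<Otimes>\<^sub>M G) (case_prod h)" using B by (rule growth_integrable(1)[OF G hm])
    from PG.integral_fst'[OF this] show "(\<integral>q. case_prod h q \<partial>(G \<Otimes>\<^sub>M G)) = (\<integral>x. (\<integral>y. h x y \<partial>G) \<partial>G)" by simp
    show "(\<lambda>x. \<integral>y. h x y \<partial>G) \<in> borel_measurable borel"
      by (rule G.borel_measurable_lebesgue_integral) (rule pair_integrable_bounded(2)[OF G1 hm])
    show "\<bar>\<integral>y. h x y \<partial>G\<bar> \<le> B * C" if x: "x \<ge> 0"
    proof -
      have "norm (\<integral>y. h x y \<partial>G) \<le> (\<integral>y. B \<partial>G)"
        by (rule Bochner_Integration.integral_norm_bound_integral)
          (use hb x B1_D(2)[OF G1] in \<open>auto intro!: B1_integrable_bounded[OF G1 sec[OF hm]]\<close>)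
      also have "\<dots> = B * measure G (space G)" by simp
      also have "\<dots> \<le> B * C" using B bounded_B1_D(3)[OF G] by (intro mult_left_mono) auto
      finally show ?thesis by simp
    qed
  qed
  have e1: "(\<integral>q. case_prod (gn n) q \<partial>(Fn n \<Otimes>\<^sub>M Fn n)) = (\<integral>x. (\<integral>y. gn n x y \<partial>Fn n) \<partial>Fn n)" for n
    by (rule iter[OF Fb(1) m(1) b(1)])
  have e2: "(\<integral>q. case_prod g q \<partial>(F \<Otimes>\<^sub>M F)) = (\<integral>x. (\<integral>y. g x y \<partial>F) \<partial>F)"
    by (rule iter[OF Fb(2) m(2) b(2)])
  show ?thesis
    unfolding e1 e2
  proof (rule B1_conv_integral[OF conv C im[OF Fb(1) m(1) b(1)] im[OF Fb(2) m(2) b(2)] ib[OF Fb(1) m(1) b(1)]])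
    fix xn :: "nat \<Rightarrow> real" and x assume x: "\<And>n. xn n \<ge> 0" "xn \<longlonglongrightarrow> x"
    show "(\<lambda>n. \<integral>y. gn n (xn n) y \<partial>Fn n) \<longlonglongrightarrow> (\<integral>y. g x y \<partial>F)"
      by (rule B1_conv_integral[OF conv C sec[OF m(1)] sec[OF m(2)] b(1)[OF x(1)]]) (use x in \<open>auto intro!: cc\<close>)
  qed auto
qed

text \<open>A continuous cut-off \<open>\<kappa>\<close> at height \<open>R\<close> reduces to
  bounded integrands. By \<open>sqrt_max_le\<close> the removed part is of order
  \<open>1 / sqrt R\<close>, uniformly over all measures in \<open>bounded_B1 C\<close>.\<close>

lemma B1_conv_double_integral:
  fixes gn :: "nat \<Rightarrow> real \<Rightarrow> real \<Rightarrow> real"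
  assumes conv: "B1_conv C Fn F" and C: "C > 0" and B: "B \<ge> 0"
    and m: "\<And>n. case_prod (gn n) \<in> borel_measurable (borel \<Otimes>\<^sub>M borel)" "case_prod g \<in> borel_measurable (borel \<Otimes>\<^sub>M borel)"
    and b: "\<And>n x y. x \<ge> 0 \<Longrightarrow> y \<ge> 0 \<Longrightarrow> \<bar>gn n x y\<bar> \<le> B * sqrt (max x y)" "\<And>x y. x \<ge> 0 \<Longrightarrow> y \<ge> 0 \<Longrightarrow> \<bar>g x y\<bar> \<le> B * sqrt (max x y)"
    and cc: "\<And>xn x yn y. (\<And>n. xn n \<ge> 0) \<Longrightarrow> (\<And>n. yn n \<ge> 0) \<Longrightarrow> xn \<longlonglongrightarrow> x \<Longrightarrow> yn \<longlonglongrightarrow> y \<Longrightarrow> (\<lambda>n. gn n (xn n) (yn n)) \<longlonglongrightarrow> g x y"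
  shows "(\<lambda>n. \<integral>q. case_prod (gn n) q \<partial>(Fn n \<Otimes>\<^sub>M Fn n)) \<longlonglongrightarrow> (\<integral>q. case_prod g q \<partial>(F \<Otimes>\<^sub>M F))"
proof -
  have Fb: "\<And>n. Fn n \<in> bounded_B1 C" "F \<in> bounded_B1 C" using conv by (auto simp: B1_conv_def)
  define \<kappa> where "\<kappa> R y z = max 0 (min 1 (R + 1 - max y z))" for R y z :: real
  have \<kappa>: "0 \<le> \<kappa> R y z" "\<kappa> R y z \<le> 1" "max y z \<le> R \<Longrightarrow> \<kappa> R y z = 1" "R + 1 \<le> max y z \<Longrightarrow> \<kappa> R y z = 0" for R y z
    by (auto simp: \<kappa>_def)
  have \<kappa>m[measurable]: "(\<lambda>q. \<kappa> R (fst q) (snd q)) \<in> borel_measurable (borel \<Otimes>\<^sub>M borel)" for R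
    unfolding \<kappa>_def by measurable
  have cut: "\<bar>(\<integral>q. case_prod h q \<partial>(G \<Otimes>\<^sub>M G)) - (\<integral>q. case_prod (\<lambda>y z. h y z * \<kappa> R y z) q \<partial>(G \<Otimes>\<^sub>M G))\<bar> \<le> B / sqrt R * (C * C)"
    if G: "G \<in> bounded_B1 C" and hm: "case_prod h \<in> borel_measurable (borel \<Otimes>\<^sub>M borel)"
      and hb: "\<And>x y. x \<ge> 0 \<Longrightarrow> y \<ge> 0 \<Longrightarrow> \<bar>h x y\<bar> \<le> B * sqrt (max x y)" and R: "R > 0" for G h R
  proof -
    have hm': "case_prod (\<lambda>y z. h y z * \<kappa> R y z) \<in> borel_measurable (borel \<Otimes>\<^sub>M borel)"
      using borel_measurable_times[OF hm \<kappa>m[of R]] by (simp add: case_prod_beta)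
    have hm'': "case_prod (\<lambda>y z. h y z - h y z * \<kappa> R y z) \<in> borel_measurable (borel \<Otimes>\<^sub>M borel)"
      using borel_measurable_diff[OF hm hm'] by (simp add: case_prod_beta)
    have b1: "\<bar>h x y\<bar> \<le> B * ((1 + x) * (1 + y))" if "x \<ge> 0" "y \<ge> 0" for x y
      using order_trans[OF hb[OF that] mult_left_mono[OF sqrt_max_le(1)[OF that] B]] .
    have b2: "\<bar>h x y * \<kappa> R x y\<bar> \<le> B * ((1 + x) * (1 + y))" if "x \<ge> 0" "y \<ge> 0" for x y
    proof -
      have "\<bar>h x y * \<kappa> R x y\<bar> \<le> \<bar>h x y\<bar> * 1" unfolding abs_mult using \<kappa>(1,2)[of R x y] by (intro mult_left_mono) auto
      then show ?thesis using b1[OF that] by simp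
    qed
    have b3: "\<bar>h x y - h x y * \<kappa> R x y\<bar> \<le> B / sqrt R * ((1 + x) * (1 + y))" if "x \<ge> 0" "y \<ge> 0" for x y
    proof (cases "max x y \<le> R")
      case True
      then show ?thesis using \<kappa>(3)[OF True] B R that by simp
    next
      case False
      have "h x y - h x y * \<kappa> R x y = h x y * (1 - \<kappa> R x y)" by (simp add: right_diff_distrib)
      then have "\<bar>h x y - h x y * \<kappa> R x y\<bar> = \<bar>h x y\<bar> * (1 - \<kappa> R x y)" using \<kappa>(2)[of R x y] by (simp add: abs_mult)
      also have "\<dots> \<le> \<bar>h x y\<bar> * 1" using \<kappa>(1)[of R x y] by (intro mult_left_mono) auto
      also have "\<dots> \<le> B * sqrt (max x y)" using hb[OF that] by simp
      also have "\<dots> \<le> B * ((1 + x) * (1 + y) / sqrt R)" using False R B that by (intro mult_left_mono sqrt_max_le(2)) auto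
      finally show ?thesis by simp
    qed
    have "(\<integral>q. case_prod h q \<partial>(G \<Otimes>\<^sub>M G)) - (\<integral>q. case_prod (\<lambda>y z. h y z * \<kappa> R y z) q \<partial>(G \<Otimes>\<^sub>M G))
       = (\<integral>q. case_prod (\<lambda>y z. h y z - h y z * \<kappa> R y z) q \<partial>(G \<Otimes>\<^sub>M G))"
      by (subst Bochner_Integration.integral_diff[OF growth_integrable(1)[OF G hm b1 B] growth_integrable(1)[OF G hm' b2 B], symmetric])
        (auto intro!: Bochner_Integration.integral_cong)
    also have "\<bar>\<dots>\<bar> \<le> B / sqrt R * (C * C)"
      by (rule growth_integrable(2)[OF G hm'' b3]) (use B R in auto)
    finally show ?thesis .
  qed
  have trunc: "(\<lambda>n. \<integral>q. case_prod (\<lambda>y z. gn n y z * \<kappa> R y z) q \<partial>(Fn n \<Otimes>\<^sub>M Fn n)) \<longlonglongrightarrow> (\<integral>q. case_prod (\<lambda>y z. g y z * \<kappa> R y z) q \<partial>(F \<Otimes>\<^sub>M F))"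
    if R: "R > 0" for R
  proof (rule B1_conv_double_integral_bounded[OF conv C])
    show "case_prod (\<lambda>y z. gn n y z * \<kappa> R y z) \<in> borel_measurable (borel \<Otimes>\<^sub>M borel)" for n
      using borel_measurable_times[OF m(1)[of n] \<kappa>m[of R]] by (simp add: case_prod_beta)
    show "case_prod (\<lambda>y z. g y z * \<kappa> R y z) \<in> borel_measurable (borel \<Otimes>\<^sub>M borel)"
      using borel_measurable_times[OF m(2) \<kappa>m[of R]] by (simp add: case_prod_beta)
    have bb: "\<bar>h * \<kappa> R x y\<bar> \<le> B * sqrt (R + 1)" if "\<bar>h\<bar> \<le> B * sqrt (max x y)" for h x y
    proof (cases "R + 1 \<le> max x y")
      case True
      then show ?thesis using \<kappa>(4)[OF True] B R by simp
    next
      case False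
      have "\<bar>h * \<kappa> R x y\<bar> \<le> \<bar>h\<bar> * 1" unfolding abs_mult using \<kappa>(1,2)[of R x y] by (intro mult_left_mono) auto
      also have "\<dots> \<le> B * sqrt (max x y)" using that by simp
      also have "\<dots> \<le> B * sqrt (R + 1)" using False B by (intro mult_left_mono) auto
      finally show ?thesis .
    qed
    show "\<bar>gn n x y * \<kappa> R x y\<bar> \<le> B * sqrt (R + 1)" if "x \<ge> 0" "y \<ge> 0" for n x y by (rule bb[OF b(1)[OF that]])
    show "\<bar>g x y * \<kappa> R x y\<bar> \<le> B * sqrt (R + 1)" if "x \<ge> 0" "y \<ge> 0" for x y by (rule bb[OF b(2)[OF that]])
    show "(\<lambda>n. gn n (xn n) (yn n) * \<kappa> R (xn n) (yn n)) \<longlonglongrightarrow> g x y * \<kappa> R x y"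
      if "\<And>n. xn n \<ge> 0" "\<And>n. yn n \<ge> 0" "xn \<longlonglongrightarrow> x" "yn \<longlonglongrightarrow> y" for xn x yn y
      unfolding \<kappa>_def by (intro tendsto_intros cc that)
  qed
  show ?thesis
  proof (rule LIMSEQ_I)
    fix e :: real assume e: "e > 0"
    \<comment> \<open>Chosen so that each of the two truncation errors is at most
      \<open>e / 4\<close>; the added 1 keeps \<open>R\<close> positive when \<open>B\<close> or
      \<open>C * C\<close> gives nothing.\<close>
    define R where "R = (4 * B * (C * C) / e + 1)\<^sup>2"
    have k: "4 * B * (C * C) / e + 1 > 0" using B e by (intro add_nonneg_pos divide_nonneg_pos) auto
    then have R: "R > 0" "sqrt R = 4 * B * (C * C) / e + 1" by (auto simp: R_def)
    have small: "B / sqrt R * (C * C) \<le> e / 4"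
    proof -
      have "4 * B * (C * C) \<le> e * sqrt R" unfolding R(2) using e by (simp add: distrib_left)
      then have "B * (C * C) \<le> e / 4 * sqrt R" by simp
      then have "B * (C * C) / sqrt R \<le> e / 4" using R(1) by (simp add: pos_divide_le_eq)
      then show ?thesis by simp
    qed
    obtain N where N: "\<And>n. n \<ge> N \<Longrightarrow> norm ((\<integral>q. case_prod (\<lambda>y z. gn n y z * \<kappa> R y z) q \<partial>(Fn n \<Otimes>\<^sub>M Fn n)) - (\<integral>q. case_prod (\<lambda>y z. g y z * \<kappa> R y z) q \<partial>(F \<Otimes>\<^sub>M F))) < e / 4"
      using LIMSEQ_D[OF trunc[OF R(1)], of "e/4"] e by auto
    show "\<exists>no. \<forall>n\<ge>no. norm ((\<integral>q. case_prod (gn n) q \<partial>(Fn n \<Otimes>\<^sub>M Fn n)) - (\<integral>q. case_prod g q \<partial>(F \<Otimes>\<^sub>M F))) < e"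
    proof (intro exI[of _ N] allI impI)
      fix n assume "n \<ge> N"
      have c1: "\<bar>(\<integral>q. case_prod (gn n) q \<partial>(Fn n \<Otimes>\<^sub>M Fn n)) - (\<integral>q. case_prod (\<lambda>y z. gn n y z * \<kappa> R y z) q \<partial>(Fn n \<Otimes>\<^sub>M Fn n))\<bar> \<le> B / sqrt R * (C * C)"
        by (rule cut[OF Fb(1) m(1) b(1) R(1)])
      have c2: "\<bar>(\<integral>q. case_prod g q \<partial>(F \<Otimes>\<^sub>M F)) - (\<integral>q. case_prod (\<lambda>y z. g y z * \<kappa> R y z) q \<partial>(F \<Otimes>\<^sub>M F))\<bar> \<le> B / sqrt R * (C * C)"
        by (rule cut[OF Fb(2) m(2) b(2) R(1)])
      from N[OF \<open>n \<ge> N\<close>] c1 c2 small e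
      show "norm ((\<integral>q. case_prod (gn n) q \<partial>(Fn n \<Otimes>\<^sub>M Fn n)) - (\<integral>q. case_prod g q \<partial>(F \<Otimes>\<^sub>M F))) < e"
        unfolding real_norm_def by linarith
    qed
  qed
qed

lemma half_line_Cc2_Cc: "\<phi> \<in> half_line_Cc2 \<Longrightarrow> \<phi> \<in> half_line_Cc"
  by (simp add: half_line_Cc2_def)

lemma half_line_Cc_Cb: "f \<in> half_line_Cc \<Longrightarrow> f \<in> half_line_Cb"
proof -
  assume f: "f \<in> half_line_Cc"
  then have c: "continuous_on {0..} f" by (simp add: half_line_Cc_def)
  obtain R where R: "\<And>x. x \<ge> 0 \<Longrightarrow> R \<le> x \<Longrightarrow> f x = 0" using f by (auto simp: half_line_Cc_def)
  have "\<And>x. x > max R 0 \<Longrightarrow> f x = 0" using R by auto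
  from bounded_on_half_line[OF c this] obtain B where "\<forall>x\<ge>0. \<bar>f x\<bar> \<le> B" by blast
  then show ?thesis using c by (auto simp: half_line_Cb_def bounded_iff)
qed

lemma half_line_Cb_D:
  assumes "f \<in> half_line_Cb"
  obtains B where "(\<lambda>x. f (max 0 x)) \<in> borel_measurable borel" "\<And>x. x \<ge> 0 \<Longrightarrow> \<bar>f x\<bar> \<le> B"
    "\<And>x. isCont (\<lambda>x. f (max 0 x)) x"
proof -
  have c: "continuous_on {0..} f" and "bounded (f ` {0..})" using assms by (auto simp: half_line_Cb_def)
  then obtain B where B: "\<And>x. x \<ge> 0 \<Longrightarrow> \<bar>f x\<bar> \<le> B" by (auto simp: bounded_iff)
  have "continuous_on UNIV (\<lambda>x. f (max 0 x))" by (intro continuous_on_compose2[OF c] continuous_intros) auto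
  then show ?thesis using B by (intro that[of B]) (auto simp: continuous_on_eq_continuous_at intro: borel_measurable_continuous_onI)
qed

lemma B1_integral_max0:
  assumes "F \<in> half_line_B1"
  shows "(\<integral>x. f x \<partial>F) = (\<integral>x. f (max 0 x) \<partial>F)"
  by (intro Bochner_Integration.integral_cong refl) (use B1_D(2)[OF assms] in auto)

lemma B1_conv_Cb:
  assumes conv: "B1_conv C Fn F" and C: "C > 0" and f: "f \<in> half_line_Cb"
  shows "(\<lambda>n. \<integral>x. f x \<partial>Fn n) \<longlonglongrightarrow> (\<integral>x. f x \<partial>F)"
proof -
  obtain B where B: "(\<lambda>x. f (max 0 x)) \<in> borel_measurable borel" "\<And>x. x \<ge> 0 \<Longrightarrow> \<bar>f x\<bar> \<le> B"
    "\<And>x. isCont (\<lambda>x. f (max 0 x)) x" using half_line_Cb_D[OF f] by blast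
  have F: "\<And>n. Fn n \<in> half_line_B1" "F \<in> half_line_B1"
    using conv bounded_B1_D(1) by (auto simp: B1_conv_def)
  have "(\<lambda>n. \<integral>x. f (max 0 x) \<partial>Fn n) \<longlonglongrightarrow> (\<integral>x. f (max 0 x) \<partial>F)"
  proof (rule B1_conv_integral[where gn="\<lambda>_ x. f (max 0 x)" and B=B, OF conv C])
    fix xn :: "nat \<Rightarrow> real" and x assume "xn \<longlonglongrightarrow> x"
    then show "(\<lambda>n. f (max 0 (xn n))) \<longlonglongrightarrow> f (max 0 x)"
      by (rule isCont_tendsto_compose[OF B(3)])
  next
    fix x :: real
    show "\<bar>f (max 0 x)\<bar> \<le> B" by (simp add: B(2))
  qed (rule B(1))+
  then show ?thesis by (simp add: B1_integral_max0[OF F(1), where f=f, symmetric] B1_integral_max0[OF F(2), where f=f, symmetric])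
qed

section \<open>Twice differentiable cut-offs and uniqueness of measures\<close>

lemma max_power_has_derivative:
  "((\<lambda>x::real. (max 0 x) ^ Suc (Suc n)) has_real_derivative real (Suc (Suc n)) * (max 0 x) ^ Suc n) (at x)"
proof (cases x "0::real" rule: linorder_cases)
  case less
  have "((\<lambda>x::real. (max 0 x) ^ Suc (Suc n)) has_real_derivative 0) (at x)"
    by (rule has_field_derivative_transform_within_open[of "\<lambda>_. 0" 0 x "{..<0}"]) (use less in auto)
  then show ?thesis using less by simp
next
  case greater
  have "((\<lambda>x::real. (max 0 x) ^ Suc (Suc n)) has_real_derivative real (Suc (Suc n)) * x ^ Suc n) (at x)"
  proof (rule has_field_derivative_transform_within_open[of "\<lambda>x. x ^ Suc (Suc n)" _ x "{0<..}"])
    show "((\<lambda>x. x ^ Suc (Suc n)) has_real_derivative real (Suc (Suc n)) * x ^ Suc n) (at x)"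
      using DERIV_pow[of "Suc (Suc n)" x] by simp
  qed (use greater in auto)
  then show ?thesis using greater by simp
next
  case equal
  have "((\<lambda>h::real. (max 0 (0 + h) ^ Suc (Suc n) - max 0 0 ^ Suc (Suc n)) / h) \<longlongrightarrow> 0) (at 0)"
  proof (rule Lim_null_comparison)
    have "((\<lambda>h::real. \<bar>h\<bar> ^ Suc n) \<longlongrightarrow> \<bar>0\<bar> ^ Suc n) (at 0)" by (intro tendsto_intros)
    then show "((\<lambda>h::real. \<bar>h\<bar> ^ Suc n) \<longlongrightarrow> 0) (at 0)" by simp
    show "\<forall>\<^sub>F h in at (0::real). norm ((max 0 (0 + h) ^ Suc (Suc n) - max 0 0 ^ Suc (Suc n)) / h) \<le> \<bar>h\<bar> ^ Suc n"
    proof (rule always_eventually, rule allI)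
      fix h :: real
      show "norm ((max 0 (0 + h) ^ Suc (Suc n) - max 0 0 ^ Suc (Suc n)) / h) \<le> \<bar>h\<bar> ^ Suc n"
        by (cases "h > 0") (simp_all add: max_def zero_le_mult_iff mult_nonpos_nonneg)
    qed
  qed
  then show ?thesis unfolding equal DERIV_def by simp
qed

text \<open>A step from 1 on the negative axis to 0 beyond 1. The cube of a positive part is twice
  continuously differentiable, so cubing at both joints gives the regularity of
  \<open>half_line_Cc2\<close>.\<close>

definition bump :: "real \<Rightarrow> real" where "bump t = (max 0 (1 - (max 0 t) ^ 3)) ^ 3"
definition bump1 :: "real \<Rightarrow> real" where "bump1 t = - (3 * (max 0 (1 - (max 0 t) ^ 3))\<^sup>2 * (3 * (max 0 t)\<^sup>2))"
definition bump2 :: "real \<Rightarrow> real" where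
  "bump2 t = 2 * max 0 (1 - (max 0 t) ^ 3) * 3 * (3 * (max 0 t)\<^sup>2) * (3 * (max 0 t)\<^sup>2) - 3 * (max 0 (1 - (max 0 t) ^ 3))\<^sup>2 * (6 * max 0 t)"

lemma max_cube_deriv: "((\<lambda>x::real. (max 0 x) ^ 3) has_real_derivative 3 * (max 0 x)\<^sup>2) (at x)"
  using max_power_has_derivative[of 1 x] by (simp add: numeral_eq_Suc)

lemma max_square_deriv: "((\<lambda>x::real. (max 0 x)\<^sup>2) has_real_derivative 2 * max 0 x) (at x)"
  using max_power_has_derivative[of 0 x] by (simp add: numeral_eq_Suc)

lemma bump_deriv: "(bump has_real_derivative bump1 t) (at t)"
proof -
  have "((\<lambda>t. 1 - (max 0 t) ^ 3) has_real_derivative - (3 * (max 0 t)\<^sup>2)) (at t)"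
    using DERIV_diff[OF DERIV_const[of 1] max_cube_deriv[of t]] by simp
  from DERIV_chain2[OF max_cube_deriv this] show ?thesis by (simp add: bump_def[abs_def] bump1_def)
qed

lemma bump1_deriv: "(bump1 has_real_derivative bump2 t) (at t)"
proof -
  have 1: "((\<lambda>t. 1 - (max 0 t) ^ 3) has_real_derivative - (3 * (max 0 t)\<^sup>2)) (at t)"
    using DERIV_diff[OF DERIV_const[of 1] max_cube_deriv[of t]] by simp
  have 2: "((\<lambda>t. (max 0 (1 - (max 0 t) ^ 3))\<^sup>2) has_real_derivative 2 * max 0 (1 - (max 0 t) ^ 3) * - (3 * (max 0 t)\<^sup>2)) (at t)"
    by (rule DERIV_chain2[OF max_square_deriv 1])
  show ?thesis unfolding bump1_def[abs_def]
    by (rule derivative_eq_intros 2 max_square_deriv refl)+ (simp add: bump2_def algebra_simps)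
qed

lemma bump2_continuous: "continuous_on UNIV bump2"
  unfolding bump2_def by (intro continuous_intros)

lemma bump_props: "t \<le> 0 \<Longrightarrow> bump t = 1" "1 \<le> t \<Longrightarrow> bump t = 0" "0 \<le> bump t" "bump t \<le> 1"
  "t \<le> 0 \<Longrightarrow> bump1 t = 0" "1 \<le> t \<Longrightarrow> bump1 t = 0" "t \<le> 0 \<Longrightarrow> bump2 t = 0" "1 \<le> t \<Longrightarrow> bump2 t = 0"
proof -
  have k: "1 \<le> (max 0 t) ^ 3" if "1 \<le> t" using that by (intro one_le_power) auto
  show "t \<le> 0 \<Longrightarrow> bump t = 1" "t \<le> 0 \<Longrightarrow> bump1 t = 0" "t \<le> 0 \<Longrightarrow> bump2 t = 0"
    by (auto simp: bump_def bump1_def bump2_def)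
  show "1 \<le> t \<Longrightarrow> bump t = 0" "1 \<le> t \<Longrightarrow> bump1 t = 0" "1 \<le> t \<Longrightarrow> bump2 t = 0"
    using k by (auto simp: bump_def bump1_def bump2_def)
  show "0 \<le> bump t" by (simp add: bump_def)
  show "bump t \<le> 1" unfolding bump_def by (rule power_le_one) auto
qed

lemma half_line_Cc2I:
  assumes d1: "\<And>x. (f has_real_derivative f1 x) (at x)" and d2: "\<And>x. (f1 has_real_derivative f2 x) (at x)"
    and c: "continuous_on UNIV f2" and z: "\<And>x. x \<ge> R \<Longrightarrow> f x = 0"
  shows "f \<in> half_line_Cc2"
    and "x \<ge> 0 \<Longrightarrow> half_line_deriv f x = f1 x"
    and "x \<ge> 0 \<Longrightarrow> half_line_deriv (half_line_deriv f) x = f2 x"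
proof -
  have w1: "(f has_real_derivative f1 x) (at x within {0..})" for x by (rule has_field_derivative_at_within[OF d1])
  have w2: "(f1 has_real_derivative f2 x) (at x within {0..})" for x by (rule has_field_derivative_at_within[OF d2])
  have e1: "half_line_deriv f x = f1 x" if "x \<ge> 0" for x by (rule half_line_deriv_eq[OF that w1])
  then show "x \<ge> 0 \<Longrightarrow> half_line_deriv f x = f1 x" .
  have w2': "(half_line_deriv f has_real_derivative f2 x) (at x within {0..})" if "x \<ge> 0" for x
    using has_field_derivative_transform_within[OF w2, of 1 x "half_line_deriv f"] that e1 by auto
  then show "x \<ge> 0 \<Longrightarrow> half_line_deriv (half_line_deriv f) x = f2 x" by (intro half_line_deriv_eq)
  have "continuous_on {0..} f1" using w2 by (intro DERIV_continuous_on)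
  then have "f \<in> half_line_C1" by (intro half_line_C1I[OF w1])
  moreover have "half_line_deriv f \<in> half_line_C1"
    by (rule half_line_C1I[OF w2']) (auto intro: continuous_on_subset[OF c])
  moreover have "continuous_on {0..} f" using w1 by (intro DERIV_continuous_on)
  then have "f \<in> half_line_Cc" using z by (auto simp: half_line_Cc_def)
  ultimately show "f \<in> half_line_Cc2" by (simp add: half_line_Cc2_def)
qed

text \<open>These functions are 1 up to \<open>a\<close> and 0 from \<open>a + 1 / k\<close> on; as
  \<open>k\<close> grows they approximate the indicator of \<open>{..a}\<close>, through which test
  functions recover distribution functions.\<close>

lemma bump_affine_Cc2:
  assumes k: "k > 0"
  shows "(\<lambda>x. bump ((x - a) * k)) \<in> half_line_Cc2"
proof (rule half_line_Cc2I(1))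
  have lin: "((\<lambda>x. (x - a) * k) has_real_derivative k) (at x)" for x by (auto intro!: derivative_eq_intros)
  show "((\<lambda>x. bump ((x - a) * k)) has_real_derivative bump1 ((x - a) * k) * k) (at x)" for x
    by (rule DERIV_chain2[OF bump_deriv lin])
  show "((\<lambda>x. bump1 ((x - a) * k) * k) has_real_derivative (bump2 ((x - a) * k) * k) * k) (at x)" for x
    by (rule DERIV_cmult_right, rule DERIV_chain2[OF bump1_deriv lin])
  show "continuous_on UNIV (\<lambda>x. (bump2 ((x - a) * k) * k) * k)"
    by (intro continuous_intros continuous_on_compose2[OF bump2_continuous]) auto
  show "bump ((x - a) * k) = 0" if "x \<ge> a + 1 / k" for x
  proof (rule bump_props(2))
    have "1 / k \<le> x - a" using that by simp
    then show "1 \<le> (x - a) * k" using k by (simp add: pos_divide_le_eq)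
  qed
qed

lemma bump_measurable [measurable]: "bump \<in> borel_measurable borel"
  unfolding bump_def by measurable

text \<open>Test functions determine the masses of all \<open>{..a}\<close> and, letting
  \<open>a\<close> grow, the total mass. Hence the lifted measures have the same distribution
  function, and \<open>unlift\<close> returns the original ones.\<close>

lemma half_line_B1_eqI:
  assumes F: "F \<in> half_line_B1" and G: "G \<in> half_line_B1"
    and eq: "\<And>\<phi>. \<phi> \<in> half_line_Cc2 \<Longrightarrow> (\<integral>x. \<phi> x \<partial>F) = (\<integral>x. \<phi> x \<partial>G)"
  shows "F = G"
proof -
  have ind: "(\<lambda>n. \<integral>x. bump ((x - a) * real (Suc n)) \<partial>H) \<longlonglongrightarrow> (\<integral>x. indicat_real {..a} x \<partial>H)"
    if H: "H \<in> half_line_B1" for H a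
  proof (rule integral_dominated_convergence[where w="\<lambda>_. 1"])
    show "integrable H (\<lambda>_. 1::real)" by (rule B1_integrable_bounded[OF H, where B=1]) auto
    show "AE x in H. (\<lambda>n. bump ((x - a) * real (Suc n))) \<longlonglongrightarrow> indicator {..a} x"
    proof (intro AE_I2)
      fix x
      show "(\<lambda>n. bump ((x - a) * real (Suc n))) \<longlonglongrightarrow> indicator {..a} x"
      proof (cases "x \<le> a")
        case True
        then have "bump ((x - a) * real (Suc n)) = 1" for n by (intro bump_props(1) mult_nonpos_nonneg) auto
        then show ?thesis using True by simp
      next
        case False
        then obtain N where N: "1 < real N * (x - a)" using reals_Archimedean3[of "x - a"] by auto
        have "bump ((x - a) * real (Suc n)) = 0" if "n \<ge> N" for n
        proof (rule bump_props(2))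
          have "real N * (x - a) \<le> real (Suc n) * (x - a)" using that False by (intro mult_right_mono) auto
          then show "1 \<le> (x - a) * real (Suc n)" using N by (simp add: mult.commute)
        qed
        then have "\<forall>\<^sub>F n in sequentially. bump ((x - a) * real (Suc n)) = 0" by (auto simp: eventually_sequentially)
        then show ?thesis using False by (simp add: tendsto_eventually)
      qed
    qed
    show "AE x in H. norm (bump ((x - a) * real (Suc n))) \<le> 1" for n
      using bump_props(3,4) by (intro AE_I2) auto
  qed (rule B1_measurable[OF H], measurable)+
  have e1: "(\<integral>x. indicat_real {..a} x \<partial>F) = (\<integral>x. indicat_real {..a} x \<partial>G)" for a :: real
  proof -
    have "(\<integral>x. bump ((x - a) * real (Suc n)) \<partial>F) = (\<integral>x. bump ((x - a) * real (Suc n)) \<partial>G)" for n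
      by (intro eq bump_affine_Cc2) simp
    then have "(\<lambda>n. \<integral>x. bump ((x - a) * real (Suc n)) \<partial>G) \<longlonglongrightarrow> (\<integral>x. indicat_real {..a} x \<partial>F)"
      using ind[OF F, of a] by (simp only:)
    then show ?thesis using ind[OF G, of a] by (rule LIMSEQ_unique)
  qed
  have mass: "(\<lambda>n. \<integral>x. indicat_real {..real n} x \<partial>H) \<longlonglongrightarrow> (\<integral>x. 1 \<partial>H)" if H: "H \<in> half_line_B1" for H
  proof (rule integral_dominated_convergence[where w="\<lambda>_. 1"])
    show "integrable H (\<lambda>_. 1::real)" by (rule B1_integrable_bounded[OF H, where B=1]) auto
    show "AE x in H. (\<lambda>n. indicator {..real n} x) \<longlonglongrightarrow> (1::real)"
    proof (intro AE_I2)
      fix x :: real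
      obtain N where N: "x \<le> real N" using real_arch_simple by blast
      have "\<forall>\<^sub>F n in sequentially. indicator {..real n} x = (1::real)"
        unfolding eventually_sequentially using N by (intro exI[of _ N]) (auto intro: order_trans)
      then show "(\<lambda>n. indicator {..real n} x) \<longlonglongrightarrow> (1::real)" by (rule tendsto_eventually)
    qed
  qed (auto simp: indicator_def intro: B1_measurable[OF H])
  have e2: "(\<integral>x. 1 \<partial>F) = (\<integral>x. (1::real) \<partial>G)"
    by (rule LIMSEQ_unique[OF mass[OF F, unfolded e1] mass[OF G]])
  \<comment> \<open>Any common bound works, since both measures must be lifted with the same
    constant; the added 1 makes it positive.\<close>
  define C where "C = max (\<integral>x. 1 + x \<partial>F) (\<integral>x. 1 + x \<partial>G) + 1"
  have nn: "0 \<le> (\<integral>x. 1 + x \<partial>F)" using B1_D(2)[OF F] by (intro integral_nonneg_AE AE_I2) auto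
  then have C: "C > 0" by (simp add: C_def)
  have FG: "F \<in> bounded_B1 C" "G \<in> bounded_B1 C" using F G by (auto simp: bounded_B1_def C_def)
  interpret F: finite_measure F by (rule B1_D(3)[OF F])
  interpret G: finite_measure G by (rule B1_D(3)[OF G])
  have m1: "measure F (space F) = measure G (space G)" using e2 by simp
  have m2: "emeasure F ({..a} \<inter> {0..}) = emeasure G ({..a} \<inter> {0..})" for a
  proof -
    have "(\<integral>x. indicat_real {..a} x \<partial>H) = measure H ({..a} \<inter> {0..})" if "H \<in> half_line_B1" for H
      using B1_D(2)[OF that] by simp
    then have "measure F ({..a} \<inter> {0..}) = measure G ({..a} \<inter> {0..})" using e1 F G by metis
    then show ?thesis by (simp add: F.emeasure_eq_measure G.emeasure_eq_measure)
  qed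
  have "cdf (lift C F) = cdf (lift C G)"
    unfolding cdf_def measure_def fun_eq_iff by (simp add: emeasure_lift[OF F] emeasure_lift[OF G] m1 m2)
  then have "lift C F = lift C G"
    by (intro cdf_unique real_distribution_lift FG C)
  then show ?thesis using unlift_lift[OF F C] unlift_lift[OF G C] by metis
qed

section \<open>Tightness and weak limits\<close>

lemma lift_tight:
  assumes F: "\<And>n. Fn n \<in> bounded_B1 C" and C: "C > 0"
  shows "tight (\<lambda>n. lift C (Fn n))"
  unfolding tight_def
proof (intro conjI allI impI)
  show "real_distribution (lift C (Fn n))" for n by (rule real_distribution_lift[OF F C])
  fix \<epsilon> :: real assume e: "\<epsilon> > 0"
  \<comment> \<open>Markov's inequality bounds the lifted mass above \<open>b\<close> by
    \<open>1 / b\<close>, which is half of \<open>\<epsilon>\<close>. The left end -2 below lies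
    beyond the atom at -1.\<close>
  define b where "b = 2 / \<epsilon>"
  have b: "b > 0" using e by (simp add: b_def)
  have "measure (lift C (Fn n)) {-2<..b} > 1 - \<epsilon>" for n
  proof -
    interpret L: real_distribution "lift C (Fn n)" by (rule real_distribution_lift[OF F C])
    note F1 = bounded_B1_D(1)[OF F[of n]]
    have "C * L.prob {b<..} = C * (\<integral>x. indicat_real {b<..} x \<partial>lift C (Fn n))" by simp
    also have "\<dots> = (\<integral>x. indicat_real {b<..} x \<partial>Fn n)"
      by (rule integral_lift[OF F1 C, symmetric]) (use b in auto)
    also have "\<dots> \<le> (\<integral>x. x / b \<partial>Fn n)"
    proof (rule integral_mono_AE)
      show "integrable (Fn n) (indicator {b<..} :: real \<Rightarrow> real)"
        by (rule B1_integrable_bounded[OF F1, where B=1]) (auto simp: indicator_def)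
      show "integrable (Fn n) (\<lambda>x. x / b)" using B1_integrable_id[OF F1] by simp
      show "AE x in Fn n. indicator {b<..} x \<le> x / b"
        using b B1_D(2)[OF F1] by (intro AE_I2) (auto simp: indicator_def)
    qed
    also have "\<dots> = (\<integral>x. x \<partial>Fn n) / b" by simp
    also have "\<dots> \<le> C / b" using bounded_B1_D(4)[OF F[of n]] b by (intro divide_right_mono) auto
    finally have "C * L.prob {b<..} \<le> C * (1 / b)" by simp
    then have p1: "L.prob {b<..} \<le> 1 / b" using C by (rule mult_left_le_imp_le)
    have p2: "L.prob {..-2} = 0"
    proof -
      have "{..-2} \<inter> {0..} = ({}::real set)" by auto
      then have "emeasure (lift C (Fn n)) {..-2} = 0" using emeasure_lift[OF F1, of "{..-2}" C] by simp
      then show ?thesis by (simp add: measure_def)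
    qed
    have "1 = L.prob ({..-2} \<union> {-2<..b} \<union> {b<..})"
    proof -
      have "{..-2} \<union> {-2<..b} \<union> {b<..} = (UNIV::real set)" using b by auto
      then show ?thesis using L.prob_space by simp
    qed
    also have "\<dots> \<le> L.prob {..-2} + L.prob {-2<..b} + L.prob {b<..}"
      by (intro order_trans[OF measure_Un_le] add_mono measure_Un_le order_refl) auto
    also have "\<dots> \<le> L.prob {-2<..b} + \<epsilon> / 2" using p1 p2 by (simp add: b_def)
    finally show ?thesis using e by simp
  qed
  then show "\<exists>a b. a < b \<and> (\<forall>n. 1 - \<epsilon> < measure (lift C (Fn n)) {a<..b})"
    using b by (intro exI[of _ "-2"] exI[of _ b]) auto
qed

text \<open>It has to be shown that a weak limit of lifted measures is again lifted, that is,
  carried by -1 and the half line with a bounded moment. Both facts are tested against bounded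
  continuous functions.\<close>

lemma B1_weak_limit:
  assumes F: "\<And>n. Fn n \<in> bounded_B1 C" and C: "C > 0"
    and M: "real_distribution M" and w: "weak_conv_m (\<lambda>n. lift C (Fn n)) M"
  shows "unlift C M \<in> bounded_B1 C" "lift C (unlift C M) = M"
proof -
  interpret M: real_distribution M by (rule M)
  note rd = real_distribution_lift[OF F C]
  note F1 = bounded_B1_D(1)[OF F]
  note wc = weak_conv_imp_integral_bdd_continuous_conv[OF rd M w]
  \<comment> \<open>\<open>h\<close> is bounded, continuous and vanishes exactly at -1 and on the
    half line, so its integral detects any mass in the gap or further left.\<close>
  define h where "h x = min 1 (max 0 (- x) * \<bar>x + 1\<bar>)" for x :: real
  have h: "0 \<le> h x" "h x \<le> 1" "isCont h x" for x
    unfolding h_def by (auto intro!: continuous_intros)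
  have hm: "h \<in> borel_measurable borel" unfolding h_def by measurable
  have "(\<integral>x. h x \<partial>lift C (Fn n)) = 0" for n
    by (rule integral_eq_zero_AE) (use lift_gap_null[OF F1[of n], of C] in \<open>auto elim!: eventually_mono simp: h_def\<close>)
  then have "(\<lambda>n. 0::real) \<longlonglongrightarrow> (\<integral>x. h x \<partial>M)"
    using wc[of h 1] h by auto
  then have h0: "(\<integral>x. h x \<partial>M) = 0" using LIMSEQ_unique[OF tendsto_const] by metis
  have hi: "integrable M h" by (rule M.integrable_const_bound[where B=1]) (use h hm in auto)
  have "AE x in M. h x = 0"
    using integral_nonneg_eq_0_iff_AE[OF hi] h h0 by auto
  then have null: "AE x in M. x = -1 \<or> 0 \<le> x"
    by eventually_elim (auto simp: h_def min_def max_def split: if_splits)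
  \<comment> \<open>Truncations of \<open>1 + x\<close> that vanish at -1, so that the added atom
    does not contribute to the moment; monotone convergence removes the truncation.\<close>
  define k where "k n x = min (real n) (max 0 (1 + x))" for n and x :: real
  have k: "0 \<le> k n x" "k n x \<le> real n" "isCont (k n) x" for n x
    unfolding k_def by (auto intro!: continuous_intros)
  have km: "k n \<in> borel_measurable borel" for n unfolding k_def by measurable
  have kM: "(\<integral>x. k m x \<partial>M) \<le> 1" for m
  proof (rule LIMSEQ_le_const2)
    show "(\<lambda>n. \<integral>x. k m x \<partial>lift C (Fn n)) \<longlonglongrightarrow> (\<integral>x. k m x \<partial>M)"
      using wc[of "k m" "real m"] k by auto
    have "(\<integral>x. k m x \<partial>lift C (Fn n)) \<le> 1" for n
    proof -
      have "(\<integral>x. k m x \<partial>lift C (Fn n)) = (\<integral>x. indicat_real {0..} x * k m x \<partial>lift C (Fn n))"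
      proof (rule integral_cong_AE)
        have [measurable]: "k m \<in> borel_measurable borel" by (rule km)
        show "k m \<in> borel_measurable (lift C (Fn n))" "(\<lambda>x. indicator {0..} x * k m x) \<in> borel_measurable (lift C (Fn n))"
          by (simp_all add: measurable_cong_sets[OF sets_lift refl])
        show "AE x in lift C (Fn n). k m x = indicator {0..} x * k m x"
          using lift_gap_null[OF F1[of n], of C] by eventually_elim (auto simp: k_def)
      qed
      then have "C * (\<integral>x. k m x \<partial>lift C (Fn n)) = (\<integral>x. indicat_real {0..} x * k m x \<partial>Fn n)"
        using integral_lift[OF F1[of n] C, of "\<lambda>x. indicator {0..} x * k m x"] km by simp
      also have "\<dots> \<le> (\<integral>x. 1 + x \<partial>Fn n)"
        by (rule integral_mono_AE) (use k km B1_D(2,4)[OF F1] in \<open>auto intro!: B1_integrable_bounded[OF F1, where B="real m"] AE_I2 simp: indicator_def k_def\<close>)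
      also have "\<dots> \<le> C * 1" using bounded_B1_D(2)[OF F] by simp
      finally show ?thesis using C by (simp add: mult_le_cancel_left)
    qed
    then show "\<exists>N. \<forall>n\<ge>N. (\<integral>x. k m x \<partial>lift C (Fn n)) \<le> 1" by blast
  qed
  have nn1: "(\<integral>\<^sup>+x. ennreal (max 0 (1 + x)) \<partial>M) \<le> 1"
  proof -
    have "(\<integral>\<^sup>+x. ennreal (max 0 (1 + x)) \<partial>M) = (\<integral>\<^sup>+x. (SUP n. ennreal (k n x)) \<partial>M)"
    proof (intro nn_integral_cong)
      fix x :: real
      obtain N where N: "max 0 (1 + x) \<le> real N" using real_arch_simple by blast
      show "ennreal (max 0 (1 + x)) = (SUP n. ennreal (k n x))"
      proof (rule antisym)
        show "ennreal (max 0 (1 + x)) \<le> (SUP n. ennreal (k n x))"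
          by (rule SUP_upper2[of N]) (use N in \<open>simp_all add: k_def\<close>)
        show "(SUP n. ennreal (k n x)) \<le> ennreal (max 0 (1 + x))"
          by (rule SUP_least, rule ennreal_leI) (simp only: k_def min.cobounded2)
      qed
    qed
    also have "\<dots> = (SUP n. \<integral>\<^sup>+x. ennreal (k n x) \<partial>M)"
    proof (rule nn_integral_monotone_convergence_SUP)
      show "incseq (\<lambda>n x. ennreal (k n x))"
        unfolding incseq_def le_fun_def k_def by (intro allI impI ennreal_leI min.mono) auto
    qed (use km in auto)
    also have "\<dots> \<le> 1"
    proof (rule SUP_least)
      fix n
      have "integrable M (k n)" by (rule M.integrable_const_bound[where B="real n"]) (use k km in auto)
      then have "(\<integral>\<^sup>+x. ennreal (k n x) \<partial>M) = ennreal (\<integral>x. k n x \<partial>M)"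
        by (rule nn_integral_eq_integral) (use k in auto)
      also have "\<dots> \<le> ennreal 1" using kM by (rule ennreal_leI)
      finally show "(\<integral>\<^sup>+x. ennreal (k n x) \<partial>M) \<le> 1" by simp
    qed
    finally show ?thesis .
  qed
  have nn: "(\<integral>\<^sup>+x. ennreal (1 + x) \<partial>unlift C M) \<le> ennreal C"
  proof -
    have "(\<integral>\<^sup>+x. ennreal (1 + x) \<partial>unlift C M) = ennreal C * (\<integral>\<^sup>+x. ennreal (1 + x) * indicator {0..} x \<partial>M)"
      by (rule nn_integral_unlift) auto
    also have "\<dots> \<le> ennreal C * (\<integral>\<^sup>+x. ennreal (max 0 (1 + x)) \<partial>M)"
      by (intro mult_left_mono nn_integral_mono) (auto simp: indicator_def)
    also have "\<dots> \<le> ennreal C * 1" by (intro mult_left_mono nn1) simp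
    finally show ?thesis by simp
  qed
  have sD: "sets (unlift C M) = sets (restrict_space borel {0..})" by (rule sets_unlift) simp
  then have spD: "space (unlift C M) = {0..}" using sets_eq_imp_space_eq[OF sD] by simp
  have mD: "(\<lambda>x. 1 + x) \<in> borel_measurable (unlift C M)"
    by (subst measurable_cong_sets[OF sD refl]) (rule measurable_restrict_space1, measurable)
  have iD: "integrable (unlift C M) (\<lambda>x. 1 + x)"
  proof (rule integrableI_nonneg[OF mD])
    show "AE x in unlift C M. 0 \<le> 1 + x" using spD by (intro AE_I2) auto
    show "(\<integral>\<^sup>+x. ennreal (1 + x) \<partial>unlift C M) < \<infinity>" by (rule le_less_trans[OF nn]) simp
  qed
  have fD: "finite_measure (unlift C M)"
  proof (rule finite_measureI)
    have "emeasure (unlift C M) (space (unlift C M)) = (\<integral>\<^sup>+x. 1 \<partial>unlift C M)" by simp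
    also have "\<dots> \<le> (\<integral>\<^sup>+x. ennreal (1 + x) \<partial>unlift C M)"
      using spD by (intro nn_integral_mono) auto
    finally show "emeasure (unlift C M) (space (unlift C M)) \<noteq> \<infinity>" using nn by (auto simp: top_unique)
  qed
  have DB1: "unlift C M \<in> half_line_B1" using sD fD iD by (simp add: half_line_B1_def)
  have "ennreal (\<integral>x. 1 + x \<partial>unlift C M) \<le> ennreal C"
  proof -
    have "AE x in unlift C M. 0 \<le> 1 + x" using spD by (intro AE_I2) auto
    then show ?thesis using nn nn_integral_eq_integral[OF iD] by simp
  qed
  then show "unlift C M \<in> bounded_B1 C" using DB1 C by (simp add: bounded_B1_def ennreal_le_iff)
  show "lift C (unlift C M) = M" by (rule lift_unlift[OF M null C DB1])
qed

lemma B1_compact: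
  assumes F: "\<And>n. Fn n \<in> bounded_B1 C" and C: "C > 0"
  shows "\<exists>k G. strict_mono (k :: nat \<Rightarrow> nat) \<and> B1_conv C (\<lambda>n. Fn (k n)) G"
proof -
  obtain k M where k: "strict_mono (k :: nat \<Rightarrow> nat)" "real_distribution M" "weak_conv_m ((\<lambda>n. lift C (Fn n)) \<circ> id \<circ> k) M"
    using tight_imp_convergent_subsubsequence[OF lift_tight[of Fn, OF F C] strict_mono_id] by blast
  have w: "weak_conv_m (\<lambda>n. lift C (Fn (k n))) M" using k(3) by (simp add: o_def)
  note G = B1_weak_limit[of "\<lambda>n. Fn (k n)", OF F C k(2) w]
  have "B1_conv C (\<lambda>n. Fn (k n)) (unlift C M)"
    using F G w by (simp add: B1_conv_def)
  then show ?thesis using k(1) by blast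
qed

text \<open>By tightness it is enough to identify the limits of weakly convergent subsequences, and
  these have the test integrals of \<open>G\<close>.\<close>

lemma B1_convI:
  assumes F: "\<And>n. Fn n \<in> bounded_B1 C" and G: "G \<in> bounded_B1 C" and C: "C > 0"
    and lim: "\<And>\<phi>. \<phi> \<in> half_line_Cc2 \<Longrightarrow> (\<lambda>n. \<integral>x. \<phi> x \<partial>Fn n) \<longlonglongrightarrow> (\<integral>x. \<phi> x \<partial>G)"
  shows "B1_conv C Fn G"
proof -
  have "weak_conv_m (\<lambda>n. lift C (Fn n)) (lift C G)"
  proof (rule tight_subseq_weak_converge[OF real_distribution_lift[OF F C] real_distribution_lift[OF G C] lift_tight[of Fn, OF F C]])
    fix s :: "nat \<Rightarrow> nat" and \<nu> assume s: "strict_mono s" and \<nu>: "real_distribution \<nu>"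
      and w: "weak_conv_m ((\<lambda>n. lift C (Fn n)) \<circ> s) \<nu>"
    have w': "weak_conv_m (\<lambda>n. lift C (Fn (s n))) \<nu>" using w by (simp add: o_def)
    note H = B1_weak_limit[of "\<lambda>n. Fn (s n)", OF F C \<nu> w']
    have conv: "B1_conv C (\<lambda>n. Fn (s n)) (unlift C \<nu>)" using F H w' by (simp add: B1_conv_def)
    have "unlift C \<nu> = G"
    proof (rule half_line_B1_eqI[OF bounded_B1_D(1)[OF H(1)] bounded_B1_D(1)[OF G]])
      fix \<phi> assume \<phi>: "\<phi> \<in> half_line_Cc2"
      have "(\<lambda>n. \<integral>x. \<phi> x \<partial>Fn (s n)) \<longlonglongrightarrow> (\<integral>x. \<phi> x \<partial>unlift C \<nu>)"
        by (rule B1_conv_Cb[OF conv C half_line_Cc_Cb[OF half_line_Cc2_Cc[OF \<phi>]]])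
      moreover have "(\<lambda>n. \<integral>x. \<phi> x \<partial>Fn (s n)) \<longlonglongrightarrow> (\<integral>x. \<phi> x \<partial>G)"
        using LIMSEQ_subseq_LIMSEQ[OF lim[OF \<phi>] s] by (simp add: o_def)
      ultimately show "(\<integral>x. \<phi> x \<partial>unlift C \<nu>) = (\<integral>x. \<phi> x \<partial>G)" by (rule LIMSEQ_unique)
    qed
    then have "\<nu> = lift C G" using H(2) by simp
    then show "weak_conv_m ((\<lambda>n. lift C (Fn n)) \<circ> s) (lift C G)" using w by simp
  qed
  then show ?thesis using F G by (simp add: B1_conv_def)
qed

subsection \<open>Limits of the collision terms\<close>

definition measurable3 :: "(real \<Rightarrow> real \<Rightarrow> real \<Rightarrow> real) \<Rightarrow> bool" where
  "measurable3 g \<longleftrightarrow> (\<lambda>(x, y, z). g x y z) \<in> borel_measurable (borel \<Otimes>\<^sub>M borel \<Otimes>\<^sub>M borel)"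

lemma measurable3_compose:
  assumes "measurable3 g" "f1 \<in> borel_measurable N" "f2 \<in> borel_measurable N" "f3 \<in> borel_measurable N"
  shows "(\<lambda>w. g (f1 w) (f2 w) (f3 w)) \<in> borel_measurable N"
  using measurable_compose[OF measurable_Pair[OF assms(2) measurable_Pair[OF assms(3,4)]] assms(1)[unfolded measurable3_def]]
  by simp

lemma measurable3I:
  assumes "(\<lambda>w. g (fst w) (fst (snd w)) (snd (snd w))) \<in> borel_measurable (borel \<Otimes>\<^sub>M borel \<Otimes>\<^sub>M borel)"
  shows "measurable3 g"
  using assms by (simp add: measurable3_def case_prod_beta)

definition integral3 :: "real measure \<Rightarrow> (real \<Rightarrow> real \<Rightarrow> real \<Rightarrow> real) \<Rightarrow> real" where
  "integral3 F g = (\<integral>(x, y, z). g x y z \<partial>(F \<Otimes>\<^sub>M F \<Otimes>\<^sub>M F))"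

lemma B1_id_measurable: "F \<in> half_line_B1 \<Longrightarrow> (\<lambda>x. x) \<in> measurable F borel"
  by (rule B1_measurable) simp_all

lemma B1_coordinates:
  assumes F: "F \<in> half_line_B1" and f: "f \<in> measurable M F"
  shows "f \<in> borel_measurable M"
  using measurable_compose[OF f B1_id_measurable[OF F]] .

lemma B1_measurable3:
  assumes F: "F \<in> half_line_B1" and g: "measurable3 g"
  shows "(\<lambda>(x, y, z). g x y z) \<in> borel_measurable (F \<Otimes>\<^sub>M F \<Otimes>\<^sub>M F)"
    and "(\<lambda>(q, z). g (fst q) (snd q) z) \<in> borel_measurable ((F \<Otimes>\<^sub>M F) \<Otimes>\<^sub>M F)"
    and "(\<lambda>(y, z). g x y z) \<in> borel_measurable (F \<Otimes>\<^sub>M F)"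
    and "g x y \<in> borel_measurable borel"
proof -
  note fs = measurable_compose[OF measurable_snd measurable_fst] measurable_compose[OF measurable_snd measurable_snd]
    measurable_compose[OF measurable_fst measurable_fst] measurable_compose[OF measurable_fst measurable_snd]
  show "(\<lambda>(x, y, z). g x y z) \<in> borel_measurable (F \<Otimes>\<^sub>M F \<Otimes>\<^sub>M F)"
    unfolding case_prod_beta
    by (rule measurable3_compose[OF g B1_coordinates[OF F measurable_fst] B1_coordinates[OF F fs(1)] B1_coordinates[OF F fs(2)]])
  show "(\<lambda>(q, z). g (fst q) (snd q) z) \<in> borel_measurable ((F \<Otimes>\<^sub>M F) \<Otimes>\<^sub>M F)"
    unfolding case_prod_beta
    by (rule measurable3_compose[OF g B1_coordinates[OF F fs(3)] B1_coordinates[OF F fs(4)] B1_coordinates[OF F measurable_snd]])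
  show "(\<lambda>(y, z). g x y z) \<in> borel_measurable (F \<Otimes>\<^sub>M F)"
    unfolding case_prod_beta
    by (rule measurable3_compose[OF g _ B1_coordinates[OF F measurable_fst] B1_coordinates[OF F measurable_snd]]) simp
  show "g x y \<in> borel_measurable borel" by (rule measurable3_compose[OF g]) auto
qed

lemma integral3_bounded:
  assumes F: "F \<in> bounded_B1 C" and g: "measurable3 g" and B: "B \<ge> 0" 
    and b: "\<And>x y z. x \<ge> 0 \<Longrightarrow> y \<ge> 0 \<Longrightarrow> z \<ge> 0 \<Longrightarrow> \<bar>g x y z\<bar> \<le> B"
  shows "integrable (F \<Otimes>\<^sub>M F \<Otimes>\<^sub>M F) (\<lambda>(x, y, z). g x y z)" and "\<bar>integral3 F g\<bar> \<le> B * C ^ 3"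
proof -
  note F1 = bounded_B1_D(1)[OF F]
  interpret F: finite_measure F by (rule B1_D(3)[OF F1])
  interpret FF: finite_measure "F \<Otimes>\<^sub>M F" by (rule finite_measure_pair_measure) unfold_locales
  interpret FFF: finite_measure "F \<Otimes>\<^sub>M F \<Otimes>\<^sub>M F" by (rule finite_measure_pair_measure) unfold_locales
  note m = B1_measurable3(1)[OF F1 g]
  have bd: "norm (case w of (x, y, z) \<Rightarrow> g x y z) \<le> B" if "w \<in> space (F \<Otimes>\<^sub>M F \<Otimes>\<^sub>M F)" for w
    using that b B1_D(2)[OF F1] by (auto simp: space_pair_measure)
  show i: "integrable (F \<Otimes>\<^sub>M F \<Otimes>\<^sub>M F) (\<lambda>(x, y, z). g x y z)"
    by (rule FFF.integrable_const_bound[where B=B]) (use bd m in \<open>auto intro!: AE_I2\<close>)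
  have mass: "measure (F \<Otimes>\<^sub>M F \<Otimes>\<^sub>M F) (space (F \<Otimes>\<^sub>M F \<Otimes>\<^sub>M F)) = measure F (space F) ^ 3"
  proof -
    have "emeasure (F \<Otimes>\<^sub>M F \<Otimes>\<^sub>M F) (space (F \<Otimes>\<^sub>M F \<Otimes>\<^sub>M F)) = emeasure F (space F) * (emeasure F (space F) * emeasure F (space F))"
      by (simp add: space_pair_measure FF.emeasure_pair_measure_Times F.emeasure_pair_measure_Times sets.top)
    then show ?thesis by (simp add: measure_def enn2real_mult power3_eq_cube)
  qed
  have "\<bar>integral3 F g\<bar> \<le> (\<integral>w. B \<partial>(F \<Otimes>\<^sub>M F \<Otimes>\<^sub>M F))"
    unfolding integral3_def real_norm_def[symmetric]
    by (rule Bochner_Integration.integral_norm_bound_integral[OF i]) (use bd in auto)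
  also have "\<dots> = B * measure F (space F) ^ 3" using mass by simp
  also have "\<dots> \<le> B * C ^ 3" using B bounded_B1_D(3)[OF F] by (intro mult_left_mono power_mono) auto
  finally show "\<bar>integral3 F g\<bar> \<le> B * C ^ 3" .
qed

text \<open>The last two variables are exchanged inside the section at fixed \<open>x\<close>. For
  the first two, \<open>z\<close> is integrated out first and Fubini is applied to the resulting
  bounded function of two variables. Together the two exchanges generate all permutations.\<close>

lemma integral3_swap:
  assumes F: "F \<in> bounded_B1 C" and g: "measurable3 g"
    and b: "\<And>x y z. x \<ge> 0 \<Longrightarrow> y \<ge> 0 \<Longrightarrow> z \<ge> 0 \<Longrightarrow> \<bar>g x y z\<bar> \<le> B"
  shows "integral3 F (\<lambda>x y z. g x z y) = integral3 F g" (is ?yz)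
    and "integral3 F (\<lambda>x y z. g y x z) = integral3 F g" (is ?xy)
proof -
  note F1 = bounded_B1_D(1)[OF F]
  have B: "B \<ge> 0" using b[of 0 0 0] by simp
  interpret F: finite_measure F by (rule B1_D(3)[OF F1])
  interpret FF: finite_measure "F \<Otimes>\<^sub>M F" by (rule finite_measure_pair_measure) unfold_locales
  interpret P: pair_sigma_finite F F by (rule B1_pair_sigma_finite[OF F1])
  interpret T: pair_sigma_finite F "F \<Otimes>\<^sub>M F" by standard
  have iter: "integral3 F h = (\<integral>x. (\<integral>(y, z). h x y z \<partial>(F \<Otimes>\<^sub>M F)) \<partial>F)"
    if "measurable3 h" "\<And>x y z. x \<ge> 0 \<Longrightarrow> y \<ge> 0 \<Longrightarrow> z \<ge> 0 \<Longrightarrow> \<bar>h x y z\<bar> \<le> B" for h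
    using T.integral_fst'[OF integral3_bounded(1)[OF F that(1) B that(2)]] by (simp add: integral3_def)
  have sw: "measurable3 (\<lambda>x y z. g x z y)" "measurable3 (\<lambda>x y z. g y x z)"
    by (rule measurable3I, rule measurable3_compose[OF g]; measurable)+
  note sec = B1_measurable3(3)[OF F1 g]
  show ?yz
  proof -
    have "integral3 F (\<lambda>x y z. g x z y) = (\<integral>x. (\<integral>(y, z). g x z y \<partial>(F \<Otimes>\<^sub>M F)) \<partial>F)"
      by (rule iter[OF sw(1)]) (rule b)
    also have "\<dots> = (\<integral>x. (\<integral>(y, z). g x y z \<partial>(F \<Otimes>\<^sub>M F)) \<partial>F)"
      using P.integral_product_swap[OF sec] by simp
    also have "\<dots> = integral3 F g" by (rule iter[OF g, symmetric]) (rule b)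
    finally show ?thesis .
  qed
  have H: "(\<lambda>(x, y). \<integral>z. g x y z \<partial>F) \<in> borel_measurable (F \<Otimes>\<^sub>M F)"
    using F.borel_measurable_lebesgue_integral[OF B1_measurable3(2)[OF F1 g]] by (simp add: case_prod_beta)
  have bH: "\<bar>\<integral>z. g x y z \<partial>F\<bar> \<le> B * measure F (space F)" if "x \<ge> 0" "y \<ge> 0" for x y
  proof -
    note m = B1_measurable3(4)[OF F1 g]
    have "norm (\<integral>z. g x y z \<partial>F) \<le> (\<integral>z. B \<partial>F)"
      by (rule Bochner_Integration.integral_norm_bound_integral)
        (use b that B1_D(2)[OF F1] in \<open>auto intro!: B1_integrable_bounded[OF F1 m]\<close>)
    then show ?thesis by (simp add: mult.commute)
  qed
  have iH: "integrable (F \<Otimes>\<^sub>M F) (\<lambda>(x, y). \<integral>z. g x y z \<partial>F)"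
    by (rule FF.integrable_const_bound[where B="B * measure F (space F)"])
      (use H bH B1_D(2)[OF F1] in \<open>auto intro!: AE_I2 simp: space_pair_measure\<close>)
  have inner: "(\<integral>(y, z). h x y z \<partial>(F \<Otimes>\<^sub>M F)) = (\<integral>y. (\<integral>z. h x y z \<partial>F) \<partial>F)"
    if "x \<ge> 0" and h: "measurable3 h" "\<And>x y z. x \<ge> 0 \<Longrightarrow> y \<ge> 0 \<Longrightarrow> z \<ge> 0 \<Longrightarrow> \<bar>h x y z\<bar> \<le> B" for x h
  proof -
    have "(\<lambda>(y, z). h x y z) \<in> borel_measurable (F \<Otimes>\<^sub>M F)" by (rule B1_measurable3(3)[OF F1 h(1)])
    then have "integrable (F \<Otimes>\<^sub>M F) (\<lambda>(y, z). h x y z)"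
      by (intro FF.integrable_const_bound[where B=B])
        (use h(2) that(1) B1_D(2)[OF F1] in \<open>auto intro!: AE_I2 simp: space_pair_measure\<close>)
    from P.integral_fst'[OF this] show ?thesis by simp
  qed
  have it: "integral3 F h = (\<integral>x. (\<integral>y. (\<integral>z. h x y z \<partial>F) \<partial>F) \<partial>F)"
    if h: "measurable3 h" "\<And>x y z. x \<ge> 0 \<Longrightarrow> y \<ge> 0 \<Longrightarrow> z \<ge> 0 \<Longrightarrow> \<bar>h x y z\<bar> \<le> B" for h
  proof -
    have "integral3 F h = (\<integral>x. (\<integral>(y, z). h x y z \<partial>(F \<Otimes>\<^sub>M F)) \<partial>F)"
      by (rule iter[OF h(1)]) (rule h(2))
    also have "\<dots> = (\<integral>x. (\<integral>y. (\<integral>z. h x y z \<partial>F) \<partial>F) \<partial>F)"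
    proof (intro Bochner_Integration.integral_cong refl)
      fix x assume "x \<in> space F"
      then have "x \<ge> 0" using B1_D(2)[OF F1] by simp
      then show "(\<integral>(y, z). h x y z \<partial>(F \<Otimes>\<^sub>M F)) = (\<integral>y. (\<integral>z. h x y z \<partial>F) \<partial>F)"
        by (rule inner[OF _ h(1)]) (rule h(2))
    qed
    finally show ?thesis .
  qed
  show ?xy
  proof -
    have "integral3 F (\<lambda>x y z. g y x z) = (\<integral>x. (\<integral>y. (\<integral>z. g y x z \<partial>F) \<partial>F) \<partial>F)"
      by (rule it[OF sw(2)]) (rule b)
    also have "\<dots> = (\<integral>x. (\<integral>y. (\<integral>z. g x y z \<partial>F) \<partial>F) \<partial>F)" by (rule P.Fubini_integral[OF iH])
    also have "\<dots> = integral3 F g" by (rule it[OF g, symmetric]) (rule b)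
    finally show ?thesis .
  qed
qed

lemma measurable3_add:
  assumes m: "measurable3 f" "measurable3 g"
  shows "measurable3 (\<lambda>x y z. f x y z + g x y z)"
  by (rule measurable3I, rule borel_measurable_add; rule measurable3_compose[OF m(1)] measurable3_compose[OF m(2)]; measurable)

lemma integral3_add:
  assumes F: "F \<in> bounded_B1 C" and B: "B \<ge> 0" and m: "measurable3 f" "measurable3 g"
    and b: "\<And>x y z. x \<ge> 0 \<Longrightarrow> y \<ge> 0 \<Longrightarrow> z \<ge> 0 \<Longrightarrow> \<bar>f x y z\<bar> \<le> B"
      "\<And>x y z. x \<ge> 0 \<Longrightarrow> y \<ge> 0 \<Longrightarrow> z \<ge> 0 \<Longrightarrow> \<bar>g x y z\<bar> \<le> B"
  shows "integral3 F (\<lambda>x y z. f x y z + g x y z) = integral3 F f + integral3 F g"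
  unfolding integral3_def
  by (subst Bochner_Integration.integral_add[OF integral3_bounded(1)[OF F m(1) B b(1)] integral3_bounded(1)[OF F m(2) B b(2)], symmetric])
    (auto intro!: Bochner_Integration.integral_cong)

context collision
begin

definition Ke0 :: "real \<Rightarrow> real \<Rightarrow> real \<Rightarrow> real \<Rightarrow> real" where
  "Ke0 e x y z = e ^ 3 * (W (Phi p e 1) x y z * (\<phi>0 x + \<phi>0 (x_star x y z) - \<phi>0 y - \<phi>0 z))"

lemma Ke0_eq: "x \<ge> 0 \<Longrightarrow> y \<ge> 0 \<Longrightarrow> z \<ge> 0 \<Longrightarrow> Ke0 e x y z = Ke e x y z"
  by (simp add: Ke0_def Ke_def K_op_def \<phi>0_def x_star_def)

lemma Ke0_measurable3: "measurable3 (Ke0 e)"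
proof (rule measurable3I)
  show "(\<lambda>w. Ke0 e (fst w) (fst (snd w)) (snd (snd w))) \<in> borel_measurable (borel \<Otimes>\<^sub>M borel \<Otimes>\<^sub>M borel)"
    unfolding Ke0_def x_star_def
    by (intro borel_measurable_times borel_measurable_const borel_measurable_diff borel_measurable_add
        W_measurable Phi_measurable p_measurable measurable_compose[OF _ \<phi>0_measurable]) measurable
qed

text \<open>The bad region and its transpose in \<open>y\<close>, \<open>z\<close> are disjoint.
  Permuting variables turns the transposed contribution into \<open>g1 y x z\<close>, so that
  \<open>Ke_cancel\<close> applies pointwise. The constant is 8 from \<open>Ke_small\<close> plus 25
  from \<open>Ke_cancel\<close>.\<close>

lemma Ke_integral:
  assumes F: "F \<in> bounded_B1 M" and e: "e > 0" "e \<le> 1"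
  shows "\<bar>integral3 F (Ke e)\<bar> \<le> 33 * C * BS * M ^ 3 * sqrt (sqrt (sqrt e))"
proof -
  note F1 = bounded_B1_D(1)[OF F]
  define A where "A x y z \<longleftrightarrow> x < e \<and> y < e \<and> e \<le> z" for x y z
  define g1 where "g1 x y z = of_bool (A x y z) * Ke0 e x y z" for x y z
  define g2 where "g2 x y z = of_bool (\<not> A x y z \<and> \<not> A x z y) * Ke0 e x y z" for x y z
  note K = Ke0_measurable3[of e]
  have m: "measurable3 g1" "measurable3 g2"
    by (rule measurable3I, unfold g1_def g2_def A_def, intro borel_measurable_times,
        measurable, rule measurable3_compose[OF K]; measurable)+
  have m': "measurable3 (\<lambda>x y z. g1 x z y)" "measurable3 (\<lambda>x y z. g1 y x z)"
    by (rule measurable3I, rule measurable3_compose[OF m(1)]; measurable)+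
  define B where "B = 8 * C * BS"
  have B: "B \<ge> 0" using C_nonneg BS_nonneg by (simp add: B_def)
  have bK: "\<bar>Ke0 e x y z\<bar> \<le> B" if "x \<ge> 0" "y \<ge> 0" "z \<ge> 0" for x y z
    unfolding Ke0_eq[OF that] B_def by (rule Ke_bound[OF e that])
  have b: "\<bar>g1 x y z\<bar> \<le> B" "\<bar>g2 x y z\<bar> \<le> B" if "x \<ge> 0" "y \<ge> 0" "z \<ge> 0" for x y z
    using bK[OF that] B by (auto simp: g1_def g2_def)
  have B2: "2 * B \<ge> 0" using B by simp
  have b2: "\<bar>u\<bar> \<le> B \<Longrightarrow> \<bar>v\<bar> \<le> B \<Longrightarrow> \<bar>u + v\<bar> \<le> 2 * B" "\<bar>u\<bar> \<le> B \<Longrightarrow> \<bar>u\<bar> \<le> 2 * B" for u v :: real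
    using B by linarith+
  have add1: "integral3 F (\<lambda>x y z. g1 x y z + g1 x z y) = integral3 F g1 + integral3 F (\<lambda>x y z. g1 x z y)"
    by (rule integral3_add[OF F B m(1) m'(1)]) (use b in auto)
  have add2: "integral3 F (\<lambda>x y z. g1 x y z + g1 y x z) = integral3 F g1 + integral3 F (\<lambda>x y z. g1 y x z)"
    by (rule integral3_add[OF F B m(1) m'(2)]) (use b in auto)
  define h where "h x y z = g2 x y z + (g1 x y z + g1 y x z)" for x y z
  \<comment> \<open>The symmetry of the kernel in \<open>y\<close>, \<open>z\<close> identifies its
    restriction to the transposed region with \<open>g1 x z y\<close>.\<close>
  have split: "Ke e x y z = g2 x y z + (g1 x y z + g1 x z y)" if "x \<ge> 0" "y \<ge> 0" "z \<ge> 0" for x y z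
    using Ke_swap[OF that, of e] that by (auto simp: g1_def g2_def A_def Ke0_eq)
  have "integral3 F (Ke e) = integral3 F (\<lambda>x y z. g2 x y z + (g1 x y z + g1 x z y))"
    unfolding integral3_def
    by (intro Bochner_Integration.integral_cong refl) (use split B1_D(2)[OF F1] in \<open>auto simp: space_pair_measure\<close>)
  also have "\<dots> = integral3 F g2 + (integral3 F g1 + integral3 F (\<lambda>x y z. g1 x z y))"
    unfolding add1[symmetric]
    by (rule integral3_add[OF F B2 m(2) measurable3_add[OF m(1) m'(1)]]) (rule b2; rule b; assumption)+
  \<comment> \<open>Both arrangements have the integral of \<open>g1\<close>; only the second one
    pairs \<open>x\<close> with \<open>y\<close>, where the cancellation takes place.\<close>
  also have "integral3 F (\<lambda>x y z. g1 x z y) = integral3 F (\<lambda>x y z. g1 y x z)"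
    using integral3_swap[OF F m(1) b(1)] by simp
  also have "integral3 F g2 + (integral3 F g1 + integral3 F (\<lambda>x y z. g1 y x z)) = integral3 F h"
    unfolding add2[symmetric] h_def
    by (rule integral3_add[OF F B2 m(2) measurable3_add[OF m(1) m'(2)], symmetric]) (rule b2; rule b; assumption)+
  also have "\<bar>\<dots>\<bar> \<le> 33 * C * BS * sqrt (sqrt (sqrt e)) * M ^ 3"
  proof (rule integral3_bounded(2)[OF F])
    show "measurable3 h" unfolding h_def
      by (rule measurable3I, intro borel_measurable_add; rule measurable3_compose[OF m(1)] measurable3_compose[OF m(2)]; measurable)
    fix x y z :: real assume nn: "x \<ge> 0" "y \<ge> 0" "z \<ge> 0"
    have s: "sqrt (sqrt e) \<le> sqrt (sqrt (sqrt e))"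
    proof -
      have "t \<le> sqrt t" if "0 \<le> t" "t \<le> 1" for t :: real
        by (rule real_le_rsqrt) (use mult_left_mono[OF that(2,1)] in \<open>simp add: power2_eq_square\<close>)
      then show ?thesis using e by (intro real_sqrt_le_mono) auto
    qed
    have "\<bar>g2 x y z\<bar> \<le> 8 * C * BS * sqrt (sqrt e)"
      using Ke_small[OF e nn] e C_nonneg BS_nonneg by (auto simp: g2_def A_def Ke0_eq[OF nn])
    also have "\<dots> \<le> 8 * C * BS * sqrt (sqrt (sqrt e))"
      using s C_nonneg BS_nonneg by (intro mult_left_mono) auto
    finally have 1: "\<bar>g2 x y z\<bar> \<le> 8 * C * BS * sqrt (sqrt (sqrt e))" .
    have 2: "\<bar>g1 x y z + g1 y x z\<bar> \<le> 25 * C * BS * sqrt (sqrt (sqrt e))"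
      using Ke_cancel[OF e nn(1) _ nn(2), of z] e C_nonneg BS_nonneg nn
      by (auto simp: g1_def A_def Ke0_eq)
    show "\<bar>h x y z\<bar> \<le> 33 * C * BS * sqrt (sqrt (sqrt e))"
      using 1 2 abs_triangle_ineq[of "g2 x y z" "g1 x y z + g1 y x z"] by (simp add: h_def)
  qed (use C_nonneg BS_nonneg e in auto)
  finally show ?thesis by (simp add: mult_ac)
qed

end

section \<open>The quadratic term along convergent measures\<close>

lemma B1_pair_max0:
  assumes "F \<in> half_line_B1"
  shows "(\<integral>(y, z). g y z \<partial>(F \<Otimes>\<^sub>M F)) = (\<integral>q. case_prod (\<lambda>y z. g (max 0 y) (max 0 z)) q \<partial>(F \<Otimes>\<^sub>M F))"
  by (intro Bochner_Integration.integral_cong refl) (use B1_D(2)[OF assms] in \<open>auto simp: space_pair_measure\<close>)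

context collision
begin

text \<open>Only nonnegative arguments matter; the truncation makes the functions measurable on the whole plane.\<close>

definition J0 :: "real \<Rightarrow> real \<Rightarrow> real \<Rightarrow> real" where
  "J0 e y z = J_op p e 1 \<phi> (max 0 y) (max 0 z)"

definition L0 :: "real \<Rightarrow> real \<Rightarrow> real" where
  "L0 y z = L_op \<phi> (max 0 y) (max 0 z)"

lemma J0_measurable: "case_prod (J0 e) \<in> borel_measurable (borel \<Otimes>\<^sub>M borel)"
proof -
  have eq: "J0 e y z = 1 / 2 * (\<integral>x. indicator {0..} x * indicator {..max 0 y + max 0 z} x *
      (W (Phi p e 1) x (max 0 y) (max 0 z) * (\<phi>0 x + \<phi>0 (x_star x (max 0 y) (max 0 z)) - \<phi>0 y - \<phi>0 z) * sqrt x) \<partial>lborel)" for y z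
    unfolding J0_def J_op_def set_lebesgue_integral_def K_op_def
    by (intro arg_cong[where f="\<lambda>v. 1 / 2 * v"] Bochner_Integration.integral_cong refl)
      (auto simp: indicator_def \<phi>0_def x_star_def)
  have [measurable]: "(\<lambda>w. W (Phi p e 1) (f1 w) (f2 w) (f3 w)) \<in> borel_measurable M"
    if "f1 \<in> borel_measurable M" "f2 \<in> borel_measurable M" "f3 \<in> borel_measurable M" for f1 f2 f3 and M :: "'c measure"
    by (rule W_measurable[OF Phi_measurable[OF p_measurable] that])
  show ?thesis
    unfolding eq[abs_def] case_prod_beta x_star_def indicator_def atLeast_iff atMost_iff
    by measurable
qed

lemma L0_limit: "(\<lambda>n. J0 (inverse (real (Suc n))) y z) \<longlonglongrightarrow> L0 y z"
  unfolding J0_def L0_def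
  by (rule J_op_tendsto) (use LIMSEQ_inverse_real_of_nat in auto)

text \<open>\<open>L\<close> inherits measurability, and in \<open>L0_bound\<close> also the growth
  bound, as a pointwise limit of \<open>J\<close> along \<open>1 / (n + 1)\<close>; its formula with
  derivatives is not unfolded.\<close>

lemma L0_measurable: "case_prod L0 \<in> borel_measurable (borel \<Otimes>\<^sub>M borel)"
  by (rule borel_measurable_LIMSEQ_real[OF _ J0_measurable]) (auto intro: L0_limit)

lemma J0_bound: "e > 0 \<Longrightarrow> y \<ge> 0 \<Longrightarrow> z \<ge> 0 \<Longrightarrow> \<bar>J0 e y z\<bar> \<le> 256 * pi * C * sqrt (max y z)"
  using J_op_bound[of y z e] by (simp add: J0_def)

lemma L0_bound: "y \<ge> 0 \<Longrightarrow> z \<ge> 0 \<Longrightarrow> \<bar>L0 y z\<bar> \<le> 256 * pi * C * sqrt (max y z)"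
  by (rule LIMSEQ_le_const2[OF tendsto_rabs[OF L0_limit]]) (use J0_bound in auto)

text \<open>A continuously convergent family has a continuous limit: for each \<open>n\<close> a
  parameter \<open>en n\<close> is chosen so small that \<open>J0\<close> nearly equals
  \<open>L0\<close> at the \<open>n\<close>-th point, and \<open>J_op_tendsto\<close> is applied
  along this choice.\<close>

lemma L0_tendsto:
  assumes l: "yn \<longlonglongrightarrow> y" "zn \<longlonglongrightarrow> z" and nn: "\<And>n. yn n \<ge> 0" "\<And>n. zn n \<ge> 0"
  shows "(\<lambda>n. L0 (yn n) (zn n)) \<longlonglongrightarrow> L0 y z"
proof -
  define \<delta> where "\<delta> n = inverse (real (Suc n))" for n
  have \<delta>: "\<And>n. \<delta> n > 0" "\<delta> \<longlonglongrightarrow> 0" unfolding \<delta>_def by (simp, rule LIMSEQ_inverse_real_of_nat)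
  have "\<exists>e. 0 < e \<and> e \<le> \<delta> n \<and> \<bar>J0 e (yn n) (zn n) - L0 (yn n) (zn n)\<bar> < \<delta> n" for n
  proof -
    have "\<forall>\<^sub>F m in sequentially. \<bar>J0 (\<delta> m) (yn n) (zn n) - L0 (yn n) (zn n)\<bar> < \<delta> n"
      using tendstoD[OF L0_limit \<delta>(1)[of n]] by (simp add: dist_real_def \<delta>_def)
    then obtain N where N: "\<And>m. m \<ge> N \<Longrightarrow> \<bar>J0 (\<delta> m) (yn n) (zn n) - L0 (yn n) (zn n)\<bar> < \<delta> n"
      by (auto simp: eventually_sequentially)
    have "\<delta> (max N n) \<le> \<delta> n" unfolding \<delta>_def by (intro le_imp_inverse_le) auto
    then show ?thesis using N[of "max N n"] \<delta>(1) by (intro exI[of _ "\<delta> (max N n)"]) auto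
  qed
  then obtain en where en: "\<And>n. 0 < en n" "\<And>n. en n \<le> \<delta> n"
    "\<And>n. \<bar>J0 (en n) (yn n) (zn n) - L0 (yn n) (zn n)\<bar> < \<delta> n" by metis
  have e0: "en \<longlonglongrightarrow> 0"
    by (rule tendsto_sandwich[OF _ _ tendsto_const \<delta>(2)]) (use en in \<open>auto intro!: always_eventually less_imp_le\<close>)
  have yz: "y \<ge> 0" "z \<ge> 0" using l nn by (auto intro: LIMSEQ_le_const)
  have "(\<lambda>n. J_op p (en n) 1 \<phi> (yn n) (zn n)) \<longlonglongrightarrow> L_op \<phi> y z"
    by (rule J_op_tendsto[OF l e0 en(1) nn])
  then have J: "(\<lambda>n. J0 (en n) (yn n) (zn n)) \<longlonglongrightarrow> L0 y z" using nn yz by (simp add: J0_def L0_def max_absorb2)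
  have "(\<lambda>n. J0 (en n) (yn n) (zn n) - L0 (yn n) (zn n)) \<longlonglongrightarrow> 0"
    by (rule Lim_null_comparison[OF _ \<delta>(2)]) (use en(3) in \<open>auto intro!: always_eventually less_imp_le\<close>)
  from tendsto_diff[OF J this] show ?thesis by simp
qed

lemma J_integral_bound:
  assumes F: "F \<in> bounded_B1 M" and e: "e > 0"
  shows "\<bar>\<integral>(y, z). J_op p e 1 \<phi> y z \<partial>(F \<Otimes>\<^sub>M F)\<bar> \<le> 256 * pi * C * (M * M)"
  unfolding B1_pair_max0[OF bounded_B1_D(1)[OF F], of "J_op p e 1 \<phi>"] J0_def[symmetric]
proof (rule growth_integrable(2)[OF F J0_measurable])
  fix y z :: real assume yz: "y \<ge> 0" "z \<ge> 0"
  show "\<bar>J0 e y z\<bar> \<le> 256 * pi * C * ((1 + y) * (1 + z))"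
    by (rule order_trans[OF J0_bound[OF e yz] mult_left_mono[OF sqrt_max_le(1)[OF yz]]]) (use C_nonneg in auto)
qed (use C_nonneg in auto)

lemma L_integral_bound:
  assumes F: "F \<in> bounded_B1 M" and B: "B \<ge> 0" "\<And>y z. y \<ge> 0 \<Longrightarrow> z \<ge> 0 \<Longrightarrow> \<bar>L_op \<phi> y z\<bar> \<le> B"
  shows "\<bar>\<integral>(y, z). L_op \<phi> y z \<partial>(F \<Otimes>\<^sub>M F)\<bar> \<le> B * (M * M)"
  unfolding B1_pair_max0[OF bounded_B1_D(1)[OF F], of "L_op \<phi>"] L0_def[symmetric]
proof (rule growth_integrable(2)[OF F L0_measurable _ B(1)])
  fix y z :: real assume yz: "y \<ge> 0" "z \<ge> 0"
  have "1 \<le> (1 + y) * (1 + z)" using mult_mono[of 1 "1 + y" 1 "1 + z"] yz by simp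
  then have "B * 1 \<le> B * ((1 + y) * (1 + z))" using B(1) by (rule mult_left_mono)
  then show "\<bar>L0 y z\<bar> \<le> B * ((1 + y) * (1 + z))" using B(2)[OF yz] yz by (simp add: L0_def)
qed

lemma J_integral_tendsto:
  assumes conv: "B1_conv M Fn F" and M: "M > 0" and e: "\<And>n. en n > 0" "en \<longlonglongrightarrow> 0"
  shows "(\<lambda>n. \<integral>(y, z). J_op p (en n) 1 \<phi> y z \<partial>(Fn n \<Otimes>\<^sub>M Fn n)) \<longlonglongrightarrow> (\<integral>(y, z). L_op \<phi> y z \<partial>(F \<Otimes>\<^sub>M F))"
proof -
  have F: "\<And>n. Fn n \<in> half_line_B1" "F \<in> half_line_B1" using conv bounded_B1_D(1) by (auto simp: B1_conv_def)
  show ?thesis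
    unfolding B1_pair_max0[OF F(1), of _ "J_op p (en n) 1 \<phi>" for n] B1_pair_max0[OF F(2), of "L_op \<phi>"] J0_def[symmetric] L0_def[symmetric]
  proof (rule B1_conv_double_integral[OF conv M _ J0_measurable L0_measurable])
    fix xn yn :: "nat \<Rightarrow> real" and x y
    assume x: "\<And>n. xn n \<ge> 0" "\<And>n. yn n \<ge> 0" "xn \<longlonglongrightarrow> x" "yn \<longlonglongrightarrow> y"
    have "x \<ge> 0" "y \<ge> 0" using x by (auto intro: LIMSEQ_le_const)
    then show "(\<lambda>n. J0 (en n) (xn n) (yn n)) \<longlonglongrightarrow> L0 x y"
      using J_op_tendsto[OF x(3,4) e(2,1) x(1,2)] x by (simp add: J0_def L0_def max_absorb2)
  next
    show "0 \<le> 256 * pi * C" using C_nonneg by simp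
  qed (use J0_bound[OF e(1)] L0_bound in auto)
qed

lemma L_integral_tendsto:
  assumes conv: "B1_conv M Fn F" and M: "M > 0"
  shows "(\<lambda>n. \<integral>(y, z). L_op \<phi> y z \<partial>(Fn n \<Otimes>\<^sub>M Fn n)) \<longlonglongrightarrow> (\<integral>(y, z). L_op \<phi> y z \<partial>(F \<Otimes>\<^sub>M F))"
proof -
  have F: "\<And>n. Fn n \<in> half_line_B1" "F \<in> half_line_B1" using conv bounded_B1_D(1) by (auto simp: B1_conv_def)
  show ?thesis
    unfolding B1_pair_max0[OF F(1), of _ "L_op \<phi>"] B1_pair_max0[OF F(2), of "L_op \<phi>"] L0_def[symmetric]
  proof (rule B1_conv_double_integral[OF conv M _ L0_measurable L0_measurable])
    show "0 \<le> 256 * pi * C" using C_nonneg by simp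
  qed (use L0_bound L0_tendsto in auto)
qed

end

section \<open>The truncated energy as a test function\<close>

definition energy_cut :: "real \<Rightarrow> real \<Rightarrow> real" where
  "energy_cut R x = x * bump (x / R - 1)"

text \<open>For \<open>t \<le> 1\<close> both truncated variables lie between 0 and 1, so the
  coefficients decide: 9 for the first derivative and 54 + 18 for the second. Beyond 1 both
  derivatives vanish.\<close>

lemma bump_derivative_bounds: "\<bar>bump1 t\<bar> \<le> 9" "\<bar>bump2 t\<bar> \<le> 72"
proof -
  define u where "u = max 0 t"
  define v where "v = max 0 (1 - u ^ 3)"
  have v: "0 \<le> v" "v \<le> 1" by (auto simp: v_def u_def)
  have e: "bump1 t = - (9 * (v\<^sup>2 * u\<^sup>2))" "bump2 t = 54 * (v * (u\<^sup>2 * u\<^sup>2)) - 18 * (v\<^sup>2 * u)"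
    by (simp_all add: bump1_def bump2_def u_def v_def)
  have "\<bar>bump1 t\<bar> \<le> 9 \<and> \<bar>bump2 t\<bar> \<le> 72"
  proof (cases "t \<le> 1")
    case True
    then have u: "0 \<le> u" "u \<le> 1" by (auto simp: u_def)
    have "v\<^sup>2 * u\<^sup>2 \<le> 1 * 1" "v * (u\<^sup>2 * u\<^sup>2) \<le> 1 * (1 * 1)" "v\<^sup>2 * u \<le> 1 * 1"
      using u v by (intro mult_mono power_le_one; simp)+
    moreover have "0 \<le> v\<^sup>2 * u\<^sup>2" "0 \<le> v * (u\<^sup>2 * u\<^sup>2)" "0 \<le> v\<^sup>2 * u" using u v by auto
    ultimately show ?thesis unfolding e by linarith
  qed (use bump_props(6,8)[of t] in auto)
  then show "\<bar>bump1 t\<bar> \<le> 9" "\<bar>bump2 t\<bar> \<le> 72" by auto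
qed

lemma energy_cut_Cc2:
  assumes R: "R > 0"
  shows "energy_cut R \<in> half_line_Cc2"
    and "x \<ge> 0 \<Longrightarrow> half_line_deriv (energy_cut R) x = bump (x / R - 1) + x / R * bump1 (x / R - 1)"
    and "x \<ge> 0 \<Longrightarrow> half_line_deriv (half_line_deriv (energy_cut R)) x = (2 * bump1 (x / R - 1) + x / R * bump2 (x / R - 1)) / R"
proof -
  have lin: "((\<lambda>x. x / R - 1) has_real_derivative 1 / R) (at x)" for x
    using R by (auto intro!: derivative_eq_intros simp: inverse_eq_divide)
  have lin0: "((\<lambda>x. x / R) has_real_derivative 1 / R) (at x)" for x
    using DERIV_cdivide[OF DERIV_ident] .
  note b = DERIV_chain2[OF bump_deriv lin] DERIV_chain2[OF bump1_deriv lin]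
  have d1: "(energy_cut R has_real_derivative bump (x / R - 1) + x / R * bump1 (x / R - 1)) (at x)" for x
    unfolding energy_cut_def[abs_def] by (rule derivative_eq_intros b refl)+ simp
  have d2: "((\<lambda>x. bump (x / R - 1) + x / R * bump1 (x / R - 1)) has_real_derivative (2 * bump1 (x / R - 1) + x / R * bump2 (x / R - 1)) / R) (at x)" for x
    by (rule DERIV_cong[OF DERIV_add[OF b(1) DERIV_mult[OF lin0 b(2)]]]) (simp add: add_divide_distrib)
  have c: "continuous_on UNIV (\<lambda>x. (2 * bump1 (x / R - 1) + x / R * bump2 (x / R - 1)) / R)"
    unfolding bump1_def bump2_def by (intro continuous_intros) (use R in auto)
  have z: "energy_cut R x = 0" if "x \<ge> 2 * R" for x
  proof -
    have "1 \<le> x / R - 1" using R that by (simp add: pos_le_divide_eq)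
    then show ?thesis by (simp add: energy_cut_def bump_props(2))
  qed
  show "energy_cut R \<in> half_line_Cc2" by (rule half_line_Cc2I(1)[OF d1 d2 c z])
  show "x \<ge> 0 \<Longrightarrow> half_line_deriv (energy_cut R) x = bump (x / R - 1) + x / R * bump1 (x / R - 1)"
    by (rule half_line_Cc2I(2)[OF d1 d2 c z])
  show "x \<ge> 0 \<Longrightarrow> half_line_deriv (half_line_deriv (energy_cut R)) x = (2 * bump1 (x / R - 1) + x / R * bump2 (x / R - 1)) / R"
    by (rule half_line_Cc2I(3)[OF d1 d2 c z])
qed

text \<open>Below \<open>R\<close> the truncation is linear, and \<open>L\<close> annihilates it.
  Otherwise the prefactor of \<open>L\<close> is at most \<open>4 * pi / sqrt R\<close>, while the
  first derivative and \<open>x\<close> times the second are bounded independently of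
  \<open>R\<close> by scaling; the bracket is at most 432 + 38 = 470.\<close>

lemma L_energy_cut:
  assumes R: "R > 0" and y: "y \<ge> 0" and z: "z \<ge> 0"
  shows "\<bar>L_op (energy_cut R) y z\<bar> \<le> 1880 * pi / sqrt R"
proof (cases "max y z \<le> R")
  case True
  then have k: "y / R - 1 \<le> 0" "z / R - 1 \<le> 0" using R by (auto simp: pos_divide_le_eq)
  have "L_op (energy_cut R) y z = 0"
    using k by (simp add: L_op_def energy_cut_Cc2(2,3)[OF R] y z bump_props)
  then show ?thesis using R by simp
next
  case False
  then have mx: "max y z > R" "max y z > 0" using R by auto
  have d1: "\<bar>half_line_deriv (energy_cut R) x\<bar> \<le> 19"
    and d2: "\<bar>half_line_deriv (half_line_deriv (energy_cut R)) x\<bar> * x \<le> 324" if x: "x \<ge> 0" for x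
  proof -
    define t where "t = x / R - 1"
    have s: "x / R = t + 1" "0 \<le> t + 1" using x R by (auto simp: t_def)
    have b: "\<bar>bump t\<bar> \<le> 1" using bump_props(3,4) by simp
    have "\<bar>(t + 1) * bump1 t\<bar> \<le> 18 \<and> \<bar>2 * bump1 t + (t + 1) * bump2 t\<bar> * (t + 1) \<le> 324"
    proof (cases "t \<le> 1")
      case True
      have "\<bar>t + 1\<bar> * \<bar>bump1 t\<bar> \<le> 2 * 9" "\<bar>t + 1\<bar> * \<bar>bump2 t\<bar> \<le> 2 * 72"
        using True s bump_derivative_bounds by (intro mult_mono; simp)+
      moreover from this have "\<bar>2 * bump1 t + (t + 1) * bump2 t\<bar> \<le> 162"
        using abs_triangle_ineq[of "2 * bump1 t" "(t + 1) * bump2 t"] bump_derivative_bounds(1)[of t] by (simp add: abs_mult)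
      then have "\<bar>2 * bump1 t + (t + 1) * bump2 t\<bar> * (t + 1) \<le> 162 * 2" using True s by (intro mult_mono) auto
      ultimately show ?thesis by (simp add: abs_mult)
    qed (use bump_props(6,8)[of t] in auto)
    then have 1: "\<bar>(t + 1) * bump1 t\<bar> \<le> 18" and 2: "\<bar>2 * bump1 t + (t + 1) * bump2 t\<bar> * (t + 1) \<le> 324" by auto
    show "\<bar>half_line_deriv (energy_cut R) x\<bar> \<le> 19"
      unfolding energy_cut_Cc2(2)[OF R x] s(1) add_diff_cancel_right'
      using abs_triangle_ineq[of "bump t" "(t + 1) * bump1 t"] b 1 by linarith
    have "\<bar>half_line_deriv (half_line_deriv (energy_cut R)) x\<bar> * x = \<bar>2 * bump1 t + (t + 1) * bump2 t\<bar> * (t + 1)"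
      unfolding energy_cut_Cc2(3)[OF R x] s(1) add_diff_cancel_right' using R unfolding s(1)[symmetric] by (simp add: abs_divide)
    then show "\<bar>half_line_deriv (half_line_deriv (energy_cut R)) x\<bar> * x \<le> 324" using 2 by simp
  qed
  define D1 where "D1 = half_line_deriv (energy_cut R)"
  define D2 where "D2 = half_line_deriv D1"
  have "\<bar>D2 y\<bar> * min y z \<le> \<bar>D2 y\<bar> * y" "\<bar>D2 z\<bar> * min y z \<le> \<bar>D2 z\<bar> * z" by (intro mult_left_mono; simp)+
  then have "\<bar>D2 y\<bar> * min y z \<le> 324" "\<bar>D2 z\<bar> * min y z \<le> 324"
    using d2[OF y] d2[OF z] by (auto simp: D1_def D2_def)
  moreover have "\<bar>(D2 y + D2 z) * min y z\<bar> \<le> \<bar>D2 y\<bar> * min y z + \<bar>D2 z\<bar> * min y z"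
    using abs_triangle_ineq[of "D2 y * min y z" "D2 z * min y z"] y z by (simp add: abs_mult distrib_right)
  ultimately have "\<bar>(D2 y + D2 z) * min y z\<bar> \<le> 648" by linarith
  then have A: "\<bar>2 / 3 * (D2 y + D2 z) * min y z\<bar> \<le> 432" unfolding mult.assoc abs_mult[of "2/3"] by simp
  have B: "\<bar>(D1 y - D1 z) * sgn (y - z)\<bar> \<le> 38"
  proof -
    have "\<bar>D1 y - D1 z\<bar> * \<bar>sgn (y - z)\<bar> \<le> 38 * 1"
      using d1[OF y] d1[OF z] by (intro mult_mono) (auto simp: D1_def sgn_if)
    then show ?thesis by (simp add: abs_mult)
  qed
  have "\<bar>L_op (energy_cut R) y z\<bar> = 4 * pi / sqrt (max y z) * \<bar>2 / 3 * (D2 y + D2 z) * min y z - (D1 y - D1 z) * sgn (y - z)\<bar>"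
  proof -
    have "\<not> (y = 0 \<and> z = 0)" using mx(2) by auto
    then show ?thesis using y z by (simp add: L_op_def D1_def D2_def abs_mult)
  qed
  also have "\<dots> \<le> 4 * pi / sqrt R * 470"
  proof (intro mult_mono divide_left_mono)
    show "\<bar>2 / 3 * (D2 y + D2 z) * min y z - (D1 y - D1 z) * sgn (y - z)\<bar> \<le> 470" using A B by linarith
  qed (use mx R in auto)
  finally show ?thesis by simp
qed

subsection \<open>Compactness of solutions\<close>

lemma at_within_half_line: "x < b \<Longrightarrow> at (x::real) within {0..} = at x within {0..b}"
  by (rule at_within_nhd[of _ "{..<b}"]) auto

text \<open>Supplies a countable dense set of times for the diagonal argument, enumerated by pairs;
  the denominator \<open>Suc b\<close> avoids division by 0.\<close>

lemma uniform_grid_dense: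
  fixes t \<delta> :: real
  assumes "t \<ge> 0" "\<delta> > 0"
  shows "\<exists>n. \<bar>(case prod_decode n of (a, b) \<Rightarrow> real a / real (Suc b)) - t\<bar> < \<delta>"
proof -
  obtain b where b: "inverse (real (Suc b)) < \<delta>" using reals_Archimedean assms(2) by blast
  define a where "a = nat \<lfloor>t * real (Suc b)\<rfloor>"
  have "real a = of_int \<lfloor>t * real (Suc b)\<rfloor>" using assms by (simp add: a_def)
  then have a: "real a \<le> t * real (Suc b)" "t * real (Suc b) < real a + 1" by linarith+
  have p: "real (Suc b) > 0" by simp
  have "real a / real (Suc b) \<le> t" using a(1) p by (simp only: pos_divide_le_eq)
  moreover have "t < real a / real (Suc b) + inverse (real (Suc b))"
    using a(2) p by (simp only: pos_less_divide_eq inverse_eq_divide add_divide_distrib[symmetric])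
  ultimately have "\<bar>real a / real (Suc b) - t\<bar> < \<delta>" using b by linarith
  then show ?thesis by (intro exI[of _ "prod_encode (a, b)"]) simp
qed

definition BE_rate :: "(real \<Rightarrow> real) \<Rightarrow> real \<Rightarrow> (real \<Rightarrow> real) \<Rightarrow> real measure \<Rightarrow> real" where
  "BE_rate p e \<phi> F = (\<integral>(y, z). J_op p e 1 \<phi> y z \<partial>(F \<Otimes>\<^sub>M F)) +
     e ^ 3 * (\<integral>(x, y, z). K_op p e 1 \<phi> x y z \<partial>(F \<Otimes>\<^sub>M F \<Otimes>\<^sub>M F))"

definition FPL_rate :: "(real \<Rightarrow> real) \<Rightarrow> real measure \<Rightarrow> real" where
  "FPL_rate \<phi> F = (\<integral>(y, z). L_op \<phi> y z \<partial>(F \<Otimes>\<^sub>M F))"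

context profile
begin

lemma collision:
  assumes "\<phi> \<in> half_line_Cc2"
  obtains C where "collision p c0 c1 \<phi> (half_line_deriv \<phi>) (half_line_deriv (half_line_deriv \<phi>)) C"
  using half_line_Cc2_test_function[OF assms] profile_axioms by (metis collision.intro)

lemma cubic_rate_bound:
  assumes "\<phi> \<in> half_line_Cc2"
  obtains B where "B \<ge> 0" "\<And>e M F. 0 < e \<Longrightarrow> e \<le> 1 \<Longrightarrow> F \<in> bounded_B1 M \<Longrightarrow>
    \<bar>e ^ 3 * (\<integral>(x, y, z). K_op p e 1 \<phi> x y z \<partial>(F \<Otimes>\<^sub>M F \<Otimes>\<^sub>M F))\<bar> \<le> B * M ^ 3 * sqrt (sqrt (sqrt e))"
proof -
  obtain C where "collision p c0 c1 \<phi> (half_line_deriv \<phi>) (half_line_deriv (half_line_deriv \<phi>)) C"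
    using collision[OF assms] .
  then interpret collision p c0 c1 \<phi> "half_line_deriv \<phi>" "half_line_deriv (half_line_deriv \<phi>)" C .
  have eq: "e ^ 3 * (\<integral>(x, y, z). K_op p e 1 \<phi> x y z \<partial>(F \<Otimes>\<^sub>M F \<Otimes>\<^sub>M F)) = integral3 F (Ke e)" for e F
    unfolding integral3_def Ke_def case_prod_beta by (rule integral_mult_right_zero[symmetric])
  show ?thesis
    by (rule that[of "33 * C * BS"]) (use C_nonneg BS_nonneg Ke_integral in \<open>simp_all add: eq\<close>)
qed

lemma BE_rate_bound:
  assumes "\<phi> \<in> half_line_Cc2" and M: "M > 0"
  obtains B where "B \<ge> 0" "\<And>e F. 0 < e \<Longrightarrow> e \<le> 1 \<Longrightarrow> F \<in> bounded_B1 M \<Longrightarrow> \<bar>BE_rate p e \<phi> F\<bar> \<le> B"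
proof -
  obtain C where "collision p c0 c1 \<phi> (half_line_deriv \<phi>) (half_line_deriv (half_line_deriv \<phi>)) C"
    using collision[OF assms(1)] .
  then interpret collision p c0 c1 \<phi> "half_line_deriv \<phi>" "half_line_deriv (half_line_deriv \<phi>)" C .
  obtain B where B: "B \<ge> 0" "\<And>e M F. 0 < e \<Longrightarrow> e \<le> 1 \<Longrightarrow> F \<in> bounded_B1 M \<Longrightarrow>
    \<bar>e ^ 3 * (\<integral>(x, y, z). K_op p e 1 \<phi> x y z \<partial>(F \<Otimes>\<^sub>M F \<Otimes>\<^sub>M F))\<bar> \<le> B * M ^ 3 * sqrt (sqrt (sqrt e))"
    using cubic_rate_bound[OF assms(1)] by blast
  show ?thesis
  proof (rule that[of "256 * pi * C * (M * M) + B * M ^ 3 * 1"])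
    fix e :: real and F assume e: "0 < e" "e \<le> 1" and F: "F \<in> bounded_B1 M"
    have "B * M ^ 3 * sqrt (sqrt (sqrt e)) \<le> B * M ^ 3 * 1"
      using e B(1) M by (intro mult_left_mono) auto
    then show "\<bar>BE_rate p e \<phi> F\<bar> \<le> 256 * pi * C * (M * M) + B * M ^ 3 * 1"
      unfolding BE_rate_def using J_integral_bound[OF F e(1)] B(2)[OF e F] by linarith
  qed (use B(1) C_nonneg M in auto)
qed

lemma BE_rate_tendsto:
  assumes \<phi>: "\<phi> \<in> half_line_Cc2" and conv: "B1_conv M Fn F" and M: "M > 0"
    and e: "\<And>n. en n > 0" "\<And>n. en n \<le> 1" "en \<longlonglongrightarrow> 0"
  shows "(\<lambda>n. \<integral>(y, z). J_op p (en n) 1 \<phi> y z \<partial>(Fn n \<Otimes>\<^sub>M Fn n)) \<longlonglongrightarrow> FPL_rate \<phi> F"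
    and "(\<lambda>n. BE_rate p (en n) \<phi> (Fn n)) \<longlonglongrightarrow> FPL_rate \<phi> F"
proof -
  obtain C where "collision p c0 c1 \<phi> (half_line_deriv \<phi>) (half_line_deriv (half_line_deriv \<phi>)) C"
    using collision[OF \<phi>] .
  then interpret collision p c0 c1 \<phi> "half_line_deriv \<phi>" "half_line_deriv (half_line_deriv \<phi>)" C .
  obtain B where B: "B \<ge> 0" "\<And>e M F. 0 < e \<Longrightarrow> e \<le> 1 \<Longrightarrow> F \<in> bounded_B1 M \<Longrightarrow>
    \<bar>e ^ 3 * (\<integral>(x, y, z). K_op p e 1 \<phi> x y z \<partial>(F \<Otimes>\<^sub>M F \<Otimes>\<^sub>M F))\<bar> \<le> B * M ^ 3 * sqrt (sqrt (sqrt e))"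
    using cubic_rate_bound[OF \<phi>] by blast
  have F: "\<And>n. Fn n \<in> bounded_B1 M" using conv by (simp add: B1_conv_def)
  show J: "(\<lambda>n. \<integral>(y, z). J_op p (en n) 1 \<phi> y z \<partial>(Fn n \<Otimes>\<^sub>M Fn n)) \<longlonglongrightarrow> FPL_rate \<phi> F"
    unfolding FPL_rate_def by (rule J_integral_tendsto[OF conv M e(1,3)])
  have "(\<lambda>n. B * M ^ 3 * sqrt (sqrt (sqrt (en n)))) \<longlonglongrightarrow> B * M ^ 3 * sqrt (sqrt (sqrt 0))"
    by (intro tendsto_intros e)
  then have l: "(\<lambda>n. B * M ^ 3 * sqrt (sqrt (sqrt (en n)))) \<longlonglongrightarrow> 0" by simp
  have "(\<lambda>n. en n ^ 3 * (\<integral>(x, y, z). K_op p (en n) 1 \<phi> x y z \<partial>(Fn n \<Otimes>\<^sub>M Fn n \<Otimes>\<^sub>M Fn n))) \<longlonglongrightarrow> 0"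
    by (rule Lim_null_comparison[OF _ l]) (use B(2)[OF e(1,2) F] in \<open>simp add: always_eventually\<close>)
  from tendsto_add[OF J this] show "(\<lambda>n. BE_rate p (en n) \<phi> (Fn n)) \<longlonglongrightarrow> FPL_rate \<phi> F"
    by (simp add: BE_rate_def)
qed

lemma FPL_rate_tendsto:
  assumes \<phi>: "\<phi> \<in> half_line_Cc2" and conv: "B1_conv M Fn F" and M: "M > 0"
  shows "(\<lambda>n. FPL_rate \<phi> (Fn n)) \<longlonglongrightarrow> FPL_rate \<phi> F"
proof -
  obtain C where "collision p c0 c1 \<phi> (half_line_deriv \<phi>) (half_line_deriv (half_line_deriv \<phi>)) C"
    using collision[OF \<phi>] .
  then interpret collision p c0 c1 \<phi> "half_line_deriv \<phi>" "half_line_deriv (half_line_deriv \<phi>)" C .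
  show ?thesis unfolding FPL_rate_def by (rule L_integral_tendsto[OF conv M])
qed

lemma FPL_rate_energy_cut:
  assumes F: "F \<in> bounded_B1 M" and R: "R > 0"
  shows "\<bar>FPL_rate (energy_cut R) F\<bar> \<le> 1880 * pi / sqrt R * (M * M)"
proof -
  obtain C where "collision p c0 c1 (energy_cut R) (half_line_deriv (energy_cut R)) (half_line_deriv (half_line_deriv (energy_cut R))) C"
    using collision[OF energy_cut_Cc2(1)[OF R]] .
  then interpret collision p c0 c1 "energy_cut R" "half_line_deriv (energy_cut R)" "half_line_deriv (half_line_deriv (energy_cut R))" C .
  show ?thesis
    unfolding FPL_rate_def by (rule L_integral_bound[OF F _ L_energy_cut[OF R]]) (use R in auto)
qed

end

section \<open>Sequences of solutions and their limits\<close>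

locale BE_sequence = profile +
  fixes en :: "nat \<Rightarrow> real" and Fn :: "nat \<Rightarrow> real \<Rightarrow> real measure" and M :: real
  assumes M: "M > 0"
    and en: "\<And>n. en n > 0" "\<And>n. en n \<le> 1" "en \<longlonglongrightarrow> 0"
    and Fn: "\<And>n t. t \<ge> 0 \<Longrightarrow> Fn n t \<in> bounded_B1 M"
    and Fn_mass: "\<And>n t. t \<ge> 0 \<Longrightarrow> (\<integral>x. 1 \<partial>Fn n t) = (\<integral>x. (1::real) \<partial>Fn n 0)"
    and Fn_C1: "\<And>n \<phi>. \<phi> \<in> half_line_Cc2 \<Longrightarrow> (\<lambda>t. \<integral>x. \<phi> x \<partial>Fn n t) \<in> half_line_C1"
    and Fn_deriv: "\<And>n \<phi> t. \<phi> \<in> half_line_Cc2 \<Longrightarrow> t \<ge> 0 \<Longrightarrow>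
      half_line_deriv (\<lambda>t. \<integral>x. \<phi> x \<partial>Fn n t) t = BE_rate p (en n) \<phi> (Fn n t)"
begin

lemma Fn_has_derivative:
  assumes "\<phi> \<in> half_line_Cc2" "t \<ge> 0"
  shows "((\<lambda>t. \<integral>x. \<phi> x \<partial>Fn n t) has_real_derivative BE_rate p (en n) \<phi> (Fn n t)) (at t within {0..})"
  using half_line_C1_has_derivative[OF Fn_C1[OF assms(1)] assms(2), of n] by (simp add: Fn_deriv[OF assms])

lemma Fn_Lipschitz:
  assumes \<phi>: "\<phi> \<in> half_line_Cc2"
  obtains B where "B \<ge> 0" "\<And>n s t. s \<ge> 0 \<Longrightarrow> t \<ge> 0 \<Longrightarrow> \<bar>(\<integral>x. \<phi> x \<partial>Fn n s) - (\<integral>x. \<phi> x \<partial>Fn n t)\<bar> \<le> B * \<bar>s - t\<bar>"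
    "\<And>n t. t \<ge> 0 \<Longrightarrow> \<bar>BE_rate p (en n) \<phi> (Fn n t)\<bar> \<le> B"
proof -
  obtain B where B: "B \<ge> 0" "\<And>e F. 0 < e \<Longrightarrow> e \<le> 1 \<Longrightarrow> F \<in> bounded_B1 M \<Longrightarrow> \<bar>BE_rate p e \<phi> F\<bar> \<le> B"
    using BE_rate_bound[OF \<phi> M] by blast
  have b: "\<bar>BE_rate p (en n) \<phi> (Fn n t)\<bar> \<le> B" if "t \<ge> 0" for n t by (rule B(2)[OF en(1,2) Fn[OF that]])
  show ?thesis
  proof (rule that[OF B(1) _ b])
    fix n and s t :: real assume "s \<ge> 0" "t \<ge> 0"
    then show "\<bar>(\<integral>x. \<phi> x \<partial>Fn n s) - (\<integral>x. \<phi> x \<partial>Fn n t)\<bar> \<le> B * \<bar>s - t\<bar>"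
      using field_differentiable_bound[of "{0..}" "\<lambda>t. \<integral>x. \<phi> x \<partial>Fn n t" "\<lambda>t. BE_rate p (en n) \<phi> (Fn n t)" B s t]
        Fn_has_derivative[OF \<phi>] b by simp
  qed
qed

text \<open>Compactness at each grid time and diagonal extraction give convergence on the grid. The
  Lipschitz constant in \<open>t\<close> depends on \<open>\<phi>\<close> but not on the index, so
  the Cauchy property extends to all times.\<close>

lemma convergent_subsequence:
  obtains k :: "nat \<Rightarrow> nat" where "strict_mono k"
    "\<And>t \<phi>. t \<ge> 0 \<Longrightarrow> \<phi> \<in> half_line_Cc2 \<Longrightarrow> convergent (\<lambda>i. \<integral>x. \<phi> x \<partial>Fn (k i) t)"
proof -
  define r where "r n = (case prod_decode n of (a, b) \<Rightarrow> real a / real (Suc b))" for n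
  have r: "r n \<ge> 0" for n by (simp add: r_def split: prod.split)
  define P where "P n s \<longleftrightarrow> (\<forall>\<phi>\<in>half_line_Cc2. convergent (\<lambda>i. \<integral>x. \<phi> x \<partial>Fn (s i) (r n)))" for n and s :: "nat \<Rightarrow> nat"
  interpret S: subseqs P
  proof
    fix n and s :: "nat \<Rightarrow> nat" assume "strict_mono s"
    obtain k G where k: "strict_mono (k :: nat \<Rightarrow> nat)" "B1_conv M (\<lambda>i. Fn (s (k i)) (r n)) G"
      using B1_compact[of "\<lambda>i. Fn (s i) (r n)", OF Fn[OF r] M] by blast
    have "P n (s \<circ> k)"
      unfolding P_def o_def convergent_def
      using B1_conv_Cb[OF k(2) M half_line_Cc_Cb[OF half_line_Cc2_Cc]] by blast
    then show "\<exists>r'. strict_mono r' \<and> P n (s \<circ> r')" using k(1) by blast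
  qed
  define k where "k = S.diagseq"
  have k: "strict_mono k" unfolding k_def by (rule S.subseq_diagseq)
  have rat: "convergent (\<lambda>i. \<integral>x. \<phi> x \<partial>Fn (k i) (r n))" if \<phi>: "\<phi> \<in> half_line_Cc2" for \<phi> n
  proof -
    \<comment> \<open>Only from index \<open>Suc n\<close> on is the diagonal sequence guaranteed to
      refine the \<open>n\<close>-th extraction; the shift is undone by
      \<open>LIMSEQ_offset\<close>.\<close>
    have "P n (k \<circ> ((+) (Suc n)))" unfolding k_def
    proof (rule S.diagseq_holds)
      fix q s :: "nat \<Rightarrow> nat" and m assume q: "strict_mono q" "P m s"
      then show "P m (s \<circ> q)"
        unfolding P_def using convergent_subseq_convergent[OF _ q(1)] by (fastforce simp: o_def)
    qed
    then have "convergent (\<lambda>i. \<integral>x. \<phi> x \<partial>Fn (k (Suc n + i)) (r n))" using \<phi> by (simp add: P_def)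
    then obtain l where l: "(\<lambda>i. \<integral>x. \<phi> x \<partial>Fn (k (i + Suc n)) (r n)) \<longlonglongrightarrow> l"
      unfolding convergent_def by (subst (asm) add.commute) blast
    show ?thesis using LIMSEQ_offset[OF l] by (auto simp: convergent_def)
  qed
  show ?thesis
  proof (rule that[OF k])
    fix t :: real and \<phi> assume t: "t \<ge> 0" and \<phi>: "\<phi> \<in> half_line_Cc2"
    obtain B where B: "B \<ge> 0" "\<And>n s t. s \<ge> 0 \<Longrightarrow> t \<ge> 0 \<Longrightarrow> \<bar>(\<integral>x. \<phi> x \<partial>Fn n s) - (\<integral>x. \<phi> x \<partial>Fn n t)\<bar> \<le> B * \<bar>s - t\<bar>"
      using Fn_Lipschitz[OF \<phi>] by metis
    have "Cauchy (\<lambda>i. \<integral>x. \<phi> x \<partial>Fn (k i) t)"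
    proof (rule CauchyI)
      fix e :: real assume e: "e > 0"
      \<comment> \<open>The denominator \<open>B + 1\<close> instead of \<open>B\<close> covers a
        vanishing Lipschitz constant.\<close>
      define \<delta> where "\<delta> = e / (3 * (B + 1))"
      have \<delta>: "\<delta> > 0" "B * \<delta> \<le> e / 3"
        using e B(1) by (auto simp: \<delta>_def field_simps)
      obtain n where n: "\<bar>r n - t\<bar> < \<delta>" using uniform_grid_dense[OF t \<delta>(1)] by (auto simp: r_def)
      have near: "\<bar>(\<integral>x. \<phi> x \<partial>Fn m (r n)) - (\<integral>x. \<phi> x \<partial>Fn m t)\<bar> \<le> e / 3" for m
      proof -
        have "B * \<bar>r n - t\<bar> \<le> B * \<delta>" using n B(1) by (intro mult_left_mono) auto
        then show ?thesis using B(2)[OF r t, of m n] \<delta>(2) by linarith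
      qed
      obtain N where N: "\<And>i j. i \<ge> N \<Longrightarrow> j \<ge> N \<Longrightarrow> norm ((\<integral>x. \<phi> x \<partial>Fn (k i) (r n)) - (\<integral>x. \<phi> x \<partial>Fn (k j) (r n))) < e / 3"
        using CauchyD[OF convergent_Cauchy[OF rat[OF \<phi>, of n]], of "e / 3"] e by auto
      show "\<exists>N. \<forall>i\<ge>N. \<forall>j\<ge>N. norm ((\<integral>x. \<phi> x \<partial>Fn (k i) t) - (\<integral>x. \<phi> x \<partial>Fn (k j) t)) < e"
      proof (intro exI[of _ N] allI impI)
        fix i j assume "i \<ge> N" "j \<ge> N"
        from N[OF this] near[of "k i"] near[of "k j"]
        show "norm ((\<integral>x. \<phi> x \<partial>Fn (k i) t) - (\<integral>x. \<phi> x \<partial>Fn (k j) t)) < e" unfolding real_norm_def by linarith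
      qed
    qed
    then show "convergent (\<lambda>i. \<integral>x. \<phi> x \<partial>Fn (k i) t)" by (rule Cauchy_convergent)
  qed
qed

text \<open>At each \<open>t\<close> compactness provides a limit measure along a further
  subsequence depending on \<open>t\<close>. As all test integrals already converge, that measure is
  the limit along \<open>k\<close> itself, so a single \<open>k\<close> serves every time.\<close>

lemma limit_family:
  obtains k :: "nat \<Rightarrow> nat" and G where "strict_mono k" "\<And>t. t \<ge> 0 \<Longrightarrow> B1_conv M (\<lambda>i. Fn (k i) t) (G t)"
proof -
  obtain k :: "nat \<Rightarrow> nat" where k: "strict_mono k"
    "\<And>t \<phi>. t \<ge> 0 \<Longrightarrow> \<phi> \<in> half_line_Cc2 \<Longrightarrow> convergent (\<lambda>i. \<integral>x. \<phi> x \<partial>Fn (k i) t)"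
    using convergent_subsequence by blast
  have "\<exists>G. t \<ge> 0 \<longrightarrow> B1_conv M (\<lambda>i. Fn (k i) t) G" for t
  proof (cases "t \<ge> 0")
    case t: True
    obtain s G where s: "strict_mono (s :: nat \<Rightarrow> nat)" "B1_conv M (\<lambda>i. Fn (k (s i)) t) G"
      using B1_compact[of "\<lambda>i. Fn (k i) t", OF Fn[OF t] M] by blast
    have "B1_conv M (\<lambda>i. Fn (k i) t) G"
    proof (rule B1_convI[OF Fn[OF t] _ M])
      show "G \<in> bounded_B1 M" using s(2) by (simp add: B1_conv_def)
      fix \<phi> assume \<phi>: "\<phi> \<in> half_line_Cc2"
      obtain l where l: "(\<lambda>i. \<integral>x. \<phi> x \<partial>Fn (k i) t) \<longlonglongrightarrow> l" using k(2)[OF t \<phi>] by (auto simp: convergent_def)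
      have "(\<lambda>i. \<integral>x. \<phi> x \<partial>Fn (k (s i)) t) \<longlonglongrightarrow> l" using LIMSEQ_subseq_LIMSEQ[OF l s(1)] by (simp add: o_def)
      moreover have "(\<lambda>i. \<integral>x. \<phi> x \<partial>Fn (k (s i)) t) \<longlonglongrightarrow> (\<integral>x. \<phi> x \<partial>G)"
        by (rule B1_conv_Cb[OF s(2) M half_line_Cc_Cb[OF half_line_Cc2_Cc[OF \<phi>]]])
      ultimately have "l = (\<integral>x. \<phi> x \<partial>G)" by (rule LIMSEQ_unique)
      then show "(\<lambda>i. \<integral>x. \<phi> x \<partial>Fn (k i) t) \<longlonglongrightarrow> (\<integral>x. \<phi> x \<partial>G)" using l by simp
    qed
    then show ?thesis by blast
  qed simp
  then obtain G where "\<And>t. t \<ge> 0 \<longrightarrow> B1_conv M (\<lambda>i. Fn (k i) t) (G t)" by metis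
  then show ?thesis using k(1) by (intro that) auto
qed

end

locale BE_limit = BE_sequence +
  fixes G :: "real \<Rightarrow> real measure"
  assumes conv: "\<And>t. t \<ge> 0 \<Longrightarrow> B1_conv M (\<lambda>n. Fn n t) (G t)"
begin

lemma G: "t \<ge> 0 \<Longrightarrow> G t \<in> bounded_B1 M"
  using conv by (auto simp: B1_conv_def)

lemma moment_tendsto: "\<phi> \<in> half_line_Cc2 \<Longrightarrow> t \<ge> 0 \<Longrightarrow> (\<lambda>n. \<integral>x. \<phi> x \<partial>Fn n t) \<longlonglongrightarrow> (\<integral>x. \<phi> x \<partial>G t)"
  by (rule B1_conv_Cb[OF conv M half_line_Cc_Cb[OF half_line_Cc2_Cc]])

text \<open>The Lipschitz estimates of the test integrals survive the limit, and by
  \<open>B1_convI\<close> they amount to weak continuity in time; this makes \<open>FPL_rate\<close>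
  continuous in time.\<close>

lemma G_continuous:
  assumes t: "\<And>n. tn n \<ge> 0" "tn \<longlonglongrightarrow> t"
  shows "B1_conv M (\<lambda>n. G (tn n)) (G t)"
proof -
  have t0: "t \<ge> 0" using t by (auto intro: LIMSEQ_le_const)
  show ?thesis
  proof (rule B1_convI[OF G[OF t(1)] G[OF t0] M])
    fix \<phi> assume \<phi>: "\<phi> \<in> half_line_Cc2"
    obtain B where B: "B \<ge> 0" "\<And>n s t. s \<ge> 0 \<Longrightarrow> t \<ge> 0 \<Longrightarrow> \<bar>(\<integral>x. \<phi> x \<partial>Fn n s) - (\<integral>x. \<phi> x \<partial>Fn n t)\<bar> \<le> B * \<bar>s - t\<bar>"
      using Fn_Lipschitz[OF \<phi>] by metis
    have L: "\<bar>(\<integral>x. \<phi> x \<partial>G s) - (\<integral>x. \<phi> x \<partial>G t)\<bar> \<le> B * \<bar>s - t\<bar>" if "s \<ge> 0" for s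
    proof (rule LIMSEQ_le_const2)
      show "(\<lambda>n. \<bar>(\<integral>x. \<phi> x \<partial>Fn n s) - (\<integral>x. \<phi> x \<partial>Fn n t)\<bar>) \<longlonglongrightarrow> \<bar>(\<integral>x. \<phi> x \<partial>G s) - (\<integral>x. \<phi> x \<partial>G t)\<bar>"
        by (intro tendsto_intros moment_tendsto \<phi> that t0)
    qed (use B(2)[OF that t0] in auto)
    have "(\<lambda>n. B * \<bar>tn n - t\<bar>) \<longlonglongrightarrow> B * \<bar>t - t\<bar>" by (intro tendsto_intros t)
    then have "(\<lambda>n. B * \<bar>tn n - t\<bar>) \<longlonglongrightarrow> 0" by simp
    then have "(\<lambda>n. (\<integral>x. \<phi> x \<partial>G (tn n)) - (\<integral>x. \<phi> x \<partial>G t)) \<longlonglongrightarrow> 0"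
      by (rule Lim_null_comparison[rotated]) (use L[OF t(1)] in \<open>simp add: always_eventually\<close>)
    then show "(\<lambda>n. \<integral>x. \<phi> x \<partial>G (tn n)) \<longlonglongrightarrow> (\<integral>x. \<phi> x \<partial>G t)" by (rule LIM_zero_cancel)
  qed
qed

lemma FPL_rate_continuous:
  assumes \<phi>: "\<phi> \<in> half_line_Cc2"
  shows "continuous_on {0..} (\<lambda>t. FPL_rate \<phi> (G t))"
  unfolding continuous_on_sequentially o_def
  by (intro ballI allI impI FPL_rate_tendsto[OF \<phi> G_continuous M]) auto

text \<open>Derivatives need not pass to the limit, so the equation is integrated first; the rates
  converge at each time and share the constant bound \<open>B\<close> on the time interval.\<close>

lemma G_integral_equation:
  assumes \<phi>: "\<phi> \<in> half_line_Cc2" and T: "T \<ge> 0"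
  shows "(\<integral>x. \<phi> x \<partial>G T) = (\<integral>x. \<phi> x \<partial>G 0) + integral {0..T} (\<lambda>t. FPL_rate \<phi> (G t))"
proof -
  obtain B where B: "\<And>n t. t \<ge> 0 \<Longrightarrow> \<bar>BE_rate p (en n) \<phi> (Fn n t)\<bar> \<le> B"
    using Fn_Lipschitz[OF \<phi>] by metis
  have hi: "((\<lambda>t. BE_rate p (en n) \<phi> (Fn n t)) has_integral (\<integral>x. \<phi> x \<partial>Fn n T) - (\<integral>x. \<phi> x \<partial>Fn n 0)) {0..T}" for n
  proof (rule fundamental_theorem_of_calculus[OF T])
    fix t assume "t \<in> {0..T}"
    then have "((\<lambda>t. \<integral>x. \<phi> x \<partial>Fn n t) has_real_derivative BE_rate p (en n) \<phi> (Fn n t)) (at t within {0..T})"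
      by (intro DERIV_subset[OF Fn_has_derivative[OF \<phi>]]) auto
    then show "((\<lambda>t. \<integral>x. \<phi> x \<partial>Fn n t) has_vector_derivative BE_rate p (en n) \<phi> (Fn n t)) (at t within {0..T})"
      by (simp add: has_real_derivative_iff_has_vector_derivative)
  qed
  have "(\<lambda>n. integral {0..T} (\<lambda>t. BE_rate p (en n) \<phi> (Fn n t))) \<longlonglongrightarrow> integral {0..T} (\<lambda>t. FPL_rate \<phi> (G t))"
  proof (rule dominated_convergence(2)[where h="\<lambda>_. B"])
    show "(\<lambda>t. BE_rate p (en n) \<phi> (Fn n t)) integrable_on {0..T}" for n using hi by (rule has_integral_integrable)
    show "(\<lambda>_. B) integrable_on {0..T}" by (rule integrable_const_ivl)
    show "norm (BE_rate p (en n) \<phi> (Fn n t)) \<le> B" if "t \<in> {0..T}" for n t using B that by simp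
    show "(\<lambda>n. BE_rate p (en n) \<phi> (Fn n t)) \<longlonglongrightarrow> FPL_rate \<phi> (G t)" if "t \<in> {0..T}" for t
      by (rule BE_rate_tendsto(2)[OF \<phi> conv M en]) (use that in auto)
  qed
  then have "(\<lambda>n. (\<integral>x. \<phi> x \<partial>Fn n T) - (\<integral>x. \<phi> x \<partial>Fn n 0)) \<longlonglongrightarrow> integral {0..T} (\<lambda>t. FPL_rate \<phi> (G t))"
    by (simp add: integral_unique[OF hi])
  moreover have "(\<lambda>n. (\<integral>x. \<phi> x \<partial>Fn n T) - (\<integral>x. \<phi> x \<partial>Fn n 0)) \<longlonglongrightarrow> (\<integral>x. \<phi> x \<partial>G T) - (\<integral>x. \<phi> x \<partial>G 0)"
    by (intro tendsto_intros moment_tendsto \<phi> T) simp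
  ultimately show ?thesis using LIMSEQ_unique by fastforce
qed

text \<open>The integral is differentiated on \<open>{0..t + 1}\<close>, where \<open>t\<close> is
  not the right end point; near \<open>t\<close> this interval coincides with the half line, and at
  \<open>t = 0\<close> the derivative is one-sided as required.\<close>

lemma G_has_derivative:
  assumes \<phi>: "\<phi> \<in> half_line_Cc2" and t: "t \<ge> 0"
  shows "((\<lambda>t. \<integral>x. \<phi> x \<partial>G t) has_real_derivative FPL_rate \<phi> (G t)) (at t within {0..})"
proof -
  have "((\<lambda>s. (\<integral>x. \<phi> x \<partial>G 0) + integral {0..s} (\<lambda>t. FPL_rate \<phi> (G t))) has_real_derivative 0 + FPL_rate \<phi> (G t)) (at t within {0..t + 1})"
    by (rule DERIV_add[OF DERIV_const integral_has_real_derivative[of 0 "t + 1" _ t]])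
      (use t in \<open>auto intro: continuous_on_subset[OF FPL_rate_continuous[OF \<phi>]]\<close>)
  then have "((\<lambda>s. (\<integral>x. \<phi> x \<partial>G 0) + integral {0..s} (\<lambda>t. FPL_rate \<phi> (G t))) has_real_derivative FPL_rate \<phi> (G t)) (at t within {0..})"
    by (simp add: at_within_half_line[of t "t + 1"])
  then show ?thesis
  proof (rule has_field_derivative_transform_within[OF _ zero_less_one])
    show "(\<integral>x. \<phi> x \<partial>G 0) + integral {0..s} (\<lambda>t. FPL_rate \<phi> (G t)) = (\<integral>x. \<phi> x \<partial>G s)" if "s \<in> {0..}" for s
      by (rule G_integral_equation[OF \<phi>, symmetric]) (use that in simp)
  qed (use t in simp)
qed

lemma G_mass: "t \<ge> 0 \<Longrightarrow> (\<integral>x. 1 \<partial>G t) = (\<integral>x. (1::real) \<partial>G 0)"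
proof -
  have Cb: "(\<lambda>_. 1) \<in> half_line_Cb" by (auto simp: half_line_Cb_def bounded_iff)
  assume t: "t \<ge> 0"
  have "(\<lambda>n. \<integral>x. (1::real) \<partial>Fn n t) \<longlonglongrightarrow> (\<integral>x. 1 \<partial>G 0)"
    unfolding Fn_mass[OF t] by (rule B1_conv_Cb[OF conv M Cb]) simp
  with B1_conv_Cb[OF conv[OF t] M Cb] show ?thesis by (rule LIMSEQ_unique)
qed

text \<open>The argument runs on the limit family itself: by \<open>G_has_derivative\<close> and the
  mean value inequality, the truncated energy changes up to time \<open>t\<close> by at most a
  multiple of \<open>t / sqrt R\<close>. Domination by \<open>x\<close> removes the truncation as
  \<open>R\<close> runs through the integers.\<close>

lemma G_energy:
  assumes t: "t \<ge> 0"
  shows "(\<integral>x. x \<partial>G t) = (\<integral>x. x \<partial>G 0)"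
proof -
  have lim: "(\<lambda>n. \<integral>x. energy_cut (real (Suc n)) x \<partial>F) \<longlonglongrightarrow> (\<integral>x. x \<partial>F)" if F: "F \<in> half_line_B1" for F
  proof (rule integral_dominated_convergence[where w="\<lambda>x. x"])
    show "integrable F (\<lambda>x. x)" by (rule B1_integrable_id[OF F])
    show "(\<lambda>x. x) \<in> borel_measurable F" by (rule B1_id_measurable[OF F])
    show "energy_cut (real (Suc n)) \<in> borel_measurable F" for n
      by (rule B1_measurable[OF F]) (unfold energy_cut_def[abs_def], measurable)
    show "AE x in F. (\<lambda>n. energy_cut (real (Suc n)) x) \<longlonglongrightarrow> x"
    proof (rule AE_I2)
      fix x
      obtain N where N: "x \<le> real N" using real_arch_simple by blast
      have "\<forall>\<^sub>F n in sequentially. energy_cut (real (Suc n)) x = x"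
        unfolding eventually_sequentially
      proof (intro exI[of _ N] allI impI)
        fix n assume "N \<le> n"
        then have "x \<le> real (Suc n)" using N by simp
        then have "x / real (Suc n) - 1 \<le> 0" by (simp add: pos_divide_le_eq del: of_nat_Suc)
        then show "energy_cut (real (Suc n)) x = x" by (simp add: energy_cut_def bump_props(1) del: of_nat_Suc)
      qed
      then show "(\<lambda>n. energy_cut (real (Suc n)) x) \<longlonglongrightarrow> x" by (rule tendsto_eventually)
    qed
    show "AE x in F. norm (energy_cut (real (Suc n)) x) \<le> x" for n
    proof (rule AE_I2)
      fix x assume "x \<in> space F"
      then have "x \<ge> 0" using B1_D(2)[OF F] by simp
      then show "norm (energy_cut (real (Suc n)) x) \<le> x"
        using mult_left_mono[OF bump_props(4), of x] bump_props(3) by (simp add: energy_cut_def abs_mult del: of_nat_Suc)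
    qed
  qed
  have "(\<lambda>n. (\<integral>x. energy_cut (real (Suc n)) x \<partial>G t) - (\<integral>x. energy_cut (real (Suc n)) x \<partial>G 0)) \<longlonglongrightarrow> 0"
  proof (rule Lim_null_comparison)
    show "\<forall>\<^sub>F n in sequentially. norm ((\<integral>x. energy_cut (real (Suc n)) x \<partial>G t) - (\<integral>x. energy_cut (real (Suc n)) x \<partial>G 0))
      \<le> 1880 * pi / sqrt (real (Suc n)) * (M * M) * t"
    proof (intro always_eventually allI)
      fix n
      have R: "real (Suc n) > 0" by simp
      have "norm ((\<integral>x. energy_cut (real (Suc n)) x \<partial>G t) - (\<integral>x. energy_cut (real (Suc n)) x \<partial>G 0))
        \<le> 1880 * pi / sqrt (real (Suc n)) * (M * M) * norm (t - 0)"
        by (rule field_differentiable_bound[of "{0..}" _ "\<lambda>t. FPL_rate (energy_cut (real (Suc n))) (G t)"])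
          (use t G_has_derivative[OF energy_cut_Cc2(1)[OF R]] FPL_rate_energy_cut[OF G R] in auto)
      then show "norm ((\<integral>x. energy_cut (real (Suc n)) x \<partial>G t) - (\<integral>x. energy_cut (real (Suc n)) x \<partial>G 0))
        \<le> 1880 * pi / sqrt (real (Suc n)) * (M * M) * t" using t by simp
    qed
    show "(\<lambda>n. 1880 * pi / sqrt (real (Suc n)) * (M * M) * t) \<longlonglongrightarrow> 0" by real_asymp
  qed
  moreover have "(\<lambda>n. (\<integral>x. energy_cut (real (Suc n)) x \<partial>G t) - (\<integral>x. energy_cut (real (Suc n)) x \<partial>G 0)) \<longlonglongrightarrow> (\<integral>x. x \<partial>G t) - (\<integral>x. x \<partial>G 0)"
    by (intro tendsto_diff lim bounded_B1_D(1)[OF G] t) simp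
  ultimately show ?thesis using LIMSEQ_unique by fastforce
qed

lemma G_FPL: "FPL_weak_solution G"
  unfolding FPL_weak_solution_def conservative_family_def
proof (intro conjI allI impI ballI)
  fix \<phi> assume \<phi>: "\<phi> \<in> half_line_Cc2"
  show "(\<lambda>t. \<integral>x. \<phi> x \<partial>G t) \<in> half_line_C1"
    by (rule half_line_C1I[OF G_has_derivative[OF \<phi>] FPL_rate_continuous[OF \<phi>]])
  show "half_line_deriv (\<lambda>t. \<integral>x. \<phi> x \<partial>G t) t = (\<integral>(x, y). L_op \<phi> x y \<partial>(G t \<Otimes>\<^sub>M G t))" if "t \<ge> 0" for t
    using half_line_deriv_eq[OF that G_has_derivative[OF \<phi> that]] by (simp add: FPL_rate_def)
qed (rule bounded_B1_D(1)[OF G] G_mass G_energy; assumption)+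

end

section \<open>Reduction to a measurable profile, and conclusion\<close>

lemma K_op_max0: "e > 0 \<Longrightarrow> K_op q e l \<phi> x y z = K_op (\<lambda>r. q (max 0 r)) e l \<phi> x y z"
  unfolding K_op_def by (subst W_cong[of "Phi q e l" "Phi (\<lambda>r. q (max 0 r)) e l"]) (simp_all add: Phi_def)

lemma J_op_max0: "e > 0 \<Longrightarrow> J_op q e l \<phi> y z = J_op (\<lambda>r. q (max 0 r)) e l \<phi> y z"
  unfolding J_op_def by (subst K_op_max0) simp_all

lemma half_line_profile:
  assumes "q \<in> half_line_Cb" "2 * pi * (LBINT r:{0..}. r ^ 3 * \<bar>q r\<bar>\<^sup>2) = 1" "bdd_above ((\<lambda>r. r * \<bar>q r\<bar>) ` {0..})"
  obtains c0 c1 where "profile (\<lambda>r. q (max 0 r)) c0 c1"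
proof (rule half_line_Cb_D[OF assms(1)])
  fix c0 assume c0: "(\<lambda>r. q (max 0 r)) \<in> borel_measurable borel" "\<And>r. r \<ge> 0 \<Longrightarrow> \<bar>q r\<bar> \<le> c0"
  obtain c1 where c1: "\<And>r. r \<ge> 0 \<Longrightarrow> r * \<bar>q r\<bar> \<le> c1" using assms(3) by (auto simp: bdd_above_def)
  have "(LBINT r:{0..}. r ^ 3 * \<bar>q (max 0 r)\<bar>\<^sup>2) = (LBINT r:{0..}. r ^ 3 * \<bar>q r\<bar>\<^sup>2)"
    by (rule set_lebesgue_integral_cong) auto
  then have "profile (\<lambda>r. q (max 0 r)) c0 c1"
    using c0 c1 assms(2) by (simp add: profile_def)
  then show ?thesis by (rule that)
qed

lemma BE_solution_bounded:
  assumes sol: "BE_weak_solution q e F" and M: "(\<integral>x. 1 + x \<partial>F 0) \<le> M" and t: "t \<ge> 0"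
  shows "F t \<in> bounded_B1 M"
proof -
  have c: "F t \<in> half_line_B1" "F 0 \<in> half_line_B1" "(\<integral>x. 1 \<partial>F t) = (\<integral>x. (1::real) \<partial>F 0)" "(\<integral>x. x \<partial>F t) = (\<integral>x. x \<partial>F 0)"
    using sol t unfolding BE_weak_solution_def conservative_family_def by blast+
  have "(\<integral>x. 1 + x \<partial>H) = (\<integral>x. 1 \<partial>H) + (\<integral>x. x \<partial>H)" if "H \<in> half_line_B1" for H
    by (rule Bochner_Integration.integral_add[OF B1_integrable_bounded[OF that, where B=1] B1_integrable_id[OF that]]) auto
  then have "(\<integral>x. 1 + x \<partial>F t) = (\<integral>x. 1 + x \<partial>F 0)" by (simp only: c)
  then show ?thesis using M c(1) by (simp add: bounded_B1_def)
qed

theorem theorem1p27: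
  fixes phihat :: "real \<Rightarrow> real"
    and eps0 :: real
    and F0 :: "real \<Rightarrow> real measure"
    and F :: "real \<Rightarrow> real \<Rightarrow> real measure"
  assumes phihat_Cb: "phihat \<in> half_line_Cb"
    and phihat_normalized: "2 * pi * (LBINT r:{0..}. r ^ 3 * \<bar>phihat r\<bar>\<^sup>2) = 1"
    and phihat_decay: "bdd_above ((\<lambda>r. r * \<bar>phihat r\<bar>) ` {0..})"
    and eps0_pos: "eps0 > 0"
    and F0_B1: "\<And>eps. 0 < eps \<Longrightarrow> eps \<le> eps0 \<Longrightarrow> F0 eps \<in> half_line_B1"
    and F0_bound: "bdd_above ((\<lambda>eps. \<integral>x. 1 + x \<partial>F0 eps) ` {0<..eps0})"
    and F_BE: "\<And>eps. 0 < eps \<Longrightarrow> eps \<le> eps0 \<Longrightarrow> BE_weak_solution phihat eps (F eps)"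
    and F_init: "\<And>eps. 0 < eps \<Longrightarrow> eps \<le> eps0 \<Longrightarrow> F eps 0 = F0 eps"
  shows
    "(\<forall>e :: nat \<Rightarrow> real. (\<forall>n. 0 < e n \<and> e n \<le> eps0) \<longrightarrow> e \<longlonglongrightarrow> 0 \<longrightarrow>
       (\<exists>(k :: nat \<Rightarrow> nat) (G :: real \<Rightarrow> real measure).
          strict_mono k \<and> FPL_weak_solution G \<and>
          (\<forall>t\<ge>0.
             half_line_weak_conv (\<lambda>n. F (e (k n)) t) (G t) \<and>
             (\<forall>\<phi>\<in>half_line_Cc.
                (\<lambda>n. \<integral>x. \<phi> x \<partial>F (e (k n)) t) \<longlonglongrightarrow> (\<integral>x. \<phi> x \<partial>G t)) \<and>
             (\<forall>\<phi>\<in>half_line_Cc2.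
                (\<lambda>n. \<integral>(y, z). J_op phihat (e (k n)) 1 \<phi> y z
                        \<partial>(F (e (k n)) t \<Otimes>\<^sub>M F (e (k n)) t))
                  \<longlonglongrightarrow> (\<integral>(y, z). L_op \<phi> y z \<partial>(G t \<Otimes>\<^sub>M G t))))))
     \<and>
     (\<forall>t\<ge>0. \<forall>\<phi>\<in>half_line_Cc2.
        ((\<lambda>eps. eps ^ 3 * (\<integral>(x, y, z). K_op phihat eps 1 \<phi> x y z
                              \<partial>(F eps t \<Otimes>\<^sub>M F eps t \<Otimes>\<^sub>M F eps t)))
           \<longlongrightarrow> 0) (at_right 0))"
proof -
  obtain c0 c1 where "profile (\<lambda>r. phihat (max 0 r)) c0 c1"
    using half_line_profile[OF phihat_Cb phihat_normalized phihat_decay] .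
  then interpret profile "\<lambda>r. phihat (max 0 r)" c0 c1 .
  obtain M0 where "\<forall>eps\<in>{0<..eps0}. (\<integral>x. 1 + x \<partial>F0 eps) \<le> M0"
    using F0_bound unfolding bdd_above_def by auto
  then have M0: "(\<integral>x. 1 + x \<partial>F0 eps) \<le> M0" if "0 < eps" "eps \<le> eps0" for eps using that by simp
  \<comment> \<open>The maximum with 1 secures the positivity that \<open>lift\<close>
    needs.\<close>
  define M where "M = max M0 1"
  have M: "M > 0" by (simp add: M_def)
  have FM: "F eps t \<in> bounded_B1 M" if "0 < eps" "eps \<le> eps0" "t \<ge> 0" for eps t
  proof (rule BE_solution_bounded[OF F_BE[OF that(1,2)] _ that(3)])
    show "(\<integral>x. 1 + x \<partial>F eps 0) \<le> M" using M0[OF that(1,2)] by (simp add: F_init[OF that(1,2)] M_def)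
  qed
  have K: "(\<lambda>(x, y, z). K_op phihat eps 1 \<phi> x y z) = (\<lambda>(x, y, z). K_op (\<lambda>r. phihat (max 0 r)) eps 1 \<phi> x y z)" if "eps > 0" for eps \<phi>
    by (simp add: K_op_max0[OF that, symmetric])
  have J: "(\<lambda>(y, z). J_op phihat eps 1 \<phi> y z) = (\<lambda>(y, z). J_op (\<lambda>r. phihat (max 0 r)) eps 1 \<phi> y z)" if "eps > 0" for eps \<phi>
    by (simp add: J_op_max0[OF that, symmetric])
  have cubic: "((\<lambda>eps. eps ^ 3 * (\<integral>(x, y, z). K_op phihat eps 1 \<phi> x y z \<partial>(F eps t \<Otimes>\<^sub>M F eps t \<Otimes>\<^sub>M F eps t))) \<longlongrightarrow> 0) (at_right 0)"
    if t: "t \<ge> 0" and \<phi>: "\<phi> \<in> half_line_Cc2" for t \<phi>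
  proof -
    obtain B where B: "\<And>e M F. 0 < e \<Longrightarrow> e \<le> 1 \<Longrightarrow> F \<in> bounded_B1 M \<Longrightarrow>
      \<bar>e ^ 3 * (\<integral>(x, y, z). K_op (\<lambda>r. phihat (max 0 r)) e 1 \<phi> x y z \<partial>(F \<Otimes>\<^sub>M F \<Otimes>\<^sub>M F))\<bar> \<le> B * M ^ 3 * sqrt (sqrt (sqrt e))"
      using cubic_rate_bound[OF \<phi>] by metis
    have "((\<lambda>eps. B * M ^ 3 * sqrt (sqrt (sqrt eps))) \<longlongrightarrow> B * M ^ 3 * sqrt (sqrt (sqrt 0))) (at_right 0)"
      by (intro tendsto_intros)
    then have l: "((\<lambda>eps. B * M ^ 3 * sqrt (sqrt (sqrt eps))) \<longlongrightarrow> 0) (at_right 0)" by simp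
    have "min 1 eps0 > 0" using eps0_pos by simp
    then have "\<forall>\<^sub>F eps in at_right 0. eps \<in> {0<..<min 1 eps0}" by (rule eventually_at_right_real)
    then have "\<forall>\<^sub>F eps in at_right 0. norm (eps ^ 3 * (\<integral>(x, y, z). K_op phihat eps 1 \<phi> x y z \<partial>(F eps t \<Otimes>\<^sub>M F eps t \<Otimes>\<^sub>M F eps t)))
      \<le> B * M ^ 3 * sqrt (sqrt (sqrt eps))"
    proof eventually_elim
      case (elim eps)
      then have e: "0 < eps" "eps \<le> 1" "eps \<le> eps0" by auto
      show ?case unfolding K[OF e(1)] real_norm_def by (rule B[OF e(1,2) FM[OF e(1,3) t]])
    qed
    then show ?thesis by (rule Lim_null_comparison[OF _ l])
  qed
  have main: "\<exists>(k :: nat \<Rightarrow> nat) (G :: real \<Rightarrow> real measure). strict_mono k \<and> FPL_weak_solution G \<and>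
    (\<forall>t\<ge>0. half_line_weak_conv (\<lambda>n. F (e (k n)) t) (G t) \<and>
       (\<forall>\<phi>\<in>half_line_Cc. (\<lambda>n. \<integral>x. \<phi> x \<partial>F (e (k n)) t) \<longlonglongrightarrow> (\<integral>x. \<phi> x \<partial>G t)) \<and>
       (\<forall>\<phi>\<in>half_line_Cc2. (\<lambda>n. \<integral>(y, z). J_op phihat (e (k n)) 1 \<phi> y z \<partial>(F (e (k n)) t \<Otimes>\<^sub>M F (e (k n)) t))
          \<longlonglongrightarrow> (\<integral>(y, z). L_op \<phi> y z \<partial>(G t \<Otimes>\<^sub>M G t))))"
    if e: "\<And>n. 0 < e n" "\<And>n. e n \<le> eps0" "e \<longlonglongrightarrow> 0" for e :: "nat \<Rightarrow> real"
  proof -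
    have "\<forall>\<^sub>F n in sequentially. e n < 1" by (rule order_tendstoD(2)[OF e(3)]) simp
    \<comment> \<open>The estimates of the cubic term are for parameters at most 1, while only
      \<open>eps0\<close> bounds the sequence; the first \<open>N\<close> members are
      dropped.\<close>
    then obtain N where N: "\<And>n. n \<ge> N \<Longrightarrow> e n < 1" by (auto simp: eventually_sequentially)
    have seq: "BE_sequence (\<lambda>r. phihat (max 0 r)) c0 c1 (\<lambda>n. e (j n)) (\<lambda>n. F (e (j n))) M"
      if j: "\<And>n. j n \<ge> N" "(\<lambda>n. e (j n)) \<longlonglongrightarrow> 0" for j :: "nat \<Rightarrow> nat"
    proof unfold_locales
      fix n
      note sol = F_BE[OF e(1,2), of "j n", unfolded BE_weak_solution_def conservative_family_def]
      show "(\<integral>x. 1 \<partial>F (e (j n)) t) = (\<integral>x. (1::real) \<partial>F (e (j n)) 0)" if "t \<ge> 0" for t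
        using sol that by blast
      show "(\<lambda>t. \<integral>x. \<phi> x \<partial>F (e (j n)) t) \<in> half_line_C1" if "\<phi> \<in> half_line_Cc2" for \<phi>
        using sol that by blast
      show "half_line_deriv (\<lambda>t. \<integral>x. \<phi> x \<partial>F (e (j n)) t) t = BE_rate (\<lambda>r. phihat (max 0 r)) (e (j n)) \<phi> (F (e (j n)) t)"
        if "\<phi> \<in> half_line_Cc2" "t \<ge> 0" for \<phi> t
        using sol that unfolding BE_rate_def K[OF e(1), symmetric] J[OF e(1), symmetric] by blast
      show "e (j n) \<le> 1" using N[OF j(1)] by (rule less_imp_le)
    qed (use M e FM j in auto)
    have sh: "(\<lambda>n. e (n + N)) \<longlonglongrightarrow> 0" by (rule LIMSEQ_ignore_initial_segment[OF e(3)])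
    interpret S: BE_sequence "\<lambda>r. phihat (max 0 r)" c0 c1 "\<lambda>n. e (n + N)" "\<lambda>n. F (e (n + N))" M
      by (rule seq[OF _ sh]) simp
    obtain k :: "nat \<Rightarrow> nat" and G where k: "strict_mono k"
      and conv: "\<And>t. t \<ge> 0 \<Longrightarrow> B1_conv M (\<lambda>i. F (e (k i + N)) t) (G t)"
      using S.limit_family by blast
    have ek: "(\<lambda>n. e (k n + N)) \<longlonglongrightarrow> 0" using LIMSEQ_subseq_LIMSEQ[OF sh k] by (simp add: o_def)
    have ek1: "e (k n + N) \<le> 1" for n using N[of "k n + N"] by simp
    have "BE_sequence (\<lambda>r. phihat (max 0 r)) c0 c1 (\<lambda>n. e (k n + N)) (\<lambda>n. F (e (k n + N))) M"
      by (rule seq[OF _ ek]) simp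
    then interpret L: BE_limit "\<lambda>r. phihat (max 0 r)" c0 c1 "\<lambda>n. e (k n + N)" "\<lambda>n. F (e (k n + N))" M G
      using conv by (simp add: BE_limit_def BE_limit_axioms_def)
    show ?thesis
    \<comment> \<open>Adding \<open>N\<close> translates indices of the shortened sequence back to
      those of the original one and preserves strict monotonicity.\<close>
    proof (intro exI[of _ "\<lambda>n. k n + N"] exI[of _ G] conjI allI impI ballI)
      show "strict_mono (\<lambda>n. k n + N)" using k by (simp add: strict_mono_def)
      show "FPL_weak_solution G" by (rule L.G_FPL)
      fix t :: real assume t: "t \<ge> 0"
      show "half_line_weak_conv (\<lambda>n. F (e (k n + N)) t) (G t)"
        unfolding half_line_weak_conv_def using B1_conv_Cb[OF conv[OF t] M] by blast
      show "(\<lambda>n. \<integral>x. \<phi> x \<partial>F (e (k n + N)) t) \<longlonglongrightarrow> (\<integral>x. \<phi> x \<partial>G t)" if "\<phi> \<in> half_line_Cc" for \<phi>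
        by (rule B1_conv_Cb[OF conv[OF t] M half_line_Cc_Cb[OF that]])
      show "(\<lambda>n. \<integral>(y, z). J_op phihat (e (k n + N)) 1 \<phi> y z \<partial>(F (e (k n + N)) t \<Otimes>\<^sub>M F (e (k n + N)) t))
        \<longlonglongrightarrow> (\<integral>(y, z). L_op \<phi> y z \<partial>(G t \<Otimes>\<^sub>M G t))" if "\<phi> \<in> half_line_Cc2" for \<phi>
        unfolding J[OF e(1)] FPL_rate_def[symmetric]
        by (rule BE_rate_tendsto(1)[OF that conv[OF t] M e(1) ek1 ek])
    qed
  qed
  show ?thesis using main cubic by blast
qed

end
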